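(* Let $d\ge2$ and let $\xi=\{\xi(t):t\in\mathbb{R}_+^N\}$ be a centered continuous real-valued Gaussian random field satisfying the assumptions (A1), (A2), (A3) stated in the context on a compact interval $I\subset\mathbb{R}_+^N$, with exponents $H_j:=\alpha_j=(1+\gamma_j)^{-1}$, $1\le j\le N$. Let $\{\xi_{i,j}\}$ be independent copies of $\xi$, let $X^1(t)$ be the real symmetric $d\times d$ matrix with entries $X^1_{i,j}(t)=\xi_{i,j}(t)$ for $i<j$, $X^1_{i,i}(t)=\sqrt2\,\xi_{i,i}(t)$, and $X^1_{i,j}(t)=\xi_{j,i}(t)$ for $i>j$. Let $A^1$ be a deterministic real symmetric $d\times d$ matrix, and let $\lambda_1(t),\dots,\lambda_d(t)$ be the eigenvalues (with multiplicity) of $Y^1(t)=A^1+X^1(t)$. For any $k\in\{2,\dots,d\}$, if $$\sum_{j=1}^N\frac1{H_j}=\frac{(k+2)(k-1)}{2},$$ then $$\mathbb{P}\big(\lambda_{i_1}(t)=\cdots=\lambda_{i_k}(t)\text{ for some }t\in I\text{ and some }1\le i_1<\cdots<i_k\le d\big)=0.$$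
   Context: $\mathbb{R}_+=[0,\infty)$. For finite constants $c_j<c_j'$ ($1\le j\le N$), $I=\prod_{j=1}^N[c_j,c_j']$ and, for $\epsilon>0$, $I^{(\epsilon)}=\prod_{j=1}^N(c_j-\epsilon,c_j'+\epsilon)$; below $\epsilon_0>0$ is such that $I^{(\epsilon_0)}\subset\mathbb{R}_+^N$. $\|Y\|_{L^2}=(\mathbb{E}|Y|^2)^{1/2}$. Gaussian noise: for a Borel measure $\nu$ on $\mathbb{R}_+$, a (real-valued) Gaussian noise with control measure $\nu$ is a set function $A\mapsto W(A)$ defined on the Borel sets $\mathcal{B}(\mathbb{R}_+)$ with values in $L^2(\Omega,\mathcal{F},\mathbb{P})$ such that each $W(A)$ is a centered normal variable with variance $\nu(A)$, and $W(A\cup B)=W(A)+W(B)$ with $W(A)$ and $W(B)$ independent whenever $A\cap B=\emptyset$. (A1) There are a Gaussian random field $\{W(A,t):A\in\mathcal{B}(\mathbb{R}_+),t\in\mathbb{R}_+^N\}$ and $\epsilon_0>0$ such that: (a1) for all $t\in I^{(\epsilon_0)}$, $A\mapsto W(A,t)$ is a Gaussian noise with a control measure $\nu_t$ such that $W(\mathbb{R}_+,t)=\xi(t)$, and when $A\cap B=\emptyset$, $W(A,\cdot)$ and $W(B,\cdot)$ are independent; (a2) there exist constants $a_0\ge0$, $c_0>0$, $\gamma_j>0$ ($1\le j\le N$) such that for all $a_0\le a<b\le+\infty$ and all $s,t\in I^{(\epsilon_0)}$, $$\big\|W([a,b),s)-\xi(s)-W([a,b),t)+\xi(t)\big\|_{L^2}\le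 c_0\Big[\sum_{j=1}^N a^{\gamma_j}|s_j-t_j|+b^{-1}\Big]$$ and $$\big\|W([0,a_0),s)-W([0,a_0),t)\big\|_{L^2}\le c_0\sum_{j=1}^N|s_j-t_j|.$$ Set $\alpha_j=(1+\gamma_j)^{-1}$ and $\Delta(s,t)=\sum_{j=1}^N|s_j-t_j|^{\alpha_j}$. (A2) There exists $d_0>0$ such that $\|\xi(t)\|_{L^2}\ge d_0$ for all $t\in I^{(\epsilon_0)}$. (A3) There exists $\rho_0>0$ with the following property: for each $t\in I$ there exist $t'=t'(t)\in I^{(\epsilon_0)}$, $\delta_j=\delta_j(t)\in(\alpha_j,1]$ for $1\le j\le N$, and $C=C(t)>0$, such that $$\Big|\mathbb{E}\big[\xi(t')\big(\xi(s)-\xi(\bar s)\big)\big]\Big|\le C\sum_{j=1}^N|s_j-\bar s_j|^{\delta_j}$$ for all $s,\bar s\in I^{(\epsilon_0)}$ with $\max\{\Delta(t,s),\Delta(t,\bar s)\}\le2\rho_0$. *)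

theory Defs
  imports "Jordan_Normal_Form.Char_Poly" "HOL-Probability.Probability"
begin

(* "$" is the component of a vector of type real ^ 'n throughout. *)
no_notation Matrix.vec_index (infixl "$" 100)

section \<open>Gaussian variables and fields\<close>

text \<open>The parameter \<open>v\<close> is the variance; for \<open>v = 0\<close> the law is the point mass at \<open>m\<close>.\<close>

definition normal_rv :: "'w measure \<Rightarrow> ('w \<Rightarrow> real) \<Rightarrow> real \<Rightarrow> real \<Rightarrow> bool" where
  "normal_rv M X m v \<longleftrightarrow>
     X \<in> borel_measurable M \<and> 0 \<le> v \<and>
     (if v = 0 then (AE \<omega> in M. X \<omega> = m)
      else distributed M lborel X (\<lambda>x. ennreal (normal_density m (sqrt v) x)))"

definition gaussian_field :: "'w measure \<Rightarrow> 'i set \<Rightarrow> ('i \<Rightarrow> 'w \<Rightarrow> real) \<Rightarrow> bool" where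
  "gaussian_field M T X \<longleftrightarrow>
     (\<forall>S u. finite S \<longrightarrow> S \<subseteq> T \<longrightarrow>
        (\<exists>m v. normal_rv M (\<lambda>\<omega>. \<Sum>i\<in>S. u i * X i \<omega>) m v))"

definition centered_field :: "'w measure \<Rightarrow> 'i set \<Rightarrow> ('i \<Rightarrow> 'w \<Rightarrow> real) \<Rightarrow> bool" where
  "centered_field M T X \<longleftrightarrow> (\<forall>t\<in>T. (\<integral>\<omega>. X t \<omega> \<partial>M) = 0)"

text \<open>Continuity of a field is almost sure continuity of its sample paths.\<close>

definition continuous_field ::
    "'w measure \<Rightarrow> 'i set \<Rightarrow> ('i::topological_space \<Rightarrow> 'w \<Rightarrow> real) \<Rightarrow> bool" where
  "continuous_field M T X \<longleftrightarrow> (AE \<omega> in M. continuous_on T (\<lambda>t. X t \<omega>))"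

definition sample_path :: "'i set \<Rightarrow> ('i \<Rightarrow> 'w \<Rightarrow> real) \<Rightarrow> 'w \<Rightarrow> 'i \<Rightarrow> real" where
  "sample_path T X \<omega> = (\<lambda>t\<in>T. X t \<omega>)"

definition path_space :: "'i set \<Rightarrow> ('i \<Rightarrow> real) measure" where
  "path_space T = PiM T (\<lambda>_. borel)"

definition indep_fields ::
    "'w measure \<Rightarrow> 'i set \<Rightarrow> ('i \<Rightarrow> 'w \<Rightarrow> real) \<Rightarrow> ('i \<Rightarrow> 'w \<Rightarrow> real) \<Rightarrow> bool" where
  "indep_fields M T X Y \<longleftrightarrow>
     prob_space.indep_var M (path_space T) (sample_path T X) (path_space T) (sample_path T Y)"

text \<open>
  Independent copies \<open>Z k\<close>, \<open>k \<in> K\<close>, of a continuous field \<open>X\<close>: the copies may live on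
  another probability space. Equality in law is equality of the laws on the product space, i.e. of
  all finite-dimensional distributions; it does not determine path continuity, which is therefore
  required separately.
\<close>

definition independent_copies ::
    "'v measure \<Rightarrow> ('i::topological_space \<Rightarrow> 'v \<Rightarrow> real) \<Rightarrow> 'i set \<Rightarrow>
     'w measure \<Rightarrow> 'k set \<Rightarrow> ('k \<Rightarrow> 'i \<Rightarrow> 'w \<Rightarrow> real) \<Rightarrow> bool" where
  "independent_copies M X T M' K Z \<longleftrightarrow>
     prob_space.indep_vars M' (\<lambda>_. path_space T) (\<lambda>k. sample_path T (Z k)) K \<and>
     (\<forall>k\<in>K. distr M' (path_space T) (sample_path T (Z k)) = distr M (path_space T) (sample_path T X)
            \<and> continuous_field M' T (Z k))"

definition L2norm :: "'w measure \<Rightarrow> ('w \<Rightarrow> real) \<Rightarrow> real" where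
  "L2norm M Y = sqrt (\<integral>\<omega>. (Y \<omega>)\<^sup>2 \<partial>M)"

section \<open>Gaussian noise\<close>

definition borel_Rplus :: "real measure" where
  "borel_Rplus = restrict_space borel {0..}"

text \<open>
  The variance \<open>v\<close> of \<open>W A\<close> is a real number, so \<open>\<nu>\<close> is automatically finite. Elements of
  \<open>L\<^sup>2\<close> are identified when they agree almost surely.
\<close>

definition gaussian_noise ::
    "'w measure \<Rightarrow> real measure \<Rightarrow> (real set \<Rightarrow> 'w \<Rightarrow> real) \<Rightarrow> bool" where
  "gaussian_noise M \<nu> W \<longleftrightarrow>
     sets \<nu> = sets borel_Rplus \<and>
     (\<forall>A\<in>sets borel_Rplus. \<exists>v\<ge>0. emeasure \<nu> A = ennreal v \<and> normal_rv M (W A) 0 v) \<and>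
     (\<forall>A\<in>sets borel_Rplus. \<forall>B\<in>sets borel_Rplus. A \<inter> B = {} \<longrightarrow>
        (AE \<omega> in M. W (A \<union> B) \<omega> = W A \<omega> + W B \<omega>) \<and>
        prob_space.indep_var M borel (W A) borel (W B))"

section \<open>The assumptions on the field\<close>

definition orthant :: "(real ^ 'n) set" where
  "orthant = {t. \<forall>j. 0 \<le> t $ j}"

text \<open>The box \<open>I\<close> with corners \<open>c\<close>, \<open>c'\<close> is \<open>cbox c c'\<close>; the following is \<open>I\<^sup>(\<^sup>\<epsilon>\<^sup>)\<close>.\<close>

definition enlarged_box :: "real ^ 'n \<Rightarrow> real ^ 'n \<Rightarrow> real \<Rightarrow> (real ^ 'n) set" where
  "enlarged_box c c' \<epsilon> = {t. \<forall>j. c $ j - \<epsilon> < t $ j \<and> t $ j < c' $ j + \<epsilon>}"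

definition alpha :: "('n \<Rightarrow> real) \<Rightarrow> 'n \<Rightarrow> real" where
  "alpha \<gamma> j = 1 / (1 + \<gamma> j)"

definition Delta :: "('n::finite \<Rightarrow> real) \<Rightarrow> real ^ 'n \<Rightarrow> real ^ 'n \<Rightarrow> real" where
  "Delta \<gamma> s t = (\<Sum>j\<in>UNIV. \<bar>s $ j - t $ j\<bar> powr alpha \<gamma> j)"

text \<open>
  The bound \<open>b\<close> ranges over \<open>(a, +\<infinity>]\<close>, and \<open>J\<close> is \<open>[a, b)\<close>; \<open>inverse \<infinity> = 0\<close> in \<open>ereal\<close>.
\<close>

definition assumption_A1 ::
    "'w measure \<Rightarrow> (real ^ 'n \<Rightarrow> 'w \<Rightarrow> real) \<Rightarrow> real ^ 'n \<Rightarrow> real ^ 'n \<Rightarrow> real \<Rightarrow>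
     ('n::finite \<Rightarrow> real) \<Rightarrow> bool" where
  "assumption_A1 M \<xi> c c' \<epsilon> \<gamma> \<longleftrightarrow>
     0 < \<epsilon> \<and> enlarged_box c c' \<epsilon> \<subseteq> orthant \<and> (\<forall>j. 0 < \<gamma> j) \<and>
     (\<exists>(W :: real set \<Rightarrow> real ^ 'n \<Rightarrow> 'w \<Rightarrow> real) \<nu>.
        gaussian_field M (sets borel_Rplus \<times> orthant) (\<lambda>(A, t). W A t) \<and>
        (\<forall>t\<in>enlarged_box c c' \<epsilon>.
            gaussian_noise M (\<nu> t) (\<lambda>A. W A t) \<and> (AE \<omega> in M. W {0..} t \<omega> = \<xi> t \<omega>)) \<and>
        (\<forall>A\<in>sets borel_Rplus. \<forall>B\<in>sets borel_Rplus. A \<inter> B = {} \<longrightarrow>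
            indep_fields M orthant (W A) (W B)) \<and>
        (\<exists>a0 c0. 0 \<le> a0 \<and> 0 < c0 \<and>
           (\<forall>(a::real) (b::ereal). \<forall>s\<in>enlarged_box c c' \<epsilon>. \<forall>t\<in>enlarged_box c c' \<epsilon>.
              a0 \<le> a \<longrightarrow> ereal a < b \<longrightarrow>
              (let J = {x::real. a \<le> x \<and> ereal x < b} in
               L2norm M (\<lambda>\<omega>. W J s \<omega> - \<xi> s \<omega> - W J t \<omega> + \<xi> t \<omega>)
                 \<le> c0 * ((\<Sum>j\<in>UNIV. a powr \<gamma> j * \<bar>s $ j - t $ j\<bar>) + real_of_ereal (inverse b)))) \<and>
           (\<forall>s\<in>enlarged_box c c' \<epsilon>. \<forall>t\<in>enlarged_box c c' \<epsilon>.
              L2norm M (\<lambda>\<omega>. W {0..<a0} s \<omega> - W {0..<a0} t \<omega>)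
                \<le> c0 * (\<Sum>j\<in>UNIV. \<bar>s $ j - t $ j\<bar>))))"

definition assumption_A2 ::
    "'w measure \<Rightarrow> (real ^ 'n \<Rightarrow> 'w \<Rightarrow> real) \<Rightarrow> real ^ 'n \<Rightarrow> real ^ 'n \<Rightarrow> real \<Rightarrow> bool" where
  "assumption_A2 M \<xi> c c' \<epsilon> \<longleftrightarrow>
     (\<exists>d0>0. \<forall>t\<in>enlarged_box c c' \<epsilon>. d0 \<le> L2norm M (\<xi> t))"

definition assumption_A3 ::
    "'w measure \<Rightarrow> (real ^ 'n \<Rightarrow> 'w \<Rightarrow> real) \<Rightarrow> real ^ 'n \<Rightarrow> real ^ 'n \<Rightarrow> real \<Rightarrow>
     ('n::finite \<Rightarrow> real) \<Rightarrow> bool" where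
  "assumption_A3 M \<xi> c c' \<epsilon> \<gamma> \<longleftrightarrow>
     (\<exists>\<rho>0>0. \<forall>t\<in>cbox c c'. \<exists>t'\<in>enlarged_box c c' \<epsilon>. \<exists>\<delta> C.
        (\<forall>j. alpha \<gamma> j < \<delta> j \<and> \<delta> j \<le> 1) \<and> 0 < C \<and>
        (\<forall>s\<in>enlarged_box c c' \<epsilon>. \<forall>r\<in>enlarged_box c c' \<epsilon>.
           max (Delta \<gamma> t s) (Delta \<gamma> t r) \<le> 2 * \<rho>0 \<longrightarrow>
           \<bar>\<integral>\<omega>. \<xi> t' \<omega> * (\<xi> s \<omega> - \<xi> r \<omega>) \<partial>M\<bar>
             \<le> C * (\<Sum>j\<in>UNIV. \<bar>s $ j - r $ j\<bar> powr \<delta> j)))"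

section \<open>The matrix-valued process\<close>

text \<open>Rows and columns are numbered \<open>0, \<dots>, d - 1\<close>; only \<open>\<zeta> (i, j)\<close> with \<open>i \<le> j < d\<close> occur.\<close>

definition upper_indices :: "nat \<Rightarrow> (nat \<times> nat) set" where
  "upper_indices d = {(i, j). i \<le> j \<and> j < d}"

definition X1 :: "nat \<Rightarrow> (nat \<times> nat \<Rightarrow> 'i \<Rightarrow> 'w \<Rightarrow> real) \<Rightarrow> 'i \<Rightarrow> 'w \<Rightarrow> real mat" where
  "X1 d \<zeta> t \<omega> = Matrix.mat d d (\<lambda>(i, j).
     if i < j then \<zeta> (i, j) t \<omega>
     else if i = j then sqrt 2 * \<zeta> (i, i) t \<omega>
     else \<zeta> (j, i) t \<omega>)"

text \<open>
  \<open>l 1, \<dots>, l d\<close> are the eigenvalues of the \<open>d \<times> d\<close> matrix \<open>B\<close>, repeated according to their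
  multiplicity as roots of the characteristic polynomial, in no particular order.
\<close>

definition eigenvalue_family :: "nat \<Rightarrow> real mat \<Rightarrow> (nat \<Rightarrow> real) \<Rightarrow> bool" where
  "eigenvalue_family d B l \<longleftrightarrow> char_poly B = (\<Prod>i\<in>{1..d}. [:- l i, 1:])"

end

theory Submission
  imports Defs
begin

text \<open>
  The matrices with an eigenvalue of multiplicity \<open>k\<close> form a set of codimension
  \<open>\<kappa> = (k + 2) (k - 1) / 2\<close>, and a patch of parameters consists of about \<open>r\<^sup>-\<^sup>\<kappa>\<close> anisotropic cells of
  size \<open>r\<close>, with sides \<open>r\<^sup>1\<^sup>+\<^sup>\<gamma>\<^sup>j\<close>. A cell of size \<open>r\<close> on which the field oscillates by at most
  \<open>\<eta> r\<close> meets this set with probability of order \<open>(\<eta> r)\<^sup>\<kappa>\<close>. With \<open>\<eta> = 1\<close> a union bound over the cells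
  is therefore critical: it is bounded but does not tend to \<open>0\<close>.

  The gain comes from the noise \<open>W\<close>. The contributions of disjoint bands to the oscillations at
  well separated scales are independent, and each of them is at most \<open>\<eta> r\<close> with a probability bounded
  below. So, up to a small probability, every point lies in a cell of one of many scales on which the
  oscillation is at most \<open>\<eta> r\<close>. Covering the patch by the largest such cells costs at most
  a constant times \<open>\<eta>\<^sup>\<kappa>\<close>, for every \<open>\<eta> > 0\<close>.

  The choice of the cover has to be independent of where the matrix is. It is made from
  \<open>\<xi>(x) - \<alpha>(x) \<xi>(x\<^sub>0)\<close>, the residual of the regression on the value at the corner \<open>x\<^sub>0\<close> of the patch;
  given the residual, \<open>\<xi>(x\<^sub>0)\<close> still has a bounded density.
\<close>

section \<open>Laws of families of real random variables\<close>

text \<open>\<kappa> is a count of parameters. A symmetric matrix with an eigenvalue of multiplicity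
  \<open>k\<close> is rebuilt from this eigenvalue and, for each further one, from its value and the
  axis of the reflection that splits it off: \<open>k + l\<close> numbers for the
  \<open>l\<close>-th. Subtracting 1 + (k + 1) + ... + d from d (d + 1) / 2 leaves \<kappa>. As
  \<kappa> is an integer, oscillation can be measured by sums of even powers 2 \<kappa>, whose
  expectations are Gaussian moments. The obstacle is that a cover chosen from the path depends on
  the position of the path. Regression on the corner removes this dependence, but \<alpha>(x)
  \<xi>(x0) has to be put back without spoiling small oscillation, so \<alpha> must vary by o(r)
  over distance r. It does: in E[\<xi>(x0) (\<xi>(s) - \<xi>(t))] only equal bands of the noise
  correlate; low bands vary smoothly, and high bands of \<xi>(x0) have small norm. Independence of
  the matrix entries turns a small ball bound for one entry into a power of it. The cover is built
  from countably many coordinates, so it is measurable even where the hitting set is not known to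
  be.\<close>

lemma integral_mult_iexp_eq_imp_integral_indicator_eq_nonneg:
  fixes X :: "'a \<Rightarrow> real" and X' :: "'b \<Rightarrow> real" and h :: "'a \<Rightarrow> real" and h' :: "'b \<Rightarrow> real"
  assumes "prob_space M" "prob_space M'"
    and [measurable]: "X \<in> borel_measurable M" "X' \<in> borel_measurable M'"
      "h \<in> borel_measurable M" "h' \<in> borel_measurable M'"
    and h: "\<And>x. 0 \<le> h x" "\<And>x. h x \<le> B" and h': "\<And>x. 0 \<le> h' x" "\<And>x. h' x \<le> B"
    and eq: "\<And>u. (\<integral>x. iexp (u * X x) * h x \<partial>M) = (\<integral>x. iexp (u * X' x) * h' x \<partial>M')"
    and A: "A \<in> sets borel"
  shows "(\<integral>x. indicator A (X x) * h x \<partial>M) = (\<integral>x. indicator A (X' x) * h' x \<partial>M')"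
proof -
  interpret M: prob_space M by fact
  interpret M': prob_space M' by fact
  have int: "integrable M h" "integrable M' h'"
    using h h' by (auto intro!: M.integrable_const_bound[of _ B] M'.integrable_const_bound[of _ B])
  define c where "c = (\<integral>x. h x \<partial>M)"
  have "complex_of_real c = complex_of_real (\<integral>x. h' x \<partial>M')"
    using eq[of 0] unfolding c_def by (simp flip: integral_complex_of_real)
  then have c': "c = (\<integral>x. h' x \<partial>M')" by (simp only: of_real_eq_iff)
  have c0: "0 \<le> c" unfolding c_def using h by simp
  show ?thesis
  proof (cases "c = 0")
    case True
    have "AE x in M. h x = 0"
      using integral_nonneg_eq_0_iff_AE[OF int(1)] True h by (auto simp: c_def)
    then have 1: "(\<integral>x. indicator A (X x) * h x \<partial>M) = 0"
      by (intro integral_eq_zero_AE) auto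
    have "AE x in M'. h' x = 0"
      using integral_nonneg_eq_0_iff_AE[OF int(2)] True h' c' by auto
    then have "(\<integral>x. indicator A (X' x) * h' x \<partial>M') = 0"
      by (intro integral_eq_zero_AE) auto
    with 1 show ?thesis by simp
  next
    case False
    then have c: "0 < c" using c0 by simp
    \<comment> \<open>The weight divided by its integral \<open>c\<close> is a probability density.
      Under it the hypothesis \<open>eq\<close> equates two characteristic functions, so Levy's
      uniqueness theorem applies. The generic space \<open>N\<close> serves both sides.\<close>
    have D: "real_distribution (distr (density N (\<lambda>x. ennreal (g x / c))) borel Y) \<and>
        (\<forall>u. char (distr (density N (\<lambda>x. ennreal (g x / c))) borel Y) u = (\<integral>x. iexp (u * Y x) * g x \<partial>N) / c) \<and>
        measure (distr (density N (\<lambda>x. ennreal (g x / c))) borel Y) A = (\<integral>x. indicator A (Y x) * g x \<partial>N) / c"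
      if "prob_space N" and [measurable]: "Y \<in> borel_measurable N" "g \<in> borel_measurable N"
        and g: "\<And>x. 0 \<le> g x" "\<And>x. g x \<le> B" "integrable N g" "c = (\<integral>x. g x \<partial>N)"
      for N :: "'c measure" and Y g
    proof -
      interpret N: prob_space N by fact
      let ?N = "density N (\<lambda>x. ennreal (g x / c))"
      have "emeasure ?N (space ?N) = (\<integral>\<^sup>+x. ennreal (g x / c) \<partial>N)"
        by (simp add: emeasure_density cong: nn_integral_cong)
      also have "\<dots> = ennreal (\<integral>x. g x / c \<partial>N)"
        using g c by (intro nn_integral_eq_integral) auto
      also have "\<dots> = 1" using g(4) c by simp
      finally have "prob_space ?N" by (rule prob_spaceI)
      then have rd: "real_distribution (distr ?N borel Y)"
        unfolding real_distribution_def real_distribution_axioms_def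
        by (auto intro!: prob_space.prob_space_distr)
      have "char (distr ?N borel Y) u = (\<integral>x. iexp (u * Y x) * g x \<partial>N) / c" for u
      proof -
        have "char (distr ?N borel Y) u = (\<integral>x. (g x / c) *\<^sub>R iexp (u * Y x) \<partial>N)"
          unfolding char_def using g c
          by (subst integral_distr) (auto intro!: integral_density)
        also have "\<dots> = (\<integral>x. (iexp (u * Y x) * g x) / c \<partial>N)"
          by (intro Bochner_Integration.integral_cong refl) (simp add: scaleR_conv_of_real)
        finally show ?thesis by simp
      qed
      moreover have "measure (distr ?N borel Y) A = (\<integral>x. indicator A (Y x) * g x \<partial>N) / c"
      proof -
        have "measure (distr ?N borel Y) A = (\<integral>y. indicator A y \<partial>distr ?N borel Y)"
          using A by simp
        also have "\<dots> = (\<integral>x. indicator A (Y x) \<partial>?N)"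
          using A by (subst integral_distr) auto
        also have "\<dots> = (\<integral>x. (g x / c) *\<^sub>R indicator A (Y x) \<partial>N)"
          using g c A by (intro integral_density) auto
        also have "\<dots> = (\<integral>x. (indicator A (Y x) * g x) / c \<partial>N)"
          by (intro Bochner_Integration.integral_cong refl) simp
        finally show ?thesis by simp
      qed
      ultimately show ?thesis using rd by auto
    qed
    note D1 = D[OF assms(1) assms(3) assms(5) h int(1) c_def]
    note D2 = D[OF assms(2) assms(4) assms(6) h' int(2) c']
    let ?D1 = "distr (density M (\<lambda>x. ennreal (h x / c))) borel X"
    let ?D2 = "distr (density M' (\<lambda>x. ennreal (h' x / c))) borel X'"
    have "char ?D1 = char ?D2"
      using D1 D2 eq by (intro ext) simp
    then have "?D1 = ?D2" using D1 D2 by (intro Levy_uniqueness) auto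
    then show ?thesis using D1 D2 c by simp
  qed
qed

text \<open>A complex weight is split into real and imaginary part, and each part is shifted by its
  bound \<open>B\<close> to become nonnegative. The shift is paid for by \<open>eq1\<close>, the
  same identity with weight 1.\<close>

lemma integral_mult_iexp_eq_imp_integral_indicator_eq:
  fixes X :: "'a \<Rightarrow> real" and X' :: "'b \<Rightarrow> real" and h :: "'a \<Rightarrow> complex" and h' :: "'b \<Rightarrow> complex"
  assumes M: "prob_space M" "prob_space M'"
    and [measurable]: "X \<in> borel_measurable M" "X' \<in> borel_measurable M'"
      "h \<in> borel_measurable M" "h' \<in> borel_measurable M'"
    and h: "\<And>x. cmod (h x) \<le> B" and h': "\<And>x. cmod (h' x) \<le> B"
    and eq: "\<And>u. (\<integral>x. iexp (u * X x) * h x \<partial>M) = (\<integral>x. iexp (u * X' x) * h' x \<partial>M')"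
    and eq1: "\<And>u. (\<integral>x. iexp (u * X x) \<partial>M) = (\<integral>x. iexp (u * X' x) \<partial>M')"
    and A[measurable]: "A \<in> sets borel"
  shows "(\<integral>x. indicator A (X x) * h x \<partial>M) = (\<integral>x. indicator A (X' x) * h' x \<partial>M')"
proof -
  interpret M: prob_space M by fact
  interpret M': prob_space M' by fact
  have B0: "0 \<le> B" using h by (meson norm_ge_zero order_trans)
  have real_case: "(\<integral>x. indicator A (X x) * g x \<partial>M) = (\<integral>x. indicator A (X' x) * g' x \<partial>M')"
    if [measurable]: "g \<in> borel_measurable M" "g' \<in> borel_measurable M'"
      and g: "\<And>x. \<bar>g x\<bar> \<le> B" "\<And>x. \<bar>g' x\<bar> \<le> B"
      and geq: "\<And>u. (\<integral>x. iexp (u * X x) * g x \<partial>M) = (\<integral>x. iexp (u * X' x) * g' x \<partial>M')"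
    for g :: "'a \<Rightarrow> real" and g' :: "'b \<Rightarrow> real"
  proof -
    have ii: "integrable M (\<lambda>x. iexp (u * X x) * (g x))" "integrable M' (\<lambda>x. iexp (u * X' x) * (g' x))" for u
      using g by (auto intro!: M.integrable_const_bound[of _ B] M'.integrable_const_bound[of _ B] simp: norm_mult)
    have ii1: "integrable M (\<lambda>x. iexp (u * X x))" "integrable M' (\<lambda>x. iexp (u * X' x))" for u
      by (auto intro!: M.integrable_const_bound[of _ 1] M'.integrable_const_bound[of _ 1])
    have ij: "integrable M (\<lambda>x. indicator A (X x) * g x)" "integrable M' (\<lambda>x. indicator A (X' x) * g' x)"
      using g B0 by (auto intro!: M.integrable_const_bound[of _ B] M'.integrable_const_bound[of _ B]
          simp: indicator_def)
    have ij1: "integrable M (\<lambda>x. indicator A (X x) :: real)" "integrable M' (\<lambda>x. indicator A (X' x) :: real)"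
      by (auto intro!: M.integrable_const_bound[of _ 1] M'.integrable_const_bound[of _ 1] simp: indicator_def)
    have gB: "0 \<le> g x + B" "g x + B \<le> 2 * B" for x using g(1)[of x] by linarith+
    have gB': "0 \<le> g' x + B" "g' x + B \<le> 2 * B" for x using g(2)[of x] by linarith+
    have 1: "(\<integral>x. indicator A (X x) * (g x + B) \<partial>M) = (\<integral>x. indicator A (X' x) * (g' x + B) \<partial>M')"
    proof (rule integral_mult_iexp_eq_imp_integral_indicator_eq_nonneg[OF M, where B = "2 * B"])
      fix u
      show "(\<integral>x. iexp (u * X x) * (g x + B) \<partial>M) = (\<integral>x. iexp (u * X' x) * (g' x + B) \<partial>M')"
        using geq[of u] eq1[of u] ii[of u] ii1[of u] by (simp add: distrib_left)
    qed (use gB gB' in auto)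
    have 2: "(\<integral>x. indicator A (X x) * (1::real) \<partial>M) = (\<integral>x. indicator A (X' x) * 1 \<partial>M')"
      by (rule integral_mult_iexp_eq_imp_integral_indicator_eq_nonneg[OF M, where B = 1 and h = "\<lambda>_. 1" and h' = "\<lambda>_. 1"])
         (use eq1 in auto)
    show ?thesis using 1 2 ij ij1 by (simp add: distrib_left)
  qed
  have ih: "integrable M (\<lambda>x. iexp (u * X x) * h x)" "integrable M' (\<lambda>x. iexp (u * X' x) * h' x)" for u
    using h h' by (auto intro!: M.integrable_const_bound[of _ B] M'.integrable_const_bound[of _ B] simp: norm_mult)
  \<comment> \<open>Real and imaginary parts need the identity for the conjugate weight as well; it
    is the conjugate of the given identity at \<open>- u\<close>.\<close>
  have cn: "(\<integral>x. iexp (u * X x) * cnj (h x) \<partial>M) = (\<integral>x. iexp (u * X' x) * cnj (h' x) \<partial>M')" for u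
  proof -
    have "(\<integral>x. iexp (u * X x) * cnj (h x) \<partial>M) = (\<integral>x. cnj (iexp (- u * X x) * h x) \<partial>M)"
      by (intro Bochner_Integration.integral_cong refl) (simp add: exp_cnj)
    also have "\<dots> = cnj (\<integral>x. iexp (- u * X x) * h x \<partial>M)"
      by (rule integral_bounded_linear[OF bounded_linear_cnj ih(1)])
    also have "\<dots> = cnj (\<integral>x. iexp (- u * X' x) * h' x \<partial>M')" by (simp only: eq)
    also have "\<dots> = (\<integral>x. cnj (iexp (- u * X' x) * h' x) \<partial>M')"
      by (rule integral_bounded_linear[OF bounded_linear_cnj ih(2), symmetric])
    also have "\<dots> = (\<integral>x. iexp (u * X' x) * cnj (h' x) \<partial>M')"
      by (intro Bochner_Integration.integral_cong refl) (simp add: exp_cnj)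
    finally show ?thesis .
  qed
  have cm [measurable]: "(\<lambda>x. cnj (h x)) \<in> borel_measurable M" "(\<lambda>x. cnj (h' x)) \<in> borel_measurable M'"
    by (auto intro!: borel_measurable_continuous_on[OF continuous_on_cnj[OF continuous_on_id]])
  have ihc: "integrable M (\<lambda>x. iexp (u * X x) * cnj (h x))" "integrable M' (\<lambda>x. iexp (u * X' x) * cnj (h' x))" for u
    using h h' by (auto intro!: M.integrable_const_bound[of _ B] M'.integrable_const_bound[of _ B] simp: norm_mult)
  have re: "(\<integral>x. indicator A (X x) * Re (h x) \<partial>M) = (\<integral>x. indicator A (X' x) * Re (h' x) \<partial>M')"
  proof (rule real_case)
    fix u
    have *: "complex_of_real (Re z) = (z + cnj z) / 2" for z by (simp add: complex_add_cnj)
    show "(\<integral>x. iexp (u * X x) * Re (h x) \<partial>M) = (\<integral>x. iexp (u * X' x) * Re (h' x) \<partial>M')"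
      unfolding * using ih[of u] ihc[of u] eq[of u] cn[of u]
      by (simp add: distrib_left add_divide_distrib)
  qed (use h h' in \<open>auto intro: order_trans[OF abs_Re_le_cmod]\<close>)
  have im: "(\<integral>x. indicator A (X x) * Im (h x) \<partial>M) = (\<integral>x. indicator A (X' x) * Im (h' x) \<partial>M')"
  proof (rule real_case)
    fix u
    obtain c where *: "\<And>z. complex_of_real (Im z) = c * (z - cnj z)"
    proof
      show "complex_of_real (Im z) = (1 / (2 * \<i>)) * (z - cnj z)" for z by (simp add: complex_eq_iff)
    qed
    have **: "w * (c * (z - cnj z)) = c * (w * z) - c * (w * cnj z)" for w z by (simp add: algebra_simps)
    show "(\<integral>x. iexp (u * X x) * Im (h x) \<partial>M) = (\<integral>x. iexp (u * X' x) * Im (h' x) \<partial>M')"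
      unfolding * ** using ih[of u] ihc[of u] eq[of u] cn[of u] by simp
  qed (use h h' in \<open>auto intro: order_trans[OF abs_Im_le_cmod]\<close>)
  have ia: "integrable M (\<lambda>x. indicator A (X x) * h x)" "integrable M' (\<lambda>x. indicator A (X' x) * h' x)"
    using h h' B0 by (auto intro!: M.integrable_const_bound[of _ B] M'.integrable_const_bound[of _ B]
        simp: norm_mult indicator_def)
  show ?thesis
  proof (rule complex_eqI)
    have "Re (\<integral>x. indicator A (X x) * h x \<partial>M) = (\<integral>x. Re (indicator A (X x) * h x) \<partial>M)"
      using ia by (intro integral_Re[symmetric]) auto
    moreover have "Re (\<integral>x. indicator A (X' x) * h' x \<partial>M') = (\<integral>x. Re (indicator A (X' x) * h' x) \<partial>M')"
      using ia by (intro integral_Re[symmetric]) auto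
    moreover have "Re (indicator A y * z) = indicator A y * Re z" for y :: real and z by (simp add: indicator_def)
    ultimately show "Re (\<integral>x. indicator A (X x) * h x \<partial>M) = Re (\<integral>x. indicator A (X' x) * h' x \<partial>M')"
      using re by simp
    have "Im (\<integral>x. indicator A (X x) * h x \<partial>M) = (\<integral>x. Im (indicator A (X x) * h x) \<partial>M)"
      using ia by (intro integral_Im[symmetric]) auto
    moreover have "Im (\<integral>x. indicator A (X' x) * h' x \<partial>M') = (\<integral>x. Im (indicator A (X' x) * h' x) \<partial>M')"
      using ia by (intro integral_Im[symmetric]) auto
    moreover have "Im (indicator A y * z) = indicator A y * Im z" for y :: real and z by (simp add: indicator_def)
    ultimately show "Im (\<integral>x. indicator A (X x) * h x \<partial>M) = Im (\<integral>x. indicator A (X' x) * h' x \<partial>M')"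
      using im by simp
  qed
qed


lemma iexp_sum_measurable [measurable]:
  assumes "finite S" "\<And>i. i \<in> S \<Longrightarrow> Y i \<in> borel_measurable M"
  shows "(\<lambda>x. iexp (\<Sum>i\<in>S. u i * Y i x)) \<in> borel_measurable M"
  using assms by measurable

lemma emeasure_distr_prod_emb:
  fixes Z :: "'i \<Rightarrow> 'c \<Rightarrow> real"
  assumes "prob_space N" and Z: "\<And>i. i \<in> I \<Longrightarrow> Z i \<in> borel_measurable N"
    and J: "finite J" "J \<subseteq> I" and A: "\<And>i. i \<in> J \<Longrightarrow> A i \<in> sets borel"
  shows "emeasure (distr N (PiM I (\<lambda>_. borel)) (\<lambda>x. \<lambda>i\<in>I. Z i x)) (prod_emb I (\<lambda>_. borel) J (Pi\<^sub>E J A))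
      = ennreal (\<integral>x. (\<Prod>j\<in>J. indicator (A j) (Z j x)) \<partial>N)"
  proof -
    interpret N: prob_space N by fact
    let ?B = "{x \<in> space N. \<forall>j\<in>J. Z j x \<in> A j}"
    have B: "?B \<in> sets N"
    proof -
      have "{x \<in> space N. Z j x \<in> A j} \<in> sets N" if "j \<in> J" for j
      proof -
        have [measurable]: "A j \<in> sets borel" "Z j \<in> borel_measurable N" using that J Z A by auto
        show ?thesis by measurable
      qed
      then show ?thesis using J(1) by (rule sets.sets_Collect_finite_All) 
    qed
    have "emeasure (distr N (PiM I (\<lambda>_. borel)) (\<lambda>x. \<lambda>i\<in>I. Z i x)) (prod_emb I (\<lambda>_. borel) J (Pi\<^sub>E J A))
       = emeasure N ((\<lambda>x. \<lambda>i\<in>I. Z i x) -` prod_emb I (\<lambda>_. borel) J (Pi\<^sub>E J A) \<inter> space N)"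
      using J A Z by (intro emeasure_distr measurable_restrict sets_PiM_I) auto
    also have "(\<lambda>x. \<lambda>i\<in>I. Z i x) -` prod_emb I (\<lambda>_. borel) J (Pi\<^sub>E J A) \<inter> space N = ?B"
      using J by (auto simp: prod_emb_def restrict_def PiE_iff subset_eq extensional_def)
    also have "emeasure N ?B = ennreal (\<integral>x. indicator ?B x \<partial>N)"
      using B by (simp add: N.emeasure_eq_measure)
    also have "(\<integral>x. (indicator ?B x :: real) \<partial>N) = (\<integral>x. (\<Prod>j\<in>J. indicator (A j) (Z j x)) \<partial>N)"
    proof (intro Bochner_Integration.integral_cong refl)
      fix x assume "x \<in> space N"
      then show "indicator ?B x = (\<Prod>j\<in>J. indicator (A j) (Z j x) :: real)"
        using J(1) by (cases "\<forall>j\<in>J. Z j x \<in> A j") (auto simp: indicator_def)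
    qed
    finally show ?thesis .
  qed

lemma complex_of_real_integral_prod_indicator:
  fixes Z :: "'i \<Rightarrow> 'c \<Rightarrow> real"
  shows "complex_of_real (\<integral>x. (\<Prod>j\<in>J. indicator (A j) (Z j x)) \<partial>N) = (\<integral>x. (\<Prod>j\<in>J. indicator (A j) (Z j x)) \<partial>N)"
  proof -
    have "complex_of_real (\<Prod>j\<in>J. indicator (A j) (Z j x)) = (\<Prod>j\<in>J. indicator (A j) (Z j x))" for x
      unfolding of_real_prod by (intro prod.cong) (auto simp: indicator_def)
    then show ?thesis by (simp flip: integral_complex_of_real)
  qed

text \<open>The multivariate uniqueness theorem is reduced to the one-dimensional one: indicators
  are introduced one coordinate at a time, and everything that concerns the other coordinates is
  kept as a bounded complex weight.\<close>

lemma distr_PiM_eqI_char: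
  fixes Y :: "'i \<Rightarrow> 'a \<Rightarrow> real" and Y' :: "'i \<Rightarrow> 'b \<Rightarrow> real"
  assumes M: "prob_space M" "prob_space M'"
    and meas: "\<And>i. i \<in> I \<Longrightarrow> Y i \<in> borel_measurable M" "\<And>i. i \<in> I \<Longrightarrow> Y' i \<in> borel_measurable M'"
    and eq: "\<And>S u. finite S \<Longrightarrow> S \<subseteq> I \<Longrightarrow>
      (\<integral>x. iexp (\<Sum>i\<in>S. u i * Y i x) \<partial>M) = (\<integral>x. iexp (\<Sum>i\<in>S. u i * Y' i x) \<partial>M')"
  shows "distr M (PiM I (\<lambda>_. borel)) (\<lambda>x. \<lambda>i\<in>I. Y i x) = distr M' (PiM I (\<lambda>_. borel)) (\<lambda>x. \<lambda>i\<in>I. Y' i x)"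
proof -
  interpret M: prob_space M by fact
  interpret M': prob_space M' by fact
  have fm: "finite_measure (distr M (PiM I (\<lambda>_. borel)) (\<lambda>x. \<lambda>i\<in>I. Y i x))"
    using meas by (intro M.finite_measure_distr measurable_restrict) auto
  have eqJ: "emeasure (distr M (PiM I (\<lambda>_. borel)) (\<lambda>x. \<lambda>i\<in>I. Y i x)) (prod_emb I (\<lambda>_. borel) J (Pi\<^sub>E J A)) =
    emeasure (distr M' (PiM I (\<lambda>_. borel)) (\<lambda>x. \<lambda>i\<in>I. Y' i x)) (prod_emb I (\<lambda>_. borel) J (Pi\<^sub>E J A))"
    if J: "finite J" "J \<subseteq> I" and A: "\<And>i. i \<in> J \<Longrightarrow> A i \<in> sets borel" for A :: "'i \<Rightarrow> real set" and J
  proof -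
  have mJ: "Y i \<in> borel_measurable M" "Y' i \<in> borel_measurable M'" if "i \<in> J" for i
    using that J meas by auto
  have Q: "(\<integral>x. (\<Prod>j\<in>J'. indicator (A j) (Y j x)) * iexp (\<Sum>i\<in>J. u i * Y i x) \<partial>M)
         = (\<integral>x. (\<Prod>j\<in>J'. indicator (A j) (Y' j x)) * iexp (\<Sum>i\<in>J. u i * Y' i x) \<partial>M')"
    if "finite J'" "J' \<subseteq> J" for J' u
    using that
  proof (induction J' arbitrary: u)
    case empty
    then show ?case using eq[OF J] by simp
  next
    case (insert j J')
    then have j: "j \<in> J" and J': "J' \<subseteq> J" by auto
    let ?h = "\<lambda>x. (\<Prod>j\<in>J'. indicator (A j) (Y j x)) * iexp (\<Sum>i\<in>J. u i * Y i x)"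
    let ?h' = "\<lambda>x. (\<Prod>j\<in>J'. indicator (A j) (Y' j x)) * iexp (\<Sum>i\<in>J. u i * Y' i x)"
    \<comment> \<open>The exponentials of all coordinates in \<open>J\<close> stay in the weight. A
      further factor in coordinate \<open>j\<close> is then absorbed by changing \<open>u\<close> at
      \<open>j\<close>, which is why the induction is over arbitrary \<open>u\<close>.\<close>
    have split: "iexp (s * y j) * iexp (\<Sum>i\<in>J. u i * y i) = iexp (\<Sum>i\<in>J. (u(j := u j + s)) i * y i)" for s and y :: "'i \<Rightarrow> real"
    proof -
      have "(\<Sum>i\<in>J. (u(j := u j + s)) i * y i) = (\<Sum>i\<in>J. u i * y i + (if i = j then s * y j else 0))"
        by (intro sum.cong) (auto simp: algebra_simps)
      also have "\<dots> = (\<Sum>i\<in>J. u i * y i) + s * y j" using j J by (simp add: sum.distrib)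
      finally show ?thesis by (simp add: algebra_simps flip: exp_add)
    qed
    have "(\<integral>x. indicator (A j) (Y j x) * ?h x \<partial>M) = (\<integral>x. indicator (A j) (Y' j x) * ?h' x \<partial>M')"
    proof (rule integral_mult_iexp_eq_imp_integral_indicator_eq[OF M, where B = 1])
      show "Y j \<in> borel_measurable M" "Y' j \<in> borel_measurable M'" "A j \<in> sets borel"
        using j mJ A by auto
      have mA: "(\<lambda>x. indicator (A i) (Y i x) :: complex) \<in> borel_measurable M"
        "(\<lambda>x. indicator (A i) (Y' i x) :: complex) \<in> borel_measurable M'" if "i \<in> J'" for i
      proof -
        have [measurable]: "A i \<in> sets borel" "Y i \<in> borel_measurable M" "Y' i \<in> borel_measurable M'"
          using that J' mJ A by auto
        show "(\<lambda>x. indicator (A i) (Y i x) :: complex) \<in> borel_measurable M"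
        "(\<lambda>x. indicator (A i) (Y' i x) :: complex) \<in> borel_measurable M'" by measurable
      qed
      show "?h \<in> borel_measurable M" "?h' \<in> borel_measurable M'"
        using mA mJ J by (auto intro!: borel_measurable_times borel_measurable_prod iexp_sum_measurable)
      have pn: "cmod (\<Prod>j\<in>J'. indicator (A j) (y j)) \<le> 1" for y :: "'i \<Rightarrow> real"
        unfolding prod_norm[symmetric] by (intro prod_le_1) (auto simp: indicator_def)
      show "cmod (?h x) \<le> 1" for x using pn[of "\<lambda>j. Y j x"] by (simp add: norm_mult)
      show "cmod (?h' x) \<le> 1" for x using pn[of "\<lambda>j. Y' j x"] by (simp add: norm_mult)
      show "(\<integral>x. iexp (s * Y j x) * ?h x \<partial>M) = (\<integral>x. iexp (s * Y' j x) * ?h' x \<partial>M')" for s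
      proof -
        have sp: "iexp (s * y j) * ((\<Prod>j\<in>J'. indicator (A j) (y j)) * iexp (\<Sum>i\<in>J. u i * y i)) =
            (\<Prod>j\<in>J'. indicator (A j) (y j)) * iexp (\<Sum>i\<in>J. (u(j := u j + s)) i * y i)" for y :: "'i \<Rightarrow> real"
          unfolding split[symmetric] by (simp only: mult_ac)
        show ?thesis
          unfolding sp[of "\<lambda>j. Y j _"] sp[of "\<lambda>j. Y' j _"] by (rule insert.IH[OF J'])
      qed
      show "(\<integral>x. iexp (s * Y j x) \<partial>M) = (\<integral>x. iexp (s * Y' j x) \<partial>M')" for s
        using eq[of "{j}" "\<lambda>_. s"] j J by auto
    qed
    then show ?case using insert(1,2) by (simp add: mult.assoc)
  qed
  have "complex_of_real (\<integral>x. (\<Prod>j\<in>J. indicator (A j) (Y j x)) \<partial>M) = complex_of_real (\<integral>x. (\<Prod>j\<in>J. indicator (A j) (Y' j x)) \<partial>M')"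
    unfolding complex_of_real_integral_prod_indicator using Q[OF J(1) order_refl, of "\<lambda>_. 0"] by simp
  then have "(\<integral>x. (\<Prod>j\<in>J. indicator (A j) (Y j x) :: real) \<partial>M) = (\<integral>x. (\<Prod>j\<in>J. indicator (A j) (Y' j x)) \<partial>M')"
    by (simp only: of_real_eq_iff)
  then show ?thesis
    using emeasure_distr_prod_emb[OF M(1) meas(1) J A] emeasure_distr_prod_emb[OF M(2) meas(2) J A] by simp
  qed
  show ?thesis
    by (rule measure_eqI_PiM_infinite[where I = I and M = "\<lambda>_. borel", OF _ _ eqJ fm]) auto
qed

section \<open>Centred Gaussian families: decoupling and symmetrization\<close>

text \<open>Encoding by characteristic functions treats zero variance like any other and makes the
  passage to linear images immediate. Only centred families are covered, since the second moment
  takes the place of the variance.\<close>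

definition gaussian_family :: "'w measure \<Rightarrow> 'i set \<Rightarrow> ('i \<Rightarrow> 'w \<Rightarrow> real) \<Rightarrow> bool" where
  "gaussian_family M I Y \<longleftrightarrow>
     (\<forall>i\<in>I. Y i \<in> borel_measurable M \<and> integrable M (\<lambda>\<omega>. (Y i \<omega>)\<^sup>2)) \<and>
     (\<forall>S u. finite S \<longrightarrow> S \<subseteq> I \<longrightarrow>
        (\<integral>\<omega>. iexp (\<Sum>i\<in>S. u i * Y i \<omega>) \<partial>M) = exp (- (\<integral>\<omega>. (\<Sum>i\<in>S. u i * Y i \<omega>)\<^sup>2 \<partial>M) / 2))"

lemma integrable_mult_square:
  fixes f g :: "'a \<Rightarrow> real"
  assumes "f \<in> borel_measurable M" "g \<in> borel_measurable M"
    "integrable M (\<lambda>x. (f x)\<^sup>2)" "integrable M (\<lambda>x. (g x)\<^sup>2)"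
  shows "integrable M (\<lambda>x. f x * g x)"
proof (rule Bochner_Integration.integrable_bound)
  show "integrable M (\<lambda>x. (f x)\<^sup>2 + (g x)\<^sup>2)" using assms by simp
  show "(\<lambda>x. f x * g x) \<in> borel_measurable M" using assms by simp
  show "AE x in M. norm (f x * g x) \<le> norm ((f x)\<^sup>2 + (g x)\<^sup>2)"
  proof (intro AE_I2)
    fix x
    have "2 * \<bar>f x\<bar> * \<bar>g x\<bar> \<le> (f x)\<^sup>2 + (g x)\<^sup>2" using sum_squares_bound[of "\<bar>f x\<bar>" "\<bar>g x\<bar>"] by simp
    moreover have "0 \<le> \<bar>f x\<bar> * \<bar>g x\<bar>" by simp
    ultimately have "\<bar>f x\<bar> * \<bar>g x\<bar> \<le> (f x)\<^sup>2 + (g x)\<^sup>2" by linarith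
    then show "norm (f x * g x) \<le> norm ((f x)\<^sup>2 + (g x)\<^sup>2)" by (simp add: abs_mult)
  qed
qed

lemma integrable_square_add:
  fixes f g :: "'a \<Rightarrow> real"
  assumes "f \<in> borel_measurable M" "g \<in> borel_measurable M"
    "integrable M (\<lambda>x. (f x)\<^sup>2)" "integrable M (\<lambda>x. (g x)\<^sup>2)"
  shows "integrable M (\<lambda>x. (f x + g x)\<^sup>2)"
  using assms integrable_mult_square[OF assms] by (simp add: power2_sum mult.assoc)

lemma integrable_square_sum:
  fixes Y :: "'i \<Rightarrow> 'a \<Rightarrow> real"
  assumes "finite S" "\<And>i. i \<in> S \<Longrightarrow> Y i \<in> borel_measurable M" "\<And>i. i \<in> S \<Longrightarrow> integrable M (\<lambda>x. (Y i x)\<^sup>2)"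
  shows "integrable M (\<lambda>x. (\<Sum>i\<in>S. u i * Y i x)\<^sup>2)"
  using assms
proof (induction S)
  case (insert i S)
  have "integrable M (\<lambda>x. (u i * Y i x + (\<Sum>i\<in>S. u i * Y i x))\<^sup>2)"
    using insert by (intro integrable_square_add) (auto simp: power_mult_distrib)
  then show ?case using insert by simp
qed simp

lemma (in prob_space) integral_iexp_pair:
  assumes "prob_space N" "f \<in> borel_measurable M" "g \<in> borel_measurable N"
  shows "(\<integral>z. iexp (f (fst z) + g (snd z)) \<partial>(M \<Otimes>\<^sub>M N)) = (\<integral>x. iexp (f x) \<partial>M) * (\<integral>y. iexp (g y) \<partial>N)"
proof -
  interpret N: prob_space N by fact
  interpret MN: pair_prob_space M N ..
  note [measurable] = assms(2,3)
  have "integrable (M \<Otimes>\<^sub>M N) (\<lambda>z. iexp (f (fst z) + g (snd z)))"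
    by (intro MN.integrable_const_bound[of _ 1]) auto
  then have "(\<integral>z. iexp (f (fst z) + g (snd z)) \<partial>(M \<Otimes>\<^sub>M N)) = (\<integral>x. \<integral>y. iexp (f x + g y) \<partial>N \<partial>M)"
    using MN.integral_fst'[of "\<lambda>z. iexp (f (fst z) + g (snd z))"] by (simp only: split_beta fst_conv snd_conv)
  also have "\<dots> = (\<integral>x. \<integral>y. iexp (f x) * iexp (g y) \<partial>N \<partial>M)"
    by (simp add: exp_add distrib_left)
  finally show ?thesis by simp
qed

text \<open>For uncorrelated groups the second moments of combinations add, so the characteristic
  functions multiply. Independence is phrased as an equality of laws in which the second group is
  read at an independent sample point; in this form one group can be integrated out while the other
  is held fixed.\<close>

lemma (in prob_space) gaussian_decouple:
  fixes Y :: "'i + 'j \<Rightarrow> 'a \<Rightarrow> real"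
  assumes g: "gaussian_family M (I1 <+> I2) Y"
    and uncor: "\<And>i j. i \<in> I1 \<Longrightarrow> j \<in> I2 \<Longrightarrow> expectation (\<lambda>\<omega>. Y (Inl i) \<omega> * Y (Inr j) \<omega>) = 0"
  shows "distr M (PiM (I1 <+> I2) (\<lambda>_. borel)) (\<lambda>\<omega>. \<lambda>i\<in>I1 <+> I2. Y i \<omega>) =
    distr (M \<Otimes>\<^sub>M M) (PiM (I1 <+> I2) (\<lambda>_. borel))
      (\<lambda>z. \<lambda>i\<in>I1 <+> I2. Y i (case i of Inl _ \<Rightarrow> fst z | Inr _ \<Rightarrow> snd z))"
proof (rule distr_PiM_eqI_char)
  show pM: "prob_space M" by (rule prob_space_axioms)
  interpret MM: pair_prob_space M M ..
  show "prob_space (M \<Otimes>\<^sub>M M)" by (rule MM.P.prob_space_axioms)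
  have meas: "Y i \<in> borel_measurable M" "integrable M (\<lambda>\<omega>. (Y i \<omega>)\<^sup>2)" if "i \<in> I1 <+> I2" for i
    using g that by (auto simp: gaussian_family_def)
  then show "Y i \<in> borel_measurable M" if "i \<in> I1 <+> I2" for i using that by auto
  show "(\<lambda>z. Y i (case i of Inl _ \<Rightarrow> fst z | Inr _ \<Rightarrow> snd z)) \<in> borel_measurable (M \<Otimes>\<^sub>M M)"
    if "i \<in> I1 <+> I2" for i
    using meas(1)[OF that] by (cases i) auto
  fix S :: "('i + 'j) set" and u assume S: "finite S" "S \<subseteq> I1 <+> I2"
  define S1 where "S1 = Inl -` S" define S2 where "S2 = Inr -` S"
  have SS: "S = Inl ` S1 \<union> Inr ` S2" "Inl ` S1 \<inter> Inr ` S2 = {}"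
    unfolding S1_def S2_def by (auto simp: image_iff) (metis sum.exhaust)
  have fin: "finite S1" "finite S2" using S(1) unfolding S1_def S2_def
    by (auto intro!: finite_vimageI)
  have sub: "S1 \<subseteq> I1" "S2 \<subseteq> I2" using S(2) by (auto simp: S1_def S2_def)
  have split: "(\<Sum>i\<in>S. u i * y i) = (\<Sum>i\<in>S1. u (Inl i) * y (Inl i)) + (\<Sum>i\<in>S2. u (Inr i) * y (Inr i))"
    for y :: "'i + 'j \<Rightarrow> real"
    unfolding SS(1) using fin SS(2) by (subst sum.union_disjoint) (auto simp: sum.reindex)
  define f where "f \<omega> = (\<Sum>i\<in>S1. u (Inl i) * Y (Inl i) \<omega>)" for \<omega>
  define h where "h \<omega> = (\<Sum>i\<in>S2. u (Inr i) * Y (Inr i) \<omega>)" for \<omega>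
  have mf: "f \<in> borel_measurable M" "h \<in> borel_measurable M"
    unfolding f_def h_def
    by (intro borel_measurable_sum borel_measurable_times borel_measurable_const meas(1); use sub in auto)+
  have i2: "integrable M (\<lambda>\<omega>. (f \<omega>)\<^sup>2)" "integrable M (\<lambda>\<omega>. (h \<omega>)\<^sup>2)"
    unfolding f_def h_def by (intro integrable_square_sum fin meas; use sub in auto)+
  have "expectation (\<lambda>\<omega>. f \<omega> * h \<omega>) = (\<Sum>i\<in>S1. \<Sum>j\<in>S2. u (Inl i) * u (Inr j) * expectation (\<lambda>\<omega>. Y (Inl i) \<omega> * Y (Inr j) \<omega>))"
  proof -
    have "f \<omega> * h \<omega> = (\<Sum>i\<in>S1. \<Sum>j\<in>S2. u (Inl i) * u (Inr j) * (Y (Inl i) \<omega> * Y (Inr j) \<omega>))" for \<omega>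
      unfolding f_def h_def sum_product by (intro sum.cong refl) (simp add: algebra_simps)
    moreover have "integrable M (\<lambda>\<omega>. Y (Inl i) \<omega> * Y (Inr j) \<omega>)" if "i \<in> S1" "j \<in> S2" for i j
      using that sub by (intro integrable_mult_square meas) auto
    ultimately show ?thesis by (simp add: Bochner_Integration.integral_sum)
  qed
  also have "\<dots> = 0" using uncor sub by (intro sum.neutral ballI) auto
  finally have fh: "expectation (\<lambda>\<omega>. f \<omega> * h \<omega>) = 0" .
  have "expectation (\<lambda>\<omega>. (f \<omega> + h \<omega>)\<^sup>2) = expectation (\<lambda>\<omega>. (f \<omega>)\<^sup>2) + expectation (\<lambda>\<omega>. (h \<omega>)\<^sup>2) + 2 * expectation (\<lambda>\<omega>. f \<omega> * h \<omega>)"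
    using i2 integrable_mult_square[OF mf i2] by (simp add: power2_sum mult.assoc)
  then have sq: "expectation (\<lambda>\<omega>. (f \<omega> + h \<omega>)\<^sup>2) = expectation (\<lambda>\<omega>. (f \<omega>)\<^sup>2) + expectation (\<lambda>\<omega>. (h \<omega>)\<^sup>2)"
    using fh by simp
  have cf: "(\<integral>\<omega>. iexp (\<Sum>i\<in>S. u i * Y i \<omega>) \<partial>M) = exp (- (\<integral>\<omega>. (\<Sum>i\<in>S. u i * Y i \<omega>)\<^sup>2 \<partial>M) / 2)"
    if "finite S" "S \<subseteq> I1 <+> I2" for S u using g that by (auto simp: gaussian_family_def)
  have c0: "(\<integral>\<omega>. iexp (\<Sum>i\<in>S. u i * Y i \<omega>) \<partial>M) = exp (- (expectation (\<lambda>\<omega>. (f \<omega>)\<^sup>2) + expectation (\<lambda>\<omega>. (h \<omega>)\<^sup>2)) / 2)"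
    using cf[OF S, of u] unfolding split f_def[symmetric] h_def[symmetric] sq .
  have c1: "(\<integral>\<omega>. iexp (f \<omega>) \<partial>M) = exp (- expectation (\<lambda>\<omega>. (f \<omega>)\<^sup>2) / 2)"
    using cf[of "Inl ` S1" u] fin sub by (auto simp: f_def sum.reindex)
  have c2: "(\<integral>\<omega>. iexp (h \<omega>) \<partial>M) = exp (- expectation (\<lambda>\<omega>. (h \<omega>)\<^sup>2) / 2)"
    using cf[of "Inr ` S2" u] fin sub by (auto simp: h_def sum.reindex)
  have "(\<integral>z. iexp (\<Sum>i\<in>S. u i * Y i (case i of Inl _ \<Rightarrow> fst z | Inr _ \<Rightarrow> snd z)) \<partial>(M \<Otimes>\<^sub>M M)) =
     (\<integral>z. iexp (f (fst z) + h (snd z)) \<partial>(M \<Otimes>\<^sub>M M))"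
    unfolding split f_def h_def by simp
  also have "\<dots> = (\<integral>\<omega>. iexp (f \<omega>) \<partial>M) * (\<integral>\<omega>. iexp (h \<omega>) \<partial>M)"
    by (rule integral_iexp_pair[OF pM mf])
  also have "\<dots> = exp (- (expectation (\<lambda>\<omega>. (f \<omega>)\<^sup>2) + expectation (\<lambda>\<omega>. (h \<omega>)\<^sup>2)) / 2)"
    unfolding c1 c2 by (simp add: exp_add[symmetric] add_divide_distrib flip: of_real_mult)
  finally show "(\<integral>x. iexp (\<Sum>i\<in>S. u i * Y i x) \<partial>M) =
     (\<integral>z. iexp (\<Sum>i\<in>S. u i * Y i (case i of Inl _ \<Rightarrow> fst z | Inr _ \<Rightarrow> snd z)) \<partial>(M \<Otimes>\<^sub>M M))"
    using c0 by simp
qed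

text \<open>Invariance of a centred Gaussian law under rotation by 45 degrees. It opens a way to
  lower bounds for small balls, since two copies have a small difference as soon as they fall into a
  common small cell, wherever that cell is.\<close>

lemma (in prob_space) gaussian_symmetrize:
  fixes Y :: "'i \<Rightarrow> 'a \<Rightarrow> real"
  assumes g: "gaussian_family M I Y"
  shows "distr M (PiM I (\<lambda>_. borel)) (\<lambda>\<omega>. \<lambda>i\<in>I. Y i \<omega>) =
    distr (M \<Otimes>\<^sub>M M) (PiM I (\<lambda>_. borel)) (\<lambda>z. \<lambda>i\<in>I. (Y i (fst z) - Y i (snd z)) / sqrt 2)"
proof (rule distr_PiM_eqI_char)
  show pM: "prob_space M" by (rule prob_space_axioms)
  interpret MM: pair_prob_space M M ..
  show "prob_space (M \<Otimes>\<^sub>M M)" by (rule MM.P.prob_space_axioms)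
  have meas: "Y i \<in> borel_measurable M" if "i \<in> I" for i
    using g that by (auto simp: gaussian_family_def)
  then show "Y i \<in> borel_measurable M" if "i \<in> I" for i using that by auto
  show "(\<lambda>z. (Y i (fst z) - Y i (snd z)) / sqrt 2) \<in> borel_measurable (M \<Otimes>\<^sub>M M)" if "i \<in> I" for i
    using meas[OF that] by measurable
  fix S :: "'i set" and u assume S: "finite S" "S \<subseteq> I"
  define f where "f a \<omega> = (\<Sum>i\<in>S. (a * u i) * Y i \<omega>)" for a \<omega>
  have mf: "f a \<in> borel_measurable M" for a
    unfolding f_def
    by (intro borel_measurable_sum borel_measurable_times borel_measurable_const meas) (use S in auto)
  have fa: "f a \<omega> = a * f 1 \<omega>" for a \<omega> by (simp add: f_def sum_distrib_left mult.assoc)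
  have cf: "(\<integral>\<omega>. iexp (f a \<omega>) \<partial>M) = exp (- (a\<^sup>2 * expectation (\<lambda>\<omega>. (f 1 \<omega>)\<^sup>2)) / 2)" for a
  proof -
    have "(\<integral>\<omega>. iexp (f a \<omega>) \<partial>M) = exp (- expectation (\<lambda>\<omega>. (f a \<omega>)\<^sup>2) / 2)"
      unfolding f_def by (rule g[unfolded gaussian_family_def, THEN conjunct2, rule_format, OF S])
    then show ?thesis by (subst (asm) (2) fa) (simp add: power_mult_distrib)
  qed
  have "(\<integral>z. iexp (\<Sum>i\<in>S. u i * ((Y i (fst z) - Y i (snd z)) / sqrt 2)) \<partial>(M \<Otimes>\<^sub>M M)) =
     (\<integral>z. iexp (f (1 / sqrt 2) (fst z) + f (- 1 / sqrt 2) (snd z)) \<partial>(M \<Otimes>\<^sub>M M))"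
    unfolding f_def sum.distrib[symmetric]
    by (intro Bochner_Integration.integral_cong refl arg_cong[of _ _ "\<lambda>x. iexp x"] sum.cong)
       (simp add: algebra_simps diff_divide_distrib)
  also have "\<dots> = (\<integral>\<omega>. iexp (f (1 / sqrt 2) \<omega>) \<partial>M) * (\<integral>\<omega>. iexp (f (- 1 / sqrt 2) \<omega>) \<partial>M)"
    by (rule integral_iexp_pair[OF pM mf mf])
  also have "\<dots> = exp (- expectation (\<lambda>\<omega>. (f 1 \<omega>)\<^sup>2) / 2)"
    unfolding cf by (simp add: power_divide flip: of_real_mult exp_add)
  finally show "(\<integral>x. iexp (\<Sum>i\<in>S. u i * Y i x) \<partial>M) =
     (\<integral>z. iexp (\<Sum>i\<in>S. u i * ((Y i (fst z) - Y i (snd z)) / sqrt 2)) \<partial>(M \<Otimes>\<^sub>M M))"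
    using cf[of 1] by (simp add: f_def)
qed


section \<open>Normal variables and Gaussian fields\<close>

lemma normal_rv_measurable: "normal_rv M X m v \<Longrightarrow> X \<in> borel_measurable M"
  by (simp add: normal_rv_def)

text \<open>The factor is the double factorial (2 k - 1)!! written with factorials. The case
  \<open>v = 0\<close> is separate in \<open>normal_rv\<close>, and for \<open>k = 0\<close> it
  rests on \<open>0 ^ 0 = 1\<close>.\<close>

lemma (in prob_space) normal_rv_even_moment:
  assumes "normal_rv M X 0 v"
  shows "integrable M (\<lambda>\<omega>. X \<omega> ^ (2 * k))"
    and "(\<integral>\<omega>. X \<omega> ^ (2 * k) \<partial>M) = fact (2 * k) / (2 ^ k * fact k) * v ^ k"
proof -
  have X: "X \<in> borel_measurable M" and v: "0 \<le> v" using assms by (auto simp: normal_rv_def)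
  have "integrable M (\<lambda>\<omega>. X \<omega> ^ (2 * k)) \<and> (\<integral>\<omega>. X \<omega> ^ (2 * k) \<partial>M) = fact (2 * k) / (2 ^ k * fact k) * v ^ k"
  proof (cases "v = 0")
    case True
    then have ae: "AE \<omega> in M. X \<omega> ^ (2 * k) = 0 ^ (2 * k)" using assms by (auto simp: normal_rv_def)
    have "integrable M (\<lambda>\<omega>. X \<omega> ^ (2 * k)) = integrable M (\<lambda>\<omega>. 0 ^ (2 * k) :: real)"
      using X ae by (intro integrable_cong_AE) auto
    moreover have "(\<integral>\<omega>. X \<omega> ^ (2 * k) \<partial>M) = (\<integral>\<omega>. 0 ^ (2 * k) \<partial>M)"
      using X ae by (intro integral_cong_AE) auto
    ultimately show ?thesis using True by (cases k) (auto simp: prob_space)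
  next
    case False
    then have s: "0 < sqrt v" and D: "distributed M lborel X (\<lambda>x. ennreal (normal_density 0 (sqrt v) x))"
      using assms v by (auto simp: normal_rv_def)
    have "integrable M (\<lambda>\<omega>. X \<omega> ^ (2 * k)) \<longleftrightarrow> integrable lborel (\<lambda>x. normal_density 0 (sqrt v) x * x ^ (2 * k))"
      by (rule distributed_integrable[OF D, symmetric]) (auto simp: normal_density_nonneg)
    moreover have "(\<integral>x. normal_density 0 (sqrt v) x * x ^ (2 * k) \<partial>lborel) = (\<integral>\<omega>. X \<omega> ^ (2 * k) \<partial>M)"
      by (rule distributed_integral[OF D]) (auto simp: normal_density_nonneg)
    moreover note normal_moment_even[OF s, of 0 k]
    ultimately show ?thesis using v
      by (auto simp: has_bochner_integral_iff power_divide power_mult_distrib divide_simps real_sqrt_pow2)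
  qed
  then show "integrable M (\<lambda>\<omega>. X \<omega> ^ (2 * k))"
    "(\<integral>\<omega>. X \<omega> ^ (2 * k) \<partial>M) = fact (2 * k) / (2 ^ k * fact k) * v ^ k" by auto
qed

lemma (in prob_space) normal_rv_square:
  assumes "normal_rv M X 0 v"
  shows "integrable M (\<lambda>\<omega>. (X \<omega>)\<^sup>2)" "(\<integral>\<omega>. (X \<omega>)\<^sup>2 \<partial>M) = v"
  using normal_rv_even_moment[OF assms, of 1] by simp_all

lemma (in prob_space) normal_rv_mean:
  assumes "normal_rv M X m v"
  shows "integrable M X" "(\<integral>\<omega>. X \<omega> \<partial>M) = m"
proof -
  have X: "X \<in> borel_measurable M" and v: "0 \<le> v" using assms by (auto simp: normal_rv_def)
  have "integrable M X \<and> (\<integral>\<omega>. X \<omega> \<partial>M) = m"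
  proof (cases "v = 0")
    case True
    then have ae: "AE \<omega> in M. X \<omega> = m" using assms by (auto simp: normal_rv_def)
    have "integrable M X = integrable M (\<lambda>\<omega>. m)"
      using X ae by (intro integrable_cong_AE) auto
    moreover have "(\<integral>\<omega>. X \<omega> \<partial>M) = (\<integral>\<omega>. m \<partial>M)"
      using X ae by (intro integral_cong_AE) auto
    ultimately show ?thesis by (auto simp: prob_space)
  next
    case False
    then have s: "0 < sqrt v" and D: "distributed M lborel X (\<lambda>x. ennreal (normal_density m (sqrt v) x))"
      using assms v by (auto simp: normal_rv_def)
    have "integrable M X \<longleftrightarrow> integrable lborel (\<lambda>x. normal_density m (sqrt v) x * x)"
      using distributed_integrable[OF D, of "\<lambda>x. x"] by (auto simp: normal_density_nonneg)
    moreover have "(\<integral>x. normal_density m (sqrt v) x * x \<partial>lborel) = (\<integral>\<omega>. X \<omega> \<partial>M)"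
      using distributed_integral[OF D, of "\<lambda>x. x"] by (auto simp: normal_density_nonneg)
    ultimately show ?thesis using integral_normal_moment_nz_1[OF s, of m] normal_moment_nz_1[OF s, of m]
      by (auto simp: has_bochner_integral_iff)
  qed
  then show "integrable M X" "(\<integral>\<omega>. X \<omega> \<partial>M) = m" by auto
qed

lemma (in prob_space) normal_rv_char:
  assumes "normal_rv M X 0 v"
  shows "(\<integral>\<omega>. iexp (X \<omega>) \<partial>M) = exp (- v / 2)"
proof -
  have X: "X \<in> borel_measurable M" and v: "0 \<le> v" using assms by (auto simp: normal_rv_def)
  show ?thesis
  proof (cases "v = 0")
    case True
    then have "AE \<omega> in M. X \<omega> = 0" using assms by (auto simp: normal_rv_def)
    then have "(\<integral>\<omega>. iexp (X \<omega>) \<partial>M) = (\<integral>\<omega>. 1 \<partial>M)"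
      using X by (intro integral_cong_AE) auto
    then show ?thesis using True by (simp add: prob_space)
  next
    case False
    then have s: "0 < sqrt v" and D: "distributed M lborel X (\<lambda>x. ennreal (normal_density 0 (sqrt v) x))"
      using assms v by (auto simp: normal_rv_def)
    have "distributed M lborel (\<lambda>x. (X x - 0) / sqrt v) (\<lambda>x. ennreal (std_normal_density x))"
      using normal_standard_normal_convert[OF s] D by blast
    then have Z: "distr M lborel (\<lambda>x. X x / sqrt v) = std_normal_distribution"
      by (simp add: distributed_def)
    have "distr M borel (\<lambda>x. X x / sqrt v) = distr M lborel (\<lambda>x. X x / sqrt v)"
      by (intro distr_cong) auto
    then have "char (distr M borel (\<lambda>x. X x / sqrt v)) (sqrt v) = exp (- v / 2)"
      using char_std_normal_distribution s v unfolding Z by simp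
    moreover have "char (distr M borel (\<lambda>x. X x / sqrt v)) (sqrt v) = (\<integral>\<omega>. iexp (X \<omega>) \<partial>M)"
      unfolding char_def using X s by (subst integral_distr) auto
    ultimately show ?thesis by simp
  qed
qed

lemma (in prob_space) gaussian_field_sum_normal:
  assumes g: "gaussian_field M T X" and c: "\<And>t. t \<in> T \<Longrightarrow> (\<integral>\<omega>. X t \<omega> \<partial>M) = 0"
    and S: "finite S" "S \<subseteq> T"
  shows "\<exists>v. normal_rv M (\<lambda>\<omega>. \<Sum>i\<in>S. u i * X i \<omega>) 0 v"
proof -
  have g': "\<exists>m v. normal_rv M (\<lambda>\<omega>. \<Sum>i\<in>S. u i * X i \<omega>) m v" if "finite S" "S \<subseteq> T" for S u
    using g that by (auto simp: gaussian_field_def)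
  obtain m v where mv: "normal_rv M (\<lambda>\<omega>. \<Sum>i\<in>S. u i * X i \<omega>) m v" using g'[OF S] by blast
  have int: "integrable M (X i)" if "i \<in> T" for i
    using g'[of "{i}" "\<lambda>_. 1"] that normal_rv_mean(1) by auto
  have "m = (\<integral>\<omega>. (\<Sum>i\<in>S. u i * X i \<omega>) \<partial>M)" using normal_rv_mean(2)[OF mv] by simp
  also have "\<dots> = (\<Sum>i\<in>S. u i * (\<integral>\<omega>. X i \<omega> \<partial>M))"
    using int S by (subst Bochner_Integration.integral_sum) auto
  also have "\<dots> = 0" using c S by (intro sum.neutral) auto
  finally show ?thesis using mv by auto
qed

lemma (in prob_space) gaussian_field_gaussian_family:
  assumes "gaussian_field M T X" and "\<And>t. t \<in> T \<Longrightarrow> (\<integral>\<omega>. X t \<omega> \<partial>M) = 0"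
  shows "gaussian_family M T X"
  unfolding gaussian_family_def
proof (intro conjI ballI allI impI)
  fix i assume "i \<in> T"
  then obtain v where "normal_rv M (X i) 0 v"
    using gaussian_field_sum_normal[OF assms, of "{i}" "\<lambda>_. 1"] by auto
  then show "X i \<in> borel_measurable M" "integrable M (\<lambda>\<omega>. (X i \<omega>)\<^sup>2)"
    using normal_rv_measurable normal_rv_square by auto
next
  fix S u assume "finite S" "S \<subseteq> T"
  then obtain v where "normal_rv M (\<lambda>\<omega>. \<Sum>i\<in>S. u i * X i \<omega>) 0 v"
    using gaussian_field_sum_normal[OF assms] by blast
  from normal_rv_char[OF this] normal_rv_square(2)[OF this]
  show "(\<integral>\<omega>. iexp (\<Sum>i\<in>S. u i * X i \<omega>) \<partial>M) = exp (- (\<integral>\<omega>. (\<Sum>i\<in>S. u i * X i \<omega>)\<^sup>2 \<partial>M) / 2)"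
    by simp
qed

lemma gaussian_family_linear:
  fixes Y :: "'b \<Rightarrow> 'a \<Rightarrow> real" and S :: "'c \<Rightarrow> 'b set"
  assumes g: "gaussian_family M I Y"
    and S: "\<And>j. j \<in> J \<Longrightarrow> finite (S j)" "\<And>j. j \<in> J \<Longrightarrow> S j \<subseteq> I"
  shows "gaussian_family M J (\<lambda>j \<omega>. \<Sum>i\<in>S j. a j i * Y i \<omega>)"
  unfolding gaussian_family_def
proof (intro conjI ballI allI impI)
  fix j assume j: "j \<in> J"
  have mY: "Y i \<in> borel_measurable M" "integrable M (\<lambda>\<omega>. (Y i \<omega>)\<^sup>2)" if "i \<in> I" for i
    using g that by (auto simp: gaussian_family_def)
  show "(\<lambda>\<omega>. \<Sum>i\<in>S j. a j i * Y i \<omega>) \<in> borel_measurable M"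
    by (intro borel_measurable_sum borel_measurable_times borel_measurable_const mY) (use S j in auto)
  show "integrable M (\<lambda>\<omega>. (\<Sum>i\<in>S j. a j i * Y i \<omega>)\<^sup>2)"
    by (intro integrable_square_sum mY) (use S j in auto)
next
  fix T and u :: "'c \<Rightarrow> real" assume T: "finite T" "T \<subseteq> J"
  \<comment> \<open>The supports \<open>S j\<close> may overlap. Collecting coefficients over their
    union turns a combination of combinations into one finite combination of the original
    family.\<close>
  define U where "U = (\<Union>j\<in>T. S j)"
  have U: "finite U" "U \<subseteq> I" unfolding U_def using T S by auto
  have "(\<Sum>j\<in>T. u j * (\<Sum>i\<in>S j. a j i * y i)) = (\<Sum>i\<in>U. (\<Sum>j\<in>T. if i \<in> S j then u j * a j i else 0) * y i)"
    for y :: "'b \<Rightarrow> real"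
  proof -
    have "(\<Sum>j\<in>T. u j * (\<Sum>i\<in>S j. a j i * y i)) = (\<Sum>j\<in>T. \<Sum>i\<in>U. if i \<in> S j then u j * a j i * y i else 0)"
    proof (intro sum.cong refl)
      fix j assume "j \<in> T"
      then have "S j \<subseteq> U" by (auto simp: U_def)
      then have "(\<Sum>i\<in>U. if i \<in> S j then u j * a j i * y i else 0) = (\<Sum>i\<in>S j. u j * a j i * y i)"
        using U(1) by (simp add: sum.If_cases Int_absorb1)
      then show "u j * (\<Sum>i\<in>S j. a j i * y i) = (\<Sum>i\<in>U. if i \<in> S j then u j * a j i * y i else 0)"
        by (simp add: sum_distrib_left mult.assoc)
    qed
    also have "\<dots> = (\<Sum>i\<in>U. \<Sum>j\<in>T. if i \<in> S j then u j * a j i * y i else 0)" by (rule sum.swap)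
    also have "\<dots> = (\<Sum>i\<in>U. (\<Sum>j\<in>T. if i \<in> S j then u j * a j i else 0) * y i)"
      unfolding sum_distrib_right by (intro sum.cong refl) auto
    finally show ?thesis .
  qed
  note eq = this
  show "(\<integral>\<omega>. iexp (\<Sum>j\<in>T. u j * (\<Sum>i\<in>S j. a j i * Y i \<omega>)) \<partial>M) =
      exp (- (\<integral>\<omega>. (\<Sum>j\<in>T. u j * (\<Sum>i\<in>S j. a j i * Y i \<omega>))\<^sup>2 \<partial>M) / 2)"
    unfolding eq by (rule g[unfolded gaussian_family_def, THEN conjunct2, rule_format, OF U])
qed

section \<open>A multiscale functional on trees\<close>

text \<open>The ancestor at level \<open>n\<close> of a node \<open>i\<close> of level
  \<open>n + m\<close>. Nodes do not carry their level, so both levels are arguments.\<close>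

primrec anc :: "(nat \<Rightarrow> 'i \<Rightarrow> 'i) \<Rightarrow> nat \<Rightarrow> nat \<Rightarrow> 'i \<Rightarrow> 'i" where
  "anc par n 0 i = i"
| "anc par n (Suc m) i = anc par n m (par (n + m) i)"

lemma anc_add: "anc par n (m + q) i = anc par n m (anc par (n + m) q i)"
  by (induction q arbitrary: i) (simp_all add: add.assoc)

lemma even_power_add_le:
  fixes a b :: real
  shows "(a + b) ^ (2 * k) \<le> 4 ^ k * (a ^ (2 * k) + b ^ (2 * k))"
proof -
  have "(a + b) ^ (2 * k) = \<bar>a + b\<bar> ^ (2 * k)" by (simp add: power_even_abs)
  also have "\<dots> \<le> (2 * max \<bar>a\<bar> \<bar>b\<bar>) ^ (2 * k)" by (intro power_mono) auto
  also have "\<dots> = 4 ^ k * max \<bar>a\<bar> \<bar>b\<bar> ^ (2 * k)" by (simp add: power_mult_distrib power_mult)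
  also have "max \<bar>a\<bar> \<bar>b\<bar> ^ (2 * k) \<le> \<bar>a\<bar> ^ (2 * k) + \<bar>b\<bar> ^ (2 * k)"
    by (cases "\<bar>a\<bar> \<le> \<bar>b\<bar>") (auto simp: max_def)
  finally show ?thesis by (simp add: power_even_abs)
qed

text \<open>The constant 8 is the sum of the powers of \<open>8 / 9\<close> from the first one
  on.\<close>

lemma suminf_geometric_ennreal_le:
  assumes "\<And>m. a m \<le> ennreal (c * (8 / 9) ^ (m + q + 1))" "0 \<le> c"
  shows "(\<Sum>m. a m) \<le> ennreal (8 * c * (8 / 9) ^ q)"
proof -
  have s: "(\<lambda>m. c * (8 / 9) ^ (q + 1) * (8 / 9) ^ m) sums (c * (8 / 9) ^ (q + 1) * (1 / (1 - 8 / 9 :: real)))"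
    by (intro sums_mult geometric_sums) auto
  have "(\<Sum>m. a m) \<le> (\<Sum>m. ennreal (c * (8 / 9) ^ (q + 1) * (8 / 9) ^ m))"
    using assms by (intro suminf_le) (auto simp: power_add mult_ac)
  also have "\<dots> = ennreal (c * (8 / 9) ^ (q + 1) * (1 / (1 - 8 / 9)))"
    using s assms(2) by (intro suminf_ennreal_eq) auto
  finally show ?thesis by (simp add: mult_ac)
qed

text \<open>Level \<open>m\<close> has \<open>2 ^ (\<kappa> * m)\<close> nodes up to the factor
  \<open>c1\<close>, so a cell of size 2^-m owns a share of about the power \<kappa> of its size.
  That the number of children depends on the level only makes averages over different levels agree
  exactly.\<close>

locale tree =
  fixes I :: "nat \<Rightarrow> 'i set" and par :: "nat \<Rightarrow> 'i \<Rightarrow> 'i" and b :: "nat \<Rightarrow> nat"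
    and \<kappa> :: nat and c1 :: real
  assumes finite_I: "finite (I m)" and I_nonempty: "I m \<noteq> {}"
    and par_I: "i \<in> I (Suc m) \<Longrightarrow> par m i \<in> I m"
    and card_children: "i \<in> I m \<Longrightarrow> card {i' \<in> I (Suc m). par m i' = i} = b m"
    and \<kappa>_pos: "1 \<le> \<kappa>"
    and card_I_le: "real (card (I m)) \<le> 2 ^ (\<kappa> * m)"
    and card_I_ge: "2 ^ (\<kappa> * m) \<le> c1 * real (card (I m))"
begin

definition desc :: "nat \<Rightarrow> nat \<Rightarrow> 'i \<Rightarrow> 'i set" where
  "desc n m i = {i' \<in> I (n + m). anc par n m i' = i}"

definition nodes :: "(nat \<times> 'i) set" where
  "nodes = Sigma UNIV I"

definition edge :: "(nat \<times> 'i \<Rightarrow> real) \<Rightarrow> nat \<Rightarrow> 'i \<Rightarrow> real" where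
  "edge f m i = f (Suc m, i) - f (m, par m i)"

text \<open>
  The weight \<open>16 / 9 = (4 / 3)\<^sup>2\<close> makes a bound on \<open>osc\<close> control the edges \<open>m\<close> levels down by
  \<open>(3 / 4)\<^sup>m\<close>, which is summable along a branch. On the other hand an edge \<open>m\<close> levels down is of
  order \<open>2\<^sup>-\<^sup>m\<close>, so its power \<open>2 \<kappa>\<close> is of order \<open>4\<^sup>-\<^sup>\<kappa>\<^sup>m\<close>, and there are about \<open>2\<^sup>\<kappa>\<^sup>m\<close> such edges:
  the expectations still decay, because \<open>(16 / 9) 2 / 4 = 8 / 9 < 1\<close>.
\<close>

definition layer :: "nat \<Rightarrow> nat \<Rightarrow> 'i \<Rightarrow> (nat \<times> 'i \<Rightarrow> real) \<Rightarrow> real" where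
  "layer n m i f = (16 / 9) ^ (\<kappa> * Suc m) * (\<Sum>i'\<in>desc n (Suc m) i. edge f (n + m) i' ^ (2 * \<kappa>))"

definition osc :: "nat \<Rightarrow> 'i \<Rightarrow> (nat \<times> 'i \<Rightarrow> real) \<Rightarrow> ennreal" where
  "osc n i f = (\<Sum>m. ennreal (layer n m i f))"

lemma c1_ge_1: "1 \<le> c1"
proof -
  have I0: "real (card (I 0)) = 1"
    using card_I_le[of 0] I_nonempty[of 0] finite_I[of 0] by (simp add: Suc_le_eq card_gt_0_iff le_antisym)
  show ?thesis using card_I_ge[of 0] I0 by simp
qed

lemma finite_desc [simp]: "finite (desc n m i)"
  using finite_I by (simp add: desc_def)

lemma anc_I: "i \<in> I (n + m) \<Longrightarrow> anc par n m i \<in> I n"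
  by (induction m arbitrary: i) (auto dest: par_I)

lemma desc_Suc: "desc n (Suc m) i = (\<Union>i''\<in>desc n m i. {i' \<in> I (Suc (n + m)). par (n + m) i' = i''})"
  using par_I by (auto simp: desc_def)

lemma card_desc_Suc: "card (desc n (Suc m) i) = card (desc n m i) * b (n + m)"
proof -
  have "card (desc n (Suc m) i) = (\<Sum>i''\<in>desc n m i. card {i' \<in> I (Suc (n + m)). par (n + m) i' = i''})"
    unfolding desc_Suc using finite_I by (intro card_UN_disjoint) auto
  also have "\<dots> = (\<Sum>i''\<in>desc n m i. b (n + m))"
    by (intro sum.cong refl card_children) (auto simp: desc_def)
  finally show ?thesis by simp
qed

lemma card_desc_indep: "i \<in> I n \<Longrightarrow> j \<in> I n \<Longrightarrow> card (desc n m i) = card (desc n m j)"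
proof (induction m)
  case 0
  have "desc n 0 i = {i}" "desc n 0 j = {j}" using 0 by (auto simp: desc_def)
  then show ?case by simp
qed (simp add: card_desc_Suc)

lemma card_desc: 
  assumes "i \<in> I n"
  shows "card (desc n m i) * card (I n) = card (I (n + m))"
proof -
  have "I (n + m) = (\<Union>j\<in>I n. desc n m j)" using anc_I by (auto simp: desc_def)
  then have "card (I (n + m)) = (\<Sum>j\<in>I n. card (desc n m j))"
    using finite_I by (simp only:) (intro card_UN_disjoint; auto simp: desc_def)
  also have "\<dots> = (\<Sum>j\<in>I n. card (desc n m i))"
    using assms by (intro sum.cong refl card_desc_indep) auto
  finally show ?thesis by simp
qed

lemma card_desc_le:
  assumes "i \<in> I n"
  shows "real (card (desc n m i)) \<le> c1 * 2 ^ (\<kappa> * m)"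
proof -
  have pos: "0 < real (card (I n))" using finite_I I_nonempty by (simp add: card_gt_0_iff)
  have "real (card (desc n m i)) * real (card (I n)) = real (card (I (n + m)))"
    using card_desc[OF assms, of m] by (metis of_nat_mult)
  also have "\<dots> \<le> 2 ^ (\<kappa> * n) * 2 ^ (\<kappa> * m)"
    using card_I_le[of "n + m"] by (simp add: power_add[symmetric] algebra_simps)
  also have "\<dots> \<le> c1 * real (card (I n)) * 2 ^ (\<kappa> * m)"
    using card_I_ge[of n] by (intro mult_right_mono) auto
  finally show ?thesis using pos by (simp add: mult_ac)
qed

lemma layer_nonneg: "0 \<le> layer n m i f"
  unfolding layer_def by (intro mult_nonneg_nonneg sum_nonneg) auto

lemma desc_nodes: "i' \<in> desc n (Suc m) i \<Longrightarrow> (Suc (n + m), i') \<in> nodes \<and> (n + m, par (n + m) i') \<in> nodes"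
  using par_I by (auto simp: desc_def nodes_def)

lemma osc_cong:
  assumes "\<And>x. x \<in> nodes \<Longrightarrow> f x = g x"
  shows "osc n i f = osc n i g"
proof -
  have "layer n m i f = layer n m i g" for m
    unfolding layer_def edge_def using assms desc_nodes by (intro arg_cong2[where f = "(*)"] sum.cong refl) simp
  then show ?thesis by (simp add: osc_def)
qed

lemma layer_measurable:
  assumes "\<And>x. x \<in> nodes \<Longrightarrow> Y x \<in> borel_measurable M"
  shows "(\<lambda>\<omega>. layer n m i (\<lambda>x. Y x \<omega>)) \<in> borel_measurable M"
  unfolding layer_def edge_def
  by (intro borel_measurable_times borel_measurable_const borel_measurable_sum borel_measurable_power
      borel_measurable_diff assms) (use desc_nodes in auto)

lemma osc_measurable:
  assumes "\<And>x. x \<in> nodes \<Longrightarrow> Y x \<in> borel_measurable M"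
  shows "(\<lambda>\<omega>. osc n i (\<lambda>x. Y x \<omega>)) \<in> borel_measurable M"
  unfolding osc_def using layer_measurable[of Y M] assms by measurable

lemma osc_add: "osc n i (\<lambda>x. f x + g x) \<le> ennreal (4 ^ \<kappa>) * (osc n i f + osc n i g)"
proof -
  have "layer n m i (\<lambda>x. f x + g x) \<le> 4 ^ \<kappa> * (layer n m i f + layer n m i g)" for m
  proof -
    have e: "edge (\<lambda>x. f x + g x) l i = edge f l i + edge g l i" for l i by (simp add: edge_def)
    have "layer n m i (\<lambda>x. f x + g x) \<le> (16 / 9) ^ (\<kappa> * Suc m) *
        (\<Sum>i'\<in>desc n (Suc m) i. 4 ^ \<kappa> * (edge f (n + m) i' ^ (2 * \<kappa>) + edge g (n + m) i' ^ (2 * \<kappa>)))"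
      unfolding layer_def e by (intro mult_left_mono sum_mono even_power_add_le) auto
    then show ?thesis by (simp add: layer_def sum_distrib_left[symmetric] sum.distrib algebra_simps)
  qed
  then have "osc n i (\<lambda>x. f x + g x) \<le> (\<Sum>m. ennreal (4 ^ \<kappa>) * (ennreal (layer n m i f) + ennreal (layer n m i g)))"
    unfolding osc_def
    by (intro suminf_le) (auto simp: layer_nonneg ennreal_mult[symmetric] ennreal_plus[symmetric] simp del: ennreal_plus intro!: ennreal_leI)
  also have "\<dots> = ennreal (4 ^ \<kappa>) * (osc n i f + osc n i g)"
    unfolding osc_def by (simp add: ennreal_suminf_cmult suminf_add[symmetric])
  finally show ?thesis .
qed

lemma layer_scale: "layer n m i (\<lambda>x. a * f x) = a ^ (2 * \<kappa>) * layer n m i f"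
proof -
  have e: "edge (\<lambda>x. a * f x) l i = a * edge f l i" for l i by (simp add: edge_def algebra_simps)
  show ?thesis unfolding layer_def e by (simp add: power_mult_distrib sum_distrib_left mult_ac)
qed

lemma osc_scale: "osc n i (\<lambda>x. a * f x) = ennreal (a ^ (2 * \<kappa>)) * osc n i f"
proof -
  have "ennreal (a ^ (2 * \<kappa>) * layer n m i f) = ennreal (a ^ (2 * \<kappa>)) * ennreal (layer n m i f)" for m
    by (intro ennreal_mult layer_nonneg) simp
  then show ?thesis unfolding osc_def layer_scale by simp
qed

lemma osc_split:
  "osc n i f = (\<Sum>m. ennreal (layer n (m + q) i f)) + (\<Sum>m<q. ennreal (layer n m i f))"
  unfolding osc_def by (rule suminf_offset) auto

lemma layer_calc:
  assumes "0 \<le> B"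
  shows "(16 / 9) ^ (\<kappa> * Suc m) * (c1 * 2 ^ (\<kappa> * Suc m) * (B * (1 / 2) ^ (n + Suc m)) ^ (2 * \<kappa>))
      \<le> c1 * B ^ (2 * \<kappa>) * (1 / 4) ^ (\<kappa> * n) * (8 / 9) ^ Suc m"
proof -
  let ?s = "Suc m"
  have "((1 / 2 :: real) ^ (n + ?s)) ^ (2 * \<kappa>) = ((1 / 2) ^ 2) ^ (\<kappa> * n + \<kappa> * ?s)"
    by (simp only: power_mult[symmetric]) (simp add: algebra_simps)
  also have "\<dots> = (1 / 4) ^ (\<kappa> * n) * (1 / 4) ^ (\<kappa> * ?s)"
    by (simp only: power_add) (simp add: power2_eq_square)
  finally have e: "((1 / 2 :: real) ^ (n + ?s)) ^ (2 * \<kappa>) = (1 / 4) ^ (\<kappa> * n) * (1 / 4) ^ (\<kappa> * ?s)" .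
  have "(16 / 9) ^ (\<kappa> * ?s) * (c1 * 2 ^ (\<kappa> * ?s) * (B * (1 / 2) ^ (n + ?s)) ^ (2 * \<kappa>)) =
     c1 * B ^ (2 * \<kappa>) * (1 / 4) ^ (\<kappa> * n) * ((16 / 9) ^ (\<kappa> * ?s) * 2 ^ (\<kappa> * ?s) * (1 / 4) ^ (\<kappa> * ?s))"
    unfolding power_mult_distrib e by (simp only: mult_ac)
  also have "(16 / 9) ^ (\<kappa> * ?s) * 2 ^ (\<kappa> * ?s) * (1 / 4) ^ (\<kappa> * ?s) = (8 / 9 :: real) ^ (\<kappa> * ?s)"
    by (simp only: power_mult_distrib[symmetric]) simp
  \<comment> \<open>The \<kappa>-th power of the ratio is weakened to the first power, so that one
    geometric series serves every \<kappa>.\<close>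
  also have "c1 * B ^ (2 * \<kappa>) * (1 / 4) ^ (\<kappa> * n) * (8 / 9) ^ (\<kappa> * ?s)
     \<le> c1 * B ^ (2 * \<kappa>) * (1 / 4) ^ (\<kappa> * n) * (8 / 9) ^ ?s"
    using mult_right_mono[OF \<kappa>_pos, of ?s] c1_ge_1 assms by (intro mult_left_mono power_decreasing) simp_all
  finally show ?thesis .
qed

lemma layer_le:
  assumes i: "i \<in> I n" and G: "0 \<le> G" and e: "\<And>i'. i' \<in> desc n (Suc m) i \<Longrightarrow> \<bar>edge f (n + m) i'\<bar> \<le> G"
  shows "layer n m i f \<le> (16 / 9) ^ (\<kappa> * Suc m) * (c1 * 2 ^ (\<kappa> * Suc m) * G ^ (2 * \<kappa>))"
proof -
  have "layer n m i f \<le> (16 / 9) ^ (\<kappa> * Suc m) * (\<Sum>i'\<in>desc n (Suc m) i. G ^ (2 * \<kappa>))"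
    unfolding layer_def
  proof (intro mult_left_mono sum_mono)
    fix i' assume "i' \<in> desc n (Suc m) i"
    then have "\<bar>edge f (n + m) i'\<bar> ^ (2 * \<kappa>) \<le> G ^ (2 * \<kappa>)" using e by (intro power_mono) auto
    then show "edge f (n + m) i' ^ (2 * \<kappa>) \<le> G ^ (2 * \<kappa>)" by (simp add: power_even_abs)
  qed auto
  also have "\<dots> \<le> (16 / 9) ^ (\<kappa> * Suc m) * (c1 * 2 ^ (\<kappa> * Suc m) * G ^ (2 * \<kappa>))"
    using card_desc_le[OF i, of "Suc m"] G by (simp only: sum_constant) (intro mult_left_mono mult_right_mono; simp)
  finally show ?thesis .
qed

lemma osc_le_deterministic:
  assumes i: "i \<in> I n" and B: "0 \<le> B"
    and e: "\<And>m i'. i' \<in> desc n (Suc m) i \<Longrightarrow> \<bar>edge f (n + m) i'\<bar> \<le> B * (1 / 2) ^ (n + Suc m)"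
  shows "osc n i f \<le> ennreal (8 * c1 * B ^ (2 * \<kappa>) * (1 / 4) ^ (\<kappa> * n))"
proof -
  have "ennreal (layer n m i f) \<le> ennreal (c1 * B ^ (2 * \<kappa>) * (1 / 4) ^ (\<kappa> * n) * (8 / 9) ^ (m + 0 + 1))" for m
  proof (rule ennreal_leI)
    show "layer n m i f \<le> c1 * B ^ (2 * \<kappa>) * (1 / 4) ^ (\<kappa> * n) * (8 / 9) ^ (m + 0 + 1)"
      using order_trans[OF layer_le[OF i _ e[of _ m]] layer_calc[OF B, of m n]] B by simp
  qed
  from suminf_geometric_ennreal_le[OF this] show ?thesis
    unfolding osc_def using c1_ge_1 B by (simp add: mult_ac)
qed

text \<open>The form, in moments of order \<open>2 * \<kappa>\<close>, of the statement that an edge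
  leading to level \<open>l\<close> has size of order 2^-l, required from level \<open>n\<close>
  on.\<close>

definition moment_bound :: "'w measure \<Rightarrow> (nat \<times> 'i \<Rightarrow> 'w \<Rightarrow> real) \<Rightarrow> nat \<Rightarrow> real \<Rightarrow> bool" where
  "moment_bound M Y n B \<longleftrightarrow> 0 \<le> B \<and> (\<forall>x\<in>nodes. Y x \<in> borel_measurable M) \<and>
     (\<forall>l\<ge>n. \<forall>i'\<in>I (Suc l). (\<integral>\<^sup>+\<omega>. ennreal (edge (\<lambda>x. Y x \<omega>) l i' ^ (2 * \<kappa>)) \<partial>M) \<le> ennreal ((B * (1 / 2) ^ Suc l) ^ (2 * \<kappa>)))"

lemma nn_integral_layer_le:
  assumes i: "i \<in> I n" and G: "0 \<le> G" and Y: "\<And>x. x \<in> nodes \<Longrightarrow> Y x \<in> borel_measurable M"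
    and e: "\<And>i'. i' \<in> desc n (Suc m) i \<Longrightarrow>
      (\<integral>\<^sup>+\<omega>. ennreal (edge (\<lambda>x. Y x \<omega>) (n + m) i' ^ (2 * \<kappa>)) \<partial>M) \<le> ennreal (G ^ (2 * \<kappa>))"
  shows "(\<integral>\<^sup>+\<omega>. ennreal (layer n m i (\<lambda>x. Y x \<omega>)) \<partial>M) \<le>
     ennreal ((16 / 9) ^ (\<kappa> * Suc m) * (c1 * 2 ^ (\<kappa> * Suc m) * G ^ (2 * \<kappa>)))"
proof -
  have me: "(\<lambda>\<omega>. edge (\<lambda>x. Y x \<omega>) (n + m) i' ^ (2 * \<kappa>)) \<in> borel_measurable M" if "i' \<in> desc n (Suc m) i" for i'
    unfolding edge_def using desc_nodes[OF that] Y by (intro borel_measurable_power borel_measurable_diff) auto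
  have "(\<integral>\<^sup>+\<omega>. ennreal (layer n m i (\<lambda>x. Y x \<omega>)) \<partial>M) =
     (\<integral>\<^sup>+\<omega>. ennreal ((16 / 9) ^ (\<kappa> * Suc m)) * (\<Sum>i'\<in>desc n (Suc m) i. ennreal (edge (\<lambda>x. Y x \<omega>) (n + m) i' ^ (2 * \<kappa>))) \<partial>M)"
    unfolding layer_def by (intro nn_integral_cong) (simp add: ennreal_mult sum_nonneg sum_ennreal)
  also have "\<dots> = ennreal ((16 / 9) ^ (\<kappa> * Suc m)) * (\<Sum>i'\<in>desc n (Suc m) i. \<integral>\<^sup>+\<omega>. ennreal (edge (\<lambda>x. Y x \<omega>) (n + m) i' ^ (2 * \<kappa>)) \<partial>M)"
  proof -
    have me': "(\<lambda>\<omega>. ennreal (edge (\<lambda>x. Y x \<omega>) (n + m) i' ^ (2 * \<kappa>))) \<in> borel_measurable M"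
      if "i' \<in> desc n (Suc m) i" for i' using me[OF that] by measurable
    then show ?thesis
      by (subst nn_integral_cmult) (auto intro!: borel_measurable_sum simp only: nn_integral_sum)
  qed
  also have "\<dots> \<le> ennreal ((16 / 9) ^ (\<kappa> * Suc m)) * (\<Sum>i'\<in>desc n (Suc m) i. ennreal (G ^ (2 * \<kappa>)))"
    using e by (intro mult_left_mono sum_mono) auto
  also have "\<dots> = ennreal ((16 / 9) ^ (\<kappa> * Suc m) * (real (card (desc n (Suc m) i)) * G ^ (2 * \<kappa>)))"
    using G by (simp add: ennreal_mult ennreal_of_nat_eq_real_of_nat)
  also have "\<dots> \<le> ennreal ((16 / 9) ^ (\<kappa> * Suc m) * (c1 * 2 ^ (\<kappa> * Suc m) * G ^ (2 * \<kappa>)))"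
    using card_desc_le[OF i, of "Suc m"] G by (intro ennreal_leI mult_left_mono mult_right_mono) auto
  finally show ?thesis .
qed

lemma nn_integral_tail_le:
  assumes i: "i \<in> I n" and mb: "moment_bound M Y n B"
  shows "(\<integral>\<^sup>+\<omega>. (\<Sum>m. ennreal (layer n (m + q) i (\<lambda>x. Y x \<omega>))) \<partial>M) \<le>
     ennreal (8 * (c1 * B ^ (2 * \<kappa>) * (1 / 4) ^ (\<kappa> * n)) * (8 / 9) ^ q)"
proof -
  have B: "0 \<le> B" and Y: "\<And>x. x \<in> nodes \<Longrightarrow> Y x \<in> borel_measurable M"
    using mb by (auto simp: moment_bound_def)
  have "(\<integral>\<^sup>+\<omega>. (\<Sum>m. ennreal (layer n (m + q) i (\<lambda>x. Y x \<omega>))) \<partial>M) =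
     (\<Sum>m. \<integral>\<^sup>+\<omega>. ennreal (layer n (m + q) i (\<lambda>x. Y x \<omega>)) \<partial>M)"
    using layer_measurable[of Y M] Y by (intro nn_integral_suminf) auto
  also have "\<dots> \<le> ennreal (8 * (c1 * B ^ (2 * \<kappa>) * (1 / 4) ^ (\<kappa> * n)) * (8 / 9) ^ q)"
  proof (rule suminf_geometric_ennreal_le)
    fix m
    have "(\<integral>\<^sup>+\<omega>. ennreal (layer n (m + q) i (\<lambda>x. Y x \<omega>)) \<partial>M) \<le>
       ennreal ((16 / 9) ^ (\<kappa> * Suc (m + q)) * (c1 * 2 ^ (\<kappa> * Suc (m + q)) * (B * (1 / 2) ^ (n + Suc (m + q))) ^ (2 * \<kappa>)))"
      using mb B Y by (intro nn_integral_layer_le[OF i]) (auto simp: moment_bound_def desc_def)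
    also have "\<dots> \<le> ennreal (c1 * B ^ (2 * \<kappa>) * (1 / 4) ^ (\<kappa> * n) * (8 / 9) ^ (m + q + 1))"
      using layer_calc[OF B, of "m + q" n] by (intro ennreal_leI) simp
    finally show "(\<integral>\<^sup>+\<omega>. ennreal (layer n (m + q) i (\<lambda>x. Y x \<omega>)) \<partial>M) \<le>
      ennreal (c1 * B ^ (2 * \<kappa>) * (1 / 4) ^ (\<kappa> * n) * (8 / 9) ^ (m + q + 1))" .
  qed (use B c1_ge_1 in auto)
  finally show ?thesis .
qed

lemma nn_integral_osc_le:
  assumes "i \<in> I n" and "moment_bound M Y n B"
  shows "(\<integral>\<^sup>+\<omega>. osc n i (\<lambda>x. Y x \<omega>) \<partial>M) \<le> ennreal (8 * c1 * B ^ (2 * \<kappa>) * (1 / 4) ^ (\<kappa> * n))"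
  using nn_integral_tail_le[OF assms, of 0] by (simp add: osc_def mult_ac)

text \<open>An upper bound for the contribution of the first \<open>q\<close> layers to
  \<open>osc\<close> when all their edges are at most 1.\<close>

definition head_const :: "nat \<Rightarrow> real" where
  "head_const q = (\<Sum>m<q. (16 / 9) ^ (\<kappa> * Suc m) * (c1 * 2 ^ (\<kappa> * Suc m)))"

lemma head_const_nonneg: "0 \<le> head_const q"
  unfolding head_const_def using c1_ge_1 by (intro sum_nonneg) auto

text \<open>Smallness of the edges is available only over a bounded range of levels. It suffices,
  because the layers beyond depth \<open>q\<close> are controlled by the general moment bound with
  the decaying factor \<open>(8 / 9) ^ q\<close>. The number \<open>q\<close> is to be chosen first,
  then \<open>\<theta>\<close>.\<close>

lemma nn_integral_osc_le_small:
  assumes i: "i \<in> I n" and mb: "moment_bound M Y n B" and \<theta>: "0 \<le> \<theta>"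
    and small: "\<And>m i'. m < q \<Longrightarrow> i' \<in> I (Suc (n + m)) \<Longrightarrow>
      (\<integral>\<^sup>+\<omega>. ennreal (edge (\<lambda>x. Y x \<omega>) (n + m) i' ^ (2 * \<kappa>)) \<partial>M) \<le> ennreal ((\<theta> * (1 / 2) ^ n) ^ (2 * \<kappa>))"
  shows "(\<integral>\<^sup>+\<omega>. osc n i (\<lambda>x. Y x \<omega>) \<partial>M) \<le>
     ennreal ((8 * c1 * B ^ (2 * \<kappa>) * (8 / 9) ^ q + head_const q * \<theta> ^ (2 * \<kappa>)) * (1 / 4) ^ (\<kappa> * n))"
proof -
  have B: "0 \<le> B" and Y: "\<And>x. x \<in> nodes \<Longrightarrow> Y x \<in> borel_measurable M"
    using mb by (auto simp: moment_bound_def)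
  have lm: "(\<lambda>\<omega>. layer n m i (\<lambda>x. Y x \<omega>)) \<in> borel_measurable M" for m by (rule layer_measurable[OF Y])
  have p: "((\<theta> * (1 / 2) ^ n) ^ (2 * \<kappa>)) = \<theta> ^ (2 * \<kappa>) * (1 / 4) ^ (\<kappa> * n)"
  proof -
    have "((1 / 2 :: real) ^ n) ^ (2 * \<kappa>) = ((1 / 2) ^ 2) ^ (\<kappa> * n)"
      by (simp only: power_mult[symmetric]) (simp add: algebra_simps)
    then show ?thesis by (simp add: power_mult_distrib power2_eq_square)
  qed
  have "(\<integral>\<^sup>+\<omega>. (\<Sum>m<q. ennreal (layer n m i (\<lambda>x. Y x \<omega>))) \<partial>M) = (\<Sum>m<q. \<integral>\<^sup>+\<omega>. ennreal (layer n m i (\<lambda>x. Y x \<omega>)) \<partial>M)"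
    using lm by (intro nn_integral_sum) auto
  also have "\<dots> \<le> (\<Sum>m<q. ennreal ((16 / 9) ^ (\<kappa> * Suc m) * (c1 * 2 ^ (\<kappa> * Suc m) * (\<theta> * (1 / 2) ^ n) ^ (2 * \<kappa>))))"
    using small \<theta> Y by (intro sum_mono nn_integral_layer_le[OF i]) (auto simp: desc_def)
  also have "\<dots> = ennreal (\<Sum>m<q. (16 / 9) ^ (\<kappa> * Suc m) * (c1 * 2 ^ (\<kappa> * Suc m) * (\<theta> * (1 / 2) ^ n) ^ (2 * \<kappa>)))"
    using \<theta> c1_ge_1 by (intro sum_ennreal) auto
  also have "\<dots> = ennreal (head_const q * (\<theta> * (1 / 2) ^ n) ^ (2 * \<kappa>))"
    unfolding head_const_def sum_distrib_right mult.assoc ..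
  finally have head: "(\<integral>\<^sup>+\<omega>. (\<Sum>m<q. ennreal (layer n m i (\<lambda>x. Y x \<omega>))) \<partial>M) \<le> ennreal (head_const q * \<theta> ^ (2 * \<kappa>) * (1 / 4) ^ (\<kappa> * n))"
    unfolding p by (simp only: mult.assoc)
  have "(\<integral>\<^sup>+\<omega>. osc n i (\<lambda>x. Y x \<omega>) \<partial>M) =
      (\<integral>\<^sup>+\<omega>. (\<Sum>m. ennreal (layer n (m + q) i (\<lambda>x. Y x \<omega>))) \<partial>M) + (\<integral>\<^sup>+\<omega>. (\<Sum>m<q. ennreal (layer n m i (\<lambda>x. Y x \<omega>))) \<partial>M)"
    unfolding osc_split[of n i _ q] using lm by (intro nn_integral_add) auto
  also have "\<dots> \<le> ennreal (8 * (c1 * B ^ (2 * \<kappa>) * (1 / 4) ^ (\<kappa> * n)) * (8 / 9) ^ q) + ennreal (head_const q * \<theta> ^ (2 * \<kappa>) * (1 / 4) ^ (\<kappa> * n))"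
    by (intro add_mono nn_integral_tail_le[OF i mb] head)
  also have "\<dots> = ennreal ((8 * c1 * B ^ (2 * \<kappa>) * (8 / 9) ^ q + head_const q * \<theta> ^ (2 * \<kappa>)) * (1 / 4) ^ (\<kappa> * n))"
    using B \<theta> c1_ge_1 head_const_nonneg[of q] by (subst ennreal_plus[symmetric]) (auto simp: algebra_simps)
  finally show ?thesis .
qed

text \<open>All terms are nonnegative, so the power of one edge is at most its layer divided by the
  weight, and the layer is at most \<open>osc\<close>. The weight is the inverse of
  \<open>((3 / 4) ^ Suc m) ^ (2 * \<kappa>)\<close>; what remains is to take a root.\<close>

lemma edge_le_osc:
  assumes X: "0 \<le> X" and o: "osc n i f \<le> ennreal (X ^ (2 * \<kappa>))" and i': "i' \<in> desc n (Suc m) i"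
  shows "\<bar>edge f (n + m) i'\<bar> \<le> X * (3 / 4) ^ Suc m"
proof -
  have "ennreal (layer n m i f) \<le> osc n i f"
    unfolding osc_def using sum_le_suminf[of "\<lambda>m. ennreal (layer n m i f)" "{m}"] by simp
  then have "layer n m i f \<le> X ^ (2 * \<kappa>)"
    using o X by (metis ennreal_le_iff order_trans zero_le_power)
  moreover have "edge f (n + m) i' ^ (2 * \<kappa>) \<le> (\<Sum>i'\<in>desc n (Suc m) i. edge f (n + m) i' ^ (2 * \<kappa>))"
    using i' by (intro member_le_sum) auto
  ultimately have a: "(16 / 9) ^ (\<kappa> * Suc m) * edge f (n + m) i' ^ (2 * \<kappa>) \<le> X ^ (2 * \<kappa>)"
    unfolding layer_def by (meson mult_left_mono order_trans zero_le_power divide_nonneg_nonneg zero_le_numeral)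
  have b: "(16 / 9 :: real) ^ (\<kappa> * Suc m) * ((3 / 4) ^ Suc m) ^ (2 * \<kappa>) = 1"
  proof -
    have "((3 / 4 :: real) ^ Suc m) ^ (2 * \<kappa>) = ((3 / 4) ^ 2) ^ (\<kappa> * Suc m)"
      by (simp only: power_mult[symmetric]) (simp add: algebra_simps)
    then have "(16 / 9 :: real) ^ (\<kappa> * Suc m) * ((3 / 4) ^ Suc m) ^ (2 * \<kappa>) = (16 / 9 * (3 / 4) ^ 2) ^ (\<kappa> * Suc m)"
      by (simp only: power_mult_distrib)
    then show ?thesis by (simp add: power2_eq_square)
  qed
  have "edge f (n + m) i' ^ (2 * \<kappa>) =
      ((16 / 9) ^ (\<kappa> * Suc m) * ((3 / 4) ^ Suc m) ^ (2 * \<kappa>)) * edge f (n + m) i' ^ (2 * \<kappa>)"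
    unfolding b by (rule mult_1_left[symmetric])
  also have "\<dots> = ((16 / 9) ^ (\<kappa> * Suc m) * edge f (n + m) i' ^ (2 * \<kappa>)) * ((3 / 4) ^ Suc m) ^ (2 * \<kappa>)"
    by (simp only: mult_ac)
  also have "\<dots> \<le> X ^ (2 * \<kappa>) * ((3 / 4) ^ Suc m) ^ (2 * \<kappa>)"
    by (rule mult_right_mono[OF a]) auto
  finally have "edge f (n + m) i' ^ (2 * \<kappa>) \<le> X ^ (2 * \<kappa>) * ((3 / 4) ^ Suc m) ^ (2 * \<kappa>)" .
  then have "\<bar>edge f (n + m) i'\<bar> ^ (2 * \<kappa>) \<le> (X * (3 / 4) ^ Suc m) ^ (2 * \<kappa>)"
    unfolding power_mult_distrib[of X "(3 / 4) ^ Suc m"] power_even_abs[OF dvd_triv_left[of 2 \<kappa>]] .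
  moreover have "0 \<le> X * (3 / 4) ^ Suc m" using X by simp
  moreover have "0 < 2 * \<kappa>" using \<kappa>_pos by simp
  ultimately show ?thesis using power_mono_iff[OF abs_ge_zero] by blast
qed

text \<open>Along a branch the edge bounds sum to 3 \<open>X\<close>, since the powers of
  \<open>3 / 4\<close> from the first one on have sum 3. The induction carries the exact partial
  sum.\<close>

lemma osc_chain:
  assumes X: "0 \<le> X" and o: "osc n i f \<le> ennreal (X ^ (2 * \<kappa>))"
    and p: "p 0 = i" "\<And>m. p m \<in> I (n + m)" "\<And>m. par (n + m) (p (Suc m)) = p m"
  shows "\<bar>f (n + m, p m) - f (n, i)\<bar> \<le> 3 * X"
proof -
  have anc: "anc par n m (p m) = i" for m by (induction m) (simp_all add: p)
  have "\<bar>f (n + m, p m) - f (n, i)\<bar> \<le> 3 * X * (1 - (3 / 4) ^ m)"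
  proof (induction m)
    case (Suc m)
    have "p (Suc m) \<in> desc n (Suc m) i" using anc[of "Suc m"] p(2)[of "Suc m"] by (simp add: desc_def)
    from edge_le_osc[OF X o this] have "\<bar>f (Suc (n + m), p (Suc m)) - f (n + m, p m)\<bar> \<le> X * (3 / 4) ^ Suc m"
      by (simp add: edge_def p)
    then have "\<bar>f (n + Suc m, p (Suc m)) - f (n, i)\<bar> \<le> 3 * X * (1 - (3 / 4) ^ m) + X * (3 / 4) ^ Suc m"
      using Suc.IH unfolding add_Suc_right by linarith
    also have "\<dots> = 3 * X * (1 - (3 / 4) ^ Suc m)" by (simp add: algebra_simps)
    finally show ?case .
  qed (simp add: p)
  also have "\<dots> \<le> 3 * X" using X by (simp add: algebra_simps)
  finally show ?thesis .
qed

end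

section \<open>Small oscillation at one of many scales\<close>

lemma (in prob_space) prob_not_le_ennreal:
  assumes [measurable]: "u \<in> borel_measurable M" and le: "(\<integral>\<^sup>+\<omega>. u \<omega> \<partial>M) \<le> ennreal A" and a: "0 < a" and A: "0 \<le> A"
  shows "prob {\<omega> \<in> space M. \<not> u \<omega> \<le> ennreal a} \<le> A / a"
proof -
  have "emeasure M {\<omega> \<in> space M. \<not> u \<omega> \<le> ennreal a} \<le> emeasure M {\<omega> \<in> space M. 1 \<le> ennreal (1 / a) * u \<omega>}"
  proof (rule emeasure_mono)
    show "{\<omega> \<in> space M. \<not> u \<omega> \<le> ennreal a} \<subseteq> {\<omega> \<in> space M. 1 \<le> ennreal (1 / a) * u \<omega>}"
    proof safe
      fix \<omega> assume "\<not> u \<omega> \<le> ennreal a"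
      then have "ennreal (1 / a) * ennreal a \<le> ennreal (1 / a) * u \<omega>" by (intro mult_left_mono) auto
      then show "1 \<le> ennreal (1 / a) * u \<omega>" using a by (simp add: ennreal_mult[symmetric])
    qed
  qed measurable
  also have "\<dots> \<le> ennreal (1 / a) * (\<integral>\<^sup>+\<omega>. u \<omega> * indicator (space M) \<omega> \<partial>M)"
    by (rule nn_integral_Markov_inequality) auto
  also have "(\<integral>\<^sup>+\<omega>. u \<omega> * indicator (space M) \<omega> \<partial>M) = (\<integral>\<^sup>+\<omega>. u \<omega> \<partial>M)"
    by (intro nn_integral_cong) auto
  also have "ennreal (1 / a) * (\<integral>\<^sup>+\<omega>. u \<omega> \<partial>M) \<le> ennreal (1 / a) * ennreal A"
    using le by (intro mult_left_mono) auto
  also have "\<dots> = ennreal (A / a)" using a A by (simp add: ennreal_mult[symmetric])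
  finally show ?thesis using a A by (simp add: emeasure_eq_measure)
qed

text \<open>The number \<open>f\<close> of events that occur has mean \<mu> at least
  \<open>m * q\<close>, and by pairwise independence its variance is at most \<mu>. If no event
  occurs, \<open>f\<close> deviates from its mean by \<mu>, so Chebyshev's inequality gives the
  bound 1 / \<mu>.\<close>

lemma (in prob_space) prob_no_event_le:
  assumes G [measurable]: "\<And>s. s < m \<Longrightarrow> G s \<in> events" and q: "0 < q" "\<And>s. s < m \<Longrightarrow> q \<le> prob (G s)"
    and ind: "\<And>s t. s < m \<Longrightarrow> t < m \<Longrightarrow> s \<noteq> t \<Longrightarrow> prob (G s \<inter> G t) = prob (G s) * prob (G t)"
    and m: "0 < m"
  shows "prob {\<omega> \<in> space M. \<forall>s<m. \<omega> \<notin> G s} \<le> 1 / (real m * q)"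
proof -
  define f where "f \<omega> = (\<Sum>s<m. indicator (G s) \<omega> :: real)" for \<omega>
  have iG: "integrable M (indicator (G s) :: 'a \<Rightarrow> real)" if "s < m" for s
    using G[OF that] by (intro integrable_real_indicator) (auto simp: emeasure_eq_measure)
  have mf [measurable]: "f \<in> borel_measurable M" unfolding f_def by measurable
  have mu: "expectation f = (\<Sum>s<m. prob (G s))"
    unfolding f_def using iG G by (subst Bochner_Integration.integral_sum) auto
  define \<mu> where "\<mu> = (\<Sum>s<m. prob (G s))"
  have "real m * q = (\<Sum>s<m. q)" by simp
  also have "\<dots> \<le> \<mu>" unfolding \<mu>_def using q by (intro sum_mono) auto
  finally have mq: "real m * q \<le> \<mu>" .
  have mu0: "0 < \<mu>" using mq m q(1) by (smt (verit) mult_pos_pos of_nat_0_less_iff)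
  have f2: "(f \<omega>)\<^sup>2 = (\<Sum>s<m. \<Sum>t<m. indicator (G s \<inter> G t) \<omega>)" for \<omega>
    unfolding f_def power2_eq_square sum_product by (intro sum.cong refl) (auto simp: indicator_def)
  have iG2: "integrable M (indicator (G s \<inter> G t) :: 'a \<Rightarrow> real)" if "s < m" "t < m" for s t
    using G[OF that(1)] G[OF that(2)] by (intro integrable_real_indicator) (auto simp: emeasure_eq_measure)
  have if2: "integrable M (\<lambda>\<omega>. (f \<omega>)\<^sup>2)" unfolding f2 using iG2 by (intro Bochner_Integration.integrable_sum) auto
  have if1: "integrable M f" unfolding f_def using iG by (intro Bochner_Integration.integrable_sum) auto
  have "expectation (\<lambda>\<omega>. (f \<omega>)\<^sup>2) = (\<Sum>s<m. \<Sum>t<m. expectation (indicator (G s \<inter> G t)))"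
  proof -
    have "integrable M (\<lambda>\<omega>. \<Sum>t<m. indicator (G s \<inter> G t) \<omega> :: real)" if "s < m" for s
      using iG2[OF that] by (intro Bochner_Integration.integrable_sum) auto
    then show ?thesis unfolding f2 using iG2
      by (subst Bochner_Integration.integral_sum) (auto intro!: sum.cong Bochner_Integration.integral_sum)
  qed
  also have "\<dots> = (\<Sum>s<m. \<Sum>t<m. prob (G s \<inter> G t))"
    using G by (intro sum.cong refl) auto
  also have "\<dots> \<le> (\<Sum>s<m. \<Sum>t<m. prob (G s) * prob (G t) + (if t = s then prob (G s) else 0))"
  proof (intro sum_mono)
    fix s t assume "s \<in> {..<m}" "t \<in> {..<m}"
    then show "prob (G s \<inter> G t) \<le> prob (G s) * prob (G t) + (if t = s then prob (G s) else 0)"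
      using ind[of s t] by (cases "s = t") auto
  qed
  also have "\<dots> = \<mu>\<^sup>2 + \<mu>"
    by (simp add: sum.distrib \<mu>_def power2_eq_square sum_product)
  finally have E2: "expectation (\<lambda>\<omega>. (f \<omega>)\<^sup>2) \<le> \<mu>\<^sup>2 + \<mu>" .
  have var: "variance f \<le> \<mu>"
    using variance_eq[OF if1 if2] E2 unfolding mu \<mu>_def by simp
  have "prob {\<omega> \<in> space M. \<forall>s<m. \<omega> \<notin> G s} \<le> prob {\<omega> \<in> space M. \<bar>f \<omega> - expectation f\<bar> \<ge> \<mu>}"
  proof (rule finite_measure_mono)
    show "{\<omega> \<in> space M. \<forall>s<m. \<omega> \<notin> G s} \<subseteq> {\<omega> \<in> space M. \<bar>f \<omega> - expectation f\<bar> \<ge> \<mu>}"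
    proof safe
      fix \<omega> assume "\<forall>s<m. \<omega> \<notin> G s"
      then have "f \<omega> = 0" by (auto simp: f_def)
      then show "\<mu> \<le> \<bar>f \<omega> - expectation f\<bar>" unfolding mu \<mu>_def[symmetric] using mu0 by simp
    qed
  qed measurable
  also have "\<dots> \<le> variance f / \<mu>\<^sup>2"
    by (rule Chebyshev_inequality) (use if2 mu0 in auto)
  also have "\<dots> \<le> \<mu> / \<mu>\<^sup>2" using var by (intro divide_right_mono) auto
  also have "\<dots> = 1 / \<mu>" using mu0 by (simp add: power2_eq_square)
  also have "\<dots> \<le> 1 / (real m * q)" using mq m q mu0 by (intro divide_left_mono mult_pos_pos) auto
  finally show ?thesis .
qed

context tree begin

text \<open>The value of \<open>osc\<close> that stands for an oscillation of amplitude \<eta> 2^-n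
  on a cell of level \<open>n\<close>; the power is the homogeneity of \<open>osc\<close>.\<close>

definition lev :: "real \<Rightarrow> nat \<Rightarrow> ennreal" where
  "lev \<eta> n = ennreal ((\<eta> * (1 / 2) ^ n) ^ (2 * \<kappa>))"

lemma half_power: "((1 / 2 :: real) ^ n) ^ (2 * \<kappa>) = (1 / 4) ^ (\<kappa> * n)"
proof -
  have "((1 / 2 :: real) ^ n) ^ (2 * \<kappa>) = ((1 / 2) ^ 2) ^ (\<kappa> * n)"
    by (simp only: power_mult[symmetric]) (simp add: algebra_simps)
  then show ?thesis by (simp add: power2_eq_square)
qed

lemma lev_alt: "lev \<eta> n = ennreal (\<eta> ^ (2 * \<kappa>) * (1 / 4) ^ (\<kappa> * n))"
  unfolding lev_def power_mult_distrib[of \<eta>] half_power ..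

lemma layer_diff: "layer n m i (\<lambda>x. f x - g x) \<le> 4 ^ \<kappa> * (layer n m i f + layer n m i g)"
proof -
  have e: "edge (\<lambda>x. f x - g x) l i = edge f l i + - edge g l i" for l i by (simp add: edge_def)
  have "layer n m i (\<lambda>x. f x - g x) \<le> (16 / 9) ^ (\<kappa> * Suc m) *
      (\<Sum>i'\<in>desc n (Suc m) i. 4 ^ \<kappa> * (edge f (n + m) i' ^ (2 * \<kappa>) + (- edge g (n + m) i') ^ (2 * \<kappa>)))"
    unfolding layer_def e by (intro mult_left_mono sum_mono even_power_add_le) auto
  then show ?thesis by (simp add: layer_def sum_distrib_left[symmetric] sum.distrib algebra_simps)
qed

lemma tail_diff:
  "(\<Sum>m. ennreal (layer n (m + q) i (\<lambda>x. f x - g x))) \<le>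
     ennreal (4 ^ \<kappa>) * ((\<Sum>m. ennreal (layer n (m + q) i f)) + (\<Sum>m. ennreal (layer n (m + q) i g)))"
proof -
  have "(\<Sum>m. ennreal (layer n (m + q) i (\<lambda>x. f x - g x))) \<le>
     (\<Sum>m. ennreal (4 ^ \<kappa>) * (ennreal (layer n (m + q) i f) + ennreal (layer n (m + q) i g)))"
    using layer_diff
    by (intro suminf_le) (auto simp: layer_nonneg ennreal_mult[symmetric] ennreal_plus[symmetric] simp del: ennreal_plus intro!: ennreal_leI)
  also have "\<dots> = ennreal (4 ^ \<kappa>) * ((\<Sum>m. ennreal (layer n (m + q) i f)) + (\<Sum>m. ennreal (layer n (m + q) i g)))"
    by (simp add: suminf_add[symmetric])
  finally show ?thesis .
qed

text \<open>The functional \<open>osc\<close> sees only the coordinates in \<open>nodes\<close>, so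
  the equality of laws on the product space carries over to it.\<close>

lemma gaussian_osc_symmetrize:
  assumes "prob_space P" and g: "gaussian_family P nodes V"
  shows "measure P {\<omega> \<in> space P. osc n i (\<lambda>x. V x \<omega>) \<le> a} =
    measure (P \<Otimes>\<^sub>M P) {z \<in> space (P \<Otimes>\<^sub>M P). osc n i (\<lambda>x. (1 / sqrt 2) * (V x (fst z) - V x (snd z))) \<le> a}"
proof -
  interpret P: prob_space P by fact
  let ?N = "PiM nodes (\<lambda>_. borel :: real measure)"
  have V: "V x \<in> borel_measurable P" if "x \<in> nodes" for x using g that by (auto simp: gaussian_family_def)
  have mo: "(\<lambda>f. osc n i f) \<in> borel_measurable ?N"
    using osc_measurable[of "\<lambda>x f. f x" ?N n i] by simp
  have E: "{f \<in> space ?N. osc n i f \<le> a} \<in> sets ?N" using mo by measurable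
  have D: "measure (distr M' ?N (\<lambda>z. \<lambda>x\<in>nodes. W x z)) {f \<in> space ?N. osc n i f \<le> a} =
     measure M' {z \<in> space M'. osc n i (\<lambda>x. W x z) \<le> a}"
    if W: "\<And>x. x \<in> nodes \<Longrightarrow> W x \<in> borel_measurable M'" for M' :: "'c measure" and W
  proof -
    have mW: "(\<lambda>z. \<lambda>x\<in>nodes. W x z) \<in> measurable M' ?N" using W by (intro measurable_restrict) auto
    have "osc n i (\<lambda>x\<in>nodes. W x z) = osc n i (\<lambda>x. W x z)" for z by (rule osc_cong) auto
    then have "(\<lambda>z. \<lambda>x\<in>nodes. W x z) -` {f \<in> space ?N. osc n i f \<le> a} \<inter> space M' = {z \<in> space M'. osc n i (\<lambda>x. W x z) \<le> a}"
      using measurable_space[OF mW] by auto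
    then show ?thesis using measure_distr[OF mW E] by simp
  qed
  have W2: "(\<lambda>z. (V x (fst z) - V x (snd z)) / sqrt 2) \<in> borel_measurable (P \<Otimes>\<^sub>M P)" if "x \<in> nodes" for x
    using V[OF that] by measurable
  show ?thesis
    using D[of V P, OF V] D[of "\<lambda>x z. (V x (fst z) - V x (snd z)) / sqrt 2" "P \<Otimes>\<^sub>M P", OF W2] P.gaussian_symmetrize[OF g] by simp
qed

text \<open>
  Two independent copies of \<open>V\<close> whose first \<open>q\<close> layers of edges fall into the same cell of a fine
  grid have a difference of small oscillation, and with a number of grid cells bounded in terms of
  \<open>\<eta>\<close> this happens with a probability bounded below. For a centred Gaussian family the difference
  divided by \<open>sqrt 2\<close> has the law of \<open>V\<close>.
\<close>

lemma small_ball: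
  fixes P :: "'w measure"
  assumes P: "prob_space P" and B: "0 \<le> B" and \<eta>: "0 < \<eta>"
  shows "\<exists>p0>0. \<forall>V n i. i \<in> I n \<longrightarrow> gaussian_family P nodes V \<longrightarrow> moment_bound P V n B \<longrightarrow>
     p0 \<le> measure P {\<omega> \<in> space P. osc n i (\<lambda>x. V x \<omega>) \<le> lev \<eta> n}"
proof -
  interpret P: prob_space P by fact
  interpret PP: pair_prob_space P P ..
  \<comment> \<open>Two tails of size \<open>\<theta>\<close>, multiplied by the constant
    \<open>4 ^ \<kappa>\<close> of \<open>tail_diff\<close>, use up one half of the allowance
    \<open>\<eta> ^ (2 * \<kappa>)\<close>. All sizes are relative to the scale of the cell.\<close>
  define \<theta> where "\<theta> = \<eta> ^ (2 * \<kappa>) / (4 * 4 ^ \<kappa>)"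
  have \<theta>: "0 < \<theta>" using \<eta> by (simp add: \<theta>_def)
  have "(\<lambda>q. 8 * c1 * B ^ (2 * \<kappa>) * (8 / 9 :: real) ^ q) \<longlonglongrightarrow> 8 * c1 * B ^ (2 * \<kappa>) * 0"
    by (intro tendsto_mult tendsto_const LIMSEQ_power_zero) auto
  then have "\<forall>\<^sub>F q in sequentially. 8 * c1 * B ^ (2 * \<kappa>) * (8 / 9 :: real) ^ q < \<theta> / 4"
    using \<theta> by (intro order_tendstoD) auto
  then obtain q where q: "8 * c1 * B ^ (2 * \<kappa>) * (8 / 9 :: real) ^ q < \<theta> / 4"
    by (auto simp: eventually_sequentially)
  \<comment> \<open>The mesh of the grid, so fine that the first \<open>q\<close> layers cost at
    most the other half. The factor multiplied with \<open>\<eta>\<close> is below 1, so its power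
    \<open>2 * \<kappa>\<close> is at most the factor itself.\<close>
  define \<sigma> where "\<sigma> = \<eta> / (2 * (head_const q + 1))"
  have H0: "0 \<le> head_const q" by (rule head_const_nonneg)
  have \<sigma>: "0 < \<sigma>" using \<eta> H0 by (simp add: \<sigma>_def)
  have H\<sigma>: "head_const q * \<sigma> ^ (2 * \<kappa>) \<le> \<eta> ^ (2 * \<kappa>) / 2"
  proof -
    let ?x = "1 / (2 * (head_const q + 1))"
    have x: "0 \<le> ?x" "?x \<le> 1" using H0 by auto
    have "?x ^ (2 * \<kappa>) \<le> ?x ^ 1" using \<kappa>_pos x by (intro power_decreasing) auto
    then have "head_const q * ?x ^ (2 * \<kappa>) \<le> head_const q * ?x" using H0 by (intro mult_left_mono) auto
    also have "\<dots> \<le> 1 / 2" using H0 by (simp add: divide_simps)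
    finally have "head_const q * ?x ^ (2 * \<kappa>) * \<eta> ^ (2 * \<kappa>) \<le> 1 / 2 * \<eta> ^ (2 * \<kappa>)"
      using \<eta> by (intro mult_right_mono) auto
    moreover have "\<sigma> ^ (2 * \<kappa>) = ?x ^ (2 * \<kappa>) * \<eta> ^ (2 * \<kappa>)"
      unfolding \<sigma>_def by (simp add: power_mult_distrib[symmetric])
    ultimately show ?thesis by simp
  qed
  \<comment> \<open>An amplitude exceeded with probability at most 1/4 by Markov's inequality. Below
    it every edge of the first layers is at most \<open>A\<close> times the scale, which leaves
    finitely many grid cells.\<close>
  define A where "A = 32 * c1 * (B + 1)"
  have A1: "1 \<le> 32 * c1" using c1_ge_1 by simp
  have A0: "0 < A" using c1_ge_1 B by (simp add: A_def)
  have AB: "32 * c1 * B ^ (2 * \<kappa>) \<le> A ^ (2 * \<kappa>)"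
  proof -
    have "(32 * c1) ^ 1 \<le> (32 * c1) ^ (2 * \<kappa>)" using \<kappa>_pos A1 by (intro power_increasing) auto
    moreover have "B ^ (2 * \<kappa>) \<le> (B + 1) ^ (2 * \<kappa>)" using B by (intro power_mono) auto
    ultimately show ?thesis unfolding A_def power_mult_distrib[of "32 * c1"]
      using A1 B by (intro mult_mono) auto
  qed
  define L where "L = \<lceil>A / \<sigma>\<rceil> + 1"
  have L0: "0 \<le> L" unfolding L_def using A0 \<sigma> by (smt (verit) ceiling_le_zero divide_pos_pos zero_le_ceiling)
  define N where "N = nat \<lceil>\<Sum>m<q. c1 * 2 ^ (\<kappa> * Suc m)\<rceil>"
  define c where "c = real (nat (2 * L + 1))"
  have c: "1 \<le> c" using L0 by (simp add: c_def)
  show ?thesis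
  \<comment> \<open>The event \<open>Gd\<close> has probability at least 1/2 and is cut into at most
    \<open>c ^ N\<close> cells. The probability that two independent copies share a cell is the sum
    of the squared cell probabilities, which by Cauchy-Schwarz is at least the square of 1/2 divided
    by the number of cells. The constants \<open>c\<close> and \<open>N\<close> were fixed before
    \<open>V\<close>, \<open>n\<close> and \<open>i\<close>.\<close>
  proof (intro exI[of _ "1 / (4 * c ^ N)"] conjI allI impI)
    show "0 < 1 / (4 * c ^ N)" using c by simp
    fix V n i assume i: "i \<in> I n" and g: "gaussian_family P nodes V" and mb: "moment_bound P V n B"
    have V: "V x \<in> borel_measurable P" if "x \<in> nodes" for x using g that by (auto simp: gaussian_family_def)
    define h :: real where "h = (1 / 2) ^ n"
    have h: "0 < h" by (simp add: h_def)
    have hk: "h ^ (2 * \<kappa>) = (1 / 4) ^ (\<kappa> * n)" unfolding h_def by (rule half_power)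
    have hk0: "0 < h ^ (2 * \<kappa>)" using h by simp
    define tail where "tail \<omega> = (\<Sum>m. ennreal (layer n (m + q) i (\<lambda>x. V x \<omega>)))" for \<omega>
    define os where "os \<omega> = osc n i (\<lambda>x. V x \<omega>)" for \<omega>
    have lm: "(\<lambda>\<omega>. layer n m i (\<lambda>x. V x \<omega>)) \<in> borel_measurable P" for m by (rule layer_measurable[OF V])
    have mt [measurable]: "tail \<in> borel_measurable P" unfolding tail_def using lm by measurable
    have mo [measurable]: "os \<in> borel_measurable P" unfolding os_def by (rule osc_measurable[OF V])
    have pt: "P.prob {\<omega> \<in> space P. \<not> tail \<omega> \<le> ennreal (\<theta> * h ^ (2 * \<kappa>))} \<le> 1 / 4"
    proof -
      have "P.prob {\<omega> \<in> space P. \<not> tail \<omega> \<le> ennreal (\<theta> * h ^ (2 * \<kappa>))} \<le>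
          (8 * (c1 * B ^ (2 * \<kappa>) * (1 / 4) ^ (\<kappa> * n)) * (8 / 9) ^ q) / (\<theta> * h ^ (2 * \<kappa>))"
        using nn_integral_tail_le[OF i mb, of q] \<theta> h B c1_ge_1 unfolding tail_def[symmetric]
        by (intro P.prob_not_le_ennreal) auto
      also have "\<dots> = 8 * c1 * B ^ (2 * \<kappa>) * (8 / 9) ^ q / \<theta>"
        unfolding hk[symmetric] using h by (simp add: field_simps)
      also have "\<dots> \<le> 1 / 4" using q \<theta> by (simp add: divide_le_eq)
      finally show ?thesis .
    qed
    have po: "P.prob {\<omega> \<in> space P. \<not> os \<omega> \<le> lev A n} \<le> 1 / 4"
    proof -
      have "P.prob {\<omega> \<in> space P. \<not> os \<omega> \<le> lev A n} \<le>
          (8 * c1 * B ^ (2 * \<kappa>) * (1 / 4) ^ (\<kappa> * n)) / (A ^ (2 * \<kappa>) * (1 / 4) ^ (\<kappa> * n))"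
        using nn_integral_osc_le[OF i mb] A0 B c1_ge_1 unfolding lev_alt os_def[symmetric]
        by (intro P.prob_not_le_ennreal) auto
      also have "\<dots> = 8 * c1 * B ^ (2 * \<kappa>) / A ^ (2 * \<kappa>)" by simp
      also have "\<dots> \<le> 1 / 4" using AB A0 by (simp add: divide_le_eq)
      finally show ?thesis .
    qed
    define Gd where "Gd = {\<omega> \<in> space P. os \<omega> \<le> lev A n \<and> tail \<omega> \<le> ennreal (\<theta> * h ^ (2 * \<kappa>))}"
    have mGd: "Gd \<in> sets P" unfolding Gd_def by measurable
    have "space P - Gd = {\<omega> \<in> space P. \<not> tail \<omega> \<le> ennreal (\<theta> * h ^ (2 * \<kappa>))} \<union> {\<omega> \<in> space P. \<not> os \<omega> \<le> lev A n}"
      by (auto simp: Gd_def)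
    then have "P.prob (space P - Gd) \<le> P.prob {\<omega> \<in> space P. \<not> tail \<omega> \<le> ennreal (\<theta> * h ^ (2 * \<kappa>))} + P.prob {\<omega> \<in> space P. \<not> os \<omega> \<le> lev A n}"
      by (simp only:) (rule measure_Un_le; measurable)
    then have pG: "1 / 2 \<le> P.prob Gd" using pt po P.prob_compl[OF mGd] by simp
    define E where "E = (SIGMA m:{..<q}. desc n (Suc m) i)"
    have finE: "finite E" unfolding E_def by auto
    have "card E = (\<Sum>m<q. card (desc n (Suc m) i))" unfolding E_def by (subst card_SigmaI) auto
    then have "real (card E) \<le> (\<Sum>m<q. c1 * 2 ^ (\<kappa> * Suc m))"
      using card_desc_le[OF i] by (simp only: of_nat_sum) (intro sum_mono; blast)
    then have cE: "card E \<le> N" unfolding N_def by linarith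
    define ed where "ed \<omega> e = edge (\<lambda>x. V x \<omega>) (n + fst e) (snd e)" for \<omega> e
    have med [measurable]: "(\<lambda>\<omega>. ed \<omega> e) \<in> borel_measurable P" if "e \<in> E" for e
    proof -
      have "(Suc (n + fst e), snd e) \<in> nodes" "(n + fst e, par (n + fst e) (snd e)) \<in> nodes"
        using that desc_nodes by (auto simp: E_def)
      then show ?thesis unfolding ed_def edge_def using V by (intro borel_measurable_diff) auto
    qed
    define F where "F = PiE E (\<lambda>_. {-L..L})"
    have finF: "finite F" unfolding F_def using finE by (intro finite_PiE) auto
    have "card F = nat (2 * L + 1) ^ card E" unfolding F_def using finE L0 by (simp add: card_PiE)
    then have "real (card F) = c ^ card E" by (simp add: c_def)
    also have "\<dots> \<le> c ^ N" using c cE by (intro power_increasing) auto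
    finally have cF: "real (card F) \<le> c ^ N" .
    define Q where "Q \<phi> = {\<omega> \<in> Gd. \<forall>e\<in>E. of_int (\<phi> e) * (\<sigma> * h) \<le> ed \<omega> e \<and> ed \<omega> e < (of_int (\<phi> e) + 1) * (\<sigma> * h)}" for \<phi> :: "nat \<times> 'i \<Rightarrow> int"
    have mQ: "Q \<phi> \<in> sets P" for \<phi>
    proof -
      have "{\<omega> \<in> space P. \<forall>e\<in>E. of_int (\<phi> e) * (\<sigma> * h) \<le> ed \<omega> e \<and> ed \<omega> e < (of_int (\<phi> e) + 1) * (\<sigma> * h)} \<in> sets P"
        using finE by (intro sets.sets_Collect_finite_All) (auto intro!: sets.sets_Collect_conj borel_measurable_le borel_measurable_less med)
      moreover have "Q \<phi> = Gd \<inter> {\<omega> \<in> space P. \<forall>e\<in>E. of_int (\<phi> e) * (\<sigma> * h) \<le> ed \<omega> e \<and> ed \<omega> e < (of_int (\<phi> e) + 1) * (\<sigma> * h)}"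
        by (auto simp: Q_def Gd_def)
      ultimately show ?thesis using mGd by auto
    qed
    have QU: "Gd \<subseteq> (\<Union>\<phi>\<in>F. Q \<phi>)"
    proof
      fix \<omega> assume \<omega>: "\<omega> \<in> Gd"
      define \<phi> where "\<phi> = (\<lambda>e\<in>E. \<lfloor>ed \<omega> e / (\<sigma> * h)\<rfloor>)"
      have s: "0 < \<sigma> * h" using \<sigma> h by simp
      have "\<phi> e \<in> {-L..L}" if "e \<in> E" for e
      proof -
        have o: "osc n i (\<lambda>x. V x \<omega>) \<le> ennreal ((A * h) ^ (2 * \<kappa>))" using \<omega> by (simp add: Gd_def os_def lev_def h_def)
        have e: "snd e \<in> desc n (Suc (fst e)) i" using that by (auto simp: E_def)
        have "\<bar>ed \<omega> e\<bar> \<le> A * h * (3 / 4) ^ Suc (fst e)"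
          unfolding ed_def using edge_le_osc[OF _ o e] A0 h by simp
        also have "\<dots> \<le> A * h * 1" using A0 h by (intro mult_left_mono power_le_one) auto
        finally have "\<bar>ed \<omega> e / (\<sigma> * h)\<bar> \<le> A / \<sigma>"
          using s h \<sigma> by (simp add: abs_divide divide_simps abs_mult)
        then have "\<lfloor>ed \<omega> e / (\<sigma> * h)\<rfloor> \<le> L" "- L \<le> \<lfloor>ed \<omega> e / (\<sigma> * h)\<rfloor>"
          unfolding L_def by linarith+
        then show ?thesis using that by (simp add: \<phi>_def)
      qed
      then have "\<phi> \<in> F" by (auto simp: F_def \<phi>_def)
      moreover have "of_int (\<phi> e) * (\<sigma> * h) \<le> ed \<omega> e \<and> ed \<omega> e < (of_int (\<phi> e) + 1) * (\<sigma> * h)" if "e \<in> E" for e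
      proof -
        have "of_int (\<phi> e) \<le> ed \<omega> e / (\<sigma> * h)" "ed \<omega> e / (\<sigma> * h) < of_int (\<phi> e) + 1"
          using that by (auto simp: \<phi>_def)
        then show ?thesis using s by (auto simp: pos_le_divide_eq pos_divide_less_eq)
      qed
      ultimately have "\<phi> \<in> F" "\<omega> \<in> Q \<phi>" using \<omega> by (simp_all add: Q_def)
      then show "\<omega> \<in> (\<Union>\<phi>\<in>F. Q \<phi>)" by blast
    qed
    have disj: "disjoint_family_on Q F"
      unfolding disjoint_family_on_def
    proof (intro ballI impI, rule ccontr)
      fix \<phi> \<psi> assume f: "\<phi> \<in> F" "\<psi> \<in> F" "\<phi> \<noteq> \<psi>" and "Q \<phi> \<inter> Q \<psi> \<noteq> {}"
      then obtain \<omega> where w: "\<omega> \<in> Q \<phi>" "\<omega> \<in> Q \<psi>" by auto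
      have "\<phi> e = \<psi> e" if "e \<in> E" for e
      proof -
        have s: "0 < \<sigma> * h" using \<sigma> h by simp
        have a: "of_int (\<phi> e) * (\<sigma> * h) \<le> ed \<omega> e" "ed \<omega> e < (of_int (\<phi> e) + 1) * (\<sigma> * h)"
          "of_int (\<psi> e) * (\<sigma> * h) \<le> ed \<omega> e" "ed \<omega> e < (of_int (\<psi> e) + 1) * (\<sigma> * h)"
          using w that by (simp_all add: Q_def)
        have "of_int (\<phi> e) < (of_int (\<psi> e) + 1 :: real)" "of_int (\<psi> e) < (of_int (\<phi> e) + 1 :: real)"
          using le_less_trans[OF a(1) a(4)] le_less_trans[OF a(3) a(2)] s by (simp_all only: mult_less_cancel_right_pos)
        then show ?thesis by linarith
      qed
      then have "\<phi> = \<psi>" using f by (auto simp: F_def intro: PiE_ext)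
      with f show False by simp
    qed
    have "P.prob Gd \<le> P.prob (\<Union>\<phi>\<in>F. Q \<phi>)" using QU mQ finF by (intro P.finite_measure_mono) auto
    also have "\<dots> = (\<Sum>\<phi>\<in>F. P.prob (Q \<phi>))"
      using finF disj mQ by (intro P.finite_measure_finite_Union) auto
    finally have sQ: "1 / 2 \<le> (\<Sum>\<phi>\<in>F. P.prob (Q \<phi>))" using pG by simp
    have "(1 / 2)\<^sup>2 \<le> (\<Sum>\<phi>\<in>F. P.prob (Q \<phi>))\<^sup>2" using sQ by (intro power_mono) auto
    also have "\<dots> \<le> (\<Sum>\<phi>\<in>F. (P.prob (Q \<phi>))\<^sup>2) * card F"
      by (rule sum_squared_le_sum_of_squares)
    also have "\<dots> \<le> (\<Sum>\<phi>\<in>F. (P.prob (Q \<phi>))\<^sup>2) * c ^ N"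
      using cF by (intro mult_left_mono sum_nonneg) auto
    finally have s2: "1 / (4 * c ^ N) \<le> (\<Sum>\<phi>\<in>F. (P.prob (Q \<phi>))\<^sup>2)"
      using c by (simp add: divide_simps power2_eq_square mult_ac)
    let ?T = "{z \<in> space (P \<Otimes>\<^sub>M P). osc n i (\<lambda>x. (1 / sqrt 2) * (V x (fst z) - V x (snd z))) \<le> lev \<eta> n}"
    have sub: "Q \<phi> \<times> Q \<phi> \<subseteq> ?T" if "\<phi> \<in> F" for \<phi>
    proof safe
      fix \<omega> \<omega>' assume w: "\<omega> \<in> Q \<phi>" "\<omega>' \<in> Q \<phi>"
      then have w': "\<omega> \<in> space P" "\<omega>' \<in> space P" by (auto simp: Q_def Gd_def)
      then show "(\<omega>, \<omega>') \<in> space (P \<Otimes>\<^sub>M P)" by (simp add: space_pair_measure)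
      let ?d = "\<lambda>x. V x \<omega> - V x \<omega>'"
      have "(\<Sum>m. ennreal (layer n (m + q) i ?d)) \<le> ennreal (4 ^ \<kappa>) * (tail \<omega> + tail \<omega>')"
        unfolding tail_def by (rule tail_diff)
      also have "\<dots> \<le> ennreal (4 ^ \<kappa>) * (ennreal (\<theta> * h ^ (2 * \<kappa>)) + ennreal (\<theta> * h ^ (2 * \<kappa>)))"
        using w by (intro mult_left_mono add_mono) (auto simp: Q_def Gd_def)
      also have "\<dots> = ennreal (\<eta> ^ (2 * \<kappa>) / 2 * h ^ (2 * \<kappa>))"
        using \<theta> h unfolding \<theta>_def by (simp add: ennreal_plus[symmetric] ennreal_mult[symmetric] del: ennreal_plus) 
      finally have t: "(\<Sum>m. ennreal (layer n (m + q) i ?d)) \<le> ennreal (\<eta> ^ (2 * \<kappa>) / 2 * h ^ (2 * \<kappa>))" .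
      have "ennreal (layer n m i ?d) \<le> ennreal ((16 / 9) ^ (\<kappa> * Suc m) * (c1 * 2 ^ (\<kappa> * Suc m) * (\<sigma> * h) ^ (2 * \<kappa>)))"
        if m: "m < q" for m
      proof (intro ennreal_leI layer_le[OF i])
        show "0 \<le> \<sigma> * h" using \<sigma> h by simp
        fix i' assume "i' \<in> desc n (Suc m) i"
        then have e: "(m, i') \<in> E" using m by (auto simp: E_def)
        have "edge ?d (n + m) i' = ed \<omega> (m, i') - ed \<omega>' (m, i')" by (simp add: edge_def ed_def)
        moreover have "of_int (\<phi> (m, i')) * (\<sigma> * h) \<le> ed \<omega> (m, i')" "ed \<omega> (m, i') < (of_int (\<phi> (m, i')) + 1) * (\<sigma> * h)"
          "of_int (\<phi> (m, i')) * (\<sigma> * h) \<le> ed \<omega>' (m, i')" "ed \<omega>' (m, i') < (of_int (\<phi> (m, i')) + 1) * (\<sigma> * h)"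
          using w e by (auto simp: Q_def)
        ultimately show "\<bar>edge ?d (n + m) i'\<bar> \<le> \<sigma> * h" by (simp add: distrib_right abs_le_iff)
      qed
      then have "(\<Sum>m<q. ennreal (layer n m i ?d)) \<le> (\<Sum>m<q. ennreal ((16 / 9) ^ (\<kappa> * Suc m) * (c1 * 2 ^ (\<kappa> * Suc m) * (\<sigma> * h) ^ (2 * \<kappa>))))"
        by (intro sum_mono) auto
      also have "\<dots> = ennreal (\<Sum>m<q. (16 / 9) ^ (\<kappa> * Suc m) * (c1 * 2 ^ (\<kappa> * Suc m) * (\<sigma> * h) ^ (2 * \<kappa>)))"
        using c1_ge_1 \<sigma> h by (intro sum_ennreal) auto
      also have "(\<Sum>m<q. (16 / 9) ^ (\<kappa> * Suc m) * (c1 * 2 ^ (\<kappa> * Suc m) * (\<sigma> * h) ^ (2 * \<kappa>))) = head_const q * (\<sigma> * h) ^ (2 * \<kappa>)"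
        unfolding head_const_def sum_distrib_right mult.assoc ..
      also have "\<dots> = head_const q * \<sigma> ^ (2 * \<kappa>) * h ^ (2 * \<kappa>)" unfolding power_mult_distrib[of \<sigma>] by (simp only: mult.assoc)
      also have "ennreal \<dots> \<le> ennreal (\<eta> ^ (2 * \<kappa>) / 2 * h ^ (2 * \<kappa>))"
        using H\<sigma> hk0 by (intro ennreal_leI mult_right_mono) auto
      finally have hd: "(\<Sum>m<q. ennreal (layer n m i ?d)) \<le> ennreal (\<eta> ^ (2 * \<kappa>) / 2 * h ^ (2 * \<kappa>))" .
      have "osc n i ?d \<le> ennreal (\<eta> ^ (2 * \<kappa>) / 2 * h ^ (2 * \<kappa>)) + ennreal (\<eta> ^ (2 * \<kappa>) / 2 * h ^ (2 * \<kappa>))"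
        unfolding osc_split[of n i _ q] using t hd by (rule add_mono)
      also have "\<dots> = lev \<eta> n"
        unfolding lev_alt hk[symmetric] using \<eta> h by (subst ennreal_plus[symmetric]) auto
      finally have od: "osc n i ?d \<le> lev \<eta> n" .
      have "osc n i (\<lambda>x. (1 / sqrt 2) * ?d x) = ennreal ((1 / sqrt 2) ^ (2 * \<kappa>)) * osc n i ?d"
        by (rule osc_scale)
      also have "\<dots> \<le> ennreal 1 * osc n i ?d"
        by (intro mult_right_mono ennreal_leI power_le_one) auto
      finally show "osc n i (\<lambda>x. (1 / sqrt 2) * (V x (fst (\<omega>, \<omega>')) - V x (snd (\<omega>, \<omega>')))) \<le> lev \<eta> n"
        using od by simp
    qed
    have mT: "?T \<in> sets (P \<Otimes>\<^sub>M P)"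
    proof -
      have "(\<lambda>z. osc n i (\<lambda>x. (1 / sqrt 2) * (V x (fst z) - V x (snd z)))) \<in> borel_measurable (P \<Otimes>\<^sub>M P)"
        by (rule osc_measurable) (use V in measurable)
      then show ?thesis by measurable
    qed
    have "(\<Sum>\<phi>\<in>F. (P.prob (Q \<phi>))\<^sup>2) = (\<Sum>\<phi>\<in>F. PP.prob (Q \<phi> \<times> Q \<phi>))"
      using mQ by (intro sum.cong refl) (simp add: measure_def P.emeasure_pair_measure_Times enn2real_mult power2_eq_square)
    also have "\<dots> = PP.prob (\<Union>\<phi>\<in>F. Q \<phi> \<times> Q \<phi>)"
      using finF disj mQ by (intro PP.P.finite_measure_finite_Union[symmetric]) (auto simp: disjoint_family_on_def)
    also have "\<dots> \<le> PP.prob ?T"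
      using sub mT by (intro PP.P.finite_measure_mono) auto
    finally show "1 / (4 * c ^ N) \<le> P.prob {\<omega> \<in> space P. osc n i (\<lambda>x. V x \<omega>) \<le> lev \<eta> n}"
      using s2 gaussian_osc_symmetrize[OF P g, of n i "lev \<eta> n"] by simp
  qed
qed

text \<open>Quasi-additivity of \<open>osc\<close> costs \<open>4 ^ \<kappa>\<close> and two
  summands cost another 2. The power \<open>2 * \<kappa>\<close> of the quarter is 1 /
  \<open>4 ^ (2 * \<kappa>)\<close>, which absorbs both because
  \<open>1 \<le> \<kappa>\<close>.\<close>

lemma osc_add_le_lev:
  assumes "osc n i f \<le> lev (\<eta> / 4) n" "osc n i g \<le> lev (\<eta> / 4) n" "0 \<le> \<eta>"
  shows "osc n i (\<lambda>x. f x + g x) \<le> lev \<eta> n"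
proof -
  have "osc n i (\<lambda>x. f x + g x) \<le> ennreal (4 ^ \<kappa>) * (lev (\<eta> / 4) n + lev (\<eta> / 4) n)"
    by (rule order_trans[OF osc_add]) (intro mult_left_mono add_mono assms; simp)
  also have "\<dots> = ennreal (4 ^ \<kappa> * (2 * ((\<eta> / 4) ^ (2 * \<kappa>) * (1 / 4) ^ (\<kappa> * n))))"
    unfolding lev_alt using assms(3) by (simp add: ennreal_plus[symmetric] ennreal_mult[symmetric] del: ennreal_plus)
  also have "\<dots> \<le> lev \<eta> n"
    unfolding lev_alt
  proof (rule ennreal_leI)
    have "(4 :: real) ^ 1 \<le> 4 ^ \<kappa>" using \<kappa>_pos by (intro power_increasing) auto
    then have "2 * 4 ^ \<kappa> \<le> (4 :: real) ^ \<kappa> * 4 ^ \<kappa>" by (intro mult_right_mono) auto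
    also have "\<dots> = 4 ^ (2 * \<kappa>)" by (simp add: power_add[symmetric] mult_2)
    finally have "2 * 4 ^ \<kappa> / 4 ^ (2 * \<kappa>) \<le> (1 :: real)" by (simp add: divide_le_eq)
    then have "2 * 4 ^ \<kappa> / 4 ^ (2 * \<kappa>) * (\<eta> ^ (2 * \<kappa>) * (1 / 4) ^ (\<kappa> * n)) \<le> 1 * (\<eta> ^ (2 * \<kappa>) * (1 / 4) ^ (\<kappa> * n))"
      using assms(3) by (intro mult_right_mono) auto
    then show "4 ^ \<kappa> * (2 * ((\<eta> / 4) ^ (2 * \<kappa>) * (1 / 4) ^ (\<kappa> * n))) \<le> \<eta> ^ (2 * \<kappa>) * (1 / 4) ^ (\<kappa> * n)"
      by (simp add: power_divide mult_ac)
  qed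
  finally show ?thesis .
qed

text \<open>Let \<open>G s\<close> be the event that \<open>V s\<close> has small oscillation in
  every copy. Its probability is at least \<open>p0 ^ card K\<close> by independence of the copies,
  and these events inherit pairwise independence in \<open>s\<close>. Hence with the stated
  probability some \<open>G s\<close> occurs, and there \<open>Y\<close> can be bad only if one of
  the \<open>m * card K\<close> residual events occurs.\<close>

lemma prob_all_scales_bad_le:
  fixes P :: "'w measure" and K :: "'k set"
  assumes P: "prob_space P" and K: "finite K" and p0: "0 < p0" and m: "0 < m" and \<eta>: "0 \<le> \<eta>" and e: "0 \<le> e"
    and Y: "\<And>x. x \<in> nodes \<Longrightarrow> Y x \<in> borel_measurable P"
    and V: "\<And>s x. x \<in> nodes \<Longrightarrow> V s x \<in> borel_measurable P"
    and small: "\<And>s. s < m \<Longrightarrow> p0 \<le> measure P {\<omega> \<in> space P. osc (n s) (i s) (\<lambda>x. V s x \<omega>) \<le> lev (\<eta> / 4) (n s)}"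
    and ind: "\<And>s t. s < m \<Longrightarrow> t < m \<Longrightarrow> s \<noteq> t \<Longrightarrow>
       measure P {\<omega> \<in> space P. osc (n s) (i s) (\<lambda>x. V s x \<omega>) \<le> lev (\<eta> / 4) (n s) \<and> osc (n t) (i t) (\<lambda>x. V t x \<omega>) \<le> lev (\<eta> / 4) (n t)} =
       measure P {\<omega> \<in> space P. osc (n s) (i s) (\<lambda>x. V s x \<omega>) \<le> lev (\<eta> / 4) (n s)} *
       measure P {\<omega> \<in> space P. osc (n t) (i t) (\<lambda>x. V t x \<omega>) \<le> lev (\<eta> / 4) (n t)}"
    and rest: "\<And>s. s < m \<Longrightarrow>
       measure P {\<omega> \<in> space P. \<not> osc (n s) (i s) (\<lambda>x. Y x \<omega> - V s x \<omega>) \<le> lev (\<eta> / 4) (n s)} \<le> e"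
  shows "measure (PiM K (\<lambda>_. P)) {\<omega> \<in> space (PiM K (\<lambda>_. P)). \<forall>s<m. \<exists>k\<in>K. \<not> osc (n s) (i s) (\<lambda>x. Y x (\<omega> k)) \<le> lev \<eta> (n s)}
     \<le> 1 / (real m * p0 ^ card K) + real m * real (card K) * e"
proof -
  interpret P: prob_space P by fact
  interpret PK: finite_product_prob_space "\<lambda>_. P" K
    by unfold_locales (rule K)
  let ?PK = "PiM K (\<lambda>_. P)"
  define g where "g s = {\<omega> \<in> space P. osc (n s) (i s) (\<lambda>x. V s x \<omega>) \<le> lev (\<eta> / 4) (n s)}" for s
  define hb where "hb s = {\<omega> \<in> space P. \<not> osc (n s) (i s) (\<lambda>x. Y x \<omega> - V s x \<omega>) \<le> lev (\<eta> / 4) (n s)}" for s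
  have mV: "(\<lambda>\<omega>. osc (n s) (i s) (\<lambda>x. V s x \<omega>)) \<in> borel_measurable P" for s by (rule osc_measurable[OF V])
  have mR: "(\<lambda>\<omega>. osc (n s) (i s) (\<lambda>x. Y x \<omega> - V s x \<omega>)) \<in> borel_measurable P" for s
    using V Y by (intro osc_measurable borel_measurable_diff) auto
  have mg [measurable]: "g s \<in> sets P" for s unfolding g_def using mV by measurable
  have mh [measurable]: "hb s \<in> sets P" for s unfolding hb_def using mR by measurable
  define G where "G s = PiE K (\<lambda>_. g s)" for s
  have mG: "G s \<in> sets ?PK" for s unfolding G_def using K by (intro sets_PiM_I_finite) auto
  have pG: "measure ?PK (PiE K (\<lambda>_. A)) = measure P A ^ card K" if "A \<in> sets P" for A
    using that by (subst PK.finite_measure_PiM_emb) auto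
  have GG: "G s \<inter> G t = PiE K (\<lambda>_. g s \<inter> g t)" for s t by (auto simp: G_def PiE_iff)
  have gg: "P.prob (g s \<inter> g t) = P.prob (g s) * P.prob (g t)" if "s < m" "t < m" "s \<noteq> t" for s t
  proof -
    have "g s \<inter> g t = {\<omega> \<in> space P. osc (n s) (i s) (\<lambda>x. V s x \<omega>) \<le> lev (\<eta> / 4) (n s) \<and> osc (n t) (i t) (\<lambda>x. V t x \<omega>) \<le> lev (\<eta> / 4) (n t)}"
      by (auto simp: g_def)
    then show ?thesis using ind[OF that] by (simp add: g_def)
  qed
  have none: "measure ?PK {\<omega> \<in> space ?PK. \<forall>s<m. \<omega> \<notin> G s} \<le> 1 / (real m * p0 ^ card K)"
  proof (rule PK.prob_no_event_le)
    fix s assume s: "s < m"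
    show "p0 ^ card K \<le> measure ?PK (G s)"
      unfolding G_def pG[OF mg] using small[OF s] p0 by (intro power_mono) (auto simp: g_def)
  next
    fix s t assume st: "s < m" "t < m" "s \<noteq> t"
    show "measure ?PK (G s \<inter> G t) = measure ?PK (G s) * measure ?PK (G t)"
      unfolding GG unfolding G_def using mg gg[OF st] by (simp add: pG power_mult_distrib)
  qed (use mG p0 m in auto)
  define H where "H s k = {\<omega> \<in> space ?PK. \<omega> k \<in> hb s}" for s k
  have mH: "H s k \<in> sets ?PK" if "k \<in> K" for s k
    unfolding H_def using that by measurable
  have pH: "measure ?PK (H s k) \<le> e" if "s < m" "k \<in> K" for s k
  proof -
    have "measure ?PK (H s k) = measure (distr ?PK P (\<lambda>\<omega>. \<omega> k)) (hb s)"
      using that mh unfolding H_def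
      by (subst measure_distr) (auto intro!: arg_cong[of _ _ "measure ?PK"])
    also have "distr ?PK P (\<lambda>\<omega>. \<omega> k) = P"
      using PK.PiM_component[of k] that by simp
    finally show ?thesis using rest[OF that(1)] by (simp add: hb_def)
  qed
  let ?B = "{\<omega> \<in> space ?PK. \<forall>s<m. \<exists>k\<in>K. \<not> osc (n s) (i s) (\<lambda>x. Y x (\<omega> k)) \<le> lev \<eta> (n s)}"
  let ?N = "{\<omega> \<in> space ?PK. \<forall>s<m. \<omega> \<notin> G s}"
  have mN: "?N \<in> sets ?PK"
  proof -
    have "?N = space ?PK - (\<Union>s<m. G s)" by auto
    then show ?thesis using mG by auto
  qed
  have sub: "?B \<subseteq> ?N \<union> (\<Union>s<m. \<Union>k\<in>K. H s k)"
  proof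
    fix \<omega> assume w: "\<omega> \<in> ?B"
    show "\<omega> \<in> ?N \<union> (\<Union>s<m. \<Union>k\<in>K. H s k)"
    proof (rule ccontr)
      assume c: "\<not> ?thesis"
      then obtain s where s: "s < m" "\<omega> \<in> G s" using w by auto
      then obtain k where k: "k \<in> K" "\<not> osc (n s) (i s) (\<lambda>x. Y x (\<omega> k)) \<le> lev \<eta> (n s)" using w by auto
      have "\<omega> k \<in> g s" using s k by (auto simp: G_def)
      moreover have "\<omega> k \<notin> hb s" using c s k w by (auto simp: H_def)
      ultimately have "osc (n s) (i s) (\<lambda>x. V s x (\<omega> k) + (Y x (\<omega> k) - V s x (\<omega> k))) \<le> lev \<eta> (n s)"
        using \<eta> by (intro osc_add_le_lev) (auto simp: g_def hb_def)
      with k show False by simp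
    qed
  qed
  have mHK: "(\<Union>k\<in>K. H s k) \<in> sets ?PK" for s by (rule sets.finite_UN[OF K mH])
  have mHU: "(\<Union>s<m. \<Union>k\<in>K. H s k) \<in> sets ?PK" by (rule sets.finite_UN[OF finite_lessThan mHK])
  have "measure ?PK ?B \<le> measure ?PK (?N \<union> (\<Union>s<m. \<Union>k\<in>K. H s k))"
    by (rule PK.finite_measure_mono[OF sub sets.Un[OF mN mHU]])
  also have "\<dots> \<le> measure ?PK ?N + measure ?PK (\<Union>s<m. \<Union>k\<in>K. H s k)"
    by (rule measure_Un_le[OF mN mHU])
  also have "measure ?PK (\<Union>s<m. \<Union>k\<in>K. H s k) \<le> (\<Sum>s<m. measure ?PK (\<Union>k\<in>K. H s k))"
    by (rule measure_UNION_le[OF finite_lessThan mHK])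
  also have "\<dots> \<le> (\<Sum>s<m. \<Sum>k\<in>K. measure ?PK (H s k))"
    by (intro sum_mono measure_UNION_le[OF K mH])
  also have "\<dots> \<le> (\<Sum>s<m. \<Sum>k\<in>K. e)" using pH by (intro sum_mono) auto
  finally show ?thesis using none by (simp add: mult_ac)
qed

text \<open>
  \<open>V s\<close> is the part of \<open>Y\<close> that dominates the oscillation at scale \<open>n s\<close>; parts of different
  scales have pairwise independent oscillations, which is all that a second moment argument needs.
\<close>

definition decomposable :: "'w measure \<Rightarrow> (nat \<times> 'i \<Rightarrow> 'w \<Rightarrow> real) \<Rightarrow> real \<Rightarrow> bool" where
  "decomposable P Y B \<longleftrightarrow> (\<forall>q n0. \<forall>\<theta>>0. \<exists>(n :: nat \<Rightarrow> nat) V. (\<forall>s. n0 \<le> n s \<and> n s < n (Suc s)) \<and>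
     (\<forall>s. gaussian_family P nodes (V s) \<and> moment_bound P (V s) (n s) B \<and>
        moment_bound P (\<lambda>x \<omega>. Y x \<omega> - V s x \<omega>) (n s) B \<and>
        (\<forall>m<q. \<forall>i'\<in>I (Suc (n s + m)).
          (\<integral>\<^sup>+\<omega>. ennreal (edge (\<lambda>x. Y x \<omega> - V s x \<omega>) (n s + m) i' ^ (2 * \<kappa>)) \<partial>P) \<le> ennreal ((\<theta> * (1 / 2) ^ n s) ^ (2 * \<kappa>)))) \<and>
     (\<forall>s t l l' i i' a a'. s \<noteq> t \<longrightarrow>
       measure P {\<omega> \<in> space P. osc l i (\<lambda>x. V s x \<omega>) \<le> a \<and> osc l' i' (\<lambda>x. V t x \<omega>) \<le> a'} =
       measure P {\<omega> \<in> space P. osc l i (\<lambda>x. V s x \<omega>) \<le> a} * measure P {\<omega> \<in> space P. osc l' i' (\<lambda>x. V t x \<omega>) \<le> a'}))"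

text \<open>The order of the choices matters: \<open>p0\<close> depends only on \<open>B\<close> and
  \<open>\<eta>\<close>, so the number \<open>m\<close> of scales can be fixed from it; then comes
  the share \<open>e\<close> allowed to each residual event, then \<open>q\<close> and
  \<open>\<theta>\<close>, and only then the decomposition. The decomposition must therefore be
  available for every \<open>q\<close> and \<open>\<theta>\<close> with the same
  \<open>B\<close>.\<close>

lemma ex_scales_prob_all_bad_le:
  fixes P :: "'w measure" and K :: "'k set"
  assumes P: "prob_space P" and K: "finite K" "K \<noteq> {}" and B: "0 \<le> B" and \<eta>: "0 < \<eta>" and \<delta>: "0 < \<delta>"
    and Y: "\<And>x. x \<in> nodes \<Longrightarrow> Y x \<in> borel_measurable P"
    and dec: "decomposable P Y B"
  shows "\<exists>m n. 0 < m \<and> (\<forall>s. n0 \<le> n s \<and> n s < n (Suc s)) \<and> (\<forall>i. (\<forall>s<m. i s \<in> I (n s)) \<longrightarrow>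
     measure (PiM K (\<lambda>_. P)) {\<omega> \<in> space (PiM K (\<lambda>_. P)). \<forall>s<m. \<exists>k\<in>K. \<not> osc (n s) (i s) (\<lambda>x. Y x (\<omega> k)) \<le> lev \<eta> (n s)} \<le> \<delta>)"
proof -
  interpret P: prob_space P by fact
  from small_ball[OF P B, of "\<eta> / 4"] \<eta> obtain p0 where p0: "0 < p0" and sb:
    "\<And>V n i. i \<in> I n \<Longrightarrow> gaussian_family P nodes V \<Longrightarrow> moment_bound P V n B \<Longrightarrow>
     p0 \<le> measure P {\<omega> \<in> space P. osc n i (\<lambda>x. V x \<omega>) \<le> lev (\<eta> / 4) n}" by auto
  define D where "D = card K"
  have D: "0 < D" using K by (simp add: D_def card_gt_0_iff)
  obtain m :: nat where m: "2 / (\<delta> * p0 ^ D) < real m" using reals_Archimedean2 by blast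
  have "0 < 2 / (\<delta> * p0 ^ D)" using \<delta> p0 by simp
  with m have m0: "0 < m" by (metis less_trans of_nat_0_less_iff)
  have m1: "1 / (real m * p0 ^ D) \<le> \<delta> / 2" using m m0 \<delta> p0 by (simp add: divide_simps mult_ac)
  define e where "e = \<delta> / (2 * (real m * real D))"
  have e: "0 < e" using \<delta> m0 D by (simp add: e_def)
  define \<eta>1 where "\<eta>1 = (\<eta> / 4) ^ (2 * \<kappa>)"
  have \<eta>1: "0 < \<eta>1" using \<eta> by (simp add: \<eta>1_def)
  have "(\<lambda>q. 8 * c1 * B ^ (2 * \<kappa>) * (8 / 9 :: real) ^ q) \<longlonglongrightarrow> 8 * c1 * B ^ (2 * \<kappa>) * 0"
    by (intro tendsto_mult tendsto_const LIMSEQ_power_zero) auto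
  then have "\<forall>\<^sub>F q in sequentially. 8 * c1 * B ^ (2 * \<kappa>) * (8 / 9 :: real) ^ q < e * \<eta>1 / 2"
    using e \<eta>1 by (intro order_tendstoD) auto
  then obtain q where q: "8 * c1 * B ^ (2 * \<kappa>) * (8 / 9 :: real) ^ q < e * \<eta>1 / 2"
    by (auto simp: eventually_sequentially)
  define y where "y = e * \<eta>1 / (2 * (head_const q + 1))"
  have H0: "0 \<le> head_const q" by (rule head_const_nonneg)
  have y: "0 < y" using e \<eta>1 H0 by (simp add: y_def)
  define \<theta> where "\<theta> = min 1 y"
  have \<theta>: "0 < \<theta>" "\<theta> \<le> 1" using y by (auto simp: \<theta>_def)
  have "\<theta> ^ (2 * \<kappa>) \<le> \<theta> ^ 1" using \<kappa>_pos \<theta> by (intro power_decreasing) auto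
  then have "\<theta> ^ (2 * \<kappa>) \<le> y" by (simp add: \<theta>_def)
  then have "head_const q * \<theta> ^ (2 * \<kappa>) \<le> head_const q * y" using H0 by (intro mult_left_mono) auto
  also have "\<dots> \<le> e * \<eta>1 / 2"
    using H0 e \<eta>1 by (simp add: y_def divide_simps)
  finally have h\<theta>: "head_const q * \<theta> ^ (2 * \<kappa>) \<le> e * \<eta>1 / 2" .
  from dec[unfolded decomposable_def, rule_format, OF \<theta>(1), of n0 q] obtain n V where
    n: "\<And>s. n0 \<le> n s \<and> n s < n (Suc s)" and
    V: "\<And>s. gaussian_family P nodes (V s)" "\<And>s. moment_bound P (V s) (n s) B"
       "\<And>s. moment_bound P (\<lambda>x \<omega>. Y x \<omega> - V s x \<omega>) (n s) B" and
    R: "\<And>s l i'. l < q \<Longrightarrow> i' \<in> I (Suc (n s + l)) \<Longrightarrow>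
        (\<integral>\<^sup>+\<omega>. ennreal (edge (\<lambda>x. Y x \<omega> - V s x \<omega>) (n s + l) i' ^ (2 * \<kappa>)) \<partial>P) \<le> ennreal ((\<theta> * (1 / 2) ^ n s) ^ (2 * \<kappa>))" and
    ind: "\<And>s t l l' i i' a a'. s \<noteq> t \<Longrightarrow>
       measure P {\<omega> \<in> space P. osc l i (\<lambda>x. V s x \<omega>) \<le> a \<and> osc l' i' (\<lambda>x. V t x \<omega>) \<le> a'} =
       measure P {\<omega> \<in> space P. osc l i (\<lambda>x. V s x \<omega>) \<le> a} * measure P {\<omega> \<in> space P. osc l' i' (\<lambda>x. V t x \<omega>) \<le> a'}"
    by blast
  have mV: "V s x \<in> borel_measurable P" if "x \<in> nodes" for s x using V(1)[of s] that by (auto simp: gaussian_family_def)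
  have main: "measure (PiM K (\<lambda>_. P)) {\<omega> \<in> space (PiM K (\<lambda>_. P)). \<forall>s<m. \<exists>k\<in>K. \<not> osc (n s) (i s) (\<lambda>x. Y x (\<omega> k)) \<le> lev \<eta> (n s)} \<le> \<delta>"
    if i: "\<forall>s<m. i s \<in> I (n s)" for i
  proof -
    have "measure (PiM K (\<lambda>_. P)) {\<omega> \<in> space (PiM K (\<lambda>_. P)). \<forall>s<m. \<exists>k\<in>K. \<not> osc (n s) (i s) (\<lambda>x. Y x (\<omega> k)) \<le> lev \<eta> (n s)}
       \<le> 1 / (real m * p0 ^ card K) + real m * real (card K) * e"
    proof (rule prob_all_scales_bad_le[OF P K(1) p0 m0 _ _ Y mV])
      fix s assume s: "s < m"
      then show "p0 \<le> measure P {\<omega> \<in> space P. osc (n s) (i s) (\<lambda>x. V s x \<omega>) \<le> lev (\<eta> / 4) (n s)}"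
        using i V by (intro sb) auto
      have "(\<integral>\<^sup>+\<omega>. osc (n s) (i s) (\<lambda>x. Y x \<omega> - V s x \<omega>) \<partial>P) \<le>
         ennreal ((8 * c1 * B ^ (2 * \<kappa>) * (8 / 9) ^ q + head_const q * \<theta> ^ (2 * \<kappa>)) * (1 / 4) ^ (\<kappa> * n s))"
        using nn_integral_osc_le_small[of "i s" "n s" P "\<lambda>x \<omega>. Y x \<omega> - V s x \<omega>" B \<theta> q] i s V(3) R \<theta> by auto
      also have "\<dots> \<le> ennreal (e * \<eta>1 * (1 / 4) ^ (\<kappa> * n s))"
        using q h\<theta> by (intro ennreal_leI mult_right_mono) auto
      finally have "measure P {\<omega> \<in> space P. \<not> osc (n s) (i s) (\<lambda>x. Y x \<omega> - V s x \<omega>) \<le> ennreal (\<eta>1 * (1 / 4) ^ (\<kappa> * n s))}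
         \<le> e * \<eta>1 * (1 / 4) ^ (\<kappa> * n s) / (\<eta>1 * (1 / 4) ^ (\<kappa> * n s))"
        using \<eta>1 e mV Y by (intro P.prob_not_le_ennreal osc_measurable borel_measurable_diff) auto
      also have "\<dots> = e" using \<eta>1 by simp
      finally show "measure P {\<omega> \<in> space P. \<not> osc (n s) (i s) (\<lambda>x. Y x \<omega> - V s x \<omega>) \<le> lev (\<eta> / 4) (n s)} \<le> e"
        unfolding lev_alt \<eta>1_def[symmetric] .
    qed (use ind e \<eta> in auto)
    also have "\<dots> \<le> \<delta> / 2 + \<delta> / 2"
      using m1 m0 D unfolding D_def[symmetric] by (intro add_mono) (simp_all add: e_def)
    finally show ?thesis by simp
  qed
  show ?thesis
    using m0 n main by (intro exI[of _ m] exI[of _ n]) blast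
qed

end

section \<open>Covering the symmetric matrices with a multiple eigenvalue\<close>

text \<open>The Householder reflection along \<open>w\<close>. The axis is not normalised, so that
  it can be scaled to have first coordinate 1: the remaining coordinates are then free parameters,
  one fewer than the dimension.\<close>

definition reflection :: "nat \<Rightarrow> (nat \<Rightarrow> real) \<Rightarrow> real mat" where
  "reflection n w = Matrix.mat n n (\<lambda>(i, j).
     (if i = j then 1 else 0) - 2 * w i * w j / (\<Sum>l\<in>{0..<n}. (w l)\<^sup>2))"

lemma reflection_carrier [simp]: "reflection n w \<in> carrier_mat n n"
  by (simp add: reflection_def)

lemma reflection_dim [simp]: "dim_row (reflection n w) = n" "dim_col (reflection n w) = n"
  by (simp_all add: reflection_def)

lemma reflection_index:
  "i < n \<Longrightarrow> j < n \<Longrightarrow> reflection n w $$ (i, j) =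
     (if i = j then 1 else 0) - 2 * w i * w j / (\<Sum>l\<in>{0..<n}. (w l)\<^sup>2)"
  by (simp add: reflection_def)

lemma reflection_symmetric: "transpose_mat (reflection n w) = reflection n w"
  by (rule eq_matI) (auto simp: reflection_index)

lemma index_mult_carrier:
  fixes A B :: "real mat"
  assumes "A \<in> carrier_mat n n" "B \<in> carrier_mat n n" "i < n" "j < n"
  shows "(A * B) $$ (i, j) = (\<Sum>l\<in>{0..<n}. A $$ (i, l) * B $$ (l, j))"
  using assms by (auto simp: scalar_prod_def intro!: sum.cong)

lemma reflection_involutive:
  assumes "(\<Sum>l\<in>{0..<n}. (w l)\<^sup>2) \<noteq> 0"
  shows "reflection n w * reflection n w = 1\<^sub>m n"
proof (rule eq_matI)
  fix i j assume "i < dim_row (1\<^sub>m n :: real mat)" "j < dim_col (1\<^sub>m n :: real mat)"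
  then have ij: "i < n" "j < n" by auto
  define q where "q = (\<Sum>l\<in>{0..<n}. (w l)\<^sup>2)"
  have q0: "q \<noteq> 0" using assms by (simp add: q_def)
  have "(reflection n w * reflection n w) $$ (i, j) =
      (\<Sum>l\<in>{0..<n}. ((if i = l then 1 else 0) - 2 * w i * w l / q) * ((if l = j then 1 else 0) - 2 * w l * w j / q))"
    using ij by (subst index_mult_carrier[of _ n]) (auto simp: reflection_index q_def intro!: sum.cong)
  also have "\<dots> = (\<Sum>l\<in>{0..<n}. (if l = i then (if i = j then 1 else 0) else 0)
       - (if l = i then 2 * w i * w j / q else 0) - (if l = j then 2 * w i * w j / q else 0)
       + 4 * w i * w j / q\<^sup>2 * (w l)\<^sup>2)"
    by (intro sum.cong refl) (auto simp: algebra_simps power2_eq_square)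
  also have "\<dots> = (if i = j then 1 else 0) - 4 * w i * w j / q + 4 * w i * w j / q\<^sup>2 * q"
    using ij by (simp add: sum.distrib sum_subtractf q_def sum_distrib_left)
  also have "\<dots> = (if i = j then 1 else 0)"
    using q0 by (simp add: power2_eq_square)
  finally show "(reflection n w * reflection n w) $$ (i, j) = 1\<^sub>m n $$ (i, j)"
    using ij by simp
qed auto

text \<open>Since the first coordinate of \<open>u\<close> is not positive, the reflection that exchanges \<open>e\<^sub>0\<close> and
  \<open>u\<close> has an axis that can be scaled to have first entry \<open>1\<close> and all entries in \<open>[-1, 1]\<close>.\<close>

lemma reflection_first_column:
  fixes u :: "nat \<Rightarrow> real"
  assumes n: "0 < n" and unit: "(\<Sum>l\<in>{0..<n}. (u l)\<^sup>2) = 1" and u0: "u 0 \<le> 0"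
  shows "\<exists>w. w 0 = 1 \<and> (\<forall>i<n. \<bar>w i\<bar> \<le> 1) \<and> (\<forall>i<n. reflection n w $$ (i, 0) = u i)"
proof -
  define w where "w i = (if i = 0 then 1 else u i / (u 0 - 1))" for i
  have nz: "u 0 - 1 \<noteq> 0" "u 0 - 1 < 0" using u0 by auto
  have ul: "\<bar>u i\<bar> \<le> 1" if "i < n" for i
  proof -
    have "(u i)\<^sup>2 \<le> (\<Sum>l\<in>{0..<n}. (u l)\<^sup>2)"
      using that by (intro member_le_sum) auto
    then show ?thesis using unit by (simp add: abs_square_le_1)
  qed
  have wl: "\<bar>w i\<bar> \<le> 1" if "i < n" for i
  proof (cases "i = 0")
    case False
    have "\<bar>u i\<bar> \<le> \<bar>u 0 - 1\<bar>" using ul[OF that] u0 by linarith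
    then show ?thesis using False nz by (simp add: w_def abs_divide divide_le_eq)
  qed (simp add: w_def)
  have dec: "{0..<n} = insert 0 {1..<n}" using n by auto
  have rest: "(\<Sum>l\<in>{1..<n}. (u l)\<^sup>2) = 1 - (u 0)\<^sup>2"
    using unit by (subst (asm) dec) simp
  have "(\<Sum>l\<in>{0..<n}. (w l)\<^sup>2) = 1 + (\<Sum>l\<in>{1..<n}. (u l / (u 0 - 1))\<^sup>2)"
    by (subst dec) (simp add: w_def)
  also have "(\<Sum>l\<in>{1..<n}. (u l / (u 0 - 1))\<^sup>2) = (\<Sum>l\<in>{1..<n}. (u l)\<^sup>2) / (u 0 - 1)\<^sup>2"
    by (simp add: power_divide sum_divide_distrib)
  also have "1 + \<dots> = - 2 / (u 0 - 1)"
    unfolding rest using nz by (simp add: divide_simps) (simp add: power2_eq_square algebra_simps)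
  finally have q: "(\<Sum>l\<in>{0..<n}. (w l)\<^sup>2) = - 2 / (u 0 - 1)" .
  have "reflection n w $$ (i, 0) = u i" if "i < n" for i
    unfolding reflection_index[OF that n] q using nz
    by (cases "i = 0") (auto simp: w_def divide_simps)
  moreover have "w 0 = 1" by (simp add: w_def)
  ultimately show ?thesis using wl by blast
qed

text \<open>Deflation: conjugation by the reflection that sends the first basis vector to a unit
  eigenvector turns the first column into \<open>a\<close> followed by zeros, and symmetry clears
  the first row as well. Both directions are recorded, one to bound the block and one to rebuild
  \<open>B\<close>. The data \<open>a\<close> and \<open>w\<close> are exactly as many parameters as
  the step costs in dimension.\<close>

lemma peel_eigenvector:
  fixes B :: "real mat"
  assumes B: "B \<in> carrier_mat (Suc m) (Suc m)" and sym: "transpose_mat B = B"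
    and ev: "poly (char_poly B) a = 0"
  shows "\<exists>w B'. w 0 = 1 \<and> (\<forall>i<Suc m. \<bar>w i\<bar> \<le> 1) \<and> B' \<in> carrier_mat m m \<and> transpose_mat B' = B' \<and>
     four_block_mat (Matrix.mat 1 1 (\<lambda>_. a)) (0\<^sub>m 1 m) (0\<^sub>m m 1) B' = reflection (Suc m) w * B * reflection (Suc m) w \<and>
     B = reflection (Suc m) w * four_block_mat (Matrix.mat 1 1 (\<lambda>_. a)) (0\<^sub>m 1 m) (0\<^sub>m m 1) B' * reflection (Suc m) w \<and>
     char_poly B = [:- a, 1:] * char_poly B'"
proof -
  let ?n = "Suc m"
  from ev have "eigenvalue B a" using eigenvalue_root_char_poly[OF B] by simp
  then obtain v where v: "v \<in> carrier_vec ?n" "v \<noteq> 0\<^sub>v ?n" "B *\<^sub>v v = a \<cdot>\<^sub>v v"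
    using B by (auto simp: eigenvalue_def eigenvector_def)
  define s where "s = (\<Sum>l\<in>{0..<?n}. (vec_index v l)\<^sup>2)"
  have "s \<noteq> 0"
  proof
    assume "s = 0"
    then have "\<forall>l\<in>{0..<?n}. (vec_index v l)\<^sup>2 = 0"
      unfolding s_def by (subst (asm) sum_nonneg_eq_0_iff) auto
    then have "v = 0\<^sub>v ?n" using v(1) by (intro eq_vecI) auto
    with v(2) show False by simp
  qed
  moreover have "0 \<le> s" unfolding s_def by (intro sum_nonneg) auto
  ultimately have s: "0 < s" by simp
  \<comment> \<open>The sign of the eigenvector is free; it is chosen so that the first coordinate
    is not positive, as \<open>reflection_first_column\<close> demands.\<close>
  define c where "c = (if vec_index v 0 \<le> 0 then 1 else -1) / sqrt s"
  define u where "u l = c * vec_index v l" for l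
  have c2: "c\<^sup>2 = 1 / s" using s by (simp add: c_def power_divide)
  have "(\<Sum>l\<in>{0..<?n}. (u l)\<^sup>2) = c\<^sup>2 * s"
    unfolding u_def s_def sum_distrib_left by (simp add: power_mult_distrib)
  then have unit: "(\<Sum>l\<in>{0..<?n}. (u l)\<^sup>2) = 1" using s c2 by simp
  have u0: "u 0 \<le> 0" using s by (auto simp: u_def c_def mult_le_0_iff divide_le_0_iff zero_le_divide_iff)
  from reflection_first_column[of ?n u, OF _ unit u0] obtain w where
    w: "w 0 = 1" "\<forall>i<?n. \<bar>w i\<bar> \<le> 1" "\<forall>i<?n. reflection ?n w $$ (i, 0) = u i" by blast
  define H where "H = reflection ?n w"
  have Hc: "H \<in> carrier_mat ?n ?n" by (simp add: H_def)
  have "(w 0)\<^sup>2 \<le> (\<Sum>l\<in>{0..<?n}. (w l)\<^sup>2)" by (intro member_le_sum) auto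
  then have q: "(\<Sum>l\<in>{0..<?n}. (w l)\<^sup>2) \<noteq> 0" using w(1) by auto
  have HH: "H * H = 1\<^sub>m ?n" unfolding H_def by (rule reflection_involutive[OF q])
  have HT: "transpose_mat H = H" by (simp add: H_def reflection_symmetric)
  have Bu: "(\<Sum>l\<in>{0..<?n}. B $$ (i, l) * u l) = a * u i" if "i < ?n" for i
  proof -
    have "vec_index (B *\<^sub>v v) i = vec_index (a \<cdot>\<^sub>v v) i" using v(3) by simp
    then have e: "(\<Sum>l\<in>{0..<?n}. B $$ (i, l) * vec_index v l) = a * vec_index v i"
      using that B v(1) by (auto simp: scalar_prod_def)
    have "(\<Sum>l\<in>{0..<?n}. B $$ (i, l) * u l) = c * (\<Sum>l\<in>{0..<?n}. B $$ (i, l) * vec_index v l)"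
      unfolding u_def sum_distrib_left by (simp add: algebra_simps)
    also have "\<dots> = a * u i" unfolding e by (simp add: u_def algebra_simps)
    finally show ?thesis .
  qed
  have Hu: "(\<Sum>l\<in>{0..<?n}. H $$ (i, l) * u l) = (if i = 0 then 1 else 0)" if "i < ?n" for i
  proof -
    have "(H * H) $$ (i, 0) = (\<Sum>l\<in>{0..<?n}. H $$ (i, l) * H $$ (l, 0))"
      using that Hc by (subst index_mult_carrier[of _ ?n]) auto
    also have "\<dots> = (\<Sum>l\<in>{0..<?n}. H $$ (i, l) * u l)"
      using w(3) by (intro sum.cong) (auto simp: H_def)
    finally show ?thesis using that unfolding HH by auto
  qed
  define C where "C = H * B * H"
  have Cc: "C \<in> carrier_mat ?n ?n" using Hc B by (simp add: C_def)
  have BH: "(B * H) $$ (i, 0) = a * u i" if "i < ?n" for i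
  proof -
    have "(B * H) $$ (i, 0) = (\<Sum>l\<in>{0..<?n}. B $$ (i, l) * u l)"
      using that Hc B w(3) by (subst index_mult_carrier[of _ ?n]) (auto simp: H_def intro!: sum.cong)
    then show ?thesis using Bu that by simp
  qed
  have C0: "C $$ (i, 0) = (if i = 0 then a else 0)" if "i < ?n" for i
  proof -
    have "C = H * (B * H)" using Hc B by (simp add: C_def)
    then have "C $$ (i, 0) = (\<Sum>l\<in>{0..<?n}. H $$ (i, l) * (B * H) $$ (l, 0))"
      using that Hc B by (simp only:) (subst index_mult_carrier[of _ ?n]; auto)
    also have "\<dots> = (\<Sum>l\<in>{0..<?n}. H $$ (i, l) * (a * u l))"
      by (intro sum.cong) (auto simp: BH)
    also have "\<dots> = a * (\<Sum>l\<in>{0..<?n}. H $$ (i, l) * u l)"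
      by (simp add: sum_distrib_left algebra_simps)
    finally show ?thesis using Hu that by simp
  qed
  have CT: "transpose_mat C = C"
  proof -
    have "transpose_mat C = transpose_mat H * (transpose_mat B * transpose_mat H)"
      unfolding C_def using Hc B
      by (subst transpose_mult[of _ ?n ?n _ ?n]) (auto simp: transpose_mult[of _ ?n ?n _ ?n])
    then show ?thesis using Hc B by (simp add: HT sym C_def)
  qed
  have C0': "C $$ (0, i) = (if i = 0 then a else 0)" if "i < ?n" for i
  proof -
    have "transpose_mat C $$ (0, i) = C $$ (i, 0)" using that Cc by auto
    then show ?thesis using C0 that CT by simp
  qed
  define B' where "B' = Matrix.mat m m (\<lambda>(i, j). C $$ (Suc i, Suc j))"
  have B'c: "B' \<in> carrier_mat m m" by (simp add: B'_def)
  have CS: "C $$ (j, i) = C $$ (i, j)" if "i < ?n" "j < ?n" for i j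
  proof -
    have "transpose_mat C $$ (i, j) = C $$ (j, i)" using that Cc by auto
    then show ?thesis using CT by simp
  qed
  have B'T: "transpose_mat B' = B'" by (rule eq_matI) (auto simp: B'_def CS)
  let ?F = "four_block_mat (Matrix.mat 1 1 (\<lambda>_. a)) (0\<^sub>m 1 m) (0\<^sub>m m 1) B'"
  have F: "?F = C"
  proof (rule eq_matI)
    fix i j assume "i < dim_row C" "j < dim_col C"
    then have ij: "i < ?n" "j < ?n" using Cc by auto
    show "?F $$ (i, j) = C $$ (i, j)"
      using ij C0[of i] C0'[of j] by (cases i; cases j) (auto simp: B'_def)
  qed (use Cc in \<open>auto simp: B'_def\<close>)
  have "H * C * H = H * (H * B * H) * H" by (simp add: C_def)
  also have "\<dots> = (H * H) * B * (H * H)"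
    using Hc B by (simp add: assoc_mult_mat[of _ ?n ?n _ ?n _ ?n])
  also have "\<dots> = B" using B HH by simp
  finally have HCH: "B = H * C * H" by simp
  have "similar_mat B C"
    unfolding similar_mat_def similar_mat_wit_def
    using Hc B Cc HH HCH by (intro exI[of _ H]) (auto simp: Let_def)
  then have "char_poly B = char_poly C" by (rule char_poly_similar)
  also have "\<dots> = char_poly (Matrix.mat 1 1 (\<lambda>_. a)) * char_poly B'"
    unfolding F[symmetric] by (rule char_poly_four_block_zeros_col) (use B'c in auto)
  also have "char_poly (Matrix.mat 1 1 (\<lambda>_. a)) = [:- a, 1:]"
    by (subst char_poly_upper_triangular[of _ 1]) (auto simp: upper_triangular_def diag_mat_def)
  finally have cp: "char_poly B = [:- a, 1:] * char_poly B'" .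
  show ?thesis
  proof (intro exI conjI)
    show "?F = reflection (Suc m) w * B * reflection (Suc m) w"
      using F by (simp only: C_def H_def)
    show "B = reflection (Suc m) w * ?F * reflection (Suc m) w"
      using HCH unfolding F by (simp only: H_def)
  qed (rule w(1,2) B'c B'T cp)+
qed

text \<open>Symmetry excludes nilpotent parts: peeling off \<open>r\<close> repeatedly leaves
  \<open>r\<close> times the identity in the smaller block, and a scalar matrix is unchanged by
  conjugation. This is why the multiple eigenvalue costs a single parameter.\<close>

lemma char_poly_power_imp_scalar:
  fixes B :: "real mat"
  assumes "B \<in> carrier_mat k k" "transpose_mat B = B" "char_poly B = [:- r, 1:] ^ k"
  shows "B = r \<cdot>\<^sub>m 1\<^sub>m k"
  using assms
proof (induction k arbitrary: B)
  case 0
  then show ?case by (intro eq_matI) auto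
next
  case (Suc k)
  have "poly (char_poly B) r = 0" using Suc.prems by simp
  from peel_eigenvector[OF Suc.prems(1,2) this] obtain w B' where
    w: "w 0 = 1" and B': "B' \<in> carrier_mat k k" "transpose_mat B' = B'"
    and dec: "B = reflection (Suc k) w * four_block_mat (Matrix.mat 1 1 (\<lambda>_. r)) (0\<^sub>m 1 k) (0\<^sub>m k 1) B' * reflection (Suc k) w"
    and cp: "char_poly B = [:- r, 1:] * char_poly B'" by blast
  have "[:- r, 1:] * char_poly B' = [:- r, 1:] * [:- r, 1:] ^ k"
    using Suc.prems(3) cp by simp
  then have "char_poly B' = [:- r, 1:] ^ k" by (subst (asm) mult_left_cancel) auto
  from Suc.IH[OF B' this] have B'e: "B' = r \<cdot>\<^sub>m 1\<^sub>m k" .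
  have F: "four_block_mat (Matrix.mat 1 1 (\<lambda>_. r)) (0\<^sub>m 1 k) (0\<^sub>m k 1) B' = r \<cdot>\<^sub>m 1\<^sub>m (Suc k)"
    unfolding B'e by (rule eq_matI) auto
  have "(w 0)\<^sup>2 \<le> (\<Sum>l\<in>{0..<Suc k}. (w l)\<^sup>2)" by (intro member_le_sum) auto
  then have q: "(\<Sum>l\<in>{0..<Suc k}. (w l)\<^sup>2) \<noteq> 0" using w by auto
  have "B = r \<cdot>\<^sub>m (reflection (Suc k) w * reflection (Suc k) w)"
    unfolding dec F
    by (subst mult_smult_distrib[of _ "Suc k" "Suc k" _ "Suc k"];
        (subst mult_smult_assoc_mat[of _ "Suc k" "Suc k" _ "Suc k"])?; simp)
  then show ?case by (simp add: reflection_involutive[OF q])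
qed


section \<open>Nets for the symmetric matrices with a multiple eigenvalue\<close>

text \<open>The list \<open>as\<close> holds the roots that are split off one after another in an
  induction on \<open>m\<close>. It may contain \<open>r\<close>, so multiplicities above
  \<open>k\<close> are included.\<close>

definition degenerate :: "nat \<Rightarrow> nat \<Rightarrow> real mat set" where
  "degenerate k m = {B \<in> carrier_mat (k + m) (k + m). transpose_mat B = B \<and>
     (\<exists>r as. length as = m \<and> char_poly B = [:- r, 1:] ^ k * (\<Prod>a\<leftarrow>as. [:- a, 1:]))}"

lemma real_grid:
  fixes R \<epsilon> :: real
  assumes "0 \<le> R" "0 < \<epsilon>" "\<epsilon> \<le> 1"
  shows "\<exists>G. finite G \<and> real (card G) \<le> (2 * R + 2) / \<epsilon> \<and>
           (\<forall>x. \<bar>x\<bar> \<le> R \<longrightarrow> (\<exists>g\<in>G. \<bar>x - g\<bar> \<le> \<epsilon> \<and> \<bar>g\<bar> \<le> R + 1))"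
proof (intro exI conjI allI impI)
  let ?I = "{\<lfloor>- R / \<epsilon>\<rfloor>..\<lfloor>R / \<epsilon>\<rfloor>}"
  let ?G = "(\<lambda>l. \<epsilon> * of_int l) ` ?I"
  show "finite ?G" by simp
  have le: "\<lfloor>- R / \<epsilon>\<rfloor> \<le> \<lfloor>R / \<epsilon>\<rfloor>" using assms by (intro floor_mono divide_right_mono) auto
  have "real (card ?G) \<le> real (card ?I)" by (simp add: card_image_le del: card_atLeastAtMost_int)
  also have "\<dots> = of_int (\<lfloor>R / \<epsilon>\<rfloor> - \<lfloor>- R / \<epsilon>\<rfloor> + 1)" using le by (simp add: nat_add_distrib)
  also have "\<dots> \<le> R / \<epsilon> - (- R / \<epsilon> - 1) + 1" by linarith
  also have "\<dots> \<le> (2 * R + 2) / \<epsilon>" using assms by (simp add: field_simps)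
  finally show "real (card ?G) \<le> (2 * R + 2) / \<epsilon>" .
  fix x assume x: "\<bar>x\<bar> \<le> R"
  have "- R / \<epsilon> \<le> x / \<epsilon>" "x / \<epsilon> \<le> R / \<epsilon>"
    using x assms by (intro divide_right_mono; linarith)+
  then have "\<lfloor>x / \<epsilon>\<rfloor> \<in> ?I" by (simp add: floor_mono)
  moreover have "of_int \<lfloor>x / \<epsilon>\<rfloor> \<le> x / \<epsilon>" "x / \<epsilon> < of_int \<lfloor>x / \<epsilon>\<rfloor> + 1" by linarith+
  then have "\<epsilon> * of_int \<lfloor>x / \<epsilon>\<rfloor> \<le> x" "x < \<epsilon> * of_int \<lfloor>x / \<epsilon>\<rfloor> + \<epsilon>"
    using mult_left_mono[of "of_int \<lfloor>x / \<epsilon>\<rfloor>" "x / \<epsilon>" \<epsilon>] assms(2)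
    by (simp_all add: pos_divide_less_eq algebra_simps)
  then have "\<bar>x - \<epsilon> * of_int \<lfloor>x / \<epsilon>\<rfloor>\<bar> \<le> \<epsilon>" by linarith
  moreover from this have "\<bar>\<epsilon> * of_int \<lfloor>x / \<epsilon>\<rfloor>\<bar> \<le> R + 1" using x assms by linarith
  ultimately show "\<exists>g\<in>?G. \<bar>x - g\<bar> \<le> \<epsilon> \<and> \<bar>g\<bar> \<le> R + 1" by blast
qed

text \<open>Bounding the two terms separately gives 1 + 2. The case of a vanishing axis is included,
  since division by 0 yields 0.\<close>

lemma reflection_le:
  assumes "i < n" "j < n"
  shows "\<bar>reflection n w $$ (i, j)\<bar> \<le> 3"
proof -
  define q where "q = (\<Sum>l\<in>{0..<n}. (w l)\<^sup>2)"
  have "(w i)\<^sup>2 \<le> q" "(w j)\<^sup>2 \<le> q"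
    unfolding q_def using assms by (auto intro!: member_le_sum)
  moreover have "2 * \<bar>w i * w j\<bar> \<le> (w i)\<^sup>2 + (w j)\<^sup>2"
    using sum_squares_bound[of "w i" "w j"] sum_squares_bound[of "w i" "- w j"]
    by (auto simp: abs_if)
  ultimately have "\<bar>2 * w i * w j\<bar> \<le> 2 * q" by (simp add: abs_mult)
  moreover have "0 \<le> q" unfolding q_def by (intro sum_nonneg) auto
  ultimately have "\<bar>2 * w i * w j / q\<bar> \<le> 2"
    by (cases "q = 0") (auto simp: abs_divide divide_le_eq)
  moreover have "\<bar>(if i = j then 1 else 0 :: real)\<bar> \<le> 1" by simp
  ultimately show ?thesis
    unfolding reflection_index[OF assms] q_def[symmetric] by linarith
qed

text \<open>The normalisation \<open>w 0 = 1\<close> keeps the squared length of the axis above 1,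
  so the quotient in the reflection is Lipschitz on bounded axes. Products of coordinates change by
  at most 4 \<epsilon>, and the squared length by at most 4 n \<epsilon>.\<close>

lemma reflection_lipschitz:
  assumes n: "0 < n" and w: "w 0 = 1" "w' 0 = 1" "\<forall>i<n. \<bar>w i\<bar> \<le> 2" "\<forall>i<n. \<bar>w' i\<bar> \<le> 2"
    and d: "\<forall>i<n. \<bar>w i - w' i\<bar> \<le> \<epsilon>" and ij: "i < n" "j < n"
  shows "\<bar>reflection n w $$ (i, j) - reflection n w' $$ (i, j)\<bar> \<le> (8 + 32 * real n) * \<epsilon>"
proof -
  define q where "q = (\<Sum>l\<in>{0..<n}. (w l)\<^sup>2)"
  define q' where "q' = (\<Sum>l\<in>{0..<n}. (w' l)\<^sup>2)"
  have e0: "0 \<le> \<epsilon>" using d n by (meson abs_ge_zero order_trans)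
  have prod: "\<bar>w i * w j - w' i * w' j\<bar> \<le> 4 * \<epsilon>" if "i < n" "j < n" for i j
  proof -
    have "w i * w j - w' i * w' j = (w i - w' i) * w j + w' i * (w j - w' j)" by (simp add: algebra_simps)
    then have "\<bar>w i * w j - w' i * w' j\<bar> \<le> \<bar>w i - w' i\<bar> * \<bar>w j\<bar> + \<bar>w' i\<bar> * \<bar>w j - w' j\<bar>"
      by (metis abs_mult abs_triangle_ineq)
    also have "\<dots> \<le> \<epsilon> * 2 + 2 * \<epsilon>" using that w d e0 by (intro add_mono mult_mono) auto
    finally show ?thesis by simp
  qed
  have "(w 0)\<^sup>2 \<le> q" "(w' 0)\<^sup>2 \<le> q'"
    unfolding q_def q'_def using n by (auto intro!: member_le_sum)
  then have q1: "1 \<le> q" "1 \<le> q'" using w by auto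
  have "\<bar>q - q'\<bar> \<le> (\<Sum>l\<in>{0..<n}. \<bar>(w l)\<^sup>2 - (w' l)\<^sup>2\<bar>)"
    unfolding q_def q'_def sum_subtractf[symmetric] by (rule sum_abs)
  also have "\<dots> \<le> (\<Sum>l\<in>{0..<n}. 4 * \<epsilon>)"
    using prod by (intro sum_mono) (auto simp: power2_eq_square)
  finally have qq: "\<bar>q - q'\<bar> \<le> 4 * real n * \<epsilon>" by simp
  have "w i * w j / q - w' i * w' j / q' = (w i * w j - w' i * w' j) / q + w' i * w' j * ((q' - q) / (q * q'))"
    using q1 by (simp add: divide_simps) (simp add: algebra_simps)
  also have "\<bar>\<dots>\<bar> \<le> \<bar>w i * w j - w' i * w' j\<bar> / q + \<bar>w' i\<bar> * \<bar>w' j\<bar> * (\<bar>q' - q\<bar> / (q * q'))"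
    using q1 by (intro order_trans[OF abs_triangle_ineq]) (simp add: abs_mult abs_divide)
  also have "\<dots> \<le> 4 * \<epsilon> + 2 * 2 * (4 * real n * \<epsilon>)"
  proof (intro add_mono mult_mono)
    show "\<bar>w i * w j - w' i * w' j\<bar> / q \<le> 4 * \<epsilon>"
      using prod[OF ij] q1 e0 by (simp add: divide_le_eq) (smt (verit) mult_left_le mult_le_cancel_left1 mult_nonneg_nonneg)
    have "1 * 1 \<le> q * q'" using q1 by (intro mult_mono) auto
    then have "\<bar>q' - q\<bar> / (q * q') \<le> \<bar>q' - q\<bar>"
      by (simp add: divide_le_eq mult_le_cancel_left1)
    then show "\<bar>q' - q\<bar> / (q * q') \<le> 4 * real n * \<epsilon>" using qq by linarith
  qed (use w ij q1 in auto)
  finally have "\<bar>w i * w j / q - w' i * w' j / q'\<bar> \<le> 4 * \<epsilon> + 16 * real n * \<epsilon>" by simp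
  then show ?thesis
    proof -
    assume a: "\<bar>w i * w j / q - w' i * w' j / q'\<bar> \<le> 4 * \<epsilon> + 16 * real n * \<epsilon>"
    have "\<bar>reflection n w $$ (i, j) - reflection n w' $$ (i, j)\<bar> = \<bar>- 2 * (w i * w j / q - w' i * w' j / q')\<bar>"
      unfolding reflection_index[OF ij] q_def[symmetric] q'_def[symmetric] by (simp add: algebra_simps)
    also have "\<dots> \<le> 2 * (4 * \<epsilon> + 16 * real n * \<epsilon>)" using a unfolding abs_mult by simp
    finally show ?thesis by (simp add: algebra_simps)
  qed
qed

lemma triple_product_index:
  fixes H C :: "real mat"
  assumes "H \<in> carrier_mat n n" "C \<in> carrier_mat n n" "i < n" "j < n"
  shows "(H * C * H) $$ (i, j) = (\<Sum>l\<in>{0..<n}. \<Sum>h\<in>{0..<n}. H $$ (i, h) * C $$ (h, l) * H $$ (l, j))"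
proof -
  have "(H * C * H) $$ (i, j) = (\<Sum>l\<in>{0..<n}. (H * C) $$ (i, l) * H $$ (l, j))"
    using assms by (subst index_mult_carrier[of _ n]) auto
  also have "\<dots> = (\<Sum>l\<in>{0..<n}. (\<Sum>h\<in>{0..<n}. H $$ (i, h) * C $$ (h, l)) * H $$ (l, j))"
    using assms by (intro sum.cong refl) (subst index_mult_carrier[of _ n]; auto)
  finally show ?thesis by (simp add: sum_distrib_right)
qed

lemma triple_product_le:
  fixes H C :: "real mat"
  assumes H: "H \<in> carrier_mat n n" "C \<in> carrier_mat n n" and ij: "i < n" "j < n"
    and "\<forall>i<n. \<forall>j<n. \<bar>H $$ (i, j)\<bar> \<le> 3" "\<forall>i<n. \<forall>j<n. \<bar>C $$ (i, j)\<bar> \<le> r"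
  shows "\<bar>(H * C * H) $$ (i, j)\<bar> \<le> 9 * (real n)\<^sup>2 * r"
proof -
  have "\<bar>(H * C * H) $$ (i, j)\<bar> \<le> (\<Sum>l\<in>{0..<n}. \<Sum>h\<in>{0..<n}. \<bar>H $$ (i, h) * C $$ (h, l) * H $$ (l, j)\<bar>)"
    unfolding triple_product_index[OF H ij]
    by (rule order_trans[OF sum_abs]) (intro sum_mono sum_abs)
  also have "\<dots> \<le> (\<Sum>l\<in>{0..<n}. \<Sum>h\<in>{0..<n}. 3 * r * 3)"
  proof (intro sum_mono)
    fix l h assume "l \<in> {0..<n}" "h \<in> {0..<n}"
    then have "\<bar>H $$ (i, h)\<bar> \<le> 3" "\<bar>C $$ (h, l)\<bar> \<le> r" "\<bar>H $$ (l, j)\<bar> \<le> 3"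
      using assms by auto
    moreover from this have "0 \<le> r" by linarith
    ultimately    show "\<bar>H $$ (i, h) * C $$ (h, l) * H $$ (l, j)\<bar> \<le> 3 * r * 3"
      unfolding abs_mult by (intro mult_mono) auto
  qed
  finally show ?thesis by (simp add: power2_eq_square algebra_simps)
qed

lemma triple_product_diff_le:
  fixes H C H' C' :: "real mat"
  assumes H: "H \<in> carrier_mat n n" "C \<in> carrier_mat n n" and H': "H' \<in> carrier_mat n n" "C' \<in> carrier_mat n n"
    and ij: "i < n" "j < n"
    and b: "\<forall>i<n. \<forall>j<n. \<bar>H $$ (i, j)\<bar> \<le> 3" "\<forall>i<n. \<forall>j<n. \<bar>C $$ (i, j)\<bar> \<le> r"
      "\<forall>i<n. \<forall>j<n. \<bar>H' $$ (i, j)\<bar> \<le> 3" "\<forall>i<n. \<forall>j<n. \<bar>C' $$ (i, j)\<bar> \<le> r"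
      "\<forall>i<n. \<forall>j<n. \<bar>H $$ (i, j) - H' $$ (i, j)\<bar> \<le> a" "\<forall>i<n. \<forall>j<n. \<bar>C $$ (i, j) - C' $$ (i, j)\<bar> \<le> c"
  shows "\<bar>(H * C * H) $$ (i, j) - (H' * C' * H') $$ (i, j)\<bar> \<le> (real n)\<^sup>2 * (6 * r * a + 9 * c)"
proof -
  let ?t = "\<lambda>l h. H $$ (i, h) * C $$ (h, l) * H $$ (l, j) - H' $$ (i, h) * C' $$ (h, l) * H' $$ (l, j)"
  have "\<bar>(H * C * H) $$ (i, j) - (H' * C' * H') $$ (i, j)\<bar> \<le> (\<Sum>l\<in>{0..<n}. \<Sum>h\<in>{0..<n}. \<bar>?t l h\<bar>)"
    unfolding triple_product_index[OF H ij] triple_product_index[OF H' ij] sum_subtractf[symmetric]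
    by (rule order_trans[OF sum_abs]) (intro sum_mono sum_abs)
  also have "\<dots> \<le> (\<Sum>l\<in>{0..<n}. \<Sum>h\<in>{0..<n}. 6 * r * a + 9 * c)"
  proof (intro sum_mono)
    fix l h assume "l \<in> {0..<n}" "h \<in> {0..<n}"
    then have bb: "\<bar>H' $$ (i, h)\<bar> \<le> 3" "\<bar>C $$ (h, l)\<bar> \<le> r" "\<bar>H $$ (l, j)\<bar> \<le> 3" "\<bar>C' $$ (h, l)\<bar> \<le> r"
      "\<bar>H $$ (i, h) - H' $$ (i, h)\<bar> \<le> a" "\<bar>H $$ (l, j) - H' $$ (l, j)\<bar> \<le> a" "\<bar>C $$ (h, l) - C' $$ (h, l)\<bar> \<le> c"
      using assms by auto
    then have b0: "0 \<le> r" "0 \<le> a" "0 \<le> c" by linarith+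
    have "?t l h = (H $$ (i, h) - H' $$ (i, h)) * C $$ (h, l) * H $$ (l, j)
       + H' $$ (i, h) * (C $$ (h, l) - C' $$ (h, l)) * H $$ (l, j)
       + H' $$ (i, h) * C' $$ (h, l) * (H $$ (l, j) - H' $$ (l, j))" by (simp add: algebra_simps)
    also have "\<bar>\<dots>\<bar> \<le> \<bar>H $$ (i, h) - H' $$ (i, h)\<bar> * \<bar>C $$ (h, l)\<bar> * \<bar>H $$ (l, j)\<bar>
       + \<bar>H' $$ (i, h)\<bar> * \<bar>C $$ (h, l) - C' $$ (h, l)\<bar> * \<bar>H $$ (l, j)\<bar>
       + \<bar>H' $$ (i, h)\<bar> * \<bar>C' $$ (h, l)\<bar> * \<bar>H $$ (l, j) - H' $$ (l, j)\<bar>"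
      unfolding abs_mult[symmetric] by (meson abs_triangle_ineq add_right_mono order_trans)
    also have "\<dots> \<le> a * r * 3 + 3 * c * 3 + 3 * r * a"
      using bb b0 by (intro add_mono mult_mono) auto
    finally show "\<bar>?t l h\<bar> \<le> 6 * r * a + 9 * c" by (simp add: algebra_simps)
  qed
  finally show ?thesis by (simp add: power2_eq_square algebra_simps)
qed

text \<open>The exponent counts parameters: 1 for the multiple eigenvalue and, at the
  \<open>l\<close>-th peeling, one eigenvalue and \<open>k + l - 1\<close> coordinates of the axis.
  A grid of mesh \<epsilon> for all of them is mapped to matrices by a Lipschitz map.\<close>

lemma degenerate_cover:
  assumes k: "1 \<le> k" and R: "0 \<le> R"
  shows "\<exists>C\<ge>1. \<forall>\<epsilon>. 0 < \<epsilon> \<and> \<epsilon> \<le> 1 \<longrightarrow> (\<exists>F. finite F \<and>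
     real (card F) \<le> C * (1 / \<epsilon>) ^ (1 + (\<Sum>l\<in>{1..m}. k + l)) \<and>
     (\<forall>B\<in>degenerate k m. (\<forall>i<k + m. \<forall>j<k + m. \<bar>B $$ (i, j)\<bar> \<le> R) \<longrightarrow>
        (\<exists>B'\<in>F. \<forall>i<k + m. \<forall>j<k + m. \<bar>B $$ (i, j) - B' $$ (i, j)\<bar> \<le> C * \<epsilon>)))"
  using R
proof (induction m arbitrary: R)
  case 0
  show ?case
  proof (intro exI[of _ "2 * R + 2"] conjI allI impI)
    show "1 \<le> 2 * R + 2" using 0 by simp
    fix \<epsilon> :: real assume \<epsilon>: "0 < \<epsilon> \<and> \<epsilon> \<le> 1"
    with real_grid[of R \<epsilon>] 0 obtain G where G: "finite G" "real (card G) \<le> (2 * R + 2) / \<epsilon>"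
      "\<And>x. \<bar>x\<bar> \<le> R \<Longrightarrow> \<exists>g\<in>G. \<bar>x - g\<bar> \<le> \<epsilon> \<and> \<bar>g\<bar> \<le> R + 1" by blast
    let ?F = "(\<lambda>g. g \<cdot>\<^sub>m 1\<^sub>m k) ` G"
    show "\<exists>F. finite F \<and> real (card F) \<le> (2 * R + 2) * (1 / \<epsilon>) ^ (1 + (\<Sum>l\<in>{1..0}. k + l)) \<and>
     (\<forall>B\<in>degenerate k 0. (\<forall>i<k + 0. \<forall>j<k + 0. \<bar>B $$ (i, j)\<bar> \<le> R) \<longrightarrow>
        (\<exists>B'\<in>F. \<forall>i<k + 0. \<forall>j<k + 0. \<bar>B $$ (i, j) - B' $$ (i, j)\<bar> \<le> (2 * R + 2) * \<epsilon>))"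
    proof (intro exI[of _ ?F] conjI ballI impI)
      have "real (card ?F) \<le> real (card G)" using G(1) by (simp add: card_image_le)
      then show "real (card ?F) \<le> (2 * R + 2) * (1 / \<epsilon>) ^ (1 + (\<Sum>l\<in>{1..0}. k + l))"
        using G(2) by simp
      fix B assume B: "B \<in> degenerate k 0" and bound: "\<forall>i<k + 0. \<forall>j<k + 0. \<bar>B $$ (i, j)\<bar> \<le> R"
      then obtain r where "char_poly B = [:- r, 1:] ^ k" "B \<in> carrier_mat k k" "transpose_mat B = B"
        by (auto simp: degenerate_def)
      then have Br: "B = r \<cdot>\<^sub>m 1\<^sub>m k" using char_poly_power_imp_scalar by blast
      have "\<bar>B $$ (0, 0)\<bar> \<le> R" using bound k by auto
      then have "\<bar>r\<bar> \<le> R" unfolding Br using k by simp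
      then obtain g where g: "g \<in> G" "\<bar>r - g\<bar> \<le> \<epsilon>" using G(3) by blast
      have "\<epsilon> \<le> (2 * R + 2) * \<epsilon>" using \<epsilon> 0 by (simp add: algebra_simps)
      with g show "\<exists>B'\<in>?F. \<forall>i<k + 0. \<forall>j<k + 0. \<bar>B $$ (i, j) - B' $$ (i, j)\<bar> \<le> (2 * R + 2) * \<epsilon>"
        unfolding Br using \<epsilon> 0
        by (intro bexI[of _ "g \<cdot>\<^sub>m 1\<^sub>m k"]) (auto intro: order_trans[of _ \<epsilon>])
    qed (use G in auto)
  qed
next
  case (Suc m)
  let ?n = "k + m"
  \<comment> \<open>The smaller block satisfies only a larger entry bound, because conjugation by a
    matrix with entries at most 3 can enlarge entries by this factor. Hence the induction is over
    all \<open>R\<close>.\<close>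
  define R1 where "R1 = 9 * (real (Suc ?n))\<^sup>2 * R"
  have R1: "0 \<le> R1" using Suc.prems by (simp add: R1_def)
  from Suc.IH[OF R1] obtain C1 where C1: "1 \<le> C1" and IH:
    "\<And>\<epsilon>. 0 < \<epsilon> \<Longrightarrow> \<epsilon> \<le> 1 \<Longrightarrow> (\<exists>F. finite F \<and>
     real (card F) \<le> C1 * (1 / \<epsilon>) ^ (1 + (\<Sum>l\<in>{1..m}. k + l)) \<and>
     (\<forall>B\<in>degenerate k m. (\<forall>i<k + m. \<forall>j<k + m. \<bar>B $$ (i, j)\<bar> \<le> R1) \<longrightarrow>
        (\<exists>B'\<in>F. \<forall>i<k + m. \<forall>j<k + m. \<bar>B $$ (i, j) - B' $$ (i, j)\<bar> \<le> C1 * \<epsilon>)))" by blast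
  \<comment> \<open>The Lipschitz constant of rebuilding a matrix from axis, eigenvalue and block,
    read off from \<open>triple_product_diff_le\<close> and \<open>reflection_lipschitz\<close>. The
    number \<open>R1 + C1 + 1\<close> bounds the entries of both the block and its
    approximation.\<close>
  define L where "L = (real (Suc ?n))\<^sup>2 * (6 * (R1 + C1 + 1) * (8 + 32 * real (Suc ?n)) + 9 * C1)"
  have L0: "0 \<le> L" using R1 C1 by (simp add: L_def)
  \<comment> \<open>The constant in the number of combinations: \<open>4 / \<epsilon>\<close> values
    for each free coordinate of the axis, \<open>(2 * R1 + 2) / \<epsilon>\<close> for the
    eigenvalue, and the net of the smaller block.\<close>
  define K where "K = 4 ^ ?n * (2 * R1 + 2) * C1"
  have K0: "0 \<le> K" using R1 C1 by (simp add: K_def)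
  show ?case
  proof (intro exI[of _ "1 + L + K"] conjI allI impI)
    show "1 \<le> 1 + L + K" using L0 K0 by simp
    fix \<epsilon> :: real assume "0 < \<epsilon> \<and> \<epsilon> \<le> 1"
    then have \<epsilon>: "0 < \<epsilon>" "\<epsilon> \<le> 1" by auto
    from real_grid[of 1 \<epsilon>] \<epsilon> obtain G where G: "finite G" "real (card G) \<le> 4 / \<epsilon>"
      "\<And>x. \<bar>x\<bar> \<le> 1 \<Longrightarrow> \<exists>g\<in>G. \<bar>x - g\<bar> \<le> \<epsilon> \<and> \<bar>g\<bar> \<le> 2" by auto
    from real_grid[of R1 \<epsilon>] \<epsilon> R1 obtain G' where G': "finite G'" "real (card G') \<le> (2 * R1 + 2) / \<epsilon>"
      "\<And>x. \<bar>x\<bar> \<le> R1 \<Longrightarrow> \<exists>g\<in>G'. \<bar>x - g\<bar> \<le> \<epsilon> \<and> \<bar>g\<bar> \<le> R1 + 1" by blast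
    from IH[OF \<epsilon>] obtain F where F: "finite F"
      "real (card F) \<le> C1 * (1 / \<epsilon>) ^ (1 + (\<Sum>l\<in>{1..m}. k + l))"
      "\<And>B. B \<in> degenerate k m \<Longrightarrow> (\<forall>i<k + m. \<forall>j<k + m. \<bar>B $$ (i, j)\<bar> \<le> R1) \<Longrightarrow>
        (\<exists>B'\<in>F. \<forall>i<k + m. \<forall>j<k + m. \<bar>B $$ (i, j) - B' $$ (i, j)\<bar> \<le> C1 * \<epsilon>)" by blast
    \<comment> \<open>Elements of the net \<open>F\<close> come with no information on their
      dimensions, so their entries are copied into a block of the right size.\<close>
    define blk where "blk a B = four_block_mat (Matrix.mat 1 1 (\<lambda>_. a)) (0\<^sub>m 1 ?n) (0\<^sub>m ?n 1)
        (Matrix.mat ?n ?n (\<lambda>(i, j). B $$ (i, j)))" for a :: real and B :: "real mat"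
    have blk_c: "blk a B \<in> carrier_mat (Suc ?n) (Suc ?n)" for a B by (auto simp: blk_def)
    have blk_i: "blk a B $$ (i, j) = (if i = 0 \<and> j = 0 then a else if i = 0 \<or> j = 0 then 0 else B $$ (i - 1, j - 1))"
      if "i < Suc ?n" "j < Suc ?n" for a B i j using that by (auto simp: blk_def)
    define W where "W = (\<lambda>f i. if i = 0 then 1 else f i) ` (PiE {1..?n} (\<lambda>_. G))"
    define T where "T = (\<lambda>(w, a, B). reflection (Suc ?n) w * blk a B * reflection (Suc ?n) w) ` (W \<times> G' \<times> F)"
    have finW: "finite W" unfolding W_def using G(1) by (intro finite_imageI finite_PiE) auto
    have "card W \<le> card (PiE {1..?n} (\<lambda>_. G))"
      unfolding W_def using G(1) by (intro card_image_le finite_PiE) auto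
    also have "\<dots> = card G ^ ?n" by (simp add: card_PiE)
    finally have "real (card W) \<le> real (card G) ^ ?n" by (metis of_nat_le_iff of_nat_power)
    also have "\<dots> \<le> (4 / \<epsilon>) ^ ?n" using G(2) by (intro power_mono) auto
    finally have cW: "real (card W) \<le> (4 / \<epsilon>) ^ ?n" .
    have "card T \<le> card (W \<times> G' \<times> F)" unfolding T_def using finW G' F by (intro card_image_le) auto
    then have "real (card T) \<le> real (card W) * (real (card G') * real (card F))"
      by (simp add: card_cartesian_product flip: of_nat_mult)
    also have "\<dots> \<le> (4 / \<epsilon>) ^ ?n * ((2 * R1 + 2) / \<epsilon> * (C1 * (1 / \<epsilon>) ^ (1 + (\<Sum>l\<in>{1..m}. k + l))))"
      using cW G'(2) F(2) R1 C1 \<epsilon> by (intro mult_mono mult_nonneg_nonneg) auto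
    also have "\<dots> = K * (1 / \<epsilon>) ^ (1 + (\<Sum>l\<in>{1..Suc m}. k + l))"
      by (simp add: K_def power_divide power_add mult_ac)
    also have "\<dots> \<le> (1 + L + K) * (1 / \<epsilon>) ^ (1 + (\<Sum>l\<in>{1..Suc m}. k + l))"
      using L0 \<epsilon> by (intro mult_right_mono) auto
    finally have cT: "real (card T) \<le> (1 + L + K) * (1 / \<epsilon>) ^ (1 + (\<Sum>l\<in>{1..Suc m}. k + l))" .
    show "\<exists>F. finite F \<and> real (card F) \<le> (1 + L + K) * (1 / \<epsilon>) ^ (1 + (\<Sum>l\<in>{1..Suc m}. k + l)) \<and>
     (\<forall>B\<in>degenerate k (Suc m). (\<forall>i<k + Suc m. \<forall>j<k + Suc m. \<bar>B $$ (i, j)\<bar> \<le> R) \<longrightarrow>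
        (\<exists>B'\<in>F. \<forall>i<k + Suc m. \<forall>j<k + Suc m. \<bar>B $$ (i, j) - B' $$ (i, j)\<bar> \<le> (1 + L + K) * \<epsilon>))"
    proof (intro exI[of _ T] conjI ballI impI)
      show "finite T" unfolding T_def using finW G' F by auto
      show "real (card T) \<le> (1 + L + K) * (1 / \<epsilon>) ^ (1 + (\<Sum>l\<in>{1..Suc m}. k + l))" by (rule cT)
      fix B assume "B \<in> degenerate k (Suc m)" and "\<forall>i<k + Suc m. \<forall>j<k + Suc m. \<bar>B $$ (i, j)\<bar> \<le> R"
      then have B: "B \<in> carrier_mat (Suc ?n) (Suc ?n)" "transpose_mat B = B"
        and bound: "\<forall>i<Suc ?n. \<forall>j<Suc ?n. \<bar>B $$ (i, j)\<bar> \<le> R"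
        and "\<exists>r as. length as = Suc m \<and> char_poly B = [:- r, 1:] ^ k * (\<Prod>a\<leftarrow>as. [:- a, 1:])"
        by (auto simp: degenerate_def)
      \<comment> \<open>The eigenvalue to be split off is taken from the list, so that the power of
        \<open>[:- r, 1:]\<close> survives in the quotient.\<close>
      then obtain r a as where len: "length as = m"
        and cp: "char_poly B = [:- r, 1:] ^ k * ([:- a, 1:] * (\<Prod>a\<leftarrow>as. [:- a, 1:]))"
        by (auto simp: length_Suc_conv)
      have "poly (char_poly B) a = 0" unfolding cp by simp
      from peel_eigenvector[OF B this] obtain w B1 where w: "w 0 = 1" "\<forall>i<Suc ?n. \<bar>w i\<bar> \<le> 1"
        and B1: "B1 \<in> carrier_mat ?n ?n" "transpose_mat B1 = B1"
        and F1: "four_block_mat (Matrix.mat 1 1 (\<lambda>_. a)) (0\<^sub>m 1 ?n) (0\<^sub>m ?n 1) B1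
             = reflection (Suc ?n) w * B * reflection (Suc ?n) w"
        and dec: "B = reflection (Suc ?n) w * four_block_mat (Matrix.mat 1 1 (\<lambda>_. a)) (0\<^sub>m 1 ?n) (0\<^sub>m ?n 1) B1 * reflection (Suc ?n) w"
        and cp1: "char_poly B = [:- a, 1:] * char_poly B1" by blast
      have "Matrix.mat ?n ?n (\<lambda>(i, j). B1 $$ (i, j)) = B1" using B1 by (intro eq_matI) auto
      then have blk1: "four_block_mat (Matrix.mat 1 1 (\<lambda>_. a)) (0\<^sub>m 1 ?n) (0\<^sub>m ?n 1) B1 = blk a B1"
        by (simp add: blk_def)
      have "[:- a, 1:] * char_poly B1 = [:- a, 1:] * ([:- r, 1:] ^ k * (\<Prod>a\<leftarrow>as. [:- a, 1:]))"
        using cp cp1 by (simp only: mult.left_commute)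
      then have "char_poly B1 = [:- r, 1:] ^ k * (\<Prod>a\<leftarrow>as. [:- a, 1:])"
        by (subst (asm) mult_left_cancel) auto
      then have B1d: "B1 \<in> degenerate k m" using B1 len by (auto simp: degenerate_def)
      have blkR: "\<forall>i<Suc ?n. \<forall>j<Suc ?n. \<bar>blk a B1 $$ (i, j)\<bar> \<le> R1"
        unfolding blk1[symmetric] F1 R1_def
        by (intro allI impI triple_product_le) (use B bound reflection_le in auto)
      have "\<bar>blk a B1 $$ (0, 0)\<bar> \<le> R1" using blkR by blast
      then have aR: "\<bar>a\<bar> \<le> R1" by (simp add: blk_i)
      have "\<forall>i<?n. \<forall>j<?n. \<bar>B1 $$ (i, j)\<bar> \<le> R1"
      proof (intro allI impI)
        fix i j assume "i < ?n" "j < ?n"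
        then have "\<bar>blk a B1 $$ (Suc i, Suc j)\<bar> \<le> R1" "Suc i < Suc ?n" "Suc j < Suc ?n" using blkR by auto
        then show "\<bar>B1 $$ (i, j)\<bar> \<le> R1" by (simp add: blk_i)
      qed
      from F(3)[OF B1d this] obtain B2 where B2: "B2 \<in> F"
        "\<forall>i<?n. \<forall>j<?n. \<bar>B1 $$ (i, j) - B2 $$ (i, j)\<bar> \<le> C1 * \<epsilon>" by blast
      from G'(3)[OF aR] obtain a2 where a2: "a2 \<in> G'" "\<bar>a - a2\<bar> \<le> \<epsilon>" by blast
      have "\<forall>i\<in>{1..?n}. \<exists>g\<in>G. \<bar>w i - g\<bar> \<le> \<epsilon> \<and> \<bar>g\<bar> \<le> 2" using w G(3) by auto
      then obtain f where f: "\<forall>i\<in>{1..?n}. f i \<in> G \<and> \<bar>w i - f i\<bar> \<le> \<epsilon> \<and> \<bar>f i\<bar> \<le> 2" by metis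
      \<comment> \<open>The restriction makes \<open>w2\<close> agree also outside the index range
        with a function from the extensional set behind \<open>W\<close>.\<close>
      define w2 where "w2 i = (if i = 0 then 1 else restrict f {1..?n} i)" for i
      have w2W: "w2 \<in> W"
        unfolding W_def using f by (intro image_eqI[of _ _ "restrict f {1..?n}"]) (auto simp: w2_def fun_eq_iff)
      have w2: "\<forall>i<Suc ?n. \<bar>w2 i\<bar> \<le> 2" "\<forall>i<Suc ?n. \<bar>w i - w2 i\<bar> \<le> \<epsilon>"
        using f w \<epsilon> by (auto simp: w2_def)
      have eC: "\<epsilon> \<le> C1 * \<epsilon>" "C1 * \<epsilon> \<le> C1" using C1 \<epsilon> by (auto simp: mult_left_le)
      have blkd: "\<forall>i<Suc ?n. \<forall>j<Suc ?n. \<bar>blk a B1 $$ (i, j) - blk a2 B2 $$ (i, j)\<bar> \<le> C1 * \<epsilon>"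
        using B2(2) order_trans[OF a2(2) eC(1)] C1 \<epsilon> by (auto simp: blk_i)
      have blk2R: "\<forall>i<Suc ?n. \<forall>j<Suc ?n. \<bar>blk a2 B2 $$ (i, j)\<bar> \<le> R1 + C1 + 1"
      proof (intro allI impI)
        fix i j assume "i < Suc ?n" "j < Suc ?n"
        then have "\<bar>blk a B1 $$ (i, j) - blk a2 B2 $$ (i, j)\<bar> \<le> C1 * \<epsilon>" "\<bar>blk a B1 $$ (i, j)\<bar> \<le> R1"
          using blkd blkR by auto
        then show "\<bar>blk a2 B2 $$ (i, j)\<bar> \<le> R1 + C1 + 1" using eC by linarith
      qed
      have blk1R: "\<forall>i<Suc ?n. \<forall>j<Suc ?n. \<bar>blk a B1 $$ (i, j)\<bar> \<le> R1 + C1 + 1"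
        using blkR C1 by fastforce
      have fin: "\<bar>B $$ (i, j) - (reflection (Suc ?n) w2 * blk a2 B2 * reflection (Suc ?n) w2) $$ (i, j)\<bar> \<le> (1 + L + K) * \<epsilon>"
        if ij: "i < Suc ?n" "j < Suc ?n" for i j
      proof -
        have "\<bar>(reflection (Suc ?n) w * blk a B1 * reflection (Suc ?n) w) $$ (i, j)
          - (reflection (Suc ?n) w2 * blk a2 B2 * reflection (Suc ?n) w2) $$ (i, j)\<bar>
          \<le> (real (Suc ?n))\<^sup>2 * (6 * (R1 + C1 + 1) * ((8 + 32 * real (Suc ?n)) * \<epsilon>) + 9 * (C1 * \<epsilon>))"
        proof (rule triple_product_diff_le)
          show "\<forall>i<Suc ?n. \<forall>j<Suc ?n. \<bar>reflection (Suc ?n) w $$ (i, j) - reflection (Suc ?n) w2 $$ (i, j)\<bar>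
              \<le> (8 + 32 * real (Suc ?n)) * \<epsilon>"
            using w w2 by (intro allI impI reflection_lipschitz) (force simp: w2_def)+
        qed (use blkd blk1R blk2R ij blk_c reflection_le in auto)
        also have "\<dots> = L * \<epsilon>" by (simp add: L_def algebra_simps)
        also have "\<dots> \<le> (1 + L + K) * \<epsilon>" using K0 \<epsilon> by (intro mult_right_mono) auto
        finally show ?thesis using dec unfolding blk1 by simp
      qed
      show "\<exists>B'\<in>T. \<forall>i<k + Suc m. \<forall>j<k + Suc m. \<bar>B $$ (i, j) - B' $$ (i, j)\<bar> \<le> (1 + L + K) * \<epsilon>"
      proof (rule bexI)
        show "reflection (Suc ?n) w2 * blk a2 B2 * reflection (Suc ?n) w2 \<in> T"
          unfolding T_def using w2W a2(1) B2(1) by (intro image_eqI[of _ _ "(w2, a2, B2)"]) auto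
      qed (use fin in auto)
    qed
  qed
qed

section \<open>Anisotropic dyadic cells\<close>

text \<open>
  A cell of level \<open>m\<close> has side \<open>\<tau> 2\<^sup>-\<^sup>l\<close> with \<open>l = lv \<gamma> j m\<close> in direction \<open>j\<close>, about \<open>2\<^sup>-\<^sup>m\<close> in the
  metric of the field, and is named by the vector \<open>i\<close> of its integer coordinates. Cells are half-open.
\<close>

definition lv :: "('n \<Rightarrow> real) \<Rightarrow> 'n \<Rightarrow> nat \<Rightarrow> nat" where
  "lv \<gamma> j m = nat \<lfloor>real m * (1 + \<gamma> j)\<rfloor>"

definition cells :: "('n \<Rightarrow> real) \<Rightarrow> nat \<Rightarrow> ('n \<Rightarrow> nat) set" where
  "cells \<gamma> m = {i. \<forall>j. i j < 2 ^ lv \<gamma> j m}"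

definition parent :: "('n \<Rightarrow> real) \<Rightarrow> nat \<Rightarrow> ('n \<Rightarrow> nat) \<Rightarrow> ('n \<Rightarrow> nat)" where
  "parent \<gamma> m i = (\<lambda>j. i j div 2 ^ (lv \<gamma> j (Suc m) - lv \<gamma> j m))"

text \<open>A cell is represented by its lower corner, so the single cell of level 0 is represented
  by the corner \<open>x0\<close> of the patch.\<close>

definition pt :: "('n \<Rightarrow> real) \<Rightarrow> real ^ 'n \<Rightarrow> real \<Rightarrow> nat \<times> ('n \<Rightarrow> nat) \<Rightarrow> real ^ 'n" where
  "pt \<gamma> x0 \<tau> x = (\<chi> j. x0 $ j + \<tau> * real (snd x j) / 2 ^ lv \<gamma> j (fst x))"

text \<open>Closeness at distance \<open>r\<close> in the metric of the field, where coordinate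
  \<open>j\<close> is measured with the exponent
  \<open>alpha \<gamma> j = 1 / (1 + \<gamma> j)\<close>.\<close>

definition near :: "('n \<Rightarrow> real) \<Rightarrow> real \<Rightarrow> real ^ 'n \<Rightarrow> real ^ 'n \<Rightarrow> bool" where
  "near \<gamma> r s t \<longleftrightarrow> (\<forall>j. \<bar>s $ j - t $ j\<bar> \<le> r powr (1 + \<gamma> j))"

lemma lv_mono: "(\<And>j. 0 < \<gamma> j) \<Longrightarrow> m \<le> n \<Longrightarrow> lv \<gamma> j m \<le> lv \<gamma> j n"
  unfolding lv_def
  by (intro nat_mono floor_mono mult_right_mono) (auto intro!: add_nonneg_nonneg intro: less_imp_le)

lemma lv_bounds:
  assumes "0 < \<gamma> j"
  shows "real (lv \<gamma> j m) \<le> real m * (1 + \<gamma> j)" "real m * (1 + \<gamma> j) \<le> real (lv \<gamma> j m) + 1"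
proof -
  have "0 \<le> real m * (1 + \<gamma> j)" using assms by simp
  then have "0 \<le> \<lfloor>real m * (1 + \<gamma> j)\<rfloor>" by simp
  then have "real (lv \<gamma> j m) = of_int \<lfloor>real m * (1 + \<gamma> j)\<rfloor>" by (simp add: lv_def)
  then show "real (lv \<gamma> j m) \<le> real m * (1 + \<gamma> j)" "real m * (1 + \<gamma> j) \<le> real (lv \<gamma> j m) + 1" by linarith+
qed

lemma cells_PiE: "cells \<gamma> m = PiE UNIV (\<lambda>j. {..<2 ^ lv \<gamma> j m})"
  by (auto simp: cells_def PiE_iff)

lemma card_cells: "card (cells \<gamma> m) = 2 ^ (\<Sum>j\<in>(UNIV :: 'n::finite set). lv \<gamma> j m)"
  unfolding cells_PiE by (simp add: card_PiE power_sum)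

lemma mult_div_unique_nat:
  fixes x d i :: nat
  assumes "0 < d"
  shows "x div d = i \<longleftrightarrow> x \<in> {i * d..<(i + 1) * d}"
proof
  assume "x div d = i"
  then show "x \<in> {i * d..<(i + 1) * d}"
    using assms by (metis atLeastLessThan_iff div_times_less_eq_dividend dividend_less_div_times Suc_eq_plus1 mult_Suc add.commute)
next
  assume "x \<in> {i * d..<(i + 1) * d}"
  then show "x div d = i" using assms by (auto intro!: div_nat_eqI simp: mult.commute)
qed

text \<open>The unrounded exponents sum to \<open>\<kappa> * m\<close>. Rounding each of them down
  loses a factor of at most 2 per coordinate, which is the constant
  \<open>2 ^ CARD('n)\<close>.\<close>

lemma tree_cells:
  fixes \<gamma> :: "'n::finite \<Rightarrow> real"
  assumes \<gamma>: "\<And>j. 0 < \<gamma> j" and \<kappa>: "1 \<le> \<kappa>" "(\<Sum>j\<in>UNIV. 1 + \<gamma> j) = real \<kappa>"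
  shows "tree (cells \<gamma>) (parent \<gamma>) (\<lambda>m. \<Prod>j\<in>UNIV. 2 ^ (lv \<gamma> j (Suc m) - lv \<gamma> j m)) \<kappa> (2 ^ CARD('n))"
proof
  fix m
  show "finite (cells \<gamma> m)" unfolding cells_PiE by (intro finite_PiE) auto
  have "(\<lambda>_. 0) \<in> cells \<gamma> m" by (simp add: cells_def)
  then show "cells \<gamma> m \<noteq> {}" by blast
  show "1 \<le> \<kappa>" by fact
  have lsum: "real (\<Sum>j\<in>(UNIV :: 'n set). lv \<gamma> j m) \<le> real (\<kappa> * m)"
  proof -
    have "real (\<Sum>j\<in>(UNIV :: 'n set). lv \<gamma> j m) \<le> (\<Sum>j\<in>UNIV. real m * (1 + \<gamma> j))"
      using lv_bounds(1)[of \<gamma>] \<gamma> unfolding of_nat_sum by (intro sum_mono) auto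
    also have "\<dots> = real (\<kappa> * m)" unfolding sum_distrib_left[symmetric] \<kappa>(2) by simp
    finally show ?thesis .
  qed
  then show "real (card (cells \<gamma> m)) \<le> 2 ^ (\<kappa> * m)"
    unfolding card_cells of_nat_le_iff by simp
  have "real (\<kappa> * m) = (\<Sum>j\<in>UNIV. real m * (1 + \<gamma> j))" unfolding sum_distrib_left[symmetric] \<kappa>(2) by simp
  also have "\<dots> \<le> (\<Sum>j\<in>(UNIV :: 'n set). real (lv \<gamma> j m) + 1)"
    using lv_bounds(2)[of \<gamma>] \<gamma> by (intro sum_mono) auto
  also have "\<dots> = real ((\<Sum>j\<in>(UNIV :: 'n set). lv \<gamma> j m) + CARD('n))" by (simp add: sum.distrib)
  finally have "\<kappa> * m \<le> (\<Sum>j\<in>(UNIV :: 'n set). lv \<gamma> j m) + CARD('n)" unfolding of_nat_le_iff .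
  then have "(2 :: real) ^ (\<kappa> * m) \<le> 2 ^ ((\<Sum>j\<in>(UNIV :: 'n set). lv \<gamma> j m) + CARD('n))" by (intro power_increasing) auto
  then show "2 ^ (\<kappa> * m) \<le> 2 ^ CARD('n) * real (card (cells \<gamma> m))"
    unfolding card_cells by (simp add: power_add mult.commute)
next
  fix i m assume i: "i \<in> cells \<gamma> (Suc m)"
  show "parent \<gamma> m i \<in> cells \<gamma> m"
    unfolding cells_def parent_def
  proof (intro CollectI allI)
    fix j
    have "i j < 2 ^ lv \<gamma> j (Suc m)" using i by (simp add: cells_def)
    also have "(2 :: nat) ^ lv \<gamma> j (Suc m) = 2 ^ lv \<gamma> j m * 2 ^ (lv \<gamma> j (Suc m) - lv \<gamma> j m)"
      using lv_mono[of \<gamma> m "Suc m" j] \<gamma> by (simp add: power_add[symmetric])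
    finally show "i j div 2 ^ (lv \<gamma> j (Suc m) - lv \<gamma> j m) < 2 ^ lv \<gamma> j m"
      by (simp add: less_mult_imp_div_less)
  qed
next
  fix i m assume i: "i \<in> cells \<gamma> m"
  have "{i' \<in> cells \<gamma> (Suc m). parent \<gamma> m i' = i} =
    PiE UNIV (\<lambda>j. {i j * 2 ^ (lv \<gamma> j (Suc m) - lv \<gamma> j m)..<(i j + 1) * 2 ^ (lv \<gamma> j (Suc m) - lv \<gamma> j m)})" (is "?L = ?R")
  proof
    show "?L \<subseteq> ?R"
    proof
      fix i' assume "i' \<in> ?L"
      then have "i' j div 2 ^ (lv \<gamma> j (Suc m) - lv \<gamma> j m) = i j" for j by (auto simp: parent_def)
      then have "i' j \<in> {i j * 2 ^ (lv \<gamma> j (Suc m) - lv \<gamma> j m)..<(i j + 1) * 2 ^ (lv \<gamma> j (Suc m) - lv \<gamma> j m)}" for j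
        by (subst (asm) mult_div_unique_nat) auto
      then show "i' \<in> ?R" by (simp add: PiE_iff)
    qed
    show "?R \<subseteq> ?L"
    proof
      fix i' assume i': "i' \<in> ?R"
      have "parent \<gamma> m i' = i"
      proof
        fix j show "parent \<gamma> m i' j = i j"
          unfolding parent_def using i' by (subst mult_div_unique_nat) (auto simp: PiE_iff)
      qed
      moreover have "i' j < 2 ^ lv \<gamma> j (Suc m)" for j
      proof -
        have "i' j < (i j + 1) * 2 ^ (lv \<gamma> j (Suc m) - lv \<gamma> j m)" using i' by (auto simp: PiE_iff)
        also have "\<dots> \<le> 2 ^ lv \<gamma> j m * 2 ^ (lv \<gamma> j (Suc m) - lv \<gamma> j m)"
          using i by (intro mult_right_mono) (auto simp: cells_def Suc_le_eq)
        also have "\<dots> = 2 ^ lv \<gamma> j (Suc m)"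
          using lv_mono[of \<gamma> m "Suc m" j] \<gamma> by (simp add: power_add[symmetric])
        finally show ?thesis .
      qed
      ultimately show "i' \<in> ?L" by (simp add: cells_def)
    qed
  qed
  then show "card {i' \<in> cells \<gamma> (Suc m). parent \<gamma> m i' = i} = (\<Prod>j\<in>UNIV. 2 ^ (lv \<gamma> j (Suc m) - lv \<gamma> j m))"
    by (simp add: card_PiE)
qed

lemma half_powr_le_lv:
  assumes "0 < \<gamma> j"
  shows "1 / 2 ^ lv \<gamma> j m \<le> 2 * ((1 / 2) ^ m) powr (1 + \<gamma> j)"
proof -
  have "((1 / 2 :: real) ^ m) powr (1 + \<gamma> j) = 2 powr (- (real m * (1 + \<gamma> j)))"
  proof -
    have "(1 / 2 :: real) ^ m = 2 powr (- real m)" by (simp add: powr_minus_divide powr_realpow power_one_over)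
    then show ?thesis by (simp only: powr_powr mult_minus_left)
  qed
  moreover have "2 powr (- real (lv \<gamma> j m)) \<le> 2 powr (1 - real m * (1 + \<gamma> j))"
    using lv_bounds(2)[of \<gamma> j m] assms by (intro powr_mono) auto
  moreover have "2 powr (1 - real m * (1 + \<gamma> j)) = 2 * 2 powr (- (real m * (1 + \<gamma> j)))"
    by (simp add: powr_diff powr_minus_divide)
  moreover have "2 powr (- real (lv \<gamma> j m)) = 1 / 2 ^ lv \<gamma> j m"
    by (simp add: powr_minus_divide powr_realpow)
  ultimately show ?thesis by simp
qed

text \<open>The corners of a cell and of its parent differ by less than a side of the parent. The
  condition on \<open>\<tau>\<close> absorbs the factor 2 from rounding \<open>lv\<close> and the
  factor \<open>2 powr (1 + \<gamma> j)\<close> from measuring at level \<open>Suc m\<close> instead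
  of \<open>m\<close>.\<close>

lemma near_parent:
  assumes \<gamma>: "\<And>j. 0 < \<gamma> j" and \<tau>: "0 < \<tau>" "\<And>j. 2 * \<tau> * 2 powr (1 + \<gamma> j) \<le> 1"
  shows "near \<gamma> ((1 / 2) ^ Suc m) (pt \<gamma> x0 \<tau> (Suc m, i)) (pt \<gamma> x0 \<tau> (m, parent \<gamma> m i))"
  unfolding near_def
proof
  fix j
  let ?d = "(2 :: nat) ^ (lv \<gamma> j (Suc m) - lv \<gamma> j m)"
  have l: "(2 :: real) ^ lv \<gamma> j (Suc m) = 2 ^ lv \<gamma> j m * real ?d"
    using lv_mono[of \<gamma> m "Suc m" j] \<gamma> by (simp add: power_add[symmetric])
  have "real (i j) = real (i j div ?d) * real ?d + real (i j mod ?d)"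
    by (metis div_mult_mod_eq of_nat_add of_nat_mult)
  then have d: "pt \<gamma> x0 \<tau> (Suc m, i) $ j - pt \<gamma> x0 \<tau> (m, parent \<gamma> m i) $ j = \<tau> * real (i j mod ?d) / (2 ^ lv \<gamma> j m * real ?d)"
  proof -
    define A where "A = (2 :: real) ^ lv \<gamma> j m" define D where "D = real ?d"
    define Q where "Q = real (i j div ?d)" define R where "R = real (i j mod ?d)"
    have AD: "0 < A" "0 < D" by (simp_all add: A_def D_def)
    have "pt \<gamma> x0 \<tau> (Suc m, i) $ j - pt \<gamma> x0 \<tau> (m, parent \<gamma> m i) $ j = \<tau> * (Q * D + R) / (A * D) - \<tau> * Q / A"
      using \<open>real (i j) = _\<close> l by (simp add: pt_def parent_def A_def D_def Q_def R_def)
    also have "\<dots> = \<tau> * R / (A * D)" using AD by (simp add: field_simps)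
    finally show ?thesis by (simp add: A_def D_def R_def)
  qed
  have "\<bar>pt \<gamma> x0 \<tau> (Suc m, i) $ j - pt \<gamma> x0 \<tau> (m, parent \<gamma> m i) $ j\<bar> = \<tau> * real (i j mod ?d) / (2 ^ lv \<gamma> j m * real ?d)"
    unfolding d using \<tau>(1) by (simp add: abs_mult abs_divide)
  also have "\<dots> \<le> \<tau> * real ?d / (2 ^ lv \<gamma> j m * real ?d)"
  proof (intro divide_right_mono mult_left_mono)
    show "real (i j mod ?d) \<le> real ?d" by (intro of_nat_mono less_imp_le mod_less_divisor) simp
  qed (use \<tau>(1) in auto)
  also have "\<dots> = \<tau> * (1 / 2 ^ lv \<gamma> j m)" by simp
  also have "\<dots> \<le> \<tau> * (2 * ((1 / 2) ^ m) powr (1 + \<gamma> j))"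
    using half_powr_le_lv[of \<gamma> j, OF \<gamma>] \<tau> by (intro mult_left_mono) auto
  also have "((1 / 2 :: real) ^ m) powr (1 + \<gamma> j) = 2 powr (1 + \<gamma> j) * ((1 / 2) ^ Suc m) powr (1 + \<gamma> j)"
    by (simp add: powr_mult[symmetric])
  also have "\<tau> * (2 * (2 powr (1 + \<gamma> j) * ((1 / 2) ^ Suc m) powr (1 + \<gamma> j))) = (2 * \<tau> * 2 powr (1 + \<gamma> j)) * ((1 / 2) ^ Suc m) powr (1 + \<gamma> j)"
    by simp
  also have "\<dots> \<le> 1 * ((1 / 2) ^ Suc m) powr (1 + \<gamma> j)"
    using \<tau>(2)[of j] by (intro mult_right_mono) auto
  finally show "\<bar>pt \<gamma> x0 \<tau> (Suc m, i) $ j - pt \<gamma> x0 \<tau> (m, parent \<gamma> m i) $ j\<bar> \<le> ((1 / 2) ^ Suc m) powr (1 + \<gamma> j)"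
    by (simp only: mult_1_left)
qed

lemma pt_bounds:
  assumes "0 < \<tau>" "i \<in> cells \<gamma> m"
  shows "x0 $ j \<le> pt \<gamma> x0 \<tau> (m, i) $ j" "pt \<gamma> x0 \<tau> (m, i) $ j < x0 $ j + \<tau>"
proof -
  have "i j < 2 ^ lv \<gamma> j m" using assms(2) by (simp add: cells_def)
  then have "real (i j) / 2 ^ lv \<gamma> j m < 1" by simp
  then have "\<tau> * (real (i j) / 2 ^ lv \<gamma> j m) < \<tau> * 1" using assms(1) by (intro mult_strict_left_mono)
  then show "x0 $ j \<le> pt \<gamma> x0 \<tau> (m, i) $ j" "pt \<gamma> x0 \<tau> (m, i) $ j < x0 $ j + \<tau>"
    using assms(1) by (simp_all add: pt_def)
qed

text \<open>The cell of level \<open>m\<close> that contains \<open>t\<close>, provided that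
  \<open>t\<close> lies in the half-open patch.\<close>

definition address :: "('n \<Rightarrow> real) \<Rightarrow> real ^ 'n \<Rightarrow> real \<Rightarrow> real ^ 'n \<Rightarrow> nat \<Rightarrow> ('n \<Rightarrow> nat)" where
  "address \<gamma> x0 \<tau> t m = (\<lambda>j. nat \<lfloor>(t $ j - x0 $ j) / \<tau> * 2 ^ lv \<gamma> j m\<rfloor>)"

lemma address_cells:
  assumes \<tau>: "0 < \<tau>" and t: "\<And>j. x0 $ j \<le> t $ j \<and> t $ j < x0 $ j + \<tau>"
  shows "address \<gamma> x0 \<tau> t m \<in> cells \<gamma> m"
  unfolding cells_def address_def
proof (intro CollectI allI)
  fix j
  have "(t $ j - x0 $ j) / \<tau> < 1" using t[of j] \<tau> by (simp add: divide_less_eq)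
  then have "(t $ j - x0 $ j) / \<tau> * 2 ^ lv \<gamma> j m < 1 * 2 ^ lv \<gamma> j m" by (intro mult_strict_right_mono) auto
  then have "\<lfloor>(t $ j - x0 $ j) / \<tau> * 2 ^ lv \<gamma> j m\<rfloor> < 2 ^ lv \<gamma> j m" by (simp add: floor_less_iff)
  moreover have "0 \<le> (t $ j - x0 $ j) / \<tau> * 2 ^ lv \<gamma> j m" using t[of j] \<tau> by simp
  ultimately show "nat \<lfloor>(t $ j - x0 $ j) / \<tau> * 2 ^ lv \<gamma> j m\<rfloor> < 2 ^ lv \<gamma> j m"
    by (simp add: nat_less_iff)
qed

text \<open>Integer division of an integer part is the integer part of the quotient, so the
  addresses of a point form a branch of the tree.\<close>

lemma address_parent:
  assumes \<gamma>: "\<And>j. 0 < \<gamma> j" and \<tau>: "0 < \<tau>" and t: "\<And>j. x0 $ j \<le> t $ j \<and> t $ j < x0 $ j + \<tau>"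
  shows "parent \<gamma> m (address \<gamma> x0 \<tau> t (Suc m)) = address \<gamma> x0 \<tau> t m"
proof
  fix j
  let ?x = "(t $ j - x0 $ j) / \<tau>" let ?d = "lv \<gamma> j (Suc m) - lv \<gamma> j m"
  have x: "0 \<le> ?x" using t[of j] \<tau> by simp
  have l: "(2 :: real) ^ lv \<gamma> j (Suc m) = 2 ^ lv \<gamma> j m * 2 ^ ?d"
    using lv_mono[of \<gamma> m "Suc m" j] \<gamma> by (simp add: power_add[symmetric])
  have "nat \<lfloor>?x * 2 ^ lv \<gamma> j (Suc m)\<rfloor> div 2 ^ ?d = nat (\<lfloor>?x * 2 ^ lv \<gamma> j (Suc m)\<rfloor> div 2 ^ ?d)"
  proof -
    have "0 \<le> ?x * 2 ^ lv \<gamma> j (Suc m)" by (rule mult_nonneg_nonneg[OF x]) simp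
    then have "0 \<le> \<lfloor>?x * 2 ^ lv \<gamma> j (Suc m)\<rfloor>" by (simp only: zero_le_floor)
    from nat_div_distrib[OF this, of "2 ^ ?d"] show ?thesis by (simp add: nat_power_eq)
  qed
  also have "\<lfloor>?x * 2 ^ lv \<gamma> j (Suc m)\<rfloor> div 2 ^ ?d = \<lfloor>?x * 2 ^ lv \<gamma> j (Suc m) / 2 ^ ?d\<rfloor>"
    using floor_divide_real_eq_div[of "2 ^ ?d" "?x * 2 ^ lv \<gamma> j (Suc m)"] by simp
  also have "?x * 2 ^ lv \<gamma> j (Suc m) / 2 ^ ?d = ?x * 2 ^ lv \<gamma> j m" unfolding l by simp
  finally show "parent \<gamma> m (address \<gamma> x0 \<tau> t (Suc m)) j = address \<gamma> x0 \<tau> t m j"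
    by (simp add: parent_def address_def)
qed

lemma pt_address_tendsto:
  fixes \<gamma> :: "'n::finite \<Rightarrow> real"
  assumes \<gamma>: "\<And>j. 0 < \<gamma> j" and \<tau>: "0 < \<tau>" and t: "\<And>j. x0 $ j \<le> t $ j \<and> t $ j < x0 $ j + \<tau>"
  shows "(\<lambda>m. pt \<gamma> x0 \<tau> (m, address \<gamma> x0 \<tau> t m)) \<longlonglongrightarrow> t"
proof (rule vec_tendstoI)
  fix j
  have bound: "\<bar>pt \<gamma> x0 \<tau> (m, address \<gamma> x0 \<tau> t m) $ j - t $ j\<bar> \<le> \<tau> * (1 / 2) ^ m" for m
  proof -
    let ?x = "(t $ j - x0 $ j) / \<tau> * 2 ^ lv \<gamma> j m"
    have x: "0 \<le> ?x" using t[of j] \<tau> by simp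
    then have "real (nat \<lfloor>?x\<rfloor>) = of_int \<lfloor>?x\<rfloor>" by simp
    then have "\<bar>real (nat \<lfloor>?x\<rfloor>) - ?x\<bar> \<le> 1" by linarith
    moreover have "pt \<gamma> x0 \<tau> (m, address \<gamma> x0 \<tau> t m) $ j - t $ j = \<tau> / 2 ^ lv \<gamma> j m * (real (nat \<lfloor>?x\<rfloor>) - ?x)"
      using \<tau> by (simp add: pt_def address_def field_simps)
    ultimately have "\<bar>pt \<gamma> x0 \<tau> (m, address \<gamma> x0 \<tau> t m) $ j - t $ j\<bar> \<le> \<tau> / 2 ^ lv \<gamma> j m * 1"
      using \<tau> by (simp only: abs_mult) (intro mult_mono; simp)
    also have "\<dots> \<le> \<tau> * (1 / 2) ^ m"
    proof -
      have "m \<le> lv \<gamma> j m"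
      proof -
        have "real m * 1 \<le> real m * (1 + \<gamma> j)" using \<gamma>[of j] by (intro mult_left_mono) auto
        then have "int m \<le> \<lfloor>real m * (1 + \<gamma> j)\<rfloor>" by (simp add: le_floor_iff)
        then show ?thesis by (simp add: lv_def)
      qed
      then have "(2 :: real) ^ m \<le> 2 ^ lv \<gamma> j m" by (intro power_increasing) auto
      then show ?thesis using \<tau> by (simp add: power_one_over divide_simps)
    qed
    finally show ?thesis .
  qed
  have "(\<lambda>m. \<tau> * (1 / 2 :: real) ^ m) \<longlonglongrightarrow> \<tau> * 0" by (intro tendsto_mult tendsto_const LIMSEQ_power_zero) auto
  then have lim: "(\<lambda>m. \<tau> * (1 / 2 :: real) ^ m) \<longlonglongrightarrow> 0" by simp
  have "(\<lambda>m. pt \<gamma> x0 \<tau> (m, address \<gamma> x0 \<tau> t m) $ j - t $ j) \<longlonglongrightarrow> 0"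
    by (rule Lim_null_comparison[OF always_eventually lim]) (simp only: real_norm_def bound simp_thms)
  then show "(\<lambda>m. pt \<gamma> x0 \<tau> (m, address \<gamma> x0 \<tau> t m) $ j) \<longlonglongrightarrow> t $ j" by (rule LIM_zero_cancel)
qed

section \<open>Increments of the field\<close>

lemma L2norm_nonneg: "0 \<le> L2norm M X"
  by (simp add: L2norm_def integral_nonneg_AE)

lemma L2norm_square: "(L2norm M X)\<^sup>2 = (\<integral>\<omega>. (X \<omega>)\<^sup>2 \<partial>M)"
  by (simp add: L2norm_def integral_nonneg_AE)

lemma L2norm_cong_AE:
  assumes "AE \<omega> in M. X \<omega> = Y \<omega>" "X \<in> borel_measurable M" "Y \<in> borel_measurable M"
  shows "L2norm M X = L2norm M Y"
proof -
  have "(\<integral>\<omega>. (X \<omega>)\<^sup>2 \<partial>M) = (\<integral>\<omega>. (Y \<omega>)\<^sup>2 \<partial>M)"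
    using assms by (intro integral_cong_AE) auto
  then show ?thesis by (simp add: L2norm_def)
qed

lemma Cauchy_Schwarz_L2norm:
  assumes "X \<in> borel_measurable M" "Y \<in> borel_measurable M"
    "integrable M (\<lambda>\<omega>. (X \<omega>)\<^sup>2)" "integrable M (\<lambda>\<omega>. (Y \<omega>)\<^sup>2)"
  shows "\<bar>\<integral>\<omega>. X \<omega> * Y \<omega> \<partial>M\<bar> \<le> L2norm M X * L2norm M Y"
proof -
  let ?a = "\<integral>\<omega>. (X \<omega>)\<^sup>2 \<partial>M" and ?b = "\<integral>\<omega>. X \<omega> * Y \<omega> \<partial>M" and ?c = "\<integral>\<omega>. (Y \<omega>)\<^sup>2 \<partial>M"
  have i: "integrable M (\<lambda>\<omega>. X \<omega> * Y \<omega>)" by (rule integrable_mult_square[OF assms])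
  have q: "0 \<le> ?a * u\<^sup>2 + 2 * ?b * u + ?c" for u
  proof -
    have "(\<integral>\<omega>. (u * X \<omega> + Y \<omega>)\<^sup>2 \<partial>M) = (\<integral>\<omega>. u\<^sup>2 * (X \<omega>)\<^sup>2 + 2 * u * (X \<omega> * Y \<omega>) + (Y \<omega>)\<^sup>2 \<partial>M)"
      by (intro Bochner_Integration.integral_cong refl) (simp add: power2_eq_square algebra_simps)
    also have "\<dots> = u\<^sup>2 * ?a + 2 * u * ?b + ?c" using assms i by simp
    finally have "u\<^sup>2 * ?a + 2 * u * ?b + ?c = (\<integral>\<omega>. (u * X \<omega> + Y \<omega>)\<^sup>2 \<partial>M)" by simp
    moreover have "0 \<le> (\<integral>\<omega>. (u * X \<omega> + Y \<omega>)\<^sup>2 \<partial>M)" by (intro integral_nonneg_AE) auto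
    ultimately show ?thesis by (simp add: mult_ac)
  qed
  have a0: "0 \<le> ?a" "0 \<le> ?c" by (auto intro!: integral_nonneg_AE)
  have "?b\<^sup>2 \<le> ?a * ?c"
  proof (cases "?a = 0")
    case True
    have "?b = 0"
    proof (rule ccontr)
      assume b: "?b \<noteq> 0"
      have "0 \<le> 2 * ?b * (- (?c + 1) / (2 * ?b)) + ?c" using q[of "- (?c + 1) / (2 * ?b)"] True by simp
      then show False using b by (simp add: field_simps)
    qed
    then show ?thesis using True by simp
  next
    case False
    then have a: "0 < ?a" using a0(1) by linarith
    have "0 \<le> ?a * (- ?b / ?a)\<^sup>2 + 2 * ?b * (- ?b / ?a) + ?c" by (rule q)
    also have "\<dots> = (?a * ?c - ?b\<^sup>2) / ?a" using a by (simp add: field_simps power2_eq_square)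
    finally show ?thesis using a by (simp add: zero_le_divide_iff)
  qed
  then have "sqrt (?b\<^sup>2) \<le> sqrt (?a * ?c)" by (rule real_sqrt_le_mono)
  then show ?thesis by (simp add: L2norm_def real_sqrt_mult)
qed

lemma L2norm_triangle:
  assumes "X \<in> borel_measurable M" "Y \<in> borel_measurable M"
    "integrable M (\<lambda>\<omega>. (X \<omega>)\<^sup>2)" "integrable M (\<lambda>\<omega>. (Y \<omega>)\<^sup>2)"
  shows "L2norm M (\<lambda>\<omega>. X \<omega> + Y \<omega>) \<le> L2norm M X + L2norm M Y"
proof (rule power2_le_imp_le)
  have i: "integrable M (\<lambda>\<omega>. X \<omega> * Y \<omega>)" by (rule integrable_mult_square[OF assms])
  have "(L2norm M (\<lambda>\<omega>. X \<omega> + Y \<omega>))\<^sup>2 = (\<integral>\<omega>. (X \<omega>)\<^sup>2 + 2 * (X \<omega> * Y \<omega>) + (Y \<omega>)\<^sup>2 \<partial>M)"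
    unfolding L2norm_square by (intro Bochner_Integration.integral_cong refl) (simp add: power2_eq_square algebra_simps)
  also have "\<dots> = (L2norm M X)\<^sup>2 + 2 * (\<integral>\<omega>. X \<omega> * Y \<omega> \<partial>M) + (L2norm M Y)\<^sup>2"
    unfolding L2norm_square using assms i by simp
  also have "\<dots> \<le> (L2norm M X)\<^sup>2 + 2 * (L2norm M X * L2norm M Y) + (L2norm M Y)\<^sup>2"
    using Cauchy_Schwarz_L2norm[OF assms] by simp
  also have "\<dots> = (L2norm M X + L2norm M Y)\<^sup>2" by (simp add: power2_eq_square algebra_simps)
  finally show "(L2norm M (\<lambda>\<omega>. X \<omega> + Y \<omega>))\<^sup>2 \<le> (L2norm M X + L2norm M Y)\<^sup>2" .
qed (simp add: L2norm_nonneg)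

lemma L2norm_pythagoras:
  assumes "X \<in> borel_measurable M" "Y \<in> borel_measurable M"
    "integrable M (\<lambda>\<omega>. (X \<omega>)\<^sup>2)" "integrable M (\<lambda>\<omega>. (Y \<omega>)\<^sup>2)" "(\<integral>\<omega>. X \<omega> * Y \<omega> \<partial>M) = 0"
  shows "(L2norm M (\<lambda>\<omega>. X \<omega> + Y \<omega>))\<^sup>2 = (L2norm M X)\<^sup>2 + (L2norm M Y)\<^sup>2"
    and "L2norm M X \<le> L2norm M (\<lambda>\<omega>. X \<omega> + Y \<omega>)" and "L2norm M Y \<le> L2norm M (\<lambda>\<omega>. X \<omega> + Y \<omega>)"
proof -
  have i: "integrable M (\<lambda>\<omega>. X \<omega> * Y \<omega>)" by (rule integrable_mult_square[OF assms(1-4)])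
  have "(L2norm M (\<lambda>\<omega>. X \<omega> + Y \<omega>))\<^sup>2 = (\<integral>\<omega>. (X \<omega>)\<^sup>2 + 2 * (X \<omega> * Y \<omega>) + (Y \<omega>)\<^sup>2 \<partial>M)"
    unfolding L2norm_square by (intro Bochner_Integration.integral_cong refl) (simp add: power2_eq_square algebra_simps)
  also have "\<dots> = (L2norm M X)\<^sup>2 + 2 * (\<integral>\<omega>. X \<omega> * Y \<omega> \<partial>M) + (L2norm M Y)\<^sup>2"
    unfolding L2norm_square using assms i by simp
  finally show *: "(L2norm M (\<lambda>\<omega>. X \<omega> + Y \<omega>))\<^sup>2 = (L2norm M X)\<^sup>2 + (L2norm M Y)\<^sup>2" using assms by simp
  show "L2norm M X \<le> L2norm M (\<lambda>\<omega>. X \<omega> + Y \<omega>)" "L2norm M Y \<le> L2norm M (\<lambda>\<omega>. X \<omega> + Y \<omega>)"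
    by (rule power2_le_imp_le[OF _ L2norm_nonneg]; simp only: *; simp)+
qed

lemma (in prob_space) gaussian_field_diff_normal:
  assumes "gaussian_field M T X" and "\<And>t. t \<in> T \<Longrightarrow> (\<integral>\<omega>. X t \<omega> \<partial>M) = 0" and "p \<in> T" "q \<in> T"
  shows "\<exists>v. normal_rv M (\<lambda>\<omega>. X p \<omega> - X q \<omega>) 0 v"
proof (cases "p = q")
  case True
  then show ?thesis by (intro exI[of _ 0]) (simp add: normal_rv_def)
next
  case False
  then show ?thesis
    using gaussian_field_sum_normal[OF assms(1,2), of "{p, q}" "\<lambda>t. if t = p then 1 else -1"] assms(3,4) by simp
qed

text \<open>Being at least 1 and at least the moment ratio (2 k - 1)!!, its power
  \<open>2 * k\<close> dominates that ratio, so a moment bound can be written as a single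
  power.\<close>

definition moment_const :: "nat \<Rightarrow> real" where
  "moment_const k = max 1 (fact (2 * k) / (2 ^ k * fact k))"

lemma (in prob_space) nn_integral_normal_power_le:
  assumes X: "normal_rv M X 0 v" and k: "1 \<le> k" and le: "L2norm M X \<le> a"
  shows "(\<integral>\<^sup>+\<omega>. ennreal (X \<omega> ^ (2 * k)) \<partial>M) \<le> ennreal ((moment_const k * a) ^ (2 * k))"
proof -
  let ?g = "fact (2 * k) / (2 ^ k * fact k) :: real"
  have "v = (L2norm M X)\<^sup>2" using normal_rv_square(2)[OF X] by (simp add: L2norm_square)
  then have vk: "v ^ k = L2norm M X ^ (2 * k)" by (simp add: power_mult)
  have g: "1 \<le> moment_const k" "?g \<le> moment_const k" by (auto simp: moment_const_def)
  have "(\<integral>\<^sup>+\<omega>. ennreal (X \<omega> ^ (2 * k)) \<partial>M) = ennreal (\<integral>\<omega>. X \<omega> ^ (2 * k) \<partial>M)"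
    using normal_rv_even_moment(1)[OF X] by (intro nn_integral_eq_integral) auto
  also have "(\<integral>\<omega>. X \<omega> ^ (2 * k) \<partial>M) = ?g * v ^ k" by (rule normal_rv_even_moment(2)[OF X])
  also have "ennreal (?g * v ^ k) \<le> ennreal ((moment_const k * a) ^ (2 * k))"
  proof (rule ennreal_leI)
    have "?g \<le> moment_const k ^ 1" using g by simp
    also have "\<dots> \<le> moment_const k ^ (2 * k)" using g k by (intro power_increasing) auto
    finally have "?g * L2norm M X ^ (2 * k) \<le> moment_const k ^ (2 * k) * L2norm M X ^ (2 * k)"
      using L2norm_nonneg by (intro mult_right_mono) auto
    also have "moment_const k ^ (2 * k) * L2norm M X ^ (2 * k) \<le> moment_const k ^ (2 * k) * a ^ (2 * k)"
      using le L2norm_nonneg g by (intro mult_left_mono power_mono) auto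
    finally show "?g * v ^ k \<le> (moment_const k * a) ^ (2 * k)"
      unfolding vk power_mult_distrib[of "moment_const k"] .
  qed
  finally show ?thesis .
qed

locale noise = prob_space P for P :: "'v measure" +
  fixes \<xi> :: "real ^ 'n \<Rightarrow> 'v \<Rightarrow> real" and E :: "(real ^ 'n) set" and \<gamma> :: "'n::finite \<Rightarrow> real"
    and W :: "real set \<Rightarrow> real ^ 'n \<Rightarrow> 'v \<Rightarrow> real" and \<nu> :: "real ^ 'n \<Rightarrow> real measure" and a0 c0 :: real
  assumes gf: "gaussian_field P orthant \<xi>" and cf: "centered_field P orthant \<xi>"
    and E: "E \<subseteq> orthant" and \<gamma>: "\<And>j. 0 < \<gamma> j"
    and gW: "gaussian_field P (sets borel_Rplus \<times> orthant) (\<lambda>(A, t). W A t)"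
    and nW: "\<And>t. t \<in> E \<Longrightarrow> gaussian_noise P (\<nu> t) (\<lambda>A. W A t)"
    and \<xi>W: "\<And>t. t \<in> E \<Longrightarrow> AE \<omega> in P. W {0..} t \<omega> = \<xi> t \<omega>"
    and iW: "\<And>A B. A \<in> sets borel_Rplus \<Longrightarrow> B \<in> sets borel_Rplus \<Longrightarrow> A \<inter> B = {} \<Longrightarrow> indep_fields P orthant (W A) (W B)"
    and a0: "0 \<le> a0" and c0: "0 < c0"
    and incr: "\<And>a b s t. s \<in> E \<Longrightarrow> t \<in> E \<Longrightarrow> a0 \<le> a \<Longrightarrow> ereal a < b \<Longrightarrow>
       L2norm P (\<lambda>\<omega>. W {x. a \<le> x \<and> ereal x < b} s \<omega> - \<xi> s \<omega> - W {x. a \<le> x \<and> ereal x < b} t \<omega> + \<xi> t \<omega>)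
       \<le> c0 * ((\<Sum>j\<in>UNIV. a powr \<gamma> j * \<bar>s $ j - t $ j\<bar>) + real_of_ereal (inverse b))"
    and incr0: "\<And>s t. s \<in> E \<Longrightarrow> t \<in> E \<Longrightarrow>
       L2norm P (\<lambda>\<omega>. W {0..<a0} s \<omega> - W {0..<a0} t \<omega>) \<le> c0 * (\<Sum>j\<in>UNIV. \<bar>s $ j - t $ j\<bar>)"
begin

abbreviation "R \<equiv> sets borel_Rplus"

lemma R_iff: "A \<in> R \<longleftrightarrow> A \<in> sets borel \<and> A \<subseteq> {0..}"
proof
  assume "A \<in> R"
  then obtain B where "B \<in> sets borel" "A = {0..} \<inter> B" by (auto simp: borel_Rplus_def sets_restrict_space)
  then show "A \<in> sets borel \<and> A \<subseteq> {0..}" by auto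
next
  assume "A \<in> sets borel \<and> A \<subseteq> {0..}"
  then show "A \<in> R" unfolding borel_Rplus_def sets_restrict_space by (intro image_eqI[of _ _ A]) auto
qed

lemma W_normal: "t \<in> E \<Longrightarrow> A \<in> R \<Longrightarrow> \<exists>v\<ge>0. emeasure (\<nu> t) A = ennreal v \<and> normal_rv P (W A t) 0 v"
  using nW unfolding gaussian_noise_def by blast

lemma W_meas: "t \<in> E \<Longrightarrow> A \<in> R \<Longrightarrow> W A t \<in> borel_measurable P"
  using W_normal normal_rv_measurable by blast

lemma W_int2: "t \<in> E \<Longrightarrow> A \<in> R \<Longrightarrow> integrable P (\<lambda>\<omega>. (W A t \<omega>)\<^sup>2)"
  using W_normal normal_rv_square(1) by blast

lemma W_mean: "t \<in> E \<Longrightarrow> A \<in> R \<Longrightarrow> (\<integral>\<omega>. W A t \<omega> \<partial>P) = 0" "t \<in> E \<Longrightarrow> A \<in> R \<Longrightarrow> integrable P (W A t)"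
  using W_normal normal_rv_mean by blast+

lemma W_add: "t \<in> E \<Longrightarrow> A \<in> R \<Longrightarrow> B \<in> R \<Longrightarrow> A \<inter> B = {} \<Longrightarrow> AE \<omega> in P. W (A \<union> B) t \<omega> = W A t \<omega> + W B t \<omega>"
  using nW unfolding gaussian_noise_def by blast

lemma gW_E: "gaussian_field P (R \<times> E) (\<lambda>(A, t). W A t)"
  using gW E unfolding gaussian_field_def by (meson Sigma_mono order_refl subset_trans)

lemma \<xi>_mean: "t \<in> orthant \<Longrightarrow> (\<integral>\<omega>. \<xi> t \<omega> \<partial>P) = 0"
  using cf by (simp add: centered_field_def)

lemma \<xi>_normal: "t \<in> orthant \<Longrightarrow> \<exists>v. normal_rv P (\<xi> t) 0 v"
  using gaussian_field_sum_normal[OF gf \<xi>_mean, of "{t}" "\<lambda>_. 1"] by simp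

lemma \<xi>_meas: "t \<in> orthant \<Longrightarrow> \<xi> t \<in> borel_measurable P"
  using \<xi>_normal normal_rv_measurable by blast

lemma \<xi>_int2: "t \<in> orthant \<Longrightarrow> integrable P (\<lambda>\<omega>. (\<xi> t \<omega>)\<^sup>2)"
  using \<xi>_normal normal_rv_square(1) by blast

text \<open>The two parameters may differ because (A1) gives independence of the whole fields
  \<open>W A\<close> and \<open>W B\<close>, not only of their values at one point.\<close>

lemma W_orthogonal:
  assumes "A \<in> R" "B \<in> R" "A \<inter> B = {}" "s \<in> E" "t \<in> E"
  shows "(\<integral>\<omega>. W A s \<omega> * W B t \<omega> \<partial>P) = 0"
proof -
  have "indep_var (path_space orthant) (sample_path orthant (W A)) (path_space orthant) (sample_path orthant (W B))"
    using iW[OF assms(1-3)] by (simp add: indep_fields_def)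
  moreover have "(\<lambda>f. f u) \<in> measurable (path_space orthant) borel" if "u \<in> E" for u
    unfolding path_space_def using that E by (intro measurable_component_singleton) auto
  ultimately have "indep_var borel ((\<lambda>f. f s) \<circ> sample_path orthant (W A)) borel ((\<lambda>f. f t) \<circ> sample_path orthant (W B))"
    using assms by (intro indep_var_compose) auto
  moreover have "(\<lambda>f. f s) \<circ> sample_path orthant (W A) = W A s" "(\<lambda>f. f t) \<circ> sample_path orthant (W B) = W B t"
    using subsetD[OF E assms(4)] subsetD[OF E assms(5)] by (simp_all add: fun_eq_iff sample_path_def)
  ultimately have "indep_var borel (W A s) borel (W B t)" by simp
  from indep_var_lebesgue_integral[OF this] show ?thesis
    using W_mean assms by simp
qed

definition D :: "real set \<Rightarrow> real ^ 'n \<Rightarrow> real ^ 'n \<Rightarrow> 'v \<Rightarrow> real" where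
  "D A s t \<omega> = W A s \<omega> - W A t \<omega>"

lemma D_normal: "A \<in> R \<Longrightarrow> s \<in> E \<Longrightarrow> t \<in> E \<Longrightarrow> \<exists>v. normal_rv P (D A s t) 0 v"
  using gaussian_field_diff_normal[OF gW_E, of "(A, s)" "(A, t)"] W_mean(1)
  unfolding D_def[abs_def] by auto

lemma D_meas: "A \<in> R \<Longrightarrow> s \<in> E \<Longrightarrow> t \<in> E \<Longrightarrow> D A s t \<in> borel_measurable P"
  using D_normal normal_rv_measurable by blast

lemma D_int2: "A \<in> R \<Longrightarrow> s \<in> E \<Longrightarrow> t \<in> E \<Longrightarrow> integrable P (\<lambda>\<omega>. (D A s t \<omega>)\<^sup>2)"
  using D_normal normal_rv_square(1) by blast

lemma D_orthogonal:
  assumes "A \<in> R" "B \<in> R" "A \<inter> B = {}" "s \<in> E" "t \<in> E"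
  shows "(\<integral>\<omega>. D A s t \<omega> * D B s t \<omega> \<partial>P) = 0" "u \<in> E \<Longrightarrow> (\<integral>\<omega>. W A u \<omega> * D B s t \<omega> \<partial>P) = 0"
proof -
  have i: "integrable P (\<lambda>\<omega>. W A u \<omega> * W B v \<omega>)" if "u \<in> E" "v \<in> E" for u v
    using assms that by (intro integrable_mult_square W_meas W_int2)
  show *: "(\<integral>\<omega>. W A u \<omega> * D B s t \<omega> \<partial>P) = 0" if "u \<in> E" for u
    using i[OF that] assms W_orthogonal[OF assms(1-3) that] by (simp add: D_def right_diff_distrib)
  have i': "integrable P (\<lambda>\<omega>. W A u \<omega> * D B s t \<omega>)" if "u \<in> E" for u
    using assms that by (intro integrable_mult_square W_meas W_int2 D_meas D_int2)
  have "(\<integral>\<omega>. D A s t \<omega> * D B s t \<omega> \<partial>P) = (\<integral>\<omega>. W A s \<omega> * D B s t \<omega> - W A t \<omega> * D B s t \<omega> \<partial>P)"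
    by (intro Bochner_Integration.integral_cong refl) (simp add: D_def algebra_simps)
  also have "\<dots> = 0" using i' * assms by simp
  finally show "(\<integral>\<omega>. D A s t \<omega> * D B s t \<omega> \<partial>P) = 0" .
qed

lemma D_add:
  assumes "A \<in> R" "B \<in> R" "A \<inter> B = {}" "s \<in> E" "t \<in> E"
  shows "AE \<omega> in P. D (A \<union> B) s t \<omega> = D A s t \<omega> + D B s t \<omega>"
  using W_add[OF assms(4,1-3)] W_add[OF assms(5,1-3)] by eventually_elim (simp add: D_def)

lemma D_full:
  assumes "s \<in> E" "t \<in> E"
  shows "AE \<omega> in P. D {0..} s t \<omega> = \<xi> s \<omega> - \<xi> t \<omega>"
  using \<xi>W[OF assms(1)] \<xi>W[OF assms(2)] by eventually_elim (simp add: D_def)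

text \<open>Increments over disjoint bands are orthogonal, so by Pythagoras enlarging the band can
  only enlarge the norm of an increment.\<close>

lemma L2norm_D_mono:
  assumes "A \<in> R" "B \<in> R" "A \<inter> B = {}" "s \<in> E" "t \<in> E"
  shows "L2norm P (D A s t) \<le> L2norm P (D (A \<union> B) s t)"
    and "L2norm P (D (A \<union> B) s t) \<le> L2norm P (D A s t) + L2norm P (D B s t)"
proof -
  have AB: "A \<union> B \<in> R" using assms by auto
  have e: "L2norm P (D (A \<union> B) s t) = L2norm P (\<lambda>\<omega>. D A s t \<omega> + D B s t \<omega>)"
    using D_add[OF assms] D_meas AB assms by (intro L2norm_cong_AE) auto
  show "L2norm P (D A s t) \<le> L2norm P (D (A \<union> B) s t)"
    unfolding e using assms D_orthogonal by (intro L2norm_pythagoras D_meas D_int2) auto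
  show "L2norm P (D (A \<union> B) s t) \<le> L2norm P (D A s t) + L2norm P (D B s t)"
    unfolding e using assms by (intro L2norm_triangle D_meas D_int2) auto
qed

text \<open>The combination on the right is, up to sign, the increment over the complementary band.
  Thus the bound in (A1) says that outside a band the field varies little.\<close>

lemma L2norm_D_complement:
  assumes "J \<in> R" "C \<in> R" "J \<inter> C = {}" "J \<union> C = {0..}" "s \<in> E" "t \<in> E"
  shows "L2norm P (D C s t) = L2norm P (\<lambda>\<omega>. W J s \<omega> - \<xi> s \<omega> - W J t \<omega> + \<xi> t \<omega>)"
proof -
  have "AE \<omega> in P. - D C s t \<omega> = W J s \<omega> - \<xi> s \<omega> - W J t \<omega> + \<xi> t \<omega>"
    using D_add[OF assms(1-3,5,6)] D_full[OF assms(5,6)] unfolding assms(4)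
    by eventually_elim (simp add: D_def)
  then have "L2norm P (\<lambda>\<omega>. - D C s t \<omega>) = L2norm P (\<lambda>\<omega>. W J s \<omega> - \<xi> s \<omega> - W J t \<omega> + \<xi> t \<omega>)"
    using assms E by (intro L2norm_cong_AE borel_measurable_uminus D_meas borel_measurable_diff borel_measurable_add W_meas \<xi>_meas) auto
  then show ?thesis by (simp add: L2norm_def)
qed

lemma intervals_R: "0 \<le> a \<Longrightarrow> {a..<b} \<in> R" "0 \<le> a \<Longrightarrow> {a..} \<in> R"
  by (auto simp: R_iff)

text \<open>The case of an infinite upper end in (A1): the complement of the unbounded band consists
  of the low frequencies alone, and the term \<open>inverse b\<close> vanishes.\<close>

lemma L2norm_D_low:
  assumes "s \<in> E" "t \<in> E" "a0 \<le> a"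
  shows "L2norm P (D {0..<a} s t) \<le> c0 * (\<Sum>j\<in>UNIV. a powr \<gamma> j * \<bar>s $ j - t $ j\<bar>)"
proof -
  have e: "{x. a \<le> x \<and> ereal x < \<infinity>} = {a..}" by auto
  have "L2norm P (D {0..<a} s t) = L2norm P (\<lambda>\<omega>. W {a..} s \<omega> - \<xi> s \<omega> - W {a..} t \<omega> + \<xi> t \<omega>)"
    using assms a0 by (intro L2norm_D_complement intervals_R) auto
  also have "\<dots> \<le> c0 * ((\<Sum>j\<in>UNIV. a powr \<gamma> j * \<bar>s $ j - t $ j\<bar>) + real_of_ereal (inverse \<infinity>))"
    using incr[OF assms(1,2,3), of \<infinity>] unfolding e by simp
  finally show ?thesis by simp
qed

lemma L2norm_D_band:
  assumes "s \<in> E" "t \<in> E" "a0 \<le> a" "a < b"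
  shows "L2norm P (D ({0..<a} \<union> {b..}) s t) \<le> c0 * ((\<Sum>j\<in>UNIV. a powr \<gamma> j * \<bar>s $ j - t $ j\<bar>) + 1 / b)"
proof -
  have e: "{x. a \<le> x \<and> ereal x < ereal b} = {a..<b}" by auto
  have b: "0 < b" using assms a0 by simp
  have "L2norm P (D ({0..<a} \<union> {b..}) s t) = L2norm P (\<lambda>\<omega>. W {a..<b} s \<omega> - \<xi> s \<omega> - W {a..<b} t \<omega> + \<xi> t \<omega>)"
    using assms a0 by (intro L2norm_D_complement sets.Un intervals_R) auto
  also have "\<dots> \<le> c0 * ((\<Sum>j\<in>UNIV. a powr \<gamma> j * \<bar>s $ j - t $ j\<bar>) + real_of_ereal (inverse (ereal b)))"
    using incr[OF assms(1,2,3), of "ereal b"] assms(4) unfolding e by simp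
  finally show ?thesis using b by (simp add: inverse_eq_divide)
qed

definition Cinc :: real where
  "Cinc = c0 * (real CARD('n) + (\<Sum>j\<in>UNIV. a0 powr \<gamma> j) + 1)"

lemma Cinc_pos: "0 < Cinc"
  unfolding Cinc_def using c0 by (intro mult_pos_pos add_nonneg_pos add_nonneg_nonneg sum_nonneg) auto

text \<open>The frequencies are cut at \<open>a = 1 / r\<close>, which balances the two bounds.
  Below, \<open>a powr \<gamma> j * r powr (1 + \<gamma> j) = r\<close> for each coordinate. Above,
  the high band is enlarged by the frequencies under \<open>a0\<close>, so that (A1) applies and
  gives \<open>1 / a = r\<close> plus terms in \<open>a0\<close>. The condition on \<open>r\<close>
  ensures \<open>a0 < a\<close> and \<open>r \<le> 1\<close>.\<close>

lemma L2norm_\<xi>_near: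
  assumes st: "s \<in> E" "t \<in> E" and n: "near \<gamma> r s t" and r: "0 < r" "r \<le> 1 / (a0 + 1)"
  shows "L2norm P (D {0..} s t) \<le> Cinc * r"
    and "A \<in> R \<Longrightarrow> L2norm P (D A s t) \<le> Cinc * r"
proof -
  have r1: "r \<le> 1" using r a0 by (smt (verit) divide_le_eq_1)
  define a where "a = 1 / r"
  have ra: "r * (a0 + 1) \<le> 1" using r a0 by (simp add: le_divide_eq)
  have a: "a0 < a" unfolding a_def using r ra by (simp add: less_divide_eq algebra_simps)
  have ap: "0 < a" using a a0 by simp
  have le: "\<bar>s $ j - t $ j\<bar> \<le> r powr (1 + \<gamma> j)" for j using n by (simp add: near_def)
  have "L2norm P (D {0..<a} s t) \<le> c0 * (\<Sum>j\<in>UNIV. a powr \<gamma> j * \<bar>s $ j - t $ j\<bar>)"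
    using st a by (intro L2norm_D_low) auto
  also have "\<dots> \<le> c0 * (\<Sum>j\<in>(UNIV :: 'n set). r)"
  proof (intro mult_left_mono sum_mono)
    fix j
    have "a powr \<gamma> j * \<bar>s $ j - t $ j\<bar> \<le> a powr \<gamma> j * r powr (1 + \<gamma> j)" by (intro mult_left_mono le) auto
    also have "\<dots> = r" using r by (simp add: a_def powr_divide powr_add)
    finally show "a powr \<gamma> j * \<bar>s $ j - t $ j\<bar> \<le> r" .
  qed (use c0 in auto)
  finally have 1: "L2norm P (D {0..<a} s t) \<le> c0 * (real CARD('n) * r)" by simp
  have "L2norm P (D {a..} s t) \<le> L2norm P (D ({a..} \<union> {0..<a0}) s t)"
    using st a a0 by (intro L2norm_D_mono intervals_R) auto
  also have "{a..} \<union> {0..<a0} = {0..<a0} \<union> {a..}" by auto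
  also have "L2norm P (D ({0..<a0} \<union> {a..}) s t) \<le> c0 * ((\<Sum>j\<in>UNIV. a0 powr \<gamma> j * \<bar>s $ j - t $ j\<bar>) + 1 / a)"
    using st a by (intro L2norm_D_band) auto
  also have "\<dots> \<le> c0 * ((\<Sum>j\<in>UNIV. a0 powr \<gamma> j * r) + r)"
  proof (intro mult_left_mono add_mono sum_mono)
    fix j
    have "r powr (1 + \<gamma> j) \<le> r powr 1" using r r1 less_imp_le[OF \<gamma>[of j]] by (intro powr_mono') auto
    then show "\<bar>s $ j - t $ j\<bar> \<le> r" using le[of j] r by simp
  qed (use c0 a_def in auto)
  finally have 2: "L2norm P (D {a..} s t) \<le> c0 * ((\<Sum>j\<in>UNIV. a0 powr \<gamma> j) * r + r)" by (simp add: sum_distrib_right)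
  have un: "{0..<a} \<union> {a..} = {0..}" using ap by auto
  have "L2norm P (D ({0..<a} \<union> {a..}) s t) \<le> L2norm P (D {0..<a} s t) + L2norm P (D {a..} s t)"
    using st ap by (intro L2norm_D_mono(2) intervals_R) auto
  also have "\<dots> \<le> c0 * (real CARD('n) * r) + c0 * ((\<Sum>j\<in>UNIV. a0 powr \<gamma> j) * r + r)" using 1 2 by simp
  also have "\<dots> = Cinc * r" by (simp add: Cinc_def algebra_simps)
  finally show *: "L2norm P (D {0..} s t) \<le> Cinc * r" unfolding un .
  show "L2norm P (D A s t) \<le> Cinc * r" if A: "A \<in> R"
  proof -
    have "{0..} - A \<in> R" using A intervals_R(2)[of 0] by auto
    moreover have "A \<union> ({0..} - A) = {0..}" using A R_iff by auto
    ultimately show ?thesis using L2norm_D_mono(1)[of A "{0..} - A" s t] A st * by (metis Diff_disjoint order_trans)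
  qed
qed

text \<open>The control measure is finite, so the variances of the tails decrease to the measure of
  the empty set.\<close>

lemma L2norm_W_tail_tendsto_0:
  assumes "t \<in> E"
  shows "(\<lambda>n. L2norm P (W {real n..} t)) \<longlonglongrightarrow> 0"
proof -
  have sn: "sets (\<nu> t) = R" using nW[OF assms] by (simp add: gaussian_noise_def)
  have v: "emeasure (\<nu> t) A = ennreal ((L2norm P (W A t))\<^sup>2)" if A: "A \<in> R" for A
  proof -
    obtain v where "v \<ge> 0" "emeasure (\<nu> t) A = ennreal v" "normal_rv P (W A t) 0 v" using W_normal[OF assms A] by blast
    then show ?thesis using normal_rv_square(2) by (simp add: L2norm_square)
  qed
  have "(\<lambda>n. emeasure (\<nu> t) {real n..}) \<longlonglongrightarrow> emeasure (\<nu> t) (\<Inter>n. {real n..})"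
  proof (rule Lim_emeasure_decseq)
    show "range (\<lambda>n. {real n..}) \<subseteq> sets (\<nu> t)" unfolding sn using intervals_R by auto
    show "decseq (\<lambda>n. {real n..})" by (auto simp: decseq_def)
    show "emeasure (\<nu> t) {real n..} \<noteq> \<infinity>" for n using v[OF intervals_R(2)] by simp
  qed
  moreover have "(\<Inter>n. {real n..}) = {}"
  proof -
    have "\<exists>n. \<not> real n \<le> x" for x using reals_Archimedean2[of x] by (auto simp: not_le)
    then show ?thesis by auto
  qed
  ultimately have "(\<lambda>n. ennreal ((L2norm P (W {real n..} t))\<^sup>2)) \<longlonglongrightarrow> ennreal 0"
    using v[OF intervals_R(2)] by simp
  then have "(\<lambda>n. (L2norm P (W {real n..} t))\<^sup>2) \<longlonglongrightarrow> 0"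
    by (subst (asm) tendsto_ennreal_iff) auto
  then have "(\<lambda>n. sqrt ((L2norm P (W {real n..} t))\<^sup>2)) \<longlonglongrightarrow> sqrt 0" by (intro tendsto_real_sqrt)
  then show ?thesis by (simp add: L2norm_nonneg)
qed

text \<open>Covariances across disjoint bands vanish. At a fixed cut \<open>a\<close>, the low
  frequencies contribute at most a constant times the sum of \<open>r powr (1 + \<gamma> j)\<close>,
  hence o(r). For the high ones the increment is O(r), but the factor at \<open>x0\<close> has norm
  as small as desired if \<open>a\<close> is large. So \<open>a\<close> is chosen first and
  \<open>r2\<close> afterwards.\<close>

lemma covariance_increment:
  assumes x0: "x0 \<in> E" and \<eta>: "0 < \<eta>"
  shows "\<exists>r2>0. \<forall>r s t. 0 < r \<longrightarrow> r \<le> r2 \<longrightarrow> s \<in> E \<longrightarrow> t \<in> E \<longrightarrow> near \<gamma> r s t \<longrightarrow>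
     \<bar>\<integral>\<omega>. \<xi> x0 \<omega> * (\<xi> s \<omega> - \<xi> t \<omega>) \<partial>P\<bar> \<le> \<eta> * r"
proof -
  have "\<forall>\<^sub>F n in sequentially. L2norm P (W {real n..} x0) < \<eta> / (2 * Cinc)"
    using L2norm_W_tail_tendsto_0[OF x0] \<eta> Cinc_pos by (intro order_tendstoD(2)) auto
  moreover have "\<forall>\<^sub>F n in sequentially. max a0 1 \<le> real n" using eventually_ge_at_top[of "nat \<lceil>max a0 1\<rceil>"]
    by eventually_elim linarith
  ultimately have "\<forall>\<^sub>F n in sequentially. L2norm P (W {real n..} x0) < \<eta> / (2 * Cinc) \<and> max a0 1 \<le> real n"
    by eventually_elim simp
  then obtain n where n: "L2norm P (W {real n..} x0) < \<eta> / (2 * Cinc)" "max a0 1 \<le> real n"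
    by (auto simp: eventually_sequentially)
  define a where "a = real n"
  have a: "a0 \<le> a" "1 \<le> a" using n by (auto simp: a_def)
  define K where "K = L2norm P (W {0..<a} x0)"
  have K: "0 \<le> K" by (simp add: K_def L2norm_nonneg)
  have "((\<lambda>r. K * (c0 * (\<Sum>j\<in>UNIV. a powr \<gamma> j * r powr \<gamma> j))) \<longlongrightarrow> K * (c0 * (\<Sum>j\<in>(UNIV :: 'n set). a powr \<gamma> j * 0))) (at_right 0)"
    using \<gamma> by (intro tendsto_intros tendsto_sum tendsto_mult tendsto_const tendsto_zero_powrI tendsto_ident_at)
       (auto simp: eventually_at_right_less intro!: eventually_mono[OF eventually_at_right_less])
  then have "\<forall>\<^sub>F r in at_right 0. K * (c0 * (\<Sum>j\<in>UNIV. a powr \<gamma> j * r powr \<gamma> j)) < \<eta> / 2"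
    using \<eta> by (intro order_tendstoD(2)) auto
  then obtain r3 where r3: "0 < r3" "\<And>r. 0 < r \<Longrightarrow> r < r3 \<Longrightarrow> K * (c0 * (\<Sum>j\<in>UNIV. a powr \<gamma> j * r powr \<gamma> j)) < \<eta> / 2"
    by (auto simp: eventually_at_right_field)
  define r2 where "r2 = min (r3 / 2) (1 / (a0 + 1))"
  have r2: "0 < r2" "r2 < r3" "r2 \<le> 1 / (a0 + 1)" using r3 a0 by (auto simp: r2_def min_def)
  have "\<bar>\<integral>\<omega>. \<xi> x0 \<omega> * (\<xi> s \<omega> - \<xi> t \<omega>) \<partial>P\<bar> \<le> \<eta> * r"
    if r: "0 < r" "r \<le> r2" and st: "s \<in> E" "t \<in> E" and nr: "near \<gamma> r s t" for r s t
  proof -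
    let ?L = "{0..<a}" and ?U = "{a..}"
    have LU: "?L \<in> R" "?U \<in> R" "?L \<inter> ?U = {}" "?U \<inter> ?L = {}" "?L \<union> ?U = {0..}" using a intervals_R by auto
    have "AE \<omega> in P. \<xi> x0 \<omega> * (\<xi> s \<omega> - \<xi> t \<omega>) = W ?L x0 \<omega> * D ?L s t \<omega> + W ?U x0 \<omega> * D ?L s t \<omega>
        + (W ?L x0 \<omega> * D ?U s t \<omega> + W ?U x0 \<omega> * D ?U s t \<omega>)"
      using W_add[OF x0 LU(1,2,3)] \<xi>W[OF x0] D_add[OF LU(1,2,3) st] D_full[OF st] unfolding LU(5)
      by eventually_elim (simp add: algebra_simps)
    then have "(\<integral>\<omega>. \<xi> x0 \<omega> * (\<xi> s \<omega> - \<xi> t \<omega>) \<partial>P) = (\<integral>\<omega>. W ?L x0 \<omega> * D ?L s t \<omega> + W ?U x0 \<omega> * D ?L s t \<omega>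
        + (W ?L x0 \<omega> * D ?U s t \<omega> + W ?U x0 \<omega> * D ?U s t \<omega>) \<partial>P)"
      by (intro integral_cong_AE borel_measurable_times borel_measurable_diff borel_measurable_add W_meas D_meas \<xi>_meas)
         (use x0 st LU E in auto)
    also have "\<dots> = (\<integral>\<omega>. W ?L x0 \<omega> * D ?L s t \<omega> \<partial>P) + (\<integral>\<omega>. W ?U x0 \<omega> * D ?L s t \<omega> \<partial>P)
        + ((\<integral>\<omega>. W ?L x0 \<omega> * D ?U s t \<omega> \<partial>P) + (\<integral>\<omega>. W ?U x0 \<omega> * D ?U s t \<omega> \<partial>P))"
    proof -
      have i: "integrable P (\<lambda>\<omega>. W A x0 \<omega> * D B s t \<omega>)" if "A \<in> R" "B \<in> R" for A B
        using that x0 st by (intro integrable_mult_square W_meas W_int2 D_meas D_int2)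
      show ?thesis using i LU by simp
    qed
    also have "\<dots> = (\<integral>\<omega>. W ?L x0 \<omega> * D ?L s t \<omega> \<partial>P) + (\<integral>\<omega>. W ?U x0 \<omega> * D ?U s t \<omega> \<partial>P)"
      using D_orthogonal(2)[OF LU(1,2,3) st x0] D_orthogonal(2)[OF LU(2,1,4) st x0] by simp
    finally have "\<bar>\<integral>\<omega>. \<xi> x0 \<omega> * (\<xi> s \<omega> - \<xi> t \<omega>) \<partial>P\<bar> \<le>
       \<bar>\<integral>\<omega>. W ?L x0 \<omega> * D ?L s t \<omega> \<partial>P\<bar> + \<bar>\<integral>\<omega>. W ?U x0 \<omega> * D ?U s t \<omega> \<partial>P\<bar>" by simp
    also have "\<dots> \<le> L2norm P (W ?L x0) * L2norm P (D ?L s t) + L2norm P (W ?U x0) * L2norm P (D ?U s t)"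
      using LU x0 st by (intro add_mono Cauchy_Schwarz_L2norm W_meas W_int2 D_meas D_int2)
    also have "\<dots> \<le> K * (c0 * (\<Sum>j\<in>UNIV. a powr \<gamma> j * r powr \<gamma> j) * r) + \<eta> / (2 * Cinc) * (Cinc * r)"
    proof (intro add_mono mult_mono)
      have "L2norm P (D ?L s t) \<le> c0 * (\<Sum>j\<in>UNIV. a powr \<gamma> j * \<bar>s $ j - t $ j\<bar>)"
        using st a by (intro L2norm_D_low)
      also have "\<dots> \<le> c0 * (\<Sum>j\<in>UNIV. a powr \<gamma> j * r powr (1 + \<gamma> j))"
        using nr c0 by (intro mult_left_mono sum_mono) (auto simp: near_def)
      also have "\<dots> = c0 * (\<Sum>j\<in>UNIV. a powr \<gamma> j * r powr \<gamma> j) * r"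
        using r by (simp add: powr_add sum_distrib_right sum_distrib_left mult_ac)
      finally show "L2norm P (D ?L s t) \<le> c0 * (\<Sum>j\<in>UNIV. a powr \<gamma> j * r powr \<gamma> j) * r" .
      show "L2norm P (D ?U s t) \<le> Cinc * r" using L2norm_\<xi>_near(2)[OF st nr r(1)] r r2 LU by simp
      show "L2norm P (W ?U x0) \<le> \<eta> / (2 * Cinc)" using n by (simp add: a_def)
      show "L2norm P (W ?L x0) \<le> K" by (simp add: K_def)
    qed (use K L2norm_nonneg \<eta> Cinc_pos in auto)
    also have "\<dots> = K * (c0 * (\<Sum>j\<in>UNIV. a powr \<gamma> j * r powr \<gamma> j)) * r + \<eta> / 2 * r"
      using Cinc_pos by simp
    also have "\<dots> \<le> \<eta> / 2 * r + \<eta> / 2 * r"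
      using r3(2)[of r] r r2 by (intro add_mono mult_right_mono) auto
    finally show ?thesis by simp
  qed
  then show ?thesis using r2(1) by blast
qed

end

text \<open>Two conditions restrict the side \<open>\<tau>\<close>: the first one is that of
  \<open>near_parent\<close>, and \<open>\<tau>_small\<close> keeps the whole patch so close to the
  corner that the increments from it have norm at most \<open>d0 / 2\<close>.\<close>

locale patch = noise P \<xi> E \<gamma> W \<nu> a0 c0
  for P :: "'v measure" and \<xi> :: "real ^ 'n \<Rightarrow> 'v \<Rightarrow> real" and E and \<gamma> :: "'n::finite \<Rightarrow> real" and W \<nu> a0 c0 +
  fixes x0 :: "real ^ 'n" and \<tau> d0 :: real and \<kappa> :: nat
  assumes \<kappa>: "1 \<le> \<kappa>" "(\<Sum>j\<in>UNIV. 1 + \<gamma> j) = real \<kappa>"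
    and \<tau>: "0 < \<tau>" "\<And>j. 2 * \<tau> * 2 powr (1 + \<gamma> j) \<le> 1"
    and \<tau>_small: "\<And>j. \<tau> \<le> min (1 / (a0 + 1)) (d0 / (2 * Cinc)) powr (1 + \<gamma> j)"
    and pt_E: "\<And>t. (\<And>j. x0 $ j \<le> t $ j \<and> t $ j < x0 $ j + \<tau>) \<Longrightarrow> t \<in> E"
    and d0: "0 < d0" "d0 \<le> L2norm P (\<xi> x0)"

sublocale patch \<subseteq> T: tree "cells \<gamma>" "parent \<gamma>" "\<lambda>m. \<Prod>j\<in>UNIV. 2 ^ (lv \<gamma> j (Suc m) - lv \<gamma> j m)" \<kappa> "2 ^ CARD('n)"
  by (rule tree_cells) (use \<gamma> \<kappa> in auto)

context patch begin

abbreviation "p \<equiv> pt \<gamma> x0 \<tau>"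

lemma p_E: "x \<in> T.nodes \<Longrightarrow> p x \<in> E"
  using pt_bounds[OF \<tau>(1)] by (cases x) (auto simp: T.nodes_def intro!: pt_E)

lemma p_orthant: "x \<in> T.nodes \<Longrightarrow> p x \<in> orthant"
  using p_E E by blast

definition root :: "nat \<times> ('n \<Rightarrow> nat)" where
  "root = (0, \<lambda>_. 0)"

lemma root: "root \<in> T.nodes" "p root = x0"
  by (auto simp: root_def T.nodes_def cells_def pt_def vec_eq_iff)

lemma x0_E: "x0 \<in> E"
  using p_E[OF root(1)] root(2) by simp

lemma near_edge: "i \<in> cells \<gamma> (Suc l) \<Longrightarrow> near \<gamma> ((1 / 2) ^ Suc l) (p (Suc l, i)) (p (l, parent \<gamma> l i))"
  by (rule near_parent) (use \<gamma> \<tau> in auto)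

lemma edge_nodes:
  "i \<in> cells \<gamma> (Suc l) \<Longrightarrow> p (Suc l, i) \<in> E" "i \<in> cells \<gamma> (Suc l) \<Longrightarrow> p (l, parent \<gamma> l i) \<in> E"
  using p_E T.par_I by (auto simp: T.nodes_def)

text \<open>From this level on the size of a cell is in the range where
  \<open>L2norm_\<xi>_near\<close> applies.\<close>

definition m0 :: nat where
  "m0 = (LEAST m. (1 / 2) ^ m \<le> 1 / (a0 + 1))"

lemma m0: "m0 \<le> l \<Longrightarrow> (1 / 2 :: real) ^ l \<le> 1 / (a0 + 1)"
proof -
  have "\<exists>m. (1 / 2 :: real) ^ m < 1 / (a0 + 1)" using a0 by (intro real_arch_pow_inv) auto
  then have "\<exists>m. (1 / 2 :: real) ^ m \<le> 1 / (a0 + 1)" by (blast intro: less_imp_le)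
  then have "(1 / 2 :: real) ^ m0 \<le> 1 / (a0 + 1)" unfolding m0_def by (rule LeastI_ex)
  moreover assume "m0 \<le> l"
  then have "(1 / 2 :: real) ^ l \<le> (1 / 2) ^ m0" by (intro power_decreasing) auto
  ultimately show ?thesis by linarith
qed

definition Bmom :: real where
  "Bmom = moment_const \<kappa> * Cinc"

lemma Bmom_nonneg: "0 \<le> Bmom"
  unfolding Bmom_def moment_const_def using Cinc_pos by (intro mult_nonneg_nonneg) auto

lemma moment_edge:
  assumes A: "A \<in> R" and i: "i \<in> cells \<gamma> (Suc l)" and l: "m0 \<le> l"
    and X: "X \<in> borel_measurable P" "AE \<omega> in P. X \<omega> = D A (p (Suc l, i)) (p (l, parent \<gamma> l i)) \<omega>"
  shows "(\<integral>\<^sup>+\<omega>. ennreal (X \<omega> ^ (2 * \<kappa>)) \<partial>P) \<le> ennreal ((Bmom * (1 / 2) ^ Suc l) ^ (2 * \<kappa>))"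
    and "L2norm P (D A (p (Suc l, i)) (p (l, parent \<gamma> l i))) \<le> a \<Longrightarrow>
      (\<integral>\<^sup>+\<omega>. ennreal (X \<omega> ^ (2 * \<kappa>)) \<partial>P) \<le> ennreal ((moment_const \<kappa> * a) ^ (2 * \<kappa>))"
proof -
  let ?D = "D A (p (Suc l, i)) (p (l, parent \<gamma> l i))"
  obtain v where v: "normal_rv P ?D 0 v" using D_normal[OF A edge_nodes[OF i]] by blast
  have e: "(\<integral>\<^sup>+\<omega>. ennreal (X \<omega> ^ (2 * \<kappa>)) \<partial>P) = (\<integral>\<^sup>+\<omega>. ennreal (?D \<omega> ^ (2 * \<kappa>)) \<partial>P)"
    using X(2) by (intro nn_integral_cong_AE) auto
  show *: "(\<integral>\<^sup>+\<omega>. ennreal (X \<omega> ^ (2 * \<kappa>)) \<partial>P) \<le> ennreal ((moment_const \<kappa> * a) ^ (2 * \<kappa>))"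
    if "L2norm P ?D \<le> a" for a
    unfolding e by (rule nn_integral_normal_power_le[OF v \<kappa>(1) that])
  have "L2norm P ?D \<le> Cinc * (1 / 2) ^ Suc l"
    using m0[of "Suc l"] l by (intro L2norm_\<xi>_near(2)[OF edge_nodes[OF i] near_edge[OF i]] A) auto
  from *[OF this] show "(\<integral>\<^sup>+\<omega>. ennreal (X \<omega> ^ (2 * \<kappa>)) \<partial>P) \<le> ennreal ((Bmom * (1 / 2) ^ Suc l) ^ (2 * \<kappa>))"
    by (simp add: Bmom_def mult.assoc)
qed

lemma moment_bound_\<xi>: "m0 \<le> n \<Longrightarrow> T.moment_bound P (\<lambda>x. \<xi> (p x)) n Bmom"
  unfolding T.moment_bound_def
proof (intro conjI ballI allI impI)
  fix l i assume n: "m0 \<le> n" and l: "n \<le> l" and i: "i \<in> cells \<gamma> (Suc l)"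
  show "(\<integral>\<^sup>+\<omega>. ennreal (T.edge (\<lambda>x. \<xi> (p x) \<omega>) l i ^ (2 * \<kappa>)) \<partial>P) \<le> ennreal ((Bmom * (1 / 2) ^ Suc l) ^ (2 * \<kappa>))"
  proof (rule moment_edge(1)[OF intervals_R(2)[OF order_refl] i])
    show "AE \<omega> in P. T.edge (\<lambda>x. \<xi> (p x) \<omega>) l i = D {0..} (p (Suc l, i)) (p (l, parent \<gamma> l i)) \<omega>"
      using D_full[OF edge_nodes[OF i]] by eventually_elim (simp add: T.edge_def)
    show "(\<lambda>\<omega>. T.edge (\<lambda>x. \<xi> (p x) \<omega>) l i) \<in> borel_measurable P"
      unfolding T.edge_def using edge_nodes[OF i] E by (intro borel_measurable_diff \<xi>_meas) auto
  qed (use n l in auto)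
qed (use Bmom_nonneg p_orthant \<xi>_meas in auto)

lemma moment_bound_W:
  assumes A: "A \<in> R" and n: "m0 \<le> n"
  shows "T.moment_bound P (\<lambda>x. W A (p x)) n Bmom"
  unfolding T.moment_bound_def
proof (intro conjI ballI allI impI)
  fix l i assume l: "n \<le> l" and i: "i \<in> cells \<gamma> (Suc l)"
  show "(\<integral>\<^sup>+\<omega>. ennreal (T.edge (\<lambda>x. W A (p x) \<omega>) l i ^ (2 * \<kappa>)) \<partial>P) \<le> ennreal ((Bmom * (1 / 2) ^ Suc l) ^ (2 * \<kappa>))"
  proof (rule moment_edge(1)[OF A i])
    show "(\<lambda>\<omega>. T.edge (\<lambda>x. W A (p x) \<omega>) l i) \<in> borel_measurable P"
      unfolding T.edge_def using edge_nodes[OF i] A by (intro borel_measurable_diff W_meas) auto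
  qed (use n l in \<open>auto simp: T.edge_def D_def\<close>)
qed (use Bmom_nonneg p_E W_meas A in auto)

lemma edge_complement:
  assumes J: "J \<in> R" "C \<in> R" "J \<inter> C = {}" "J \<union> C = {0..}" and i: "i \<in> cells \<gamma> (Suc l)"
  shows "AE \<omega> in P. T.edge (\<lambda>x. \<xi> (p x) \<omega> - W J (p x) \<omega>) l i = D C (p (Suc l, i)) (p (l, parent \<gamma> l i)) \<omega>"
    and "(\<lambda>\<omega>. T.edge (\<lambda>x. \<xi> (p x) \<omega> - W J (p x) \<omega>) l i) \<in> borel_measurable P"
proof -
  show "AE \<omega> in P. T.edge (\<lambda>x. \<xi> (p x) \<omega> - W J (p x) \<omega>) l i = D C (p (Suc l, i)) (p (l, parent \<gamma> l i)) \<omega>"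
    using D_full[OF edge_nodes[OF i]] D_add[OF J(1-3) edge_nodes[OF i]] unfolding J(4)
    by eventually_elim (simp add: T.edge_def D_def)
  show "(\<lambda>\<omega>. T.edge (\<lambda>x. \<xi> (p x) \<omega> - W J (p x) \<omega>) l i) \<in> borel_measurable P"
    unfolding T.edge_def using edge_nodes[OF i] J E by (intro borel_measurable_diff W_meas \<xi>_meas) auto
qed

lemma moment_bound_complement:
  assumes J: "J \<in> R" "C \<in> R" "J \<inter> C = {}" "J \<union> C = {0..}" and n: "m0 \<le> n"
  shows "T.moment_bound P (\<lambda>x \<omega>. \<xi> (p x) \<omega> - W J (p x) \<omega>) n Bmom"
  unfolding T.moment_bound_def
proof (intro conjI ballI allI impI)
  fix l i assume l: "n \<le> l" and i: "i \<in> cells \<gamma> (Suc l)"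
  show "(\<integral>\<^sup>+\<omega>. ennreal (T.edge (\<lambda>x. \<xi> (p x) \<omega> - W J (p x) \<omega>) l i ^ (2 * \<kappa>)) \<partial>P) \<le> ennreal ((Bmom * (1 / 2) ^ Suc l) ^ (2 * \<kappa>))"
    using n l by (intro moment_edge(1)[OF J(2) i] edge_complement[OF J i]) auto
qed (use Bmom_nonneg p_E p_orthant W_meas \<xi>_meas J in auto)

lemma gaussian_family_W:
  assumes "A \<in> R"
  shows "gaussian_family P T.nodes (\<lambda>x. W A (p x))"
proof -
  have "gaussian_family P (R \<times> E) (\<lambda>(A, t). W A t)"
    using W_mean(1) by (intro gaussian_field_gaussian_family gW_E) auto
  from gaussian_family_linear[OF this, of T.nodes "\<lambda>x. {(A, p x)}" "\<lambda>_ _. 1"]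
  show ?thesis using assms p_E by auto
qed

lemma gaussian_family_\<xi>: "gaussian_family P T.nodes (\<lambda>x. \<xi> (p x))"
proof -
  have "gaussian_family P orthant \<xi>"
    using \<xi>_mean by (intro gaussian_field_gaussian_family gf) auto
  from gaussian_family_linear[OF this, of T.nodes "\<lambda>x. {p x}" "\<lambda>_ _. 1"]
  show ?thesis using p_orthant by auto
qed

text \<open>Both oscillations are measurable functions of the sample paths of \<open>W A\<close> and
  \<open>W B\<close>, so they inherit the independence of these fields.\<close>

lemma osc_W_indep:
  assumes "A \<in> R" "B \<in> R" "A \<inter> B = {}"
  shows "measure P {\<omega> \<in> space P. T.osc l i (\<lambda>x. W A (p x) \<omega>) \<le> a \<and> T.osc l' i' (\<lambda>x. W B (p x) \<omega>) \<le> a'} =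
       measure P {\<omega> \<in> space P. T.osc l i (\<lambda>x. W A (p x) \<omega>) \<le> a} * measure P {\<omega> \<in> space P. T.osc l' i' (\<lambda>x. W B (p x) \<omega>) \<le> a'}"
proof -
  have ind: "indep_var (path_space orthant) (sample_path orthant (W A)) (path_space orthant) (sample_path orthant (W B))"
    using iW[OF assms] by (simp add: indep_fields_def)
  let ?S = "\<lambda>l i a. {f \<in> space (path_space orthant). T.osc l i (\<lambda>x. f (p x)) \<le> a}"
  have m: "?S l i a \<in> sets (path_space orthant)" for l i a
  proof -
    have "(\<lambda>f. T.osc l i (\<lambda>x. f (p x))) \<in> borel_measurable (path_space orthant)"
      unfolding path_space_def using p_orthant by (intro T.osc_measurable measurable_component_singleton)
    then show ?thesis by measurable
  qed
  have s: "sample_path orthant (W A') \<omega> \<in> ?S l i a \<longleftrightarrow> T.osc l i (\<lambda>x. W A' (p x) \<omega>) \<le> a" for A' \<omega> l i a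
  proof -
    have "T.osc l i (\<lambda>x. sample_path orthant (W A') \<omega> (p x)) = T.osc l i (\<lambda>x. W A' (p x) \<omega>)"
      using p_orthant by (intro T.osc_cong) (simp add: sample_path_def)
    moreover have "sample_path orthant (W A') \<omega> \<in> space (path_space orthant)"
      by (simp add: path_space_def space_PiM sample_path_def)
    ultimately show ?thesis by simp
  qed
  have "(\<lambda>\<omega>. (sample_path orthant (W A) \<omega>, sample_path orthant (W B) \<omega>)) -` (?S l i a \<times> ?S l' i' a') \<inter> space P =
     {\<omega> \<in> space P. T.osc l i (\<lambda>x. W A (p x) \<omega>) \<le> a \<and> T.osc l' i' (\<lambda>x. W B (p x) \<omega>) \<le> a'}"
    unfolding vimage_def mem_Sigma_iff s by auto
  moreover have "sample_path orthant (W A') -` ?S l i a \<inter> space P = {\<omega> \<in> space P. T.osc l i (\<lambda>x. W A' (p x) \<omega>) \<le> a}" for A' l i a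
    unfolding vimage_def s by auto
  ultimately show ?thesis using indep_varD[OF ind m m, of l i a l' i' a'] by simp
qed

text \<open>The band \<open>J s\<close> reaches from \<open>a s\<close> to
  \<open>2 ^ (2 * L)\<close> times \<open>a s\<close>, and the scale \<open>n s\<close> sits at its
  logarithmic middle. At this scale the frequencies below the band contribute
  \<open>((1 / 2) ^ L) powr \<gamma> j\<close> and those above \<open>(1 / 2) ^ L\<close>, relative
  to the size 2^-n. Both are small for large \<open>L\<close>, while the bands for different
  \<open>s\<close> stay disjoint.\<close>

lemma decomposable_\<xi>: "T.decomposable P (\<lambda>x. \<xi> (p x)) Bmom"
  unfolding T.decomposable_def
proof (intro allI impI)
  fix q n0 :: nat and \<theta> :: real assume \<theta>: "0 < \<theta>"
  let ?g = "moment_const \<kappa>"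
  have g: "1 \<le> ?g" by (simp add: moment_const_def)
  have "(\<lambda>L. ?g * (c0 * ((\<Sum>j\<in>(UNIV :: 'n set). ((1 / 2) ^ L) powr \<gamma> j) + (1 / 2 :: real) ^ L))) \<longlonglongrightarrow>
      ?g * (c0 * ((\<Sum>j\<in>(UNIV :: 'n set). 0 powr \<gamma> j) + 0))"
    using \<gamma> by (intro tendsto_mult tendsto_const tendsto_add tendsto_sum tendsto_powr2 LIMSEQ_power_zero) (auto intro: less_imp_le)
  then have "\<forall>\<^sub>F L in sequentially. ?g * (c0 * ((\<Sum>j\<in>(UNIV :: 'n set). ((1 / 2) ^ L) powr \<gamma> j) + (1 / 2 :: real) ^ L)) < \<theta>"
    using \<theta> by (intro order_tendstoD(2)) auto
  then obtain L0 where L0: "\<And>L. L0 \<le> L \<Longrightarrow> ?g * (c0 * ((\<Sum>j\<in>(UNIV :: 'n set). ((1 / 2) ^ L) powr \<gamma> j) + (1 / 2 :: real) ^ L)) < \<theta>"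
    by (auto simp: eventually_sequentially)
  define L where "L = Suc L0"
  have L: "?g * (c0 * ((\<Sum>j\<in>(UNIV :: 'n set). ((1 / 2) ^ L) powr \<gamma> j) + (1 / 2 :: real) ^ L)) < \<theta>" "1 \<le> L"
    using L0[of L] by (auto simp: L_def)
  \<comment> \<open>Starting here places every band above \<open>a0\<close> and every scale in the
    range of the moment bounds.\<close>
  define M0 where "M0 = max n0 m0"
  define a where "a s = (2 :: real) ^ (M0 + 2 * L * s)" for s
  define n where "n s = M0 + 2 * L * s + L" for s
  define J where "J s = {a s..<a (Suc s)}" for s
  define C where "C s = {0..<a s} \<union> {a (Suc s)..}" for s
  have a_pos: "0 < a s" for s by (simp add: a_def)
  have a_Suc: "a s < a (Suc s)" for s unfolding a_def using L(2) by (intro power_strict_increasing) auto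
  have a_mono: "s < t \<Longrightarrow> a (Suc s) \<le> a t" for s t
    unfolding a_def by (intro power_increasing) (auto simp flip: mult_Suc_right)
  have a_a0: "a0 \<le> a s" for s
  proof -
    have "(1 / 2 :: real) ^ m0 \<le> 1 / (a0 + 1)" by (rule m0) simp
    then have "a0 + 1 \<le> 2 ^ m0" using a0 by (simp add: power_one_over divide_simps)
    also have "\<dots> \<le> a s" unfolding a_def M0_def by (intro power_increasing) auto
    finally show ?thesis by simp
  qed
  have JR: "J s \<in> R" for s unfolding J_def by (rule intervals_R(1)[OF less_imp_le[OF a_pos]])
  have CR: "C s \<in> R" for s unfolding C_def by (intro sets.Un intervals_R) (simp_all add: less_imp_le a_pos)
  have JCd: "J s \<inter> C s = {}" for s by (auto simp: J_def C_def)
  have JCu: "J s \<union> C s = {0..}" for s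
    using a_pos[of s] a_Suc[of s] by (auto simp: J_def C_def)
  note JC = JR CR JCd JCu
  have Jdisj: "J s \<inter> J t = {}" if "s \<noteq> t" for s t
    using a_mono[of s t] a_mono[of t s] that by (cases s t rule: linorder_cases) (auto simp: J_def)
  show "\<exists>n V. (\<forall>s. n0 \<le> n s \<and> n s < n (Suc s)) \<and>
     (\<forall>s. gaussian_family P T.nodes (V s) \<and> T.moment_bound P (V s) (n s) Bmom \<and>
        T.moment_bound P (\<lambda>x \<omega>. \<xi> (p x) \<omega> - V s x \<omega>) (n s) Bmom \<and>
        (\<forall>m<q. \<forall>i'\<in>cells \<gamma> (Suc (n s + m)).
          (\<integral>\<^sup>+\<omega>. ennreal (T.edge (\<lambda>x. \<xi> (p x) \<omega> - V s x \<omega>) (n s + m) i' ^ (2 * \<kappa>)) \<partial>P) \<le> ennreal ((\<theta> * (1 / 2) ^ n s) ^ (2 * \<kappa>)))) \<and>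
     (\<forall>s t l l' i i' a a'. s \<noteq> t \<longrightarrow>
       measure P {\<omega> \<in> space P. T.osc l i (\<lambda>x. V s x \<omega>) \<le> a \<and> T.osc l' i' (\<lambda>x. V t x \<omega>) \<le> a'} =
       measure P {\<omega> \<in> space P. T.osc l i (\<lambda>x. V s x \<omega>) \<le> a} * measure P {\<omega> \<in> space P. T.osc l' i' (\<lambda>x. V t x \<omega>) \<le> a'})"
  proof (intro exI[of _ n] exI[of _ "\<lambda>s x. W (J s) (p x)"] conjI allI impI ballI)
    fix s
    show "n0 \<le> n s" "n s < n (Suc s)" using L(2) by (auto simp: n_def M0_def)
    show "gaussian_family P T.nodes (\<lambda>x. W (J s) (p x))" by (rule gaussian_family_W[OF JC(1)])
    have nm: "m0 \<le> n s" by (auto simp: n_def M0_def)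
    show "T.moment_bound P (\<lambda>x. W (J s) (p x)) (n s) Bmom" by (rule moment_bound_W[OF JC(1) nm])
    show "T.moment_bound P (\<lambda>x \<omega>. \<xi> (p x) \<omega> - W (J s) (p x) \<omega>) (n s) Bmom"
      by (rule moment_bound_complement[OF JC nm])
    fix m i' assume i': "i' \<in> cells \<gamma> (Suc (n s + m))"
    let ?s = "p (Suc (n s + m), i')" and ?t = "p (n s + m, parent \<gamma> (n s + m) i')"
    let ?h = "(1 / 2 :: real) ^ n s"
    have "L2norm P (D (C s) ?s ?t) \<le> c0 * ((\<Sum>j\<in>UNIV. a s powr \<gamma> j * \<bar>?s $ j - ?t $ j\<bar>) + 1 / a (Suc s))"
      unfolding C_def using edge_nodes[OF i'] a_a0 a_Suc by (intro L2norm_D_band)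
    also have "\<dots> \<le> c0 * ((\<Sum>j\<in>(UNIV :: 'n set). ((1 / 2) ^ L) powr \<gamma> j * ?h) + (1 / 2) ^ L * ?h)"
    proof (intro mult_left_mono add_mono sum_mono)
      fix j
      have "\<bar>?s $ j - ?t $ j\<bar> \<le> ((1 / 2) ^ Suc (n s + m)) powr (1 + \<gamma> j)"
        using near_edge[OF i'] by (simp only: near_def)
      also have "\<dots> \<le> ?h powr (1 + \<gamma> j)"
        using \<gamma>[of j] by (intro powr_mono2 power_decreasing) auto
      finally have "a s powr \<gamma> j * \<bar>?s $ j - ?t $ j\<bar> \<le> a s powr \<gamma> j * ?h powr (1 + \<gamma> j)" by (intro mult_left_mono) auto
      also have "\<dots> = (a s * ?h) powr \<gamma> j * ?h" using a_pos[of s] by (simp add: powr_mult powr_add)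
      also have "a s * ?h = (1 / 2) ^ L"
      proof -
        have "?h = (1 / 2) ^ (M0 + 2 * L * s) * (1 / 2) ^ L" by (simp only: n_def power_add)
        then show ?thesis by (simp add: a_def power_one_over)
      qed
      finally show "a s powr \<gamma> j * \<bar>?s $ j - ?t $ j\<bar> \<le> ((1 / 2) ^ L) powr \<gamma> j * ?h" .
    next
      have "M0 + 2 * L * Suc s = n s + L" by (simp add: n_def)
      then have "1 / a (Suc s) = (1 / 2) ^ (n s + L)" by (simp only: a_def power_one_over)
      then show "1 / a (Suc s) \<le> (1 / 2) ^ L * ?h" by (simp only: power_add mult.commute order_refl)
    qed (use c0 in auto)
    also have "\<dots> = c0 * ((\<Sum>j\<in>(UNIV :: 'n set). ((1 / 2) ^ L) powr \<gamma> j) + (1 / 2) ^ L) * ?h"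
      by (simp add: sum_distrib_right distrib_right)
    finally have "L2norm P (D (C s) ?s ?t) \<le> c0 * ((\<Sum>j\<in>(UNIV :: 'n set). ((1 / 2) ^ L) powr \<gamma> j) + (1 / 2) ^ L) * ?h" .
    from moment_edge(2)[OF JC(2) i' _ edge_complement(2,1)[OF JC i'] this]
    have "(\<integral>\<^sup>+\<omega>. ennreal (T.edge (\<lambda>x. \<xi> (p x) \<omega> - W (J s) (p x) \<omega>) (n s + m) i' ^ (2 * \<kappa>)) \<partial>P) \<le>
       ennreal ((?g * (c0 * ((\<Sum>j\<in>(UNIV :: 'n set). ((1 / 2) ^ L) powr \<gamma> j) + (1 / 2) ^ L) * ?h)) ^ (2 * \<kappa>))"
      using nm by simp
    also have "\<dots> \<le> ennreal ((\<theta> * ?h) ^ (2 * \<kappa>))"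
    proof (intro ennreal_leI power_mono)
      have "?g * (c0 * ((\<Sum>j\<in>(UNIV :: 'n set). ((1 / 2) ^ L) powr \<gamma> j) + (1 / 2) ^ L)) * ?h \<le> \<theta> * ?h"
        using L(1) by (intro mult_right_mono) auto
      then show "?g * (c0 * ((\<Sum>j\<in>(UNIV :: 'n set). ((1 / 2) ^ L) powr \<gamma> j) + (1 / 2) ^ L) * ?h) \<le> \<theta> * ?h"
        by (simp only: mult.assoc)
    qed (use g c0 in \<open>auto intro!: mult_nonneg_nonneg add_nonneg_nonneg sum_nonneg\<close>)
    finally show "(\<integral>\<^sup>+\<omega>. ennreal (T.edge (\<lambda>x. \<xi> (p x) \<omega> - W (J s) (p x) \<omega>) (n s + m) i' ^ (2 * \<kappa>)) \<partial>P) \<le>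
       ennreal ((\<theta> * ?h) ^ (2 * \<kappa>))" .
  next
    fix s t l l' i i' a a' assume "s \<noteq> (t :: nat)"
    then show "measure P {\<omega> \<in> space P. T.osc l i (\<lambda>x. W (J s) (p x) \<omega>) \<le> a \<and> T.osc l' i' (\<lambda>x. W (J t) (p x) \<omega>) \<le> a'} =
       measure P {\<omega> \<in> space P. T.osc l i (\<lambda>x. W (J s) (p x) \<omega>) \<le> a} * measure P {\<omega> \<in> space P. T.osc l' i' (\<lambda>x. W (J t) (p x) \<omega>) \<le> a'}"
      using JC(1) Jdisj by (intro osc_W_indep) auto
  qed
qed

section \<open>Regression on the value at the corner\<close>

definition \<alpha> :: "nat \<times> ('n \<Rightarrow> nat) \<Rightarrow> real" where
  "\<alpha> x = (\<integral>\<omega>. \<xi> x0 \<omega> * \<xi> (p x) \<omega> \<partial>P) / (\<integral>\<omega>. (\<xi> x0 \<omega>)\<^sup>2 \<partial>P)"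

lemma var_x0: "d0\<^sup>2 \<le> (\<integral>\<omega>. (\<xi> x0 \<omega>)\<^sup>2 \<partial>P)" "0 < (\<integral>\<omega>. (\<xi> x0 \<omega>)\<^sup>2 \<partial>P)"
proof -
  have "d0\<^sup>2 \<le> (L2norm P (\<xi> x0))\<^sup>2" using d0 by (intro power_mono) auto
  then show "d0\<^sup>2 \<le> (\<integral>\<omega>. (\<xi> x0 \<omega>)\<^sup>2 \<partial>P)" by (simp add: L2norm_square)
  then show "0 < (\<integral>\<omega>. (\<xi> x0 \<omega>)\<^sup>2 \<partial>P)" using d0 by (smt (verit) zero_less_power)
qed

lemma x0_orthant: "x0 \<in> orthant"
  using x0_E E by blast

lemma cov_diff:
  assumes "s \<in> orthant" "t \<in> orthant"
  shows "(\<integral>\<omega>. \<xi> x0 \<omega> * (\<xi> s \<omega> - \<xi> t \<omega>) \<partial>P) = (\<integral>\<omega>. \<xi> x0 \<omega> * \<xi> s \<omega> \<partial>P) - (\<integral>\<omega>. \<xi> x0 \<omega> * \<xi> t \<omega> \<partial>P)"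
proof -
  have "integrable P (\<lambda>\<omega>. \<xi> x0 \<omega> * \<xi> u \<omega>)" if "u \<in> orthant" for u
    using that x0_orthant by (intro integrable_mult_square \<xi>_meas \<xi>_int2)
  then show ?thesis using assms by (simp add: right_diff_distrib)
qed

text \<open>By Cauchy-Schwarz the covariance with the corner differs from the variance at the corner
  by at most half of the latter. A lower bound for \<open>\<alpha>\<close> is what lets the density
  of the corner value, given the residual, bound the density of the value at
  \<open>p x\<close>.\<close>

lemma \<alpha>_ge:
  assumes x: "x \<in> T.nodes"
  shows "1 / 2 \<le> \<alpha> x"
proof -
  define r where "r = min (1 / (a0 + 1)) (d0 / (2 * Cinc))"
  have r: "0 < r" "r \<le> 1 / (a0 + 1)" "Cinc * r \<le> d0 / 2"
  proof -
    show "0 < r" "r \<le> 1 / (a0 + 1)" using a0 d0 Cinc_pos by (auto simp: r_def)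
    have "Cinc * r \<le> Cinc * (d0 / (2 * Cinc))" using Cinc_pos by (intro mult_left_mono) (auto simp: r_def)
    then show "Cinc * r \<le> d0 / 2" using Cinc_pos by simp
  qed
  have nr: "near \<gamma> r (p x) x0"
    unfolding near_def
  proof
    fix j
    have "x0 $ j \<le> p x $ j" "p x $ j < x0 $ j + \<tau>"
      using x pt_bounds[OF \<tau>(1), of "snd x" \<gamma> "fst x"] by (auto simp: T.nodes_def)
    then show "\<bar>p x $ j - x0 $ j\<bar> \<le> r powr (1 + \<gamma> j)" using \<tau>_small[of j] unfolding r_def by linarith
  qed
  let ?v = "\<integral>\<omega>. (\<xi> x0 \<omega>)\<^sup>2 \<partial>P" and ?n = "L2norm P (\<xi> x0)"
  have v: "?v = ?n * ?n" using L2norm_square[of P "\<xi> x0"] by (simp add: power2_eq_square)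
  have "\<bar>\<integral>\<omega>. \<xi> x0 \<omega> * (\<xi> (p x) \<omega> - \<xi> x0 \<omega>) \<partial>P\<bar> \<le> ?n * L2norm P (\<lambda>\<omega>. \<xi> (p x) \<omega> - \<xi> x0 \<omega>)"
  proof (rule Cauchy_Schwarz_L2norm)
    obtain v where "normal_rv P (\<lambda>\<omega>. \<xi> (p x) \<omega> - \<xi> x0 \<omega>) 0 v"
      using gaussian_field_diff_normal[OF gf \<xi>_mean p_orthant[OF x] x0_orthant] by blast
    then show "integrable P (\<lambda>\<omega>. (\<xi> (p x) \<omega> - \<xi> x0 \<omega>)\<^sup>2)" by (rule normal_rv_square(1))
  qed (use x0_orthant p_orthant[OF x] \<xi>_meas \<xi>_int2 in auto)
  also have "L2norm P (\<lambda>\<omega>. \<xi> (p x) \<omega> - \<xi> x0 \<omega>) = L2norm P (D {0..} (p x) x0)"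
    using D_full[OF p_E[OF x] x0_E] x0_orthant p_orthant[OF x] x0_E p_E[OF x]
    by (intro L2norm_cong_AE borel_measurable_diff \<xi>_meas D_meas intervals_R) auto
  also have "?n * L2norm P (D {0..} (p x) x0) \<le> ?n * (Cinc * r)"
    by (intro mult_left_mono L2norm_nonneg L2norm_\<xi>_near(1)[OF p_E[OF x] x0_E nr r(1,2)])
  also have "\<dots> \<le> ?n * (?n / 2)" using r(3) d0 L2norm_nonneg by (intro mult_left_mono) auto
  finally have "\<bar>\<integral>\<omega>. \<xi> x0 \<omega> * (\<xi> (p x) \<omega> - \<xi> x0 \<omega>) \<partial>P\<bar> \<le> ?v / 2" by (simp add: v)
  moreover have "(\<integral>\<omega>. \<xi> x0 \<omega> * (\<xi> (p x) \<omega> - \<xi> x0 \<omega>) \<partial>P) = (\<integral>\<omega>. \<xi> x0 \<omega> * \<xi> (p x) \<omega> \<partial>P) - ?v"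
    using cov_diff[OF p_orthant[OF x] x0_orthant] by (simp add: power2_eq_square)
  ultimately have "?v / 2 \<le> (\<integral>\<omega>. \<xi> x0 \<omega> * \<xi> (p x) \<omega> \<partial>P)" by linarith
  then show ?thesis unfolding \<alpha>_def using var_x0(2) by (simp add: pos_le_divide_eq)
qed

text \<open>This is o(r) in place of O(r): at fine levels a bounded multiple of
  \<open>\<alpha>\<close> oscillates less than any given fraction of the cell size, so residual and
  field have small oscillation together.\<close>

lemma \<alpha>_edge:
  assumes \<eta>: "0 < \<eta>"
  shows "\<exists>n1. \<forall>l\<ge>n1. \<forall>i\<in>cells \<gamma> (Suc l). \<bar>T.edge \<alpha> l i\<bar> \<le> \<eta> * (1 / 2) ^ Suc l"
proof -
  let ?v = "\<integral>\<omega>. (\<xi> x0 \<omega>)\<^sup>2 \<partial>P"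
  have v: "0 < ?v" by (rule var_x0)
  from covariance_increment[OF x0_E mult_pos_pos[OF \<eta> v]] obtain r2 where r2: "0 < r2" and
    cv: "\<And>r s t. 0 < r \<Longrightarrow> r \<le> r2 \<Longrightarrow> s \<in> E \<Longrightarrow> t \<in> E \<Longrightarrow> near \<gamma> r s t \<Longrightarrow>
     \<bar>\<integral>\<omega>. \<xi> x0 \<omega> * (\<xi> s \<omega> - \<xi> t \<omega>) \<partial>P\<bar> \<le> \<eta> * ?v * r" by blast
  obtain n1 where n1: "(1 / 2 :: real) ^ n1 < r2" using real_arch_pow_inv[OF r2, of "1 / 2"] by auto
  show ?thesis
  proof (intro exI[of _ n1] allI impI ballI)
    fix l i assume l: "n1 \<le> l" and i: "i \<in> cells \<gamma> (Suc l)"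
    let ?s = "p (Suc l, i)" and ?t = "p (l, parent \<gamma> l i)"
    have "(1 / 2 :: real) ^ Suc l \<le> (1 / 2) ^ n1" using l by (intro power_decreasing) auto
    then have "\<bar>\<integral>\<omega>. \<xi> x0 \<omega> * (\<xi> ?s \<omega> - \<xi> ?t \<omega>) \<partial>P\<bar> \<le> \<eta> * ?v * (1 / 2) ^ Suc l"
      using n1 by (intro cv[OF _ _ edge_nodes[OF i] near_edge[OF i]]) auto
    moreover have "T.edge \<alpha> l i = (\<integral>\<omega>. \<xi> x0 \<omega> * (\<xi> ?s \<omega> - \<xi> ?t \<omega>) \<partial>P) / ?v"
      unfolding T.edge_def \<alpha>_def using edge_nodes[OF i] E by (subst cov_diff) (auto simp: diff_divide_distrib)
    ultimately show "\<bar>T.edge \<alpha> l i\<bar> \<le> \<eta> * (1 / 2) ^ Suc l"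
      using v by (simp add: abs_divide divide_le_eq mult_ac)
  qed
qed

lemma regression_orthogonal:
  assumes x: "x \<in> T.nodes"
  shows "(\<integral>\<omega>. (\<xi> (p x) \<omega> - \<alpha> x * \<xi> x0 \<omega>) * \<xi> x0 \<omega> \<partial>P) = 0"
proof -
  have i: "integrable P (\<lambda>\<omega>. \<xi> x0 \<omega> * \<xi> u \<omega>)" if "u \<in> orthant" for u
    using that x0_orthant by (intro integrable_mult_square \<xi>_meas \<xi>_int2)
  have "(\<integral>\<omega>. (\<xi> (p x) \<omega> - \<alpha> x * \<xi> x0 \<omega>) * \<xi> x0 \<omega> \<partial>P) =
      (\<integral>\<omega>. \<xi> x0 \<omega> * \<xi> (p x) \<omega> - \<alpha> x * (\<xi> x0 \<omega> * \<xi> x0 \<omega>) \<partial>P)"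
    by (intro Bochner_Integration.integral_cong refl) (simp add: algebra_simps)
  also have "\<dots> = (\<integral>\<omega>. \<xi> x0 \<omega> * \<xi> (p x) \<omega> \<partial>P) - \<alpha> x * (\<integral>\<omega>. \<xi> x0 \<omega> * \<xi> x0 \<omega> \<partial>P)"
    using i[OF p_orthant[OF x]] i[OF x0_orthant] by simp
  also have "\<dots> = 0" unfolding \<alpha>_def using var_x0(2) by (simp add: power2_eq_square)
  finally show ?thesis .
qed

end

section \<open>Covering the random set of hitting parameters\<close>

text \<open>The input of the covering argument, stated for the law \<mu> of the copies on node
  values. By \<open>hit\<close>, the value at a node keeps a bounded density in all
  \<open>card K\<close> coordinates when the residuals are given. By \<open>bad\<close>, finitely
  many fixed cells, one per scale, are rarely bad all together. The bounds \<open>mom\<close> and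
  \<open>Zmom\<close> control the rest, and \<open>\<alpha>_edge\<close> makes the part along the
  corner value negligible.\<close>

locale critical = tree I par b \<kappa> c1
  for I :: "nat \<Rightarrow> 'i set" and par b \<kappa> c1 +
  fixes \<mu> :: "('k \<times> (nat \<times> 'i) \<Rightarrow> real) measure" and K :: "'k set" and root :: "nat \<times> 'i"
    and \<alpha> :: "nat \<times> 'i \<Rightarrow> real" and m0 :: nat and Ch B Cz :: real
  assumes prob_\<mu>: "prob_space \<mu>" and sets_\<mu>: "sets \<mu> = sets (PiM (K \<times> nodes) (\<lambda>_. borel))"
    and K: "finite K" "K \<noteq> {}" and root: "root \<in> nodes" and const: "0 \<le> Ch" "0 \<le> B" "0 \<le> Cz"
    and hit: "\<And>A x w \<epsilon>. A \<in> sets \<mu> \<Longrightarrow> x \<in> nodes \<Longrightarrow> 0 < \<epsilon> \<Longrightarrow>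
       measure \<mu> {y \<in> space \<mu>. (\<lambda>(k, x)\<in>K \<times> nodes. y (k, x) - \<alpha> x * y (k, root)) \<in> A \<and> (\<forall>k\<in>K. \<bar>y (k, x) - w k\<bar> \<le> \<epsilon>)}
       \<le> measure \<mu> {y \<in> space \<mu>. (\<lambda>(k, x)\<in>K \<times> nodes. y (k, x) - \<alpha> x * y (k, root)) \<in> A} * (Ch * \<epsilon>) ^ card K"
    and bad: "\<And>\<eta> \<delta> n0. 0 < \<eta> \<Longrightarrow> 0 < \<delta> \<Longrightarrow> \<exists>m n. 0 < m \<and> (\<forall>s. n0 \<le> n s \<and> n s < n (Suc s)) \<and>
       (\<forall>i. (\<forall>s<m. i s \<in> I (n s)) \<longrightarrow>
         measure \<mu> {y \<in> space \<mu>. \<forall>s<m. \<exists>k\<in>K. \<not> osc (n s) (i s) (\<lambda>x. y (k, x)) \<le> lev \<eta> (n s)} \<le> \<delta>)"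
    and mom: "\<And>k n i. k \<in> K \<Longrightarrow> m0 \<le> n \<Longrightarrow> i \<in> I n \<Longrightarrow>
       (\<integral>\<^sup>+y. osc n i (\<lambda>x. y (k, x)) \<partial>\<mu>) \<le> ennreal (B * (1 / 4) ^ (\<kappa> * n))"
    and Zmom: "\<And>k. k \<in> K \<Longrightarrow> (\<integral>\<^sup>+y. ennreal (y (k, root) ^ (2 * \<kappa>)) \<partial>\<mu>) \<le> ennreal Cz"
    and \<alpha>_edge: "\<And>\<eta>. 0 < \<eta> \<Longrightarrow> \<exists>n1. \<forall>l\<ge>n1. \<forall>i\<in>I (Suc l). \<bar>edge \<alpha> l i\<bar> \<le> \<eta> * (1 / 2) ^ Suc l"

sublocale critical \<subseteq> prob_space \<mu>
  by (rule prob_\<mu>)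

context critical begin

text \<open>The configuration of residuals. The events on which the choice of the cover is based are
  preimages under this map, as \<open>hit\<close> requires.\<close>

definition U :: "('k \<times> (nat \<times> 'i) \<Rightarrow> real) \<Rightarrow> 'k \<times> (nat \<times> 'i) \<Rightarrow> real" where
  "U y = (\<lambda>(k, x)\<in>K \<times> nodes. y (k, x) - \<alpha> x * y (k, root))"

lemma coord [measurable]: "q \<in> K \<times> nodes \<Longrightarrow> (\<lambda>y. y q) \<in> borel_measurable \<mu>"
  using measurable_component_singleton[of q "K \<times> nodes" "\<lambda>_. borel"] by (simp cong: measurable_cong_sets add: sets_\<mu>)

lemma U_measurable [measurable]: "U \<in> measurable \<mu> \<mu>"
proof -
  have "U \<in> measurable \<mu> (PiM (K \<times> nodes) (\<lambda>_. borel))"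
    unfolding U_def
  proof (rule measurable_restrict)
    fix q assume q: "q \<in> K \<times> nodes"
    obtain k x where e: "q = (k, x)" by (cases q)
    show "(\<lambda>y. case q of (k, x) \<Rightarrow> y (k, x) - \<alpha> x * y (k, root)) \<in> borel_measurable \<mu>"
      unfolding e using q root e by (simp add: borel_measurable_diff borel_measurable_times coord)
  qed
  then show ?thesis by (simp cong: measurable_cong_sets add: sets_\<mu>)
qed

lemma osc_coord [measurable]: "k \<in> K \<Longrightarrow> (\<lambda>y. osc n i (\<lambda>x. y (k, x))) \<in> borel_measurable \<mu>"
  by (intro osc_measurable coord) auto

lemma osc_U: "k \<in> K \<Longrightarrow> osc n i (\<lambda>x. U y (k, x)) = osc n i (\<lambda>x. y (k, x) + (- y (k, root)) * \<alpha> x)"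
  by (rule osc_cong) (simp add: U_def)

lemma pair_event:
  assumes "A \<in> sets \<mu>"
  shows "{y \<in> space \<mu>. U y \<in> A} \<in> sets \<mu>"
proof -
  have "{y \<in> space \<mu>. U y \<in> A} = U -` A \<inter> space \<mu>" by auto
  then show ?thesis using measurable_sets[OF U_measurable assms] by simp
qed

lemma hit_U:
  assumes "A \<in> sets \<mu>" "x \<in> nodes" "0 < \<epsilon>"
  shows "prob {y \<in> space \<mu>. U y \<in> A \<and> (\<forall>k\<in>K. \<bar>y (k, x) - w k\<bar> \<le> \<epsilon>)} \<le> prob {y \<in> space \<mu>. U y \<in> A} * (Ch * \<epsilon>) ^ card K"
  unfolding U_def by (rule hit[OF assms])

text \<open>All nodes of level \<open>n\<close> have the same number of descendants \<open>q\<close>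
  levels down, so a function of the ancestor has the same average over both levels.\<close>

lemma sum_anc:
  "(\<Sum>f\<in>I (n + q). \<phi> (anc par n q f)) * real (card (I n)) = real (card (I (n + q))) * (\<Sum>c\<in>I n. \<phi> c :: real)"
proof -
  have e: "I (n + q) = (\<Union>c\<in>I n. desc n q c)" using anc_I by (auto simp: desc_def)
  have "(\<Sum>f\<in>I (n + q). \<phi> (anc par n q f)) = (\<Sum>c\<in>I n. \<Sum>f\<in>desc n q c. \<phi> (anc par n q f))"
    unfolding e using finite_I by (intro sum.UNION_disjoint) (auto simp: desc_def)
  also have "\<dots> = (\<Sum>c\<in>I n. real (card (desc n q c)) * \<phi> c)"
  proof (intro sum.cong refl)
    fix c
    have "(\<Sum>f\<in>desc n q c. \<phi> (anc par n q f)) = (\<Sum>f\<in>desc n q c. \<phi> c)"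
      by (intro sum.cong refl) (simp add: desc_def)
    then show "(\<Sum>f\<in>desc n q c. \<phi> (anc par n q f)) = real (card (desc n q c)) * \<phi> c" by simp
  qed
  finally have "(\<Sum>f\<in>I (n + q). \<phi> (anc par n q f)) * real (card (I n)) = (\<Sum>c\<in>I n. real (card (desc n q c) * card (I n)) * \<phi> c)"
    by (simp only: sum_distrib_left sum_distrib_right of_nat_mult mult_ac)
  also have "\<dots> = (\<Sum>c\<in>I n. real (card (I (n + q))) * \<phi> c)"
    using card_desc by (intro sum.cong refl) simp
  finally show ?thesis by (simp add: sum_distrib_left)
qed

lemma half_pow_card: "real (card (I n)) * ((1 / 2) ^ n) ^ \<kappa> \<le> 1"
proof -
  have "real (card (I n)) * ((1 / 2) ^ n) ^ \<kappa> \<le> 2 ^ (\<kappa> * n) * ((1 / 2) ^ n) ^ \<kappa>"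
    using card_I_le by (intro mult_right_mono) auto
  also have "\<dots> = 1" by (simp add: power_mult[symmetric] mult.commute power_one_over)
  finally show ?thesis .
qed

lemma sum_disjoint_le_1:
  fixes m :: nat
  assumes "\<And>s. s < m \<Longrightarrow> A s \<in> sets \<mu>" "\<And>s t. s < t \<Longrightarrow> t < m \<Longrightarrow> A s \<inter> A t = {}"
  shows "(\<Sum>s<m. measure \<mu> {y \<in> space \<mu>. U y \<in> A s}) \<le> 1"
proof -
  have "(\<Sum>s<m. measure \<mu> {y \<in> space \<mu>. U y \<in> A s}) = measure \<mu> (\<Union>s<m. {y \<in> space \<mu>. U y \<in> A s})"
  proof (rule finite_measure_finite_Union[symmetric])
    show "disjoint_family_on (\<lambda>s. {y \<in> space \<mu>. U y \<in> A s}) {..<m}"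
      unfolding disjoint_family_on_def
    proof (intro ballI impI)
      fix s t assume "s \<in> {..<m}" "t \<in> {..<m}" "s \<noteq> t"
      then have "A s \<inter> A t = {}" using assms(2)[of s t] assms(2)[of t s] by (cases s t rule: linorder_cases) auto
      then show "{y \<in> space \<mu>. U y \<in> A s} \<inter> {y \<in> space \<mu>. U y \<in> A t} = {}" by auto
    qed
  qed (use assms(1) pair_event in auto)
  then show ?thesis by simp
qed

lemma path_anc:
  assumes "\<And>m. par m (c (Suc m)) = c m"
  shows "anc par n q (c (n + q)) = c n"
  by (induction q) (simp_all add: assms)

text \<open>The residual differs from the configuration by the corner value times
  \<open>\<alpha>\<close>. Quasi-additivity and homogeneity of \<open>osc\<close> reduce its
  oscillation to that of the configuration and a moment of the corner value.\<close>

lemma nn_integral_osc_U_le: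
  assumes k: "k \<in> K" and n: "m0 \<le> n" and i: "i \<in> I n"
    and a: "osc n i \<alpha> \<le> ennreal (8 * c1 * (1 / 4) ^ (\<kappa> * n))"
  shows "(\<integral>\<^sup>+y. osc n i (\<lambda>x. U y (k, x)) \<partial>\<mu>) \<le> ennreal (4 ^ \<kappa> * (B + 8 * c1 * Cz) * (1 / 4) ^ (\<kappa> * n))"
proof -
  have kr: "(\<lambda>y. y (k, root)) \<in> borel_measurable \<mu>" using k root by (intro coord) auto
  have "osc n i (\<lambda>x. U y (k, x)) \<le> ennreal (4 ^ \<kappa>) * (osc n i (\<lambda>x. y (k, x)) + ennreal (y (k, root) ^ (2 * \<kappa>)) * osc n i \<alpha>)" for y
    unfolding osc_U[OF k] using osc_add[of n i "\<lambda>x. y (k, x)" "\<lambda>x. (- y (k, root)) * \<alpha> x"] osc_scale[of n i "- y (k, root)" \<alpha>] by simp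
  then have "(\<integral>\<^sup>+y. osc n i (\<lambda>x. U y (k, x)) \<partial>\<mu>) \<le>
     (\<integral>\<^sup>+y. ennreal (4 ^ \<kappa>) * (osc n i (\<lambda>x. y (k, x)) + ennreal (y (k, root) ^ (2 * \<kappa>)) * osc n i \<alpha>) \<partial>\<mu>)"
    by (intro nn_integral_mono) auto
  also have "\<dots> = ennreal (4 ^ \<kappa>) * ((\<integral>\<^sup>+y. osc n i (\<lambda>x. y (k, x)) \<partial>\<mu>) + (\<integral>\<^sup>+y. ennreal (y (k, root) ^ (2 * \<kappa>)) \<partial>\<mu>) * osc n i \<alpha>)"
    using kr osc_coord[OF k] by (simp add: nn_integral_cmult nn_integral_add nn_integral_multc)
  also have "\<dots> \<le> ennreal (4 ^ \<kappa>) * (ennreal (B * (1 / 4) ^ (\<kappa> * n)) + ennreal Cz * ennreal (8 * c1 * (1 / 4) ^ (\<kappa> * n)))"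
    using mom[OF k n i] Zmom[OF k] a by (intro mult_left_mono add_mono mult_mono) auto
  also have "\<dots> = ennreal (4 ^ \<kappa> * (B * (1 / 4) ^ (\<kappa> * n) + Cz * (8 * c1 * (1 / 4) ^ (\<kappa> * n))))"
    using const c1_ge_1 by (simp add: ennreal_mult[symmetric] ennreal_plus[symmetric] del: ennreal_plus)
  finally show ?thesis by (simp add: algebra_simps)
qed

lemma prob_large_root_le:
  assumes "0 < a"
  shows "prob {y \<in> space \<mu>. \<exists>k\<in>K. a < \<bar>y (k, root)\<bar>} \<le> real (card K) * (Cz / a ^ (2 * \<kappa>))"
proof -
  have m: "(\<lambda>y. y (k, root)) \<in> borel_measurable \<mu>" if "k \<in> K" for k using that root by (intro coord) auto
  have e: "{y \<in> space \<mu>. \<exists>k\<in>K. a < \<bar>y (k, root)\<bar>} = (\<Union>k\<in>K. {y \<in> space \<mu>. a < \<bar>y (k, root)\<bar>})" by auto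
  have "prob (\<Union>k\<in>K. {y \<in> space \<mu>. a < \<bar>y (k, root)\<bar>}) \<le> (\<Sum>k\<in>K. prob {y \<in> space \<mu>. a < \<bar>y (k, root)\<bar>})"
  proof (rule measure_UNION_le[OF K(1)])
    fix k assume "k \<in> K"
    note [measurable] = m[OF this]
    show "{y \<in> space \<mu>. a < \<bar>y (k, root)\<bar>} \<in> sets \<mu>" by measurable
  qed
  also have "\<dots> \<le> (\<Sum>k\<in>K. Cz / a ^ (2 * \<kappa>))"
  proof (intro sum_mono)
    fix k assume k: "k \<in> K"
    note [measurable] = m[OF k]
    have "prob {y \<in> space \<mu>. a < \<bar>y (k, root)\<bar>} \<le> prob {y \<in> space \<mu>. \<not> ennreal (y (k, root) ^ (2 * \<kappa>)) \<le> ennreal (a ^ (2 * \<kappa>))}"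
    proof (rule finite_measure_mono)
      show "{y \<in> space \<mu>. a < \<bar>y (k, root)\<bar>} \<subseteq> {y \<in> space \<mu>. \<not> ennreal (y (k, root) ^ (2 * \<kappa>)) \<le> ennreal (a ^ (2 * \<kappa>))}"
      proof safe
        fix y assume lt: "a < \<bar>y (k, root)\<bar>" and le: "ennreal (y (k, root) ^ (2 * \<kappa>)) \<le> ennreal (a ^ (2 * \<kappa>))"
        have "a ^ (2 * \<kappa>) < \<bar>y (k, root)\<bar> ^ (2 * \<kappa>)" using lt assms \<kappa>_pos by (intro power_strict_mono) auto
        then show False using le assms by (simp add: power_even_abs ennreal_le_iff)
      qed
    qed measurable
    also have "\<dots> \<le> Cz / a ^ (2 * \<kappa>)"
      using Zmom[OF k] const assms by (intro prob_not_le_ennreal) auto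
    finally show "prob {y \<in> space \<mu>. a < \<bar>y (k, root)\<bar>} \<le> Cz / a ^ (2 * \<kappa>)" .
  qed
  finally show ?thesis unfolding e by simp
qed

lemma lev_mono: "0 \<le> a \<Longrightarrow> a \<le> a' \<Longrightarrow> lev a n \<le> lev a' n"
  unfolding lev_def by (intro ennreal_leI power_mono mult_right_mono mult_nonneg_nonneg) auto

text \<open>
  \<open>c\<close> is the sequence of cells that contain the parameter at which the limit \<open>v\<close> of \<open>y\<close> is taken.
\<close>

definition hits :: "('k \<Rightarrow> real) set \<Rightarrow> real \<Rightarrow> ('k \<times> (nat \<times> 'i) \<Rightarrow> real) \<Rightarrow> bool" where
  "hits D R y \<longleftrightarrow> (\<exists>c v. (\<forall>m. c m \<in> I m \<and> par m (c (Suc m)) = c m) \<and> v \<in> D \<and>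
     (\<forall>k\<in>K. (\<lambda>m. y (k, (m, c m))) \<longlonglongrightarrow> v k) \<and> (\<forall>k\<in>K. \<bar>v k\<bar> \<le> R \<and> \<bar>y (k, root)\<bar> \<le> R))"

text \<open>The bound of \<open>osc_chain\<close> does not depend on the depth and therefore passes
  to the limit along the branch.\<close>

lemma limit_close:
  assumes c: "\<And>m. c m \<in> I m" "\<And>m. par m (c (Suc m)) = c m"
    and lim: "(\<lambda>m. f (m, c m)) \<longlonglongrightarrow> v" and o: "osc n (c n) f \<le> lev a n" and a: "0 \<le> a"
  shows "\<bar>v - f (n, c n)\<bar> \<le> 3 * (a * (1 / 2) ^ n)"
proof -
  have "\<bar>f (n + m, c (n + m)) - f (n, c n)\<bar> \<le> 3 * (a * (1 / 2) ^ n)" for m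
    using o a c unfolding lev_def by (intro osc_chain[of _ _ _ _ "\<lambda>m. c (n + m)"]) auto
  moreover have "(\<lambda>m. \<bar>f (m + n, c (m + n)) - f (n, c n)\<bar>) \<longlonglongrightarrow> \<bar>v - f (n, c n)\<bar>"
    by (intro tendsto_intros LIMSEQ_ignore_initial_segment[OF lim])
  ultimately show ?thesis by (intro LIMSEQ_le_const2) (auto simp: add.commute)
qed

text \<open>Each finest cell is charged to the first good cell above it. For a fixed finest cell
  these events are disjoint, and a good cell costs a constant times \<open>\<eta> ^ \<kappa>\<close>
  times its share of the finest cells. So all good cells together cost a constant times
  \<open>\<eta> ^ \<kappa>\<close>, however many scales are used, and their number may be taken so
  large that the branches without a good cell do not matter.\<close>

theorem hitting_cover:
  assumes R: "1 \<le> R" and Cc: "1 \<le> Cc" and dim: "pe + \<kappa> = card K"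
    and cover: "\<And>\<epsilon>. 0 < \<epsilon> \<Longrightarrow> \<epsilon> \<le> 1 \<Longrightarrow> \<exists>F. finite F \<and> real (card F) \<le> Cc * (1 / \<epsilon>) ^ pe \<and>
       (\<forall>v\<in>D. (\<forall>k\<in>K. \<bar>v k\<bar> \<le> R) \<longrightarrow> (\<exists>w\<in>F. \<forall>k\<in>K. \<bar>v k - w k\<bar> \<le> Cc * \<epsilon>))"
  shows "\<exists>C\<ge>0. \<forall>\<eta>. 0 < \<eta> \<and> \<eta> < 1 \<longrightarrow> (\<exists>S\<in>sets \<mu>. measure \<mu> S \<le> C * \<eta> ^ \<kappa> \<and> {y \<in> space \<mu>. hits D R y} \<subseteq> S)"
proof -

  \<comment> \<open>Hitting the neighbourhood of a net, given the residuals\<close>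
  have "\<forall>\<epsilon>\<in>{0<..1}. \<exists>F. finite F \<and> real (card F) \<le> Cc * (1 / \<epsilon>) ^ pe \<and>
       (\<forall>v\<in>D. (\<forall>k\<in>K. \<bar>v k\<bar> \<le> R) \<longrightarrow> (\<exists>w\<in>F. \<forall>k\<in>K. \<bar>v k - w k\<bar> \<le> Cc * \<epsilon>))"
    using cover by auto
  from bchoice[OF this] obtain F where F0: "\<forall>\<epsilon>\<in>{0<..1}. finite (F \<epsilon>) \<and> real (card (F \<epsilon>)) \<le> Cc * (1 / \<epsilon>) ^ pe \<and>
       (\<forall>v\<in>D. (\<forall>k\<in>K. \<bar>v k\<bar> \<le> R) \<longrightarrow> (\<exists>w\<in>F \<epsilon>. \<forall>k\<in>K. \<bar>v k - w k\<bar> \<le> Cc * \<epsilon>))" by blast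
  have F: "finite (F \<epsilon>)" "real (card (F \<epsilon>)) \<le> Cc * (1 / \<epsilon>) ^ pe"
    "\<And>v. v \<in> D \<Longrightarrow> (\<forall>k\<in>K. \<bar>v k\<bar> \<le> R) \<Longrightarrow> \<exists>w\<in>F \<epsilon>. \<forall>k\<in>K. \<bar>v k - w k\<bar> \<le> Cc * \<epsilon>"
    if "0 < \<epsilon>" "\<epsilon> \<le> 1" for \<epsilon>
    using F0 that by auto
  \<comment> \<open>For \<open>\<epsilon> > 1\<close> there is no net, and the bound \<open>C4 * \<epsilon> ^ \<kappa>\<close> on the probability is trivial.\<close>
  define N where "N \<epsilon> x = {y \<in> space \<mu>. 1 < \<epsilon> \<or> (\<exists>w\<in>F \<epsilon>. \<forall>k\<in>K. \<bar>y (k, x) - w k\<bar> \<le> (Cc + 1) * \<epsilon>)}" for \<epsilon> x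
  \<comment> \<open>The second entry is the constant in the union bound over the net. The first one
    makes the bound true for \<epsilon> above 1.\<close>
  define C4 where "C4 = max 1 (Cc * (Ch * (Cc + 1)) ^ card K)"
  have C4: "1 \<le> C4" by (simp add: C4_def)
  have mball: "{y \<in> space \<mu>. \<forall>k\<in>K. \<bar>y (k, x) - w k\<bar> \<le> e} \<in> sets \<mu>" if x: "x \<in> nodes" for x w e
  proof (rule sets.sets_Collect_finite_All[OF _ K(1)])
    fix k assume "k \<in> K"
    then have [measurable]: "(\<lambda>y. y (k, x)) \<in> borel_measurable \<mu>" using x by (intro coord) auto
    show "{y \<in> space \<mu>. \<bar>y (k, x) - w k\<bar> \<le> e} \<in> sets \<mu>" by measurable
  qed
  have mN: "N \<epsilon> x \<in> sets \<mu>" if x: "x \<in> nodes" and e: "0 < \<epsilon>" for \<epsilon> x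
  proof (cases "1 < \<epsilon>")
    case True
    then show ?thesis by (simp add: N_def)
  next
    case False
    then have "N \<epsilon> x = (\<Union>w\<in>F \<epsilon>. {y \<in> space \<mu>. \<forall>k\<in>K. \<bar>y (k, x) - w k\<bar> \<le> (Cc + 1) * \<epsilon>})" by (auto simp: N_def)
    then show ?thesis using mball[OF x] F(1)[of \<epsilon>] e False by auto
  qed
  \<comment> \<open>A union bound over the net: the number of its points, of order \<epsilon> to the
    power \<open>- pe\<close>, meets the hitting probability, of order \<epsilon> to the power
    \<open>card K\<close>, and \<open>dim\<close> leaves \<epsilon> to the power \<kappa>. The event
    on the residuals survives as a factor.\<close>
  have NA: "prob ({y \<in> space \<mu>. U y \<in> A} \<inter> N \<epsilon> x) \<le> prob {y \<in> space \<mu>. U y \<in> A} * (C4 * \<epsilon> ^ \<kappa>)"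
    if A: "A \<in> sets \<mu>" and x: "x \<in> nodes" and e: "0 < \<epsilon>" for A \<epsilon> x
  proof (cases "1 < \<epsilon>")
    case True
    have "1 * 1 \<le> C4 * \<epsilon> ^ \<kappa>" using C4 True by (intro mult_mono one_le_power) auto
    then have "prob {y \<in> space \<mu>. U y \<in> A} * 1 \<le> prob {y \<in> space \<mu>. U y \<in> A} * (C4 * \<epsilon> ^ \<kappa>)"
      by (intro mult_left_mono) auto
    moreover have "prob ({y \<in> space \<mu>. U y \<in> A} \<inter> N \<epsilon> x) \<le> prob {y \<in> space \<mu>. U y \<in> A}"
      by (intro finite_measure_mono pair_event[OF A]) auto
    ultimately show ?thesis by simp
  next
    case False
    then have e1: "\<epsilon> \<le> 1" by simp
    let ?pA = "prob {y \<in> space \<mu>. U y \<in> A}"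
    let ?T = "\<lambda>w. {y \<in> space \<mu>. U y \<in> A} \<inter> {y \<in> space \<mu>. \<forall>k\<in>K. \<bar>y (k, x) - w k\<bar> \<le> (Cc + 1) * \<epsilon>}"
    have NT: "{y \<in> space \<mu>. U y \<in> A} \<inter> N \<epsilon> x = (\<Union>w\<in>F \<epsilon>. ?T w)" using False by (auto simp: N_def)
    have "prob ({y \<in> space \<mu>. U y \<in> A} \<inter> N \<epsilon> x) \<le> (\<Sum>w\<in>F \<epsilon>. prob (?T w))"
      unfolding NT by (rule measure_UNION_le[OF F(1)[OF e e1]]) (rule sets.Int[OF pair_event[OF A] mball[OF x]])
    also have "\<dots> \<le> (\<Sum>w\<in>F \<epsilon>. ?pA * (Ch * ((Cc + 1) * \<epsilon>)) ^ card K)"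
    proof (intro sum_mono)
      fix w
      have T: "?T w = {y \<in> space \<mu>. U y \<in> A \<and> (\<forall>k\<in>K. \<bar>y (k, x) - w k\<bar> \<le> (Cc + 1) * \<epsilon>)}" by blast
      have "0 < (Cc + 1) * \<epsilon>" using e Cc by simp
      then show "prob (?T w) \<le> ?pA * (Ch * ((Cc + 1) * \<epsilon>)) ^ card K"
        unfolding T by (rule hit_U[OF A x])
    qed
    also have "\<dots> = real (card (F \<epsilon>)) * (?pA * (Ch * ((Cc + 1) * \<epsilon>)) ^ card K)" by simp
    also have "\<dots> \<le> Cc * (1 / \<epsilon>) ^ pe * (?pA * (Ch * ((Cc + 1) * \<epsilon>)) ^ card K)"
      using F(2)[OF e e1] const Cc e by (intro mult_right_mono) auto
    also have "(Ch * ((Cc + 1) * \<epsilon>)) ^ card K = (Ch * (Cc + 1)) ^ card K * (\<epsilon> ^ pe * \<epsilon> ^ \<kappa>)"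
      unfolding power_add[symmetric] dim by (simp add: power_mult_distrib mult_ac)
    also have "Cc * (1 / \<epsilon>) ^ pe * (?pA * ((Ch * (Cc + 1)) ^ card K * (\<epsilon> ^ pe * \<epsilon> ^ \<kappa>))) =
        ?pA * ((Cc * (Ch * (Cc + 1)) ^ card K) * \<epsilon> ^ \<kappa>) * ((1 / \<epsilon>) ^ pe * \<epsilon> ^ pe)" by (simp only: mult_ac)
    also have "(1 / \<epsilon>) ^ pe * \<epsilon> ^ pe = 1" using e by (simp add: power_one_over)
    also have "?pA * ((Cc * (Ch * (Cc + 1)) ^ card K) * \<epsilon> ^ \<kappa>) * 1 \<le> ?pA * (C4 * \<epsilon> ^ \<kappa>)"
      using e by (simp only: mult_1_right) (intro mult_left_mono mult_right_mono; simp add: C4_def)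
    finally show ?thesis .
  qed
  \<comment> \<open>The constant \<open>Cc + 1\<close> adds the distance of the limit from the net
    to its distance from the value at the node.\<close>
  have N_hit: "y \<in> N \<epsilon> x"
    if y: "y \<in> space \<mu>" and v: "v \<in> D" "\<forall>k\<in>K. \<bar>v k\<bar> \<le> R" and cl: "\<And>k. k \<in> K \<Longrightarrow> \<bar>v k - y (k, x)\<bar> \<le> \<epsilon>" and e: "0 < \<epsilon>" for y v \<epsilon> x
  proof (cases "1 < \<epsilon>")
    case False
    then obtain w where w: "w \<in> F \<epsilon>" "\<forall>k\<in>K. \<bar>v k - w k\<bar> \<le> Cc * \<epsilon>" using F(3)[OF e _ v] by auto
    have "\<bar>y (k, x) - w k\<bar> \<le> (Cc + 1) * \<epsilon>" if "k \<in> K" for k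
    proof -
      have "\<bar>v k - w k\<bar> \<le> Cc * \<epsilon>" "\<bar>v k - y (k, x)\<bar> \<le> \<epsilon>" using w(2) cl that by auto
      then show ?thesis unfolding distrib_right by linarith
    qed
    then show ?thesis using y w(1) by (auto simp: N_def)
  qed (use y in \<open>simp add: N_def\<close>)
  define C3 where "C3 = 4 ^ \<kappa> * (B + 8 * c1 * Cz)"
  have C3: "0 \<le> C3" unfolding C3_def using const c1_ge_1 by auto
  define Dk where "Dk = real (card K)"
  have Dk: "0 \<le> Dk" by (simp add: Dk_def)
  \<comment> \<open>The four summands are the bounds for the parts \<open>S1\<close> to
    \<open>S4\<close> of the cover.\<close>
  define C where "C = C4 * 12 ^ \<kappa> + 2 * C4 * 12 ^ \<kappa> + 2 * Dk * C3 * C4 * 24 ^ \<kappa> + 1"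
  have C0: "0 \<le> C" unfolding C_def using C4 C3 Dk by auto
  have "\<exists>S\<in>sets \<mu>. measure \<mu> S \<le> C * \<eta> ^ \<kappa> \<and> {y \<in> space \<mu>. hits D R y} \<subseteq> S" if \<eta>: "0 < \<eta>" "\<eta> < 1" for \<eta>
  proof -

    \<comment> \<open>Thresholds, scales and exceptional branches\<close>
    \<comment> \<open>Chosen so that \<open>a ^ \<kappa> * \<delta> = \<eta> ^ \<kappa>\<close> for
      the size \<open>a = 1 / \<eta>\<close> tolerated on branches without a good cell.\<close>
    define \<delta> where "\<delta> = \<eta> ^ (2 * \<kappa>)"
    have \<delta>: "0 < \<delta>" using \<eta> by (simp add: \<delta>_def)
    \<comment> \<open>A bound that the corner values exceed with probability at most
      \<open>\<delta>\<close>, by Markov's inequality for the power \<open>2 * \<kappa>\<close>; as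
      it is at least 1, the power may be replaced by \<open>R1\<close> itself.\<close>
    define R1 where "R1 = max R (Dk * Cz / \<delta>)"
    have R1: "1 \<le> R1" "R \<le> R1" "Dk * Cz / \<delta> \<le> R1" using R by (auto simp: R1_def)
    have root_R1: "prob {y \<in> space \<mu>. \<exists>k\<in>K. R1 < \<bar>y (k, root)\<bar>} \<le> \<delta>"
    proof -
      have "prob {y \<in> space \<mu>. \<exists>k\<in>K. R1 < \<bar>y (k, root)\<bar>} \<le> Dk * (Cz / R1 ^ (2 * \<kappa>))"
        unfolding Dk_def using R1 by (intro prob_large_root_le) auto
      also have "\<dots> \<le> Dk * (Cz / R1)"
      proof -
        have "R1 ^ 1 \<le> R1 ^ (2 * \<kappa>)" using R1 \<kappa>_pos by (intro power_increasing) auto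
        then show ?thesis using R1 const Dk by (intro mult_left_mono divide_left_mono) auto
      qed
      also have "\<dots> \<le> \<delta>" using R1 \<delta> by (simp add: divide_le_eq mult.commute)
      finally show ?thesis .
    qed
    \<comment> \<open>With edges of this relative size, \<open>\<alpha>\<close> multiplied by a
      corner value up to \<open>R1\<close> stays below amplitude \<open>\<eta> / 4\<close>. The
      factor \<open>8 * c1\<close> comes from \<open>osc_le_deterministic\<close>.\<close>
    define \<eta>2 where "\<eta>2 = \<eta> / (4 * (8 * c1) * R1)"
    have \<eta>2: "0 < \<eta>2" "\<eta>2 \<le> 1"
    proof -
      show "0 < \<eta>2" using \<eta> R1 c1_ge_1 by (simp add: \<eta>2_def)
      have "1 * 1 \<le> 4 * (8 * c1) * R1" using c1_ge_1 R1 by (intro mult_mono) auto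
      then show "\<eta>2 \<le> 1" unfolding \<eta>2_def using \<eta> by (subst divide_le_eq_1_pos) linarith+
    qed
    from \<alpha>_edge[OF \<eta>2(1)] obtain n1 where n1: "\<And>l i. n1 \<le> l \<Longrightarrow> i \<in> I (Suc l) \<Longrightarrow> \<bar>edge \<alpha> l i\<bar> \<le> \<eta>2 * (1 / 2) ^ Suc l" by blast
    have osc_\<alpha>: "osc n i \<alpha> \<le> ennreal (8 * c1 * \<eta>2 ^ (2 * \<kappa>) * (1 / 4) ^ (\<kappa> * n))" if "n1 \<le> n" "i \<in> I n" for n i
      using n1 that \<eta>2 by (intro osc_le_deterministic) (auto simp: desc_def)
    have osc_z: "osc n i (\<lambda>x. z * \<alpha> x) \<le> lev (\<eta> / 4) n" if n: "n1 \<le> n" "i \<in> I n" and z: "\<bar>z\<bar> \<le> R1" for n i z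
    proof -
      have "osc n i (\<lambda>x. z * \<alpha> x) \<le> ennreal (R1 ^ (2 * \<kappa>)) * ennreal (8 * c1 * \<eta>2 ^ (2 * \<kappa>) * (1 / 4) ^ (\<kappa> * n))"
      proof -
        have "z ^ (2 * \<kappa>) \<le> R1 ^ (2 * \<kappa>)" using power_mono[OF z, of "2 * \<kappa>"] by (simp add: power_even_abs)
        then show ?thesis unfolding osc_scale using osc_\<alpha>[OF n] by (intro mult_mono ennreal_leI) auto
      qed
      also have "\<dots> = ennreal (R1 ^ (2 * \<kappa>) * (8 * c1 * \<eta>2 ^ (2 * \<kappa>) * (1 / 4) ^ (\<kappa> * n)))"
        using R1 c1_ge_1 \<eta>2 by (intro ennreal_mult[symmetric]) auto
      also have "\<dots> \<le> lev (\<eta> / 4) n"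
        unfolding lev_alt
      proof (rule ennreal_leI)
        have c8: "1 \<le> 8 * c1" using c1_ge_1 by simp
        have "(8 * c1) ^ 1 \<le> (8 * c1) ^ (2 * \<kappa>)" using c8 \<kappa>_pos by (intro power_increasing) auto
        then have "8 * c1 * (R1 * \<eta>2) ^ (2 * \<kappa>) \<le> (8 * c1) ^ (2 * \<kappa>) * (R1 * \<eta>2) ^ (2 * \<kappa>)"
          by (intro mult_right_mono) auto
        also have "\<dots> = (8 * c1 * (R1 * \<eta>2)) ^ (2 * \<kappa>)" by (simp only: power_mult_distrib)
        also have "8 * c1 * (R1 * \<eta>2) = \<eta> / 4" using c1_ge_1 R1 by (simp add: \<eta>2_def)
        finally have "8 * c1 * (R1 * \<eta>2) ^ (2 * \<kappa>) * (1 / 4) ^ (\<kappa> * n) \<le> (\<eta> / 4) ^ (2 * \<kappa>) * (1 / 4) ^ (\<kappa> * n)"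
          by (intro mult_right_mono) auto
        then show "R1 ^ (2 * \<kappa>) * (8 * c1 * \<eta>2 ^ (2 * \<kappa>) * (1 / 4) ^ (\<kappa> * n)) \<le> (\<eta> / 4) ^ (2 * \<kappa>) * (1 / 4) ^ (\<kappa> * n)"
          by (simp only: power_mult_distrib mult_ac)
      qed
      finally show ?thesis .
    qed
    obtain m n where m: "0 < m" and n: "\<And>s. max m0 n1 \<le> n s" "\<And>s. n s < n (Suc s)" and
      bd: "\<And>i. (\<forall>s<m. i s \<in> I (n s)) \<Longrightarrow>
         prob {y \<in> space \<mu>. \<forall>s<m. \<exists>k\<in>K. \<not> osc (n s) (i s) (\<lambda>x. y (k, x)) \<le> lev (\<eta> / 4) (n s)} \<le> \<delta>"
      using bad[of "\<eta> / 4" \<delta> "max m0 n1"] \<eta> \<delta> by auto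
    have nsm: "n s \<le> n t" if "s \<le> t" for s t
      using lift_Suc_mono_le[of n s t] less_imp_le[OF n(2)] that by blast
    define Nn where "Nn = n (m - 1)"
    have nN: "n s \<le> Nn" if "s < m" for s unfolding Nn_def using that by (intro nsm) auto
    have Nn: "m0 \<le> Nn" "n1 \<le> Nn" using n(1)[of "m - 1"] by (auto simp: Nn_def)
    define gd where "gd s c = {u \<in> space \<mu>. \<forall>k\<in>K. osc (n s) c (\<lambda>x. u (k, x)) \<le> lev \<eta> (n s)}" for s c
    have mgd: "gd s c \<in> sets \<mu>" for s c
      unfolding gd_def
    proof (rule sets.sets_Collect_finite_All[OF _ K(1)])
      fix k assume "k \<in> K"
      note [measurable] = osc_coord[OF this]
      show "{u \<in> space \<mu>. osc (n s) c (\<lambda>x. u (k, x)) \<le> lev \<eta> (n s)} \<in> sets \<mu>" by measurable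
    qed
    \<comment> \<open>\<open>c\<close> is the first good cell on its line of ancestors: along each branch these events are disjoint.\<close>
    define Fs where "Fs s c = gd s c - (\<Union>s'<s. gd s' (anc par (n s') (n s - n s') c))" for s c
    have mFs: "Fs s c \<in> sets \<mu>" for s c unfolding Fs_def using mgd by auto
    define up where "up s f = anc par (n s) (Nn - n s) f" for s f
    have up_I: "up s f \<in> I (n s)" if "f \<in> I Nn" "s < m" for s f
      unfolding up_def using that nN[OF that(2)] by (intro anc_I) simp
    define bs where "bs f = space \<mu> - (\<Union>s<m. gd s (up s f))" for f
    have mbs: "bs f \<in> sets \<mu>" for f unfolding bs_def using mgd by auto
    \<comment> \<open>On a branch without good cell the finest cell has to serve, whatever its oscillation:
      that up to size \<open>a\<close> is paid for by the small probability \<open>\<delta>\<close> of \<open>bs\<close>, anything larger by moments.\<close>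
    define a where "a = 1 / \<eta>"
    have a: "1 \<le> a" "0 < a" using \<eta> by (auto simp: a_def)
    define lg where "lg f j = {u \<in> space \<mu>. \<exists>k\<in>K. \<not> osc Nn f (\<lambda>x. u (k, x)) \<le> lev (a * 2 ^ j) Nn}" for f and j :: nat
    have mlg: "lg f j \<in> sets \<mu>" for f j
      unfolding lg_def
    proof (rule sets.sets_Collect_finite_Ex[OF _ K(1)])
      fix k assume "k \<in> K"
      note [measurable] = osc_coord[OF this]
      show "{u \<in> space \<mu>. \<not> osc Nn f (\<lambda>x. u (k, x)) \<le> lev (a * 2 ^ j) Nn} \<in> sets \<mu>" by measurable
    qed
    have plg: "prob {y \<in> space \<mu>. U y \<in> lg f j} \<le> Dk * (C3 / (a * 2 ^ j) ^ (2 * \<kappa>))" if f: "f \<in> I Nn" for f j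
    proof -
      have mu: "(\<lambda>y. osc Nn f (\<lambda>x. U y (k, x))) \<in> borel_measurable \<mu>" if "k \<in> K" for k
        using measurable_compose[OF U_measurable osc_coord[OF that]] .
      have oa: "osc Nn f \<alpha> \<le> ennreal (8 * c1 * (1 / 4) ^ (\<kappa> * Nn))"
      proof -
        have "\<eta>2 ^ (2 * \<kappa>) \<le> 1" using \<eta>2 by (intro power_le_one) auto
        then have "8 * c1 * \<eta>2 ^ (2 * \<kappa>) \<le> 8 * c1" using c1_ge_1 by (simp add: mult_left_le)
        then have "8 * c1 * \<eta>2 ^ (2 * \<kappa>) * (1 / 4) ^ (\<kappa> * Nn) \<le> 8 * c1 * (1 / 4) ^ (\<kappa> * Nn)"
          by (intro mult_right_mono) auto
        from order_trans[OF osc_\<alpha>[OF Nn(2) f] ennreal_leI[OF this]] show ?thesis .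
      qed
      have "{y \<in> space \<mu>. U y \<in> lg f j} \<subseteq> (\<Union>k\<in>K. {y \<in> space \<mu>. \<not> osc Nn f (\<lambda>x. U y (k, x)) \<le> lev (a * 2 ^ j) Nn})"
        by (auto simp: lg_def)
      moreover have meas: "{y \<in> space \<mu>. \<not> osc Nn f (\<lambda>x. U y (k, x)) \<le> lev (a * 2 ^ j) Nn} \<in> sets \<mu>" if "k \<in> K" for k
      proof -
        note [measurable] = mu[OF that]
        show ?thesis by measurable
      qed
      ultimately have "prob {y \<in> space \<mu>. U y \<in> lg f j} \<le> prob (\<Union>k\<in>K. {y \<in> space \<mu>. \<not> osc Nn f (\<lambda>x. U y (k, x)) \<le> lev (a * 2 ^ j) Nn})"
        using K(1) by (intro finite_measure_mono sets.finite_UN) auto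
      also have "\<dots> \<le> (\<Sum>k\<in>K. prob {y \<in> space \<mu>. \<not> osc Nn f (\<lambda>x. U y (k, x)) \<le> lev (a * 2 ^ j) Nn})"
        by (rule measure_UNION_le[OF K(1) meas])
      also have "\<dots> \<le> (\<Sum>k\<in>K. C3 * (1 / 4) ^ (\<kappa> * Nn) / ((a * 2 ^ j) ^ (2 * \<kappa>) * (1 / 4) ^ (\<kappa> * Nn)))"
        unfolding lev_alt using nn_integral_osc_U_le[OF _ Nn(1) f oa] mu a C3 unfolding C3_def[symmetric]
        by (intro sum_mono prob_not_le_ennreal) auto
      also have "\<dots> = Dk * (C3 / (a * 2 ^ j) ^ (2 * \<kappa>))" by (simp add: Dk_def)
      finally show ?thesis .
    qed
    \<comment> \<open>If the corner values are bounded by \<open>R1\<close> and the configuration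
      has amplitude \<open>\<eta> / 4\<close> on some cell of the branch, the residual has amplitude
      \<open>\<eta>\<close> there. So no good cell for the residual means a large corner value or
      failure at all scales, each of probability at most \<open>\<delta>\<close>.\<close>
    have pbs: "prob {y \<in> space \<mu>. U y \<in> bs f} \<le> 2 * \<delta>" if f: "f \<in> I Nn" for f
    proof -
      let ?X = "{y \<in> space \<mu>. \<exists>k\<in>K. R1 < \<bar>y (k, root)\<bar>}"
      let ?Y = "{y \<in> space \<mu>. \<forall>s<m. \<exists>k\<in>K. \<not> osc (n s) (up s f) (\<lambda>x. y (k, x)) \<le> lev (\<eta> / 4) (n s)}"
      have mX: "?X \<in> sets \<mu>"
      proof (rule sets.sets_Collect_finite_Ex[OF _ K(1)])
        fix k assume "k \<in> K"
        then have [measurable]: "(\<lambda>y. y (k, root)) \<in> borel_measurable \<mu>" using root by (intro coord) auto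
        show "{y \<in> space \<mu>. R1 < \<bar>y (k, root)\<bar>} \<in> sets \<mu>" by measurable
      qed
      have mY: "?Y \<in> sets \<mu>"
      proof -
        have 1: "{y \<in> space \<mu>. \<exists>k\<in>K. \<not> osc (n s) (up s f) (\<lambda>x. y (k, x)) \<le> lev (\<eta> / 4) (n s)} \<in> sets \<mu>" for s
        proof (rule sets.sets_Collect_finite_Ex[OF _ K(1)])
          fix k assume "k \<in> K"
          note [measurable] = osc_coord[OF this]
          show "{y \<in> space \<mu>. \<not> osc (n s) (up s f) (\<lambda>x. y (k, x)) \<le> lev (\<eta> / 4) (n s)} \<in> sets \<mu>" by measurable
        qed
        have "?Y = {y \<in> space \<mu>. \<forall>s\<in>{..<m}. \<exists>k\<in>K. \<not> osc (n s) (up s f) (\<lambda>x. y (k, x)) \<le> lev (\<eta> / 4) (n s)}" by auto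
        then show ?thesis using sets.sets_Collect_finite_All[OF 1, of "{..<m}"] by simp
      qed
      have "{y \<in> space \<mu>. U y \<in> bs f} \<subseteq> ?X \<union> ?Y"
      proof
        fix y assume y: "y \<in> {y \<in> space \<mu>. U y \<in> bs f}"
        show "y \<in> ?X \<union> ?Y"
        proof (rule ccontr)
          assume c: "y \<notin> ?X \<union> ?Y"
          then obtain s where s: "s < m" "\<forall>k\<in>K. osc (n s) (up s f) (\<lambda>x. y (k, x)) \<le> lev (\<eta> / 4) (n s)" using y by auto
          have z: "\<bar>y (k, root)\<bar> \<le> R1" if "k \<in> K" for k using c y that by (auto simp: not_less)
          have "osc (n s) (up s f) (\<lambda>x. U y (k, x)) \<le> lev \<eta> (n s)" if k: "k \<in> K" for k
            unfolding osc_U[OF k] using s k z[OF k] n(1)[of s] up_I[OF f s(1)] \<eta> by (intro osc_add_le_lev osc_z) auto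
          moreover have "U y \<in> space \<mu>" using y by (auto simp: bs_def)
          ultimately have "U y \<in> gd s (up s f)" by (simp add: gd_def)
          with y s(1) show False by (auto simp: bs_def)
        qed
      qed
      then have "prob {y \<in> space \<mu>. U y \<in> bs f} \<le> prob (?X \<union> ?Y)" by (rule finite_measure_mono[OF _ sets.Un[OF mX mY]])
      also have "\<dots> \<le> prob ?X + prob ?Y" by (rule measure_Un_le[OF mX mY])
      also have "\<dots> \<le> \<delta> + \<delta>" by (rule add_mono[OF root_R1 bd]) (use up_I[OF f] in blast)
      finally show ?thesis by simp
    qed

    \<comment> \<open>The cover and its probability\<close>
    define h where "h l = (1 / 2 :: real) ^ l" for l
    have h0: "0 < h l" for l by (simp add: h_def)
    have hk: "real (card (I l)) * h l ^ \<kappa> \<le> 1" for l unfolding h_def by (rule half_pow_card)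
    define pre where "pre A = {y \<in> space \<mu>. U y \<in> A}" for A
    have mpre: "pre A \<in> sets \<mu>" if "A \<in> sets \<mu>" for A unfolding pre_def by (rule pair_event[OF that])
    have NAp: "prob (pre A \<inter> N \<epsilon> x) \<le> prob (pre A) * (C4 * \<epsilon> ^ \<kappa>)" if "A \<in> sets \<mu>" "x \<in> nodes" "0 < \<epsilon>" for A \<epsilon> x
      unfolding pre_def by (rule NA[OF that])
    have pbs': "f \<in> I Nn \<Longrightarrow> prob (pre (bs f)) \<le> 2 * \<delta>" for f unfolding pre_def by (rule pbs)
    have plg': "f \<in> I Nn \<Longrightarrow> prob (pre (lg f j)) \<le> Dk * (C3 / (a * 2 ^ j) ^ (2 * \<kappa>))" for f j unfolding pre_def by (rule plg)
    have node: "c \<in> I l \<Longrightarrow> (l, c) \<in> nodes" for l c by (simp add: nodes_def)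
    define S1 where "S1 = (\<Union>s<m. \<Union>c\<in>I (n s). pre (Fs s c) \<inter> N (12 * \<eta> * h (n s)) (n s, c))"
    have mS1: "pre (Fs s c) \<inter> N (12 * \<eta> * h (n s)) (n s, c) \<in> sets \<mu>" if "c \<in> I (n s)" for s c
      using \<eta> h0 that by (intro sets.Int mpre mFs mN node) auto
    \<comment> \<open>Since \<open>h (n s) ^ \<kappa>\<close> is at most the reciprocal of the
      number of cells of that level, \<open>sum_anc\<close> turns the sum over cells into an average
      over the finest cells. For each of these the first-good-cell events are disjoint, so their
      probabilities sum to at most 1.\<close>
    have pS1: "prob S1 \<le> C4 * 12 ^ \<kappa> * \<eta> ^ \<kappa>"
    proof -
      have mU: "(\<Union>c\<in>I (n s). pre (Fs s c) \<inter> N (12 * \<eta> * h (n s)) (n s, c)) \<in> sets \<mu>" for s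
        using mS1 by (intro sets.finite_UN finite_I)
      have "prob S1 \<le> (\<Sum>s<m. prob (\<Union>c\<in>I (n s). pre (Fs s c) \<inter> N (12 * \<eta> * h (n s)) (n s, c)))"
        unfolding S1_def by (rule measure_UNION_le[OF finite_lessThan mU])
      also have "\<dots> \<le> (\<Sum>s<m. \<Sum>c\<in>I (n s). prob (pre (Fs s c) \<inter> N (12 * \<eta> * h (n s)) (n s, c)))"
        by (intro sum_mono measure_UNION_le[OF finite_I mS1])
      also have "\<dots> \<le> (\<Sum>s<m. \<Sum>c\<in>I (n s). prob (pre (Fs s c)) * (C4 * (12 * \<eta> * h (n s)) ^ \<kappa>))"
        using \<eta> h0 by (intro sum_mono NAp mFs node) simp_all
      also have "\<dots> = C4 * 12 ^ \<kappa> * \<eta> ^ \<kappa> * (\<Sum>s<m. h (n s) ^ \<kappa> * (\<Sum>c\<in>I (n s). prob (pre (Fs s c))))"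
        by (simp add: sum_distrib_left sum_distrib_right power_mult_distrib mult_ac)
      also have "\<dots> \<le> C4 * 12 ^ \<kappa> * \<eta> ^ \<kappa> * (\<Sum>s<m. (\<Sum>f\<in>I Nn. prob (pre (Fs s (up s f)))) / real (card (I Nn)))"
      proof (intro mult_left_mono sum_mono)
        fix s assume "s \<in> {..<m}"
        then have s: "n s \<le> Nn" using nN by auto
        have cp: "0 < real (card (I l))" for l using finite_I I_nonempty by (simp add: card_gt_0_iff)
        have "h (n s) ^ \<kappa> * (\<Sum>c\<in>I (n s). prob (pre (Fs s c))) \<le> 1 / real (card (I (n s))) * (\<Sum>c\<in>I (n s). prob (pre (Fs s c)))"
          using hk[of "n s"] cp[of "n s"] by (intro mult_right_mono sum_nonneg) (auto simp: le_divide_eq mult.commute)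
        also have "\<dots> = (\<Sum>f\<in>I Nn. prob (pre (Fs s (up s f)))) / real (card (I Nn))"
          using sum_anc[where n = "n s" and \<phi> = "\<lambda>c. prob (pre (Fs s c))" and q = "Nn - n s"] s cp[of "n s"] cp[of Nn]
          unfolding up_def by (simp add: field_simps)
        finally show "h (n s) ^ \<kappa> * (\<Sum>c\<in>I (n s). prob (pre (Fs s c))) \<le> (\<Sum>f\<in>I Nn. prob (pre (Fs s (up s f)))) / real (card (I Nn))" .
      qed (use C4 \<eta> in auto)
      also have "(\<Sum>s<m. (\<Sum>f\<in>I Nn. prob (pre (Fs s (up s f)))) / real (card (I Nn))) = (\<Sum>f\<in>I Nn. \<Sum>s<m. prob (pre (Fs s (up s f)))) / real (card (I Nn))"
        unfolding sum_divide_distrib[symmetric] by (subst sum.swap) simp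
      also have "\<dots> \<le> (\<Sum>f\<in>I Nn. 1) / real (card (I Nn))"
      proof (intro divide_right_mono sum_mono)
        fix f assume f: "f \<in> I Nn"
        show "(\<Sum>s<m. prob (pre (Fs s (up s f)))) \<le> 1"
          unfolding pre_def
        proof (rule sum_disjoint_le_1[OF mFs])
          fix s t assume st: "s < t" "t < m"
          have "n s \<le> n t" "n t \<le> Nn" using nsm[of s t] nN st by auto
          then have "up s f = anc par (n s) (n t - n s) (up t f)"
            unfolding up_def using anc_add[of par "n s" "n t - n s" "Nn - n t" f] by simp
          then show "Fs s (up s f) \<inter> Fs t (up t f) = {}" using st by (auto simp: Fs_def)
        qed
      qed auto
      also have "\<dots> \<le> 1" by simp
      finally show ?thesis using C4 \<eta> by (auto simp: mult_left_le)
    qed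
    \<comment> \<open>The dyadic thresholds stop here: beyond the last one even the plain sum over
      all finest cells, with no gain from hitting, is at most
      \<open>\<eta> ^ \<kappa>\<close>.\<close>
    obtain J :: nat where J: "real (card (I Nn)) * (Dk * C3) / \<eta> ^ \<kappa> < 2 ^ J"
      using real_arch_pow[of 2] by auto
    define S2 where "S2 = (\<Union>f\<in>I Nn. pre (bs f) \<inter> N (12 * a * h Nn) (Nn, f))"
    define S3 where "S3 = (\<Union>f\<in>I Nn. \<Union>j<J. pre (lg f j) \<inter> N (12 * (a * 2 ^ Suc j) * h Nn) (Nn, f))"
    define S4 where "S4 = (\<Union>f\<in>I Nn. pre (lg f J))"
    have m2: "pre (bs f) \<inter> N (12 * a * h Nn) (Nn, f) \<in> sets \<mu>" if "f \<in> I Nn" for f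
      using a h0 that by (intro sets.Int mpre mbs mN node) auto
    have m3: "pre (lg f j) \<inter> N (12 * (a * 2 ^ Suc j) * h Nn) (Nn, f) \<in> sets \<mu>" if "f \<in> I Nn" for f j
      using a h0 that by (intro sets.Int mpre mlg mN node) auto
    have m3': "(\<Union>j<J. pre (lg f j) \<inter> N (12 * (a * 2 ^ Suc j) * h Nn) (Nn, f)) \<in> sets \<mu>" if "f \<in> I Nn" for f
      using m3[OF that] by (intro sets.finite_UN) auto
    have m4: "pre (lg f J) \<in> sets \<mu>" for f by (rule mpre[OF mlg])
    have a\<eta>: "a ^ \<kappa> * \<delta> = \<eta> ^ \<kappa>" "1 / a = \<eta>"
      using \<eta> unfolding a_def \<delta>_def by (simp_all add: power_one_over mult_2 power_add)
    have p2: "prob S2 \<le> 2 * C4 * 12 ^ \<kappa> * \<eta> ^ \<kappa>"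
    proof -
      have "prob S2 \<le> (\<Sum>f\<in>I Nn. prob (pre (bs f) \<inter> N (12 * a * h Nn) (Nn, f)))"
        unfolding S2_def by (rule measure_UNION_le[OF finite_I m2])
      also have "\<dots> \<le> (\<Sum>f\<in>I Nn. prob (pre (bs f)) * (C4 * (12 * a * h Nn) ^ \<kappa>))"
        using a h0 by (intro sum_mono NAp mbs node) simp_all
      also have "\<dots> \<le> (\<Sum>f\<in>I Nn. 2 * \<delta> * (C4 * (12 * a * h Nn) ^ \<kappa>))"
        using C4 a h0[of Nn] by (intro sum_mono mult_right_mono pbs') simp_all
      also have "\<dots> = 2 * C4 * 12 ^ \<kappa> * (a ^ \<kappa> * \<delta>) * (real (card (I Nn)) * h Nn ^ \<kappa>)"
        by (simp add: power_mult_distrib mult_ac)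
      also have "\<dots> \<le> 2 * C4 * 12 ^ \<kappa> * (a ^ \<kappa> * \<delta>) * 1"
        using hk[of Nn] C4 a \<delta> by (intro mult_left_mono) auto
      finally show ?thesis unfolding a\<eta> by simp
    qed
    \<comment> \<open>A residual oscillation of size t = \<open>a * 2 ^ j\<close> has probability of
      order t^-2\<kappa>, while covering such a cell costs t^\<kappa>. The product t^-\<kappa> is
      summable in \<open>j\<close>, and its first factor \<open>(1 / a) ^ \<kappa>\<close> equals
      \<open>\<eta> ^ \<kappa>\<close>. The 24 is 12 times the ratio of consecutive
      thresholds.\<close>
    have p3: "prob S3 \<le> 2 * Dk * C3 * C4 * 24 ^ \<kappa> * \<eta> ^ \<kappa>"
    proof -
      have "prob S3 \<le> (\<Sum>f\<in>I Nn. prob (\<Union>j<J. pre (lg f j) \<inter> N (12 * (a * 2 ^ Suc j) * h Nn) (Nn, f)))"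
        unfolding S3_def by (rule measure_UNION_le[OF finite_I m3'])
      also have "\<dots> \<le> (\<Sum>f\<in>I Nn. \<Sum>j<J. prob (pre (lg f j) \<inter> N (12 * (a * 2 ^ Suc j) * h Nn) (Nn, f)))"
        by (intro sum_mono measure_UNION_le[OF finite_lessThan m3])
      also have "\<dots> \<le> (\<Sum>f\<in>I Nn. \<Sum>j<J. prob (pre (lg f j)) * (C4 * (12 * (a * 2 ^ Suc j) * h Nn) ^ \<kappa>))"
        using a h0 by (intro sum_mono NAp mlg node) simp_all
      also have "\<dots> \<le> (\<Sum>f\<in>I Nn. \<Sum>j<J. Dk * C3 * C4 * 24 ^ \<kappa> * (1 / a) ^ \<kappa> * h Nn ^ \<kappa> * (1 / 2) ^ j)"
      proof (intro sum_mono)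
        fix f j assume f: "f \<in> I Nn"
        have "prob (pre (lg f j)) * (C4 * (12 * (a * 2 ^ Suc j) * h Nn) ^ \<kappa>) \<le>
           Dk * (C3 / (a * 2 ^ j) ^ (2 * \<kappa>)) * (C4 * (12 * (a * 2 ^ Suc j) * h Nn) ^ \<kappa>)"
          using C4 a h0[of Nn] by (intro mult_right_mono plg'[OF f]) simp_all
        also have "\<dots> = Dk * C3 * C4 * 24 ^ \<kappa> * (1 / a) ^ \<kappa> * h Nn ^ \<kappa> * (1 / (2 ^ j) ^ \<kappa>)"
        proof -
          have e: "12 * (a * 2 ^ Suc j) * h Nn = 24 * (a * 2 ^ j) * h Nn" by simp
          have "(a * 2 ^ j) ^ (2 * \<kappa>) = (a * 2 ^ j) ^ \<kappa> * (a * 2 ^ j) ^ \<kappa>" by (simp add: mult_2 power_add)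
          then show ?thesis unfolding e using a by (simp add: power_mult_distrib power_one_over field_simps)
        qed
        also have "\<dots> \<le> Dk * C3 * C4 * 24 ^ \<kappa> * (1 / a) ^ \<kappa> * h Nn ^ \<kappa> * (1 / 2) ^ j"
        proof (intro mult_left_mono)
          have "(2 ^ j) ^ 1 \<le> ((2 :: real) ^ j) ^ \<kappa>" using \<kappa>_pos by (intro power_increasing) auto
          then show "1 / (2 ^ j) ^ \<kappa> \<le> (1 / 2 :: real) ^ j" by (simp add: power_one_over divide_simps)
        qed (use Dk C3 C4 a h0[of Nn] in auto)
        finally show "prob (pre (lg f j)) * (C4 * (12 * (a * 2 ^ Suc j) * h Nn) ^ \<kappa>) \<le> Dk * C3 * C4 * 24 ^ \<kappa> * (1 / a) ^ \<kappa> * h Nn ^ \<kappa> * (1 / 2) ^ j" .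
      qed
      also have "\<dots> = Dk * C3 * C4 * 24 ^ \<kappa> * \<eta> ^ \<kappa> * (real (card (I Nn)) * h Nn ^ \<kappa>) * (\<Sum>j<J. (1 / 2) ^ j)"
        unfolding a\<eta> by (simp add: sum_distrib_left mult_ac)
      also have "\<dots> \<le> Dk * C3 * C4 * 24 ^ \<kappa> * \<eta> ^ \<kappa> * 1 * 2"
      proof (intro mult_mono)
        have "(\<Sum>j<J. (1 / 2 :: real) ^ j) = 2 * (1 - (1 / 2) ^ J)" by (simp add: sum_gp_strict)
        also have "\<dots> \<le> 2" by simp
        finally show "(\<Sum>j<J. (1 / 2 :: real) ^ j) \<le> 2" .
      qed (use hk[of Nn] Dk C3 C4 \<eta> h0[of Nn] in \<open>auto intro!: mult_nonneg_nonneg sum_nonneg\<close>)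
      finally show ?thesis by (simp add: mult_ac)
    qed
    have p4: "prob S4 \<le> 1 * \<eta> ^ \<kappa>"
    proof -
      have "prob S4 \<le> (\<Sum>f\<in>I Nn. prob (pre (lg f J)))"
        unfolding S4_def by (rule measure_UNION_le[OF finite_I m4])
      also have "\<dots> \<le> (\<Sum>f\<in>I Nn. Dk * (C3 / (a * 2 ^ J) ^ (2 * \<kappa>)))"
        by (intro sum_mono plg')
      also have "\<dots> \<le> (\<Sum>f\<in>I Nn. Dk * (C3 / 2 ^ J))"
      proof (intro sum_mono mult_left_mono divide_left_mono)
        have "1 * 2 ^ J \<le> a * 2 ^ J" using a by (intro mult_right_mono) auto
        then have g: "2 ^ J \<le> a * 2 ^ J" by simp
        moreover have "(1 :: real) \<le> 2 ^ J" by simp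
        ultimately have "1 \<le> a * 2 ^ J" by linarith
        then have "(a * 2 ^ J) ^ 1 \<le> (a * 2 ^ J) ^ (2 * \<kappa>)" using \<kappa>_pos by (intro power_increasing) auto
        then show "2 ^ J \<le> (a * 2 ^ J) ^ (2 * \<kappa>)" using g unfolding power_one_right by linarith
      qed (use Dk C3 a in auto)
      also have "\<dots> = real (card (I Nn)) * (Dk * C3) / 2 ^ J" by simp
      also have "\<dots> \<le> \<eta> ^ \<kappa>" using J \<eta> by (simp add: divide_simps mult_ac)
      finally show ?thesis by simp
    qed
    define S where "S = S1 \<union> S2 \<union> S3 \<union> S4"
    have sS: "S1 \<in> sets \<mu>" "S2 \<in> sets \<mu>" "S3 \<in> sets \<mu>" "S4 \<in> sets \<mu>"
    proof -
      show "S1 \<in> sets \<mu>" unfolding S1_def by (rule sets.finite_UN[OF finite_lessThan sets.finite_UN[OF finite_I mS1]])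
      show "S2 \<in> sets \<mu>" unfolding S2_def by (rule sets.finite_UN[OF finite_I m2])
      show "S3 \<in> sets \<mu>" unfolding S3_def by (rule sets.finite_UN[OF finite_I m3'])
      show "S4 \<in> sets \<mu>" unfolding S4_def by (rule sets.finite_UN[OF finite_I m4])
    qed
    have "prob S \<le> prob S1 + prob S2 + prob S3 + prob S4"
      unfolding S_def
      using measure_Un_le[OF sets.Un[OF sets.Un[OF sS(1,2)] sS(3)] sS(4)]
        measure_Un_le[OF sets.Un[OF sS(1,2)] sS(3)] measure_Un_le[OF sS(1,2)] by linarith
    also have "\<dots> \<le> C * \<eta> ^ \<kappa>" using pS1 p2 p3 p4 unfolding C_def distrib_right by linarith
    finally have pS: "prob S \<le> C * \<eta> ^ \<kappa>" .

    \<comment> \<open>Every hitting configuration lies in the cover\<close>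
    have "{y \<in> space \<mu>. hits D R y} \<subseteq> S"
    proof
      fix y assume "y \<in> {y \<in> space \<mu>. hits D R y}"
      then have y: "y \<in> space \<mu>" and "hits D R y" by auto
      then obtain c v where cv: "\<forall>m. c m \<in> I m \<and> par m (c (Suc m)) = c m" and v: "v \<in> D" and
        lim': "\<forall>k\<in>K. (\<lambda>m. y (k, (m, c m))) \<longlonglongrightarrow> v k" and bnd': "\<forall>k\<in>K. \<bar>v k\<bar> \<le> R \<and> \<bar>y (k, root)\<bar> \<le> R"
        unfolding hits_def by blast
      have c: "\<And>l. c l \<in> I l" "\<And>l. par l (c (Suc l)) = c l" using cv by auto
      have lim: "\<And>k. k \<in> K \<Longrightarrow> (\<lambda>l. y (k, (l, c l))) \<longlonglongrightarrow> v k" using lim' by blast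
      have bnd: "\<forall>k\<in>K. \<bar>v k\<bar> \<le> R" "\<And>k. k \<in> K \<Longrightarrow> \<bar>y (k, root)\<bar> \<le> R" using bnd' by auto
      have Uy: "U y \<in> space \<mu>" using y measurable_space[OF U_measurable] by auto
      have cf: "anc par l (l' - l) (c l') = c l" if "l \<le> l'" for l l'
        using path_anc[of c l "l' - l"] c(2) that by simp
      \<comment> \<open>The factor 12 is 3 times 4: the configuration is recovered from its residual
        by \<open>osc_add_le_lev\<close>, which multiplies the amplitude by 4, and the chain bound
        contributes 3. The assumption that \<open>e\<close> is at least \<open>\<eta>\<close> makes
        room for the part along \<open>\<alpha>\<close>.\<close>
      have close: "y \<in> N (12 * e * h l) (l, c l)"
        if e: "\<And>k. k \<in> K \<Longrightarrow> osc l (c l) (\<lambda>x. U y (k, x)) \<le> lev e l" "\<eta> \<le> e" and l: "n1 \<le> l" for e l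
      proof (rule N_hit[OF y v bnd(1)])
        fix k assume k: "k \<in> K"
        have "osc l (c l) (\<lambda>x. U y (k, x) + y (k, root) * \<alpha> x) \<le> lev (4 * e) l"
        proof (rule osc_add_le_lev)
          show "osc l (c l) (\<lambda>x. U y (k, x)) \<le> lev (4 * e / 4) l" using e(1)[OF k] by simp
          have "osc l (c l) (\<lambda>x. y (k, root) * \<alpha> x) \<le> lev (\<eta> / 4) l"
            using bnd(2)[OF k] R1 by (intro osc_z[OF l c(1)]) auto
          also have "\<dots> \<le> lev (4 * e / 4) l" using \<eta> e(2) by (intro lev_mono) auto
          finally show "osc l (c l) (\<lambda>x. y (k, root) * \<alpha> x) \<le> lev (4 * e / 4) l" .
        qed (use \<eta> e in auto)
        also have "osc l (c l) (\<lambda>x. U y (k, x) + y (k, root) * \<alpha> x) = osc l (c l) (\<lambda>x. y (k, x))"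
          using k by (intro osc_cong) (simp add: U_def)
        finally have "\<bar>v k - y (k, (l, c l))\<bar> \<le> 3 * (4 * e * (1 / 2) ^ l)"
          using limit_close[where c = c and f = "\<lambda>x. y (k, x)" and a = "4 * e" and n = l] c lim[OF k] \<eta> e(2) by simp
        then show "\<bar>v k - y (k, (l, c l))\<bar> \<le> 12 * e * h l" by (simp add: h_def)
      next
        show "0 < 12 * e * h l" using \<eta> e(2) h0 by simp
      qed
      show "y \<in> S"
      proof (cases "\<exists>s<m. U y \<in> gd s (c (n s))")
        case True
        define s where "s = (LEAST s. U y \<in> gd s (c (n s)))"
        obtain s0 where s0: "s0 < m" "U y \<in> gd s0 (c (n s0))" using True by blast
        have s: "U y \<in> gd s (c (n s))" unfolding s_def by (rule LeastI[of "\<lambda>s. U y \<in> gd s (c (n s))", OF s0(2)])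
        have s_min: "U y \<notin> gd s' (c (n s'))" if "s' < s" for s'
          using not_less_Least[of s' "\<lambda>s. U y \<in> gd s (c (n s))"] that unfolding s_def by blast
        have "s \<le> s0" unfolding s_def by (rule Least_le[of "\<lambda>s. U y \<in> gd s (c (n s))", OF s0(2)])
        then have sm: "s < m" using s0(1) by simp
        have "U y \<notin> gd s' (anc par (n s') (n s - n s') (c (n s)))" if "s' < s" for s'
          using s_min[OF that] cf[of "n s'" "n s"] nsm[of s' s] that by simp
        then have "y \<in> pre (Fs s (c (n s)))" using s y by (auto simp: pre_def Fs_def)
        moreover have "y \<in> N (12 * \<eta> * h (n s)) (n s, c (n s))"
          using s n(1)[of s] by (intro close) (auto simp: gd_def)
        ultimately have "y \<in> S1" unfolding S1_def using sm c(1) by blast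
        then show ?thesis by (simp add: S_def)
      next
        case False
        let ?f = "c Nn"
        have fI: "?f \<in> I Nn" by (rule c(1))
        have "up s ?f = c (n s)" if "s < m" for s unfolding up_def using cf nN[OF that] by simp
        then have b: "y \<in> pre (bs ?f)" using False y Uy by (auto simp: pre_def bs_def)
        have small: "osc Nn ?f (\<lambda>x. U y (k, x)) \<le> lev (a * 2 ^ j) Nn" if "U y \<notin> lg ?f j" "k \<in> K" for j k
          using that Uy by (auto simp: lg_def)
        have \<eta>a: "\<eta> \<le> a * 2 ^ j" for j :: nat
        proof -
          have "1 * 1 \<le> a * 2 ^ j" using a by (intro mult_mono) auto
          then show ?thesis using \<eta> by simp
        qed
        show ?thesis
        proof (cases "U y \<in> lg ?f J")
          case True
          then have "y \<in> S4" unfolding S4_def using fI y by (auto simp: pre_def)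
          then show ?thesis by (simp add: S_def)
        next
          case notJ: False
          show ?thesis
          proof (cases "U y \<in> lg ?f 0")
            case False
            have "y \<in> N (12 * a * h Nn) (Nn, ?f)"
              using small[OF False] \<eta>a[of 0] Nn by (intro close) auto
            then have "y \<in> S2" unfolding S2_def using b fI by blast
            then show ?thesis by (simp add: S_def)
          next
            case True
            define j where "j = (LEAST j. U y \<notin> lg ?f j)"
            have j: "U y \<notin> lg ?f j" unfolding j_def by (rule LeastI[of "\<lambda>j. U y \<notin> lg ?f j", OF notJ])
            have j0: "j \<noteq> 0" using j True by metis
            then obtain i where i: "j = Suc i" by (cases j) auto
            have "j \<le> J" unfolding j_def by (rule Least_le[of "\<lambda>j. U y \<notin> lg ?f j", OF notJ])
            then have iJ: "i < J" using i by simp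
            have "U y \<in> lg ?f i" using not_less_Least[of i "\<lambda>j. U y \<notin> lg ?f j"] i unfolding j_def by auto
            then have "y \<in> pre (lg ?f i)" using y by (simp add: pre_def)
            moreover have "y \<in> N (12 * (a * 2 ^ Suc i) * h Nn) (Nn, ?f)"
              using small[OF j] \<eta>a[of "Suc i"] Nn unfolding i by (intro close) auto
            ultimately have "y \<in> S3" unfolding S3_def using fI iJ by blast
            then show ?thesis by (simp add: S_def)
          qed
        qed
      qed
    qed
    moreover have "S \<in> sets \<mu>" unfolding S_def by (rule sets.Un[OF sets.Un[OF sets.Un[OF sS(1,2)] sS(3)] sS(4)])
    ultimately show ?thesis using pS by blast
  qed
  then show ?thesis using C0 by blast
qed

end

section \<open>Independent copies\<close>

text \<open>The density is at most \<open>1 / (2 * d)\<close>, since \<open>sqrt (2 * pi)\<close> is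
  at least 2, and the interval for \<open>X\<close> has length \<open>2 * e / a\<close>, which is at
  most \<open>4 * e\<close>.\<close>

lemma (in prob_space) normal_rv_interval_le:
  assumes X: "normal_rv M X 0 v" and d: "0 < d" "d\<^sup>2 \<le> v" and a: "1 / 2 \<le> a" and e: "0 < e"
  shows "prob {\<omega> \<in> space M. \<bar>c + a * X \<omega>\<bar> \<le> e} \<le> 2 / d * e"
proof -
  have mX [measurable]: "X \<in> borel_measurable M" using X by (rule normal_rv_measurable)
  have "0 < d\<^sup>2" using d by simp
  then have v: "0 < v" using d by linarith
  then have s: "0 < sqrt v" and D: "distributed M lborel X (\<lambda>x. ennreal (normal_density 0 (sqrt v) x))"
    using X by (auto simp: normal_rv_def)
  have ds: "d \<le> sqrt v" using d by (simp add: real_le_rsqrt)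
  let ?I = "{(- e - c) / a..(e - c) / a}"
  have "prob {\<omega> \<in> space M. \<bar>c + a * X \<omega>\<bar> \<le> e} = measure M (X -` ?I \<inter> space M)"
    using a by (intro arg_cong[of _ _ "measure M"]) (auto simp: field_simps abs_le_iff)
  also have "emeasure M (X -` ?I \<inter> space M) = (\<integral>\<^sup>+x. ennreal (normal_density 0 (sqrt v) x) * indicator ?I x \<partial>lborel)"
    by (rule distributed_emeasure[OF D]) simp
  then have em: "emeasure M (X -` ?I \<inter> space M) \<le> ennreal (2 / d * e)"
  proof (rule ord_eq_le_trans)
    have "(\<integral>\<^sup>+x. ennreal (normal_density 0 (sqrt v) x) * indicator ?I x \<partial>lborel) \<le> (\<integral>\<^sup>+x. ennreal (1 / (2 * d)) * indicator ?I x \<partial>lborel)"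
    proof (intro nn_integral_mono mult_right_mono ennreal_leI)
      fix x
      have "normal_density 0 (sqrt v) x \<le> 1 / sqrt (2 * pi * (sqrt v)\<^sup>2) * 1"
        unfolding normal_density_def by (intro mult_left_mono) auto
      also have "sqrt (2 * pi * (sqrt v)\<^sup>2) = sqrt (2 * pi) * sqrt v" using v by (simp add: real_sqrt_mult)
      also have "1 / (sqrt (2 * pi) * sqrt v) * 1 \<le> 1 / (2 * d)"
      proof -
        have "sqrt (2\<^sup>2) \<le> sqrt (2 * pi)" using pi_gt3 by (intro real_sqrt_le_mono) auto
        then have "2 * d \<le> sqrt (2 * pi) * sqrt v" using ds d s by (intro mult_mono) auto
        then show ?thesis using d by (simp add: frac_le)
      qed
      finally show "normal_density 0 (sqrt v) x \<le> 1 / (2 * d)" .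
    qed auto
    also have "\<dots> = ennreal (1 / (2 * d)) * emeasure lborel ?I" by (simp add: nn_integral_cmult)
    also have "emeasure lborel ?I = ennreal (2 * e / a)"
      using a e by (simp add: divide_right_mono diff_divide_distrib[symmetric])
    also have "ennreal (1 / (2 * d)) * ennreal (2 * e / a) \<le> ennreal (2 / d * e)"
    proof -
      have "1 / (2 * d) * (2 * e / a) \<le> 1 / (2 * d) * (4 * e)"
      proof (rule mult_left_mono)
        have "2 * e \<le> 4 * e * a" using a e by (simp add: mult_le_cancel_left)
        then show "2 * e / a \<le> 4 * e" using a by (simp add: divide_le_eq)
      qed (use d in simp)
      then show ?thesis using d e a by (simp add: ennreal_mult[symmetric] ennreal_leI)
    qed
    finally show "(\<integral>\<^sup>+x. ennreal (normal_density 0 (sqrt v) x) * indicator ?I x \<partial>lborel) \<le> ennreal (2 / d * e)" .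
  qed
  have "measure M (X -` ?I \<inter> space M) \<le> 2 / d * e"
    using em d e by (simp add: emeasure_eq_measure)
  finally show ?thesis .
qed

lemma integral_PiM_iexp:
  fixes K :: "'k set" and X :: "'i \<Rightarrow> 'a \<Rightarrow> real"
  assumes P: "prob_space P" and K: "finite K" and S: "finite S" "S \<subseteq> K \<times> J" and X: "\<And>i. i \<in> J \<Longrightarrow> X i \<in> borel_measurable P"
  shows "(\<integral>\<omega>. iexp (\<Sum>q\<in>S. u q * X (snd q) (\<omega> (fst q))) \<partial>PiM K (\<lambda>_. P)) =
    (\<Prod>k\<in>K. \<integral>\<omega>. iexp (\<Sum>i\<in>{i. (k, i) \<in> S}. u (k, i) * X i \<omega>) \<partial>P)"
proof -
  interpret P: prob_space P by fact
  interpret PK: finite_product_prob_space "\<lambda>_. P" K by unfold_locales (rule K)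
  have finS: "finite {i. (k, i) \<in> S}" for k
    by (rule finite_subset[of _ "snd ` S"]) (use S in \<open>auto intro: rev_image_eqI\<close>)
  have Se: "S = Sigma K (\<lambda>k. {i. (k, i) \<in> S})" using S by auto
  have split: "(\<Sum>q\<in>S. g q) = (\<Sum>k\<in>K. \<Sum>i\<in>{i. (k, i) \<in> S}. g (k, i))" for g :: "'k \<times> 'i \<Rightarrow> real"
    by (subst Se) (use K finS in \<open>simp add: sum.Sigma\<close>)
  let ?f = "\<lambda>k \<omega>. iexp (\<Sum>i\<in>{i. (k, i) \<in> S}. u (k, i) * X i \<omega>)"
  have mf: "?f k \<in> borel_measurable P" for k
    using finS X S by (intro iexp_sum_measurable) auto
  have "(\<integral>\<omega>. iexp (\<Sum>q\<in>S. u q * X (snd q) (\<omega> (fst q))) \<partial>PiM K (\<lambda>_. P)) = (\<integral>\<omega>. (\<Prod>k\<in>K. ?f k (\<omega> k)) \<partial>PiM K (\<lambda>_. P))"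
    unfolding split by (simp add: exp_sum sum_distrib_left K)
  also have "\<dots> = (\<Prod>k\<in>K. \<integral>\<omega>. ?f k \<omega> \<partial>P)"
    using mf by (intro PK.product_integral_prod[OF K] P.integrable_const_bound[of _ 1]) auto
  finally show ?thesis .
qed

lemma (in prob_space) gaussian_char_factor:
  fixes Y :: "'i + 'j \<Rightarrow> 'a \<Rightarrow> real"
  assumes g: "gaussian_family M (I1 <+> I2) Y"
    and uncor: "\<And>i j. i \<in> I1 \<Longrightarrow> j \<in> I2 \<Longrightarrow> expectation (\<lambda>\<omega>. Y (Inl i) \<omega> * Y (Inr j) \<omega>) = 0"
    and S: "finite S1" "finite S2" "S1 \<subseteq> I1" "S2 \<subseteq> I2"
  shows "(\<integral>\<omega>. iexp ((\<Sum>i\<in>S1. u i * Y (Inl i) \<omega>) + (\<Sum>i\<in>S2. w i * Y (Inr i) \<omega>)) \<partial>M) =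
    (\<integral>\<omega>. iexp (\<Sum>i\<in>S1. u i * Y (Inl i) \<omega>) \<partial>M) * (\<integral>\<omega>. iexp (\<Sum>i\<in>S2. w i * Y (Inr i) \<omega>) \<partial>M)"
proof -
  interpret MM: pair_prob_space M M ..
  have "prob_space M" by unfold_locales
  let ?N = "PiM (I1 <+> I2) (\<lambda>_. borel :: real measure)"
  let ?g = "\<lambda>y. iexp ((\<Sum>i\<in>S1. u i * y (Inl i)) + (\<Sum>i\<in>S2. w i * y (Inr i)))"
  have mY: "Y i \<in> borel_measurable M" if "i \<in> I1 <+> I2" for i
    using g that by (auto simp: gaussian_family_def)
  have mg: "?g \<in> borel_measurable ?N"
  proof -
    have "(\<lambda>y. (\<Sum>i\<in>S1. u i * y (Inl i)) + (\<Sum>i\<in>S2. w i * y (Inr i))) \<in> borel_measurable ?N"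
      using S by (intro borel_measurable_add borel_measurable_sum borel_measurable_times borel_measurable_const measurable_component_singleton) auto
    then show ?thesis by measurable
  qed
  have m1: "(\<lambda>\<omega>. \<lambda>i\<in>I1 <+> I2. Y i \<omega>) \<in> measurable M ?N" using mY by (intro measurable_restrict) auto
  have m2: "(\<lambda>z. \<lambda>i\<in>I1 <+> I2. Y i (case i of Inl _ \<Rightarrow> fst z | Inr _ \<Rightarrow> snd z)) \<in> measurable (M \<Otimes>\<^sub>M M) ?N"
  proof (rule measurable_restrict)
    fix i assume i: "i \<in> I1 <+> I2"
    show "(\<lambda>z. Y i (case i of Inl _ \<Rightarrow> fst z | Inr _ \<Rightarrow> snd z)) \<in> borel_measurable (M \<Otimes>\<^sub>M M)"
      using mY[OF i] by (cases i) auto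
  qed
  have mf: "(\<lambda>\<omega>. \<Sum>i\<in>S1. u i * Y (Inl i) \<omega>) \<in> borel_measurable M" "(\<lambda>\<omega>. \<Sum>i\<in>S2. w i * Y (Inr i) \<omega>) \<in> borel_measurable M"
    by (intro borel_measurable_sum borel_measurable_times borel_measurable_const mY; use S in auto)+
  have in1: "Inl i \<in> I1 <+> I2" if "i \<in> S1" for i using that S by auto
  have in2: "Inr i \<in> I1 <+> I2" if "i \<in> S2" for i using that S by auto
  have "(\<integral>\<omega>. ?g (\<lambda>i\<in>I1 <+> I2. Y i \<omega>) \<partial>M) = (\<integral>z. ?g (\<lambda>i\<in>I1 <+> I2. Y i (case i of Inl _ \<Rightarrow> fst z | Inr _ \<Rightarrow> snd z)) \<partial>(M \<Otimes>\<^sub>M M))"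
    using gaussian_decouple[OF g uncor] integral_distr[OF m1 mg] integral_distr[OF m2 mg] by simp
  then have "(\<integral>\<omega>. iexp ((\<Sum>i\<in>S1. u i * Y (Inl i) \<omega>) + (\<Sum>i\<in>S2. w i * Y (Inr i) \<omega>)) \<partial>M) =
     (\<integral>z. iexp ((\<Sum>i\<in>S1. u i * Y (Inl i) (fst z)) + (\<Sum>i\<in>S2. w i * Y (Inr i) (snd z))) \<partial>(M \<Otimes>\<^sub>M M))"
    using in1 in2 by (simp cong: sum.cong)
  then show ?thesis using integral_iexp_pair[OF \<open>prob_space M\<close> mf] by simp
qed

text \<open>Decoupling in all copies at once: the characteristic function on the product space
  factors over \<open>K\<close>, and each factor splits into the two uncorrelated groups.\<close>

lemma gaussian_decouple_copies:
  fixes Y :: "'i + 'j \<Rightarrow> 'a \<Rightarrow> real" and K :: "'k set" and P :: "'a measure" and I1 :: "'i set" and I2 :: "'j set"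
  defines "Q \<equiv> PiM K (\<lambda>_. P)" and "J \<equiv> K \<times> (I1 <+> I2)"
  assumes P: "prob_space P" and K: "finite K" and g: "gaussian_family P (I1 <+> I2) Y"
    and uncor: "\<And>i j. i \<in> I1 \<Longrightarrow> j \<in> I2 \<Longrightarrow> (\<integral>\<omega>. Y (Inl i) \<omega> * Y (Inr j) \<omega> \<partial>P) = 0"
  shows "distr Q (PiM J (\<lambda>_. borel)) (\<lambda>\<omega>. \<lambda>q\<in>J. Y (snd q) (\<omega> (fst q))) =
    distr (Q \<Otimes>\<^sub>M Q) (PiM J (\<lambda>_. borel)) (\<lambda>z. \<lambda>q\<in>J. Y (snd q) ((case snd q of Inl _ \<Rightarrow> fst z | Inr _ \<Rightarrow> snd z) (fst q)))"
proof (rule distr_PiM_eqI_char)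
  interpret P: prob_space P by fact
  interpret PK: finite_product_prob_space "\<lambda>_. P" K by unfold_locales (rule K)
  show pQ: "prob_space Q" unfolding Q_def by (rule PK.prob_space_axioms)
  interpret Q: prob_space Q by (rule pQ)
  interpret QQ: pair_prob_space Q Q ..
  show "prob_space (Q \<Otimes>\<^sub>M Q)" by (rule QQ.P.prob_space_axioms)
  have mY: "Y i \<in> borel_measurable P" if "i \<in> I1 <+> I2" for i using g that by (auto simp: gaussian_family_def)
  have mQ: "(\<lambda>\<omega>. Y i (\<omega> k)) \<in> borel_measurable Q" if "k \<in> K" "i \<in> I1 <+> I2" for k i
    unfolding Q_def by (rule measurable_compose[OF measurable_component_singleton[OF that(1)] mY[OF that(2)]])
  show "(\<lambda>\<omega>. Y (snd q) (\<omega> (fst q))) \<in> borel_measurable Q" if "q \<in> J" for q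
    using that by (intro mQ) (auto simp: J_def)
  show "(\<lambda>z. Y (snd q) ((case snd q of Inl _ \<Rightarrow> fst z | Inr _ \<Rightarrow> snd z) (fst q))) \<in> borel_measurable (Q \<Otimes>\<^sub>M Q)" if q: "q \<in> J" for q
  proof -
    obtain k i where e: "q = (k, i)" by (cases q)
    have "(\<lambda>\<omega>. Y i (\<omega> k)) \<in> borel_measurable Q" using q by (intro mQ) (auto simp: J_def e)
    from measurable_compose[OF measurable_fst this] measurable_compose[OF measurable_snd this]
    show ?thesis unfolding e by (cases i) auto
  qed
  fix S :: "('k \<times> ('i + 'j)) set" and u assume S: "finite S" "S \<subseteq> J"
  define A1 where "A1 = {q. (fst q, Inl (snd q)) \<in> S}" define A2 where "A2 = {q. (fst q, Inr (snd q)) \<in> S}"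
  let ?l = "\<lambda>q :: 'k \<times> 'i. (fst q, Inl (snd q) :: 'i + 'j)" and ?r = "\<lambda>q :: 'k \<times> 'j. (fst q, Inr (snd q) :: 'i + 'j)"
  have SS: "S = ?l ` A1 \<union> ?r ` A2"
  proof
    show "S \<subseteq> ?l ` A1 \<union> ?r ` A2"
    proof
      fix q assume q: "q \<in> S"
      obtain k i where e: "q = (k, i)" by (cases q)
      show "q \<in> ?l ` A1 \<union> ?r ` A2"
      proof (cases i)
        case (Inl a)
        then have "(k, a) \<in> A1" using q e by (simp add: A1_def)
        then show ?thesis using e Inl by force
      next
        case (Inr a)
        then have "(k, a) \<in> A2" using q e by (simp add: A2_def)
        then show ?thesis using e Inr by force
      qed
    qed
  qed (auto simp: A1_def A2_def)
  have inj: "inj_on ?l A1" "inj_on ?r A2" by (auto simp: inj_on_def prod_eq_iff)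
  have fin: "finite A1" "finite A2"
    using S(1) unfolding SS by (auto dest: finite_imageD[OF _ inj(1)] finite_imageD[OF _ inj(2)])
  have dis: "?l ` A1 \<inter> ?r ` A2 = {}" by auto
  have split: "(\<Sum>q\<in>S. g q) = (\<Sum>q\<in>A1. g (?l q)) + (\<Sum>q\<in>A2. g (?r q))" for g :: "_ \<Rightarrow> real"
    unfolding SS using fin dis inj by (subst sum.union_disjoint) (auto simp: sum.reindex)
  have sub: "A1 \<subseteq> K \<times> I1" "A2 \<subseteq> K \<times> I2" using S(2) by (auto simp: A1_def A2_def J_def)
  have finA: "finite {i. (k, i) \<in> A1}" "finite {i. (k, i) \<in> A2}" for k
    by (rule finite_subset[of _ "snd ` A1"]; use fin in \<open>auto intro: rev_image_eqI\<close>)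
       (rule finite_subset[of _ "snd ` A2"]; use fin in \<open>auto intro: rev_image_eqI\<close>)
  let ?f = "\<lambda>\<omega>. \<Sum>q\<in>A1. u (?l q) * Y (Inl (snd q)) (\<omega> (fst q))"
  let ?h = "\<lambda>\<omega>. \<Sum>q\<in>A2. u (?r q) * Y (Inr (snd q)) (\<omega> (fst q))"
  have mf: "?f \<in> borel_measurable Q" "?h \<in> borel_measurable Q"
    by (intro borel_measurable_sum borel_measurable_times borel_measurable_const mQ; use sub in auto)+
  have I1: "(\<integral>\<omega>. iexp (?f \<omega>) \<partial>Q) = (\<Prod>k\<in>K. \<integral>\<omega>. iexp (\<Sum>i\<in>{i. (k, i) \<in> A1}. u (k, Inl i) * Y (Inl i) \<omega>) \<partial>P)"
    unfolding Q_def using integral_PiM_iexp[OF P K fin(1) sub(1), of "\<lambda>i. Y (Inl i)" "\<lambda>q. u (?l q)"] mY by auto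
  have I2: "(\<integral>\<omega>. iexp (?h \<omega>) \<partial>Q) = (\<Prod>k\<in>K. \<integral>\<omega>. iexp (\<Sum>i\<in>{i. (k, i) \<in> A2}. u (k, Inr i) * Y (Inr i) \<omega>) \<partial>P)"
    unfolding Q_def using integral_PiM_iexp[OF P K fin(2) sub(2), of "\<lambda>i. Y (Inr i)" "\<lambda>q. u (?r q)"] mY by auto
  have splitk: "(\<Sum>i\<in>{i. (k, i) \<in> S}. g i) = (\<Sum>i\<in>{i. (k, i) \<in> A1}. g (Inl i)) + (\<Sum>i\<in>{i. (k, i) \<in> A2}. g (Inr i))" for k and g :: "_ \<Rightarrow> real"
  proof -
    have "{i. (k, i) \<in> S} = Inl ` {i. (k, i) \<in> A1} \<union> Inr ` {i. (k, i) \<in> A2}"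
      by (auto simp: A1_def A2_def image_iff) (metis sum.exhaust)
    then show ?thesis using finA by (simp only:) (subst sum.union_disjoint; auto simp: sum.reindex)
  qed
  have "(\<integral>\<omega>. iexp (\<Sum>q\<in>S. u q * Y (snd q) (\<omega> (fst q))) \<partial>Q) = (\<Prod>k\<in>K. \<integral>\<omega>. iexp (\<Sum>i\<in>{i. (k, i) \<in> S}. u (k, i) * Y i \<omega>) \<partial>P)"
    unfolding Q_def using S(2) mY unfolding J_def by (intro integral_PiM_iexp[OF P K S(1)])
  also have "\<dots> = (\<Prod>k\<in>K. (\<integral>\<omega>. iexp (\<Sum>i\<in>{i. (k, i) \<in> A1}. u (k, Inl i) * Y (Inl i) \<omega>) \<partial>P) * (\<integral>\<omega>. iexp (\<Sum>i\<in>{i. (k, i) \<in> A2}. u (k, Inr i) * Y (Inr i) \<omega>) \<partial>P))"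
    unfolding splitk using sub by (intro prod.cong refl P.gaussian_char_factor[OF g uncor finA]) auto
  also have "\<dots> = (\<integral>\<omega>. iexp (?f \<omega>) \<partial>Q) * (\<integral>\<omega>. iexp (?h \<omega>) \<partial>Q)"
    unfolding I1 I2 by (rule prod.distrib)
  also have "\<dots> = (\<integral>z. iexp (?f (fst z) + ?h (snd z)) \<partial>(Q \<Otimes>\<^sub>M Q))"
    by (rule Q.integral_iexp_pair[OF pQ mf, symmetric])
  also have "\<dots> = (\<integral>z. iexp (\<Sum>q\<in>S. u q * Y (snd q) ((case snd q of Inl _ \<Rightarrow> fst z | Inr _ \<Rightarrow> snd z) (fst q))) \<partial>(Q \<Otimes>\<^sub>M Q))"
    unfolding split by simp
  finally show "(\<integral>\<omega>. iexp (\<Sum>q\<in>S. u q * Y (snd q) (\<omega> (fst q))) \<partial>Q) =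
     (\<integral>z. iexp (\<Sum>q\<in>S. u q * Y (snd q) ((case snd q of Inl _ \<Rightarrow> fst z | Inr _ \<Rightarrow> snd z) (fst q))) \<partial>(Q \<Otimes>\<^sub>M Q))" .
qed

text \<open>After decoupling, the residuals \<open>Y\<close> are read at one point of
  \<open>Q\<close> and the values \<open>Z\<close> at an independent one. For fixed residuals the
  remaining condition confines each copy of \<open>Z\<close> separately to an interval, and Fubini's
  theorem leaves the event on the residuals as a factor.\<close>

lemma prob_regression_hit_le:
  fixes Y :: "'i \<Rightarrow> 'a \<Rightarrow> real" and Z :: "'a \<Rightarrow> real" and K :: "'k set" and P :: "'a measure" and I :: "'i set"
  defines "Q \<equiv> PiM K (\<lambda>_. P)" and "N \<equiv> PiM (K \<times> I) (\<lambda>_. borel :: real measure)" and "V \<equiv> \<lambda>\<omega>. \<lambda>(k, i)\<in>K \<times> I. Y i (\<omega> k)"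
  assumes P: "prob_space P" and K: "finite K" and g: "gaussian_family P (I <+> {()}) (case_sum Y (\<lambda>_. Z))"
    and uncor: "\<And>i. i \<in> I \<Longrightarrow> (\<integral>\<omega>. Y i \<omega> * Z \<omega> \<partial>P) = 0"
    and Z: "normal_rv P Z 0 v" and d: "0 < d" "d\<^sup>2 \<le> v" and a: "1 / 2 \<le> a" and e: "0 < \<epsilon>"
    and x: "x \<in> I" and A: "A \<in> sets N"
  shows "measure Q {\<omega> \<in> space Q. V \<omega> \<in> A \<and> (\<forall>k\<in>K. \<bar>Y x (\<omega> k) + a * Z (\<omega> k) - w k\<bar> \<le> \<epsilon>)}
    \<le> measure Q {\<omega> \<in> space Q. V \<omega> \<in> A} * (2 / d * \<epsilon>) ^ card K"
proof -
  interpret P: prob_space P by fact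
  interpret PK: finite_product_prob_space "\<lambda>_. P" K by unfold_locales (rule K)
  have pQ: "prob_space Q" unfolding Q_def by (rule PK.prob_space_axioms)
  interpret Q: prob_space Q by (rule pQ)
  interpret QQ: pair_prob_space Q Q ..
  let ?J = "K \<times> (I <+> {()})"
  let ?N = "PiM ?J (\<lambda>_. borel :: real measure)"
  let ?T = "case_sum Y (\<lambda>_. Z)"
  let ?f = "\<lambda>\<omega>. \<lambda>q\<in>?J. ?T (snd q) (\<omega> (fst q))"
  let ?h = "\<lambda>z. \<lambda>q\<in>?J. ?T (snd q) ((case snd q of Inl _ \<Rightarrow> fst z | Inr _ \<Rightarrow> snd z) (fst q))"
  have mT: "?T i \<in> borel_measurable P" if "i \<in> I <+> {()}" for i using g that by (auto simp: gaussian_family_def)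
  have mY: "Y i \<in> borel_measurable P" if "i \<in> I" for i using mT[of "Inl i"] that by auto
  have mZ: "Z \<in> borel_measurable P" using mT[of "Inr ()"] by auto
  have mYQ [measurable]: "(\<lambda>\<omega>. Y i (\<omega> k)) \<in> borel_measurable Q" if "k \<in> K" "i \<in> I" for i k
    unfolding Q_def by (rule measurable_compose[OF measurable_component_singleton[OF that(1)] mY[OF that(2)]])
  have mZQ [measurable]: "(\<lambda>\<omega>. Z (\<omega> k)) \<in> borel_measurable Q" if "k \<in> K" for k
    unfolding Q_def by (rule measurable_compose[OF measurable_component_singleton[OF that(1)] mZ])
  have mV [measurable]: "V \<in> measurable Q N"
    unfolding V_def N_def by (rule measurable_restrict) (auto intro!: mYQ)
  have mf: "?f \<in> measurable Q ?N"
  proof (rule measurable_restrict)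
    fix q assume q: "q \<in> ?J"
    obtain k i where "q = (k, i)" by (cases q)
    with q show "(\<lambda>\<omega>. ?T (snd q) (\<omega> (fst q))) \<in> borel_measurable Q" by (cases i) auto
  qed
  have mh: "?h \<in> measurable (Q \<Otimes>\<^sub>M Q) ?N"
  proof (rule measurable_restrict)
    fix q assume q: "q \<in> ?J"
    obtain k i where e: "q = (k, i)" by (cases q)
    show "(\<lambda>z. ?T (snd q) ((case snd q of Inl _ \<Rightarrow> fst z | Inr _ \<Rightarrow> snd z) (fst q))) \<in> borel_measurable (Q \<Otimes>\<^sub>M Q)"
    proof (cases i)
      case (Inl j)
      then show ?thesis using q e measurable_compose[OF measurable_fst mYQ[of k j], of Q] by auto
    next
      case (Inr j)
      then show ?thesis using q e measurable_compose[OF measurable_snd mZQ[of k], of Q] by auto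
    qed
  qed
  let ?r = "\<lambda>y. \<lambda>(k, i)\<in>K \<times> I. y (k, Inl i :: 'i + unit) :: real"
  let ?G = "{y \<in> space ?N. ?r y \<in> A \<and> (\<forall>k\<in>K. \<bar>y (k, Inl x) + a * y (k, Inr ()) - w k\<bar> \<le> \<epsilon>)}"
  have mr: "?r \<in> measurable ?N N"
    unfolding N_def by (rule measurable_restrict) (auto intro!: measurable_component_singleton)
  have G: "?G \<in> sets ?N"
  proof -
    have "?G = (?r -` A \<inter> space ?N) \<inter> {y \<in> space ?N. \<forall>k\<in>K. \<bar>y (k, Inl x) + a * y (k, Inr ()) - w k\<bar> \<le> \<epsilon>}" by auto
    moreover have "?r -` A \<inter> space ?N \<in> sets ?N" using mr A by (rule measurable_sets)
    moreover have "{y \<in> space ?N. \<forall>k\<in>K. \<bar>y (k, Inl x) + a * y (k, Inr ()) - w k\<bar> \<le> \<epsilon>} \<in> sets ?N"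
    proof (rule sets.sets_Collect_finite_All[OF _ K])
      fix k assume k: "k \<in> K"
      have [measurable]: "(\<lambda>y. y (k, Inl x)) \<in> borel_measurable ?N" "(\<lambda>y. y (k, Inr ())) \<in> borel_measurable ?N"
        using k x by (auto intro!: measurable_component_singleton)
      show "{y \<in> space ?N. \<bar>y (k, Inl x) + a * y (k, Inr ()) - w k\<bar> \<le> \<epsilon>} \<in> sets ?N" by measurable
    qed
    ultimately show ?thesis by auto
  qed
  let ?E = "{\<omega> \<in> space Q. V \<omega> \<in> A \<and> (\<forall>k\<in>K. \<bar>Y x (\<omega> k) + a * Z (\<omega> k) - w k\<bar> \<le> \<epsilon>)}"
  let ?F = "{z \<in> space (Q \<Otimes>\<^sub>M Q). V (fst z) \<in> A \<and> (\<forall>k\<in>K. \<bar>Y x (fst z k) + a * Z (snd z k) - w k\<bar> \<le> \<epsilon>)}"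
  have r1: "?r (?f \<omega>) = V \<omega>" for \<omega> by (auto simp: V_def restrict_def fun_eq_iff)
  have r2: "?r (?h z) = V (fst z)" for z by (auto simp: V_def restrict_def fun_eq_iff)
  have c1: "(\<forall>k\<in>K. \<bar>?f \<omega> (k, Inl x) + a * ?f \<omega> (k, Inr ()) - w k\<bar> \<le> \<epsilon>) \<longleftrightarrow> (\<forall>k\<in>K. \<bar>Y x (\<omega> k) + a * Z (\<omega> k) - w k\<bar> \<le> \<epsilon>)" for \<omega>
    using x by (intro ball_cong) auto
  have c2: "(\<forall>k\<in>K. \<bar>?h z (k, Inl x) + a * ?h z (k, Inr ()) - w k\<bar> \<le> \<epsilon>) \<longleftrightarrow> (\<forall>k\<in>K. \<bar>Y x (fst z k) + a * Z (snd z k) - w k\<bar> \<le> \<epsilon>)" for z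
    using x by (intro ball_cong) auto
  have "?E = ?f -` ?G \<inter> space Q"
  proof (rule Set.set_eqI)
    fix \<omega>
    show "\<omega> \<in> ?E \<longleftrightarrow> \<omega> \<in> ?f -` ?G \<inter> space Q"
      unfolding vimage_eq Int_iff mem_Collect_eq r1 c1 using measurable_space[OF mf, of \<omega>] by blast
  qed
  then have "emeasure Q ?E = emeasure (distr Q ?N ?f) ?G" using emeasure_distr[OF mf G] by simp
  also have "distr Q ?N ?f = distr (Q \<Otimes>\<^sub>M Q) ?N ?h"
    unfolding Q_def by (rule gaussian_decouple_copies[OF P K g]) (use uncor in auto)
  also have "emeasure (distr (Q \<Otimes>\<^sub>M Q) ?N ?h) ?G = emeasure (Q \<Otimes>\<^sub>M Q) (?h -` ?G \<inter> space (Q \<Otimes>\<^sub>M Q))"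
    by (rule emeasure_distr[OF mh G])
  also have F: "?h -` ?G \<inter> space (Q \<Otimes>\<^sub>M Q) = ?F"
  proof (rule Set.set_eqI)
    fix z
    show "z \<in> ?h -` ?G \<inter> space (Q \<Otimes>\<^sub>M Q) \<longleftrightarrow> z \<in> ?F"
      unfolding vimage_eq Int_iff mem_Collect_eq r2 c2 using measurable_space[OF mh, of z] by blast
  qed
  also have "emeasure (Q \<Otimes>\<^sub>M Q) ?F = (\<integral>\<^sup>+\<omega>. emeasure Q (Pair \<omega> -` ?F) \<partial>Q)"
    by (rule Q.emeasure_pair_measure_alt) (use measurable_sets[OF mh G] F in simp)
  also have "\<dots> \<le> (\<integral>\<^sup>+\<omega>. ennreal ((2 / d * \<epsilon>) ^ card K) * indicator {\<omega> \<in> space Q. V \<omega> \<in> A} \<omega> \<partial>Q)"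
  proof (rule nn_integral_mono)
    fix \<omega> assume \<omega>: "\<omega> \<in> space Q"
    show "emeasure Q (Pair \<omega> -` ?F) \<le> ennreal ((2 / d * \<epsilon>) ^ card K) * indicator {\<omega> \<in> space Q. V \<omega> \<in> A} \<omega>"
    proof (cases "V \<omega> \<in> A")
      case True
      let ?B = "\<lambda>k. {\<omega>' \<in> space P. \<bar>(Y x (\<omega> k) - w k) + a * Z \<omega>'\<bar> \<le> \<epsilon>}"
      have B: "?B k \<in> sets P" for k using mZ by measurable
      have "Pair \<omega> -` ?F = PiE K ?B"
      proof (rule Set.set_eqI)
        fix \<omega>'
        have "\<bar>Y x (\<omega> k) + a * Z (\<omega>' k) - w k\<bar> = \<bar>(Y x (\<omega> k) - w k) + a * Z (\<omega>' k)\<bar>" for k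
          by (simp add: algebra_simps)
        then have "\<omega>' \<in> Pair \<omega> -` ?F \<longleftrightarrow> \<omega>' \<in> space Q \<and> (\<forall>k\<in>K. \<bar>(Y x (\<omega> k) - w k) + a * Z (\<omega>' k)\<bar> \<le> \<epsilon>)"
          using \<omega> True by (simp add: space_pair_measure)
        also have "\<dots> \<longleftrightarrow> \<omega>' \<in> PiE K ?B"
          unfolding Q_def space_PiM PiE_iff by blast
        finally show "\<omega>' \<in> Pair \<omega> -` ?F \<longleftrightarrow> \<omega>' \<in> PiE K ?B" .
      qed
      then have "emeasure Q (Pair \<omega> -` ?F) = ennreal (measure Q (PiE K ?B))" by (simp add: Q.emeasure_eq_measure)
      also have "measure Q (PiE K ?B) = (\<Prod>k\<in>K. P.prob (?B k))"
        unfolding Q_def by (rule PK.finite_measure_PiM_emb) (rule B)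
      also have "\<dots> \<le> (\<Prod>k\<in>K. 2 / d * \<epsilon>)"
        by (intro prod_mono conjI P.normal_rv_interval_le[OF Z d a e]) auto
      finally show ?thesis using True \<omega> by (simp add: ennreal_leI)
    qed (auto simp: vimage_def)
  qed
  also have "\<dots> = ennreal ((2 / d * \<epsilon>) ^ card K) * emeasure Q {\<omega> \<in> space Q. V \<omega> \<in> A}"
  proof (rule nn_integral_cmult_indicator)
    have "{\<omega> \<in> space Q. V \<omega> \<in> A} = V -` A \<inter> space Q" by auto
    then show "{\<omega> \<in> space Q. V \<omega> \<in> A} \<in> sets Q" using measurable_sets[OF mV A] by simp
  qed
  finally show ?thesis using d e by (simp add: Q.emeasure_eq_measure ennreal_mult[symmetric] mult.commute)
qed

context patch begin

text \<open>Independent copies may live on any probability space. Only their joint law at the nodes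
  matters here, and it is modelled on a power of \<open>P\<close>.\<close>

definition law :: "'k set \<Rightarrow> ('k \<times> (nat \<times> ('n \<Rightarrow> nat)) \<Rightarrow> real) measure" where
  "law K = distr (PiM K (\<lambda>_. P)) (PiM (K \<times> T.nodes) (\<lambda>_. borel)) (\<lambda>\<omega>. \<lambda>(k, x)\<in>K \<times> T.nodes. \<xi> (p x) (\<omega> k))"

lemma critical_law:
  fixes K :: "'k set"
  assumes K: "finite K" "K \<noteq> {}"
  shows "critical (cells \<gamma>) (parent \<gamma>) (\<lambda>m. \<Prod>j\<in>UNIV. 2 ^ (lv \<gamma> j (Suc m) - lv \<gamma> j m)) \<kappa> (2 ^ CARD('n))
     (law K) K root \<alpha> m0 (2 / d0) (8 * 2 ^ CARD('n) * Bmom ^ (2 * \<kappa>)) (fact (2 * \<kappa>) / (2 ^ \<kappa> * fact \<kappa>) * (\<integral>\<omega>. (\<xi> x0 \<omega>)\<^sup>2 \<partial>P) ^ \<kappa>)"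
proof -
  interpret PK: finite_product_prob_space "\<lambda>_. P" K by unfold_locales (rule K)
  let ?Q = "PiM K (\<lambda>_. P)"
  let ?N = "PiM (K \<times> T.nodes) (\<lambda>_. borel :: real measure)"
  let ?\<Phi> = "\<lambda>\<omega>. \<lambda>(k, x)\<in>K \<times> T.nodes. \<xi> (p x) (\<omega> k)"
  have m\<xi>: "\<xi> (p x) \<in> borel_measurable P" if "x \<in> T.nodes" for x using that by (intro \<xi>_meas p_orthant)
  have mQ: "(\<lambda>\<omega>. \<xi> (p x) (\<omega> k)) \<in> borel_measurable ?Q" if "k \<in> K" "x \<in> T.nodes" for k x
    by (rule measurable_compose[OF measurable_component_singleton[OF that(1)] m\<xi>[OF that(2)]])
  have m\<Phi>: "?\<Phi> \<in> measurable ?Q ?N" by (rule measurable_restrict) (auto intro!: mQ)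
  have prob: "prob_space (law K)" unfolding law_def by (rule PK.prob_space_distr[OF m\<Phi>])
  have sets: "sets (law K) = sets ?N" by (simp add: law_def)
  have space: "space (law K) = space ?N" by (simp add: law_def)
  have ev: "measure (law K) {y \<in> space (law K). H y} = measure ?Q {\<omega> \<in> space ?Q. H (?\<Phi> \<omega>)}"
    if "{y \<in> space ?N. H y} \<in> sets ?N" for H
  proof -
    have "{\<omega> \<in> space ?Q. H (?\<Phi> \<omega>)} = ?\<Phi> -` {y \<in> space ?N. H y} \<inter> space ?Q"
      using measurable_space[OF m\<Phi>] by auto
    then show ?thesis using measure_distr[OF m\<Phi> that] by (simp add: space law_def)
  qed
  obtain v where v: "normal_rv P (\<xi> x0) 0 v" using \<xi>_normal[OF x0_orthant] by blast
  have vv: "v = (\<integral>\<omega>. (\<xi> x0 \<omega>)\<^sup>2 \<partial>P)" using normal_rv_square[OF v] by simp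
  have mc: "(\<lambda>y. y q) \<in> borel_measurable ?N" if "q \<in> K \<times> T.nodes" for q
    using that by (rule measurable_component_singleton)
  have comp: "(\<integral>\<^sup>+\<omega>. f (\<omega> k) \<partial>?Q) = (\<integral>\<^sup>+\<omega>. f \<omega> \<partial>P)" if "k \<in> K" "f \<in> borel_measurable P" for k and f :: "'v \<Rightarrow> ennreal"
  proof -
    have "(\<integral>\<^sup>+\<omega>. f \<omega> \<partial>P) = (\<integral>\<^sup>+\<omega>. f \<omega> \<partial>distr ?Q P (\<lambda>\<omega>. \<omega> k))" using PK.PiM_component[OF that(1)] by simp
    also have "\<dots> = (\<integral>\<^sup>+\<omega>. f (\<omega> k) \<partial>?Q)" using that by (intro nn_integral_distr) auto
    finally show ?thesis by simp
  qed
  show ?thesis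
  proof (intro critical.intro T.tree_axioms critical_axioms.intro)
    show "prob_space (law K)" by (rule prob)
    show "sets (law K) = sets ?N" by (rule sets)
    show "finite K" "K \<noteq> {}" by (rule K)+
    show "root \<in> T.nodes" by (rule root)
    show "0 \<le> 2 / d0" using d0 by simp
    show "0 \<le> 8 * 2 ^ CARD('n) * Bmom ^ (2 * \<kappa>)" using Bmom_nonneg by simp
    show "0 \<le> fact (2 * \<kappa>) / (2 ^ \<kappa> * fact \<kappa>) * (\<integral>\<omega>. (\<xi> x0 \<omega>)\<^sup>2 \<partial>P) ^ \<kappa>" using var_x0 by simp
    show "\<exists>n1. \<forall>l\<ge>n1. \<forall>i\<in>cells \<gamma> (Suc l). \<bar>T.edge \<alpha> l i\<bar> \<le> \<eta> * (1 / 2) ^ Suc l" if "0 < \<eta>" for \<eta>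
      by (rule \<alpha>_edge[OF that])
  next
    fix A x w and \<epsilon> :: real assume A: "A \<in> sets (law K)" and x: "x \<in> T.nodes" and e: "0 < \<epsilon>"
    let ?Y = "\<lambda>x \<omega>. \<xi> (p x) \<omega> - \<alpha> x * \<xi> x0 \<omega>"
    let ?V = "\<lambda>\<omega>. \<lambda>(k, i)\<in>K \<times> T.nodes. ?Y i (\<omega> k)"
    let ?U = "\<lambda>y. \<lambda>(k, x)\<in>K \<times> T.nodes. y (k, x) - \<alpha> x * y (k, root)"
    have mU: "?U \<in> measurable ?N ?N"
      using root(1) by (intro measurable_restrict) (auto intro!: borel_measurable_diff borel_measurable_times mc)
    have U\<Phi>: "?U (?\<Phi> \<omega>) = ?V \<omega>" for \<omega> using root by (auto simp: restrict_def fun_eq_iff)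
    have g: "gaussian_family P (T.nodes <+> {()}) (case_sum ?Y (\<lambda>_. \<xi> x0))"
    proof -
      \<comment> \<open>\<open>S\<close> and \<open>a\<close> write residuals and corner value as
        finite combinations of node values. For \<open>x = root\<close> the index set is a single
        node and its two coefficients are added.\<close>
      define S where "S = case_sum (\<lambda>x. {x, root}) (\<lambda>_ :: unit. {root})"
      define a where "a = case_sum (\<lambda>x i. (if i = x then 1 else 0) - (if i = root then \<alpha> x else 0)) (\<lambda>(_ :: unit) _. 1 :: real)"
      have "finite (S z)" "S z \<subseteq> T.nodes" if "z \<in> T.nodes <+> {()}" for z
        using that root(1) by (auto simp: S_def)
      then have "gaussian_family P (T.nodes <+> {()}) (\<lambda>z \<omega>. \<Sum>i\<in>S z. a z i * \<xi> (p i) \<omega>)"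
        by (rule gaussian_family_linear[OF gaussian_family_\<xi>])
      also have "(\<lambda>z \<omega>. \<Sum>i\<in>S z. a z i * \<xi> (p i) \<omega>) = case_sum ?Y (\<lambda>_. \<xi> x0)"
      proof (intro ext)
        fix z \<omega>
        show "(\<Sum>i\<in>S z. a z i * \<xi> (p i) \<omega>) = case_sum ?Y (\<lambda>_. \<xi> x0) z \<omega>"
        proof (cases z)
          case (Inl x)
          then show ?thesis using root(2) by (cases "x = root") (simp_all add: S_def a_def left_diff_distrib)
        qed (use root(2) in \<open>simp add: S_def a_def\<close>)
      qed
      finally show ?thesis .
    qed
    have m: "{y \<in> space ?N. ?U y \<in> A} \<in> sets ?N"
    proof -
      have "{y \<in> space ?N. ?U y \<in> A} = ?U -` A \<inter> space ?N" by auto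
      then show ?thesis using measurable_sets[OF mU, of A] A sets by simp
    qed
    have m2: "{y \<in> space ?N. ?U y \<in> A \<and> (\<forall>k\<in>K. \<bar>y (k, x) - w k\<bar> \<le> \<epsilon>)} \<in> sets ?N"
    proof -
      have "{y \<in> space ?N. \<forall>k\<in>K. \<bar>y (k, x) - w k\<bar> \<le> \<epsilon>} \<in> sets ?N"
      proof (rule sets.sets_Collect_finite_All[OF _ K(1)])
        fix k assume "k \<in> K"
        then have [measurable]: "(\<lambda>y. y (k, x)) \<in> borel_measurable ?N" using x by (intro mc) auto
        show "{y \<in> space ?N. \<bar>y (k, x) - w k\<bar> \<le> \<epsilon>} \<in> sets ?N" by measurable
      qed
      from sets.Int[OF m this] show ?thesis by (rule back_subst[of "\<lambda>S. S \<in> sets ?N"]) auto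
    qed
    have "measure (law K) {y \<in> space (law K). ?U y \<in> A \<and> (\<forall>k\<in>K. \<bar>y (k, x) - w k\<bar> \<le> \<epsilon>)} =
       measure ?Q {\<omega> \<in> space ?Q. ?V \<omega> \<in> A \<and> (\<forall>k\<in>K. \<bar>?Y x (\<omega> k) + \<alpha> x * \<xi> x0 (\<omega> k) - w k\<bar> \<le> \<epsilon>)}"
      using x by (subst ev[OF m2]) (simp only: U\<Phi>, simp)
    also have "\<dots> \<le> measure ?Q {\<omega> \<in> space ?Q. ?V \<omega> \<in> A} * (2 / d0 * \<epsilon>) ^ card K"
      using regression_orthogonal var_x0(1) d0(1) vv A sets
      by (intro prob_regression_hit_le[OF prob_space_axioms K(1) g _ v _ _ \<alpha>_ge[OF x] e x]) auto
    also have "measure ?Q {\<omega> \<in> space ?Q. ?V \<omega> \<in> A} = measure (law K) {y \<in> space (law K). ?U y \<in> A}"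
      by (subst ev[OF m]) (simp only: U\<Phi>)
    finally show "measure (law K) {y \<in> space (law K). ?U y \<in> A \<and> (\<forall>k\<in>K. \<bar>y (k, x) - w k\<bar> \<le> \<epsilon>)}
       \<le> measure (law K) {y \<in> space (law K). ?U y \<in> A} * (2 / d0 * \<epsilon>) ^ card K" .
  next
    fix \<eta> \<delta> :: real and n0 :: nat assume "0 < \<eta>" "0 < \<delta>"
    from T.ex_scales_prob_all_bad_le[OF prob_space_axioms K Bmom_nonneg this m\<xi> decomposable_\<xi>, of n0]
    obtain m n where mn: "0 < m" "\<forall>s. n0 \<le> n s \<and> n s < n (Suc s)" and b: "\<And>i. (\<forall>s<m. i s \<in> cells \<gamma> (n s)) \<Longrightarrow>
       measure ?Q {\<omega> \<in> space ?Q. \<forall>s<m. \<exists>k\<in>K. \<not> T.osc (n s) (i s) (\<lambda>x. \<xi> (p x) (\<omega> k)) \<le> T.lev \<eta> (n s)} \<le> \<delta>" by blast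
    show "\<exists>m n. 0 < m \<and> (\<forall>s. n0 \<le> n s \<and> n s < n (Suc s)) \<and> (\<forall>i. (\<forall>s<m. i s \<in> cells \<gamma> (n s)) \<longrightarrow>
         measure (law K) {y \<in> space (law K). \<forall>s<m. \<exists>k\<in>K. \<not> T.osc (n s) (i s) (\<lambda>x. y (k, x)) \<le> T.lev \<eta> (n s)} \<le> \<delta>)"
    proof (intro exI[of _ m] exI[of _ n] conjI mn allI impI)
      fix i assume i: "\<forall>s<m. i s \<in> cells \<gamma> (n s)"
      have o [measurable]: "(\<lambda>y. T.osc l j (\<lambda>x. y (k, x))) \<in> borel_measurable ?N" if "k \<in> K" for k l j
        using that by (intro T.osc_measurable mc) auto
      have "{y \<in> space ?N. \<forall>s\<in>{..<m}. \<exists>k\<in>K. \<not> T.osc (n s) (i s) (\<lambda>x. y (k, x)) \<le> T.lev \<eta> (n s)} \<in> sets ?N"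
      proof (intro sets.sets_Collect_finite_All sets.sets_Collect_finite_Ex)
        fix s k assume "k \<in> K"
        then show "{y \<in> space ?N. \<not> T.osc (n s) (i s) (\<lambda>x. y (k, x)) \<le> T.lev \<eta> (n s)} \<in> sets ?N" by measurable
      qed (use K in auto)
      then have m: "{y \<in> space ?N. \<forall>s<m. \<exists>k\<in>K. \<not> T.osc (n s) (i s) (\<lambda>x. y (k, x)) \<le> T.lev \<eta> (n s)} \<in> sets ?N"
        by (simp only: Ball_def lessThan_iff)
      have oe: "T.osc l j (\<lambda>x. ?\<Phi> \<omega> (k, x)) = T.osc l j (\<lambda>x. \<xi> (p x) (\<omega> k))" if "k \<in> K" for l j k \<omega>
        using that by (intro T.osc_cong) auto
      have be: "(\<exists>k\<in>K. \<not> T.osc l j (\<lambda>x. ?\<Phi> \<omega> (k, x)) \<le> u) \<longleftrightarrow> (\<exists>k\<in>K. \<not> T.osc l j (\<lambda>x. \<xi> (p x) (\<omega> k)) \<le> u)" for l j u \<omega>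
        by (intro bex_cong refl) (simp only: oe)
      show "measure (law K) {y \<in> space (law K). \<forall>s<m. \<exists>k\<in>K. \<not> T.osc (n s) (i s) (\<lambda>x. y (k, x)) \<le> T.lev \<eta> (n s)} \<le> \<delta>"
        unfolding ev[OF m] be by (rule b[OF i])
    qed
  next
    fix k n i assume k: "k \<in> K" and n: "m0 \<le> n" and i: "i \<in> cells \<gamma> n"
    have m: "(\<lambda>y. T.osc n i (\<lambda>x. y (k, x))) \<in> borel_measurable ?N"
      using k by (intro T.osc_measurable mc) auto
    have "(\<integral>\<^sup>+y. T.osc n i (\<lambda>x. y (k, x)) \<partial>law K) = (\<integral>\<^sup>+\<omega>. T.osc n i (\<lambda>x. ?\<Phi> \<omega> (k, x)) \<partial>?Q)"
      unfolding law_def by (rule nn_integral_distr[OF m\<Phi>]) (simp only: measurable_distr_eq1 m)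
    also have "\<dots> = (\<integral>\<^sup>+\<omega>. T.osc n i (\<lambda>x. \<xi> (p x) (\<omega> k)) \<partial>?Q)"
      using k by (intro nn_integral_cong T.osc_cong) auto
    also have "\<dots> = (\<integral>\<^sup>+\<omega>. T.osc n i (\<lambda>x. \<xi> (p x) \<omega>) \<partial>P)"
      by (rule comp[OF k T.osc_measurable[OF m\<xi>]])
    also have "\<dots> \<le> ennreal (8 * 2 ^ CARD('n) * Bmom ^ (2 * \<kappa>) * (1 / 4) ^ (\<kappa> * n))"
      by (rule T.nn_integral_osc_le[OF i moment_bound_\<xi>[OF n]])
    finally show "(\<integral>\<^sup>+y. T.osc n i (\<lambda>x. y (k, x)) \<partial>law K) \<le> ennreal (8 * 2 ^ CARD('n) * Bmom ^ (2 * \<kappa>) * (1 / 4) ^ (\<kappa> * n))" .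
  next
    fix k assume k: "k \<in> K"
    have m: "(\<lambda>y. ennreal (y (k, root) ^ (2 * \<kappa>))) \<in> borel_measurable ?N"
    proof -
      have [measurable]: "(\<lambda>y. y (k, root)) \<in> borel_measurable ?N" using k root(1) by (intro mc) auto
      show ?thesis by measurable
    qed
    have "(\<integral>\<^sup>+y. ennreal (y (k, root) ^ (2 * \<kappa>)) \<partial>law K) = (\<integral>\<^sup>+\<omega>. ennreal (?\<Phi> \<omega> (k, root) ^ (2 * \<kappa>)) \<partial>?Q)"
      unfolding law_def by (rule nn_integral_distr[OF m\<Phi>]) (simp only: measurable_distr_eq1 m)
    also have "\<dots> = (\<integral>\<^sup>+\<omega>. ennreal (\<xi> x0 (\<omega> k) ^ (2 * \<kappa>)) \<partial>?Q)"
      using k root by simp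
    also have "\<dots> = (\<integral>\<^sup>+\<omega>. ennreal (\<xi> x0 \<omega> ^ (2 * \<kappa>)) \<partial>P)"
    proof (rule comp[OF k])
      have [measurable]: "\<xi> x0 \<in> borel_measurable P" by (rule \<xi>_meas[OF x0_orthant])
      show "(\<lambda>\<omega>. ennreal (\<xi> x0 \<omega> ^ (2 * \<kappa>))) \<in> borel_measurable P" by measurable
    qed
    also have "\<dots> = ennreal (fact (2 * \<kappa>) / (2 ^ \<kappa> * fact \<kappa>) * v ^ \<kappa>)"
      using normal_rv_even_moment[OF v, of \<kappa>] by (subst nn_integral_eq_integral) auto
    finally show "(\<integral>\<^sup>+y. ennreal (y (k, root) ^ (2 * \<kappa>)) \<partial>law K) \<le> ennreal (fact (2 * \<kappa>) / (2 ^ \<kappa> * fact \<kappa>) * (\<integral>\<omega>. (\<xi> x0 \<omega>)\<^sup>2 \<partial>P) ^ \<kappa>)"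
      by (simp add: vv)
  qed
qed

end

section \<open>Vanishing probability\<close>

definition symm_mat :: "nat \<Rightarrow> (nat \<times> nat \<Rightarrow> real) \<Rightarrow> real mat" where
  "symm_mat d v = Matrix.mat d d (\<lambda>(i, j). if i < j then v (i, j) else if i = j then sqrt 2 * v (i, i) else v (j, i))"

lemma X1_symm_mat: "X1 d \<zeta> t \<omega> = symm_mat d (\<lambda>q. \<zeta> q t \<omega>)"
  by (simp add: X1_def symm_mat_def)

lemma symm_mat_carrier [simp]: "symm_mat d v \<in> carrier_mat d d"
  by (simp add: symm_mat_def)

lemma finite_upper_indices: "finite (upper_indices d)"
  by (rule finite_subset[of _ "{..d} \<times> {..d}"]) (auto simp: upper_indices_def)

lemma card_upper_indices: "2 * card (upper_indices d) = d * (d + 1)"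
proof -
  have "upper_indices d = prod.swap ` Sigma {..<d} (\<lambda>j. {..j})"
    by (auto simp: upper_indices_def image_iff)
  then have "card (upper_indices d) = (\<Sum>j<d. Suc j)"
    by (simp add: card_image card_SigmaI)
  also have "2 * (\<Sum>j<d. Suc j) = d * (d + 1)"
    by (induction d) auto
  finally show ?thesis .
qed

text \<open>The dimension of the symmetric matrices minus the number of parameters in
  \<open>degenerate_cover\<close>; this is where the special form of \<kappa> enters.\<close>

lemma codimension_eq:
  assumes "1 \<le> k" "k \<le> d" and "real \<kappa> = (real k + 2) * (real k - 1) / 2"
  shows "1 + (\<Sum>l\<in>{1..d - k}. k + l) + \<kappa> = card (upper_indices d)"
proof -
  obtain m where m: "d = k + m" using assms(2) le_Suc_ex by blast
  have "2 * (\<Sum>l\<in>{1..m}. k + l) = 2 * k * m + m * (m + 1)"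
    by (induction m) (auto simp: algebra_simps)
  then have "2 * real (\<Sum>l\<in>{1..m}. k + l) = 2 * real k * real m + real m * (real m + 1)"
    by (metis (mono_tags, opaque_lifting) of_nat_1 of_nat_add of_nat_mult of_nat_numeral)
  moreover have "2 * real (card (upper_indices d)) = (real k + real m) * (real k + real m + 1)"
    using card_upper_indices[of d] m by (metis (mono_tags, opaque_lifting) of_nat_1 of_nat_add of_nat_mult of_nat_numeral)
  ultimately have "2 * real (1 + (\<Sum>l\<in>{1..d - k}. k + l) + \<kappa>) = 2 * real (card (upper_indices d))"
    using assms(3) m by (simp add: field_simps)
  then show ?thesis by (metis mult_cancel_left of_nat_eq_iff zero_neq_numeral)
qed

text \<open>The net of matrices is pulled back to the coordinates in the upper triangle. Division by
  \<open>sqrt 2\<close> on the diagonal does not increase distances, so the constant stays the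
  same.\<close>

lemma degenerate_parameter_cover:
  assumes k: "1 \<le> k" "k \<le> d" and A: "A \<in> carrier_mat d d" and r: "0 \<le> r"
  shows "\<exists>C\<ge>1. \<forall>\<epsilon>. 0 < \<epsilon> \<and> \<epsilon> \<le> 1 \<longrightarrow> (\<exists>F. finite F \<and>
     real (card F) \<le> C * (1 / \<epsilon>) ^ (1 + (\<Sum>l\<in>{1..d - k}. k + l)) \<and>
     (\<forall>v\<in>{v. A + symm_mat d v \<in> degenerate k (d - k)}. (\<forall>q\<in>upper_indices d. \<bar>v q\<bar> \<le> r) \<longrightarrow>
        (\<exists>w\<in>F. \<forall>q\<in>upper_indices d. \<bar>v q - w q\<bar> \<le> C * \<epsilon>)))"
proof -
  let ?s = "\<Sum>i<d. \<Sum>j<d. \<bar>A $$ (i, j)\<bar>"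
  have s: "\<bar>A $$ (i, j)\<bar> \<le> ?s" if "i < d" "j < d" for i j
  proof -
    have "\<bar>A $$ (i, j)\<bar> \<le> (\<Sum>j<d. \<bar>A $$ (i, j)\<bar>)" using that by (intro member_le_sum) auto
    also have "\<dots> \<le> ?s" using that by (intro member_le_sum[of i "{..<d}" "\<lambda>i. \<Sum>j<d. \<bar>A $$ (i, j)\<bar>"]) (auto intro: sum_nonneg)
    finally show ?thesis .
  qed
  have s0: "0 \<le> ?s" by (intro sum_nonneg) auto
  have dk: "k + (d - k) = d" using k by simp
  have R0: "0 \<le> ?s + 2 * r" using s0 r by simp
  obtain C where C: "1 \<le> C" and
    cov: "\<And>\<epsilon>. 0 < \<epsilon> \<and> \<epsilon> \<le> 1 \<Longrightarrow> \<exists>F. finite F \<and> real (card F) \<le> C * (1 / \<epsilon>) ^ (1 + (\<Sum>l\<in>{1..d - k}. k + l)) \<and>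
     (\<forall>B\<in>degenerate k (d - k). (\<forall>i<d. \<forall>j<d. \<bar>B $$ (i, j)\<bar> \<le> ?s + 2 * r) \<longrightarrow>
        (\<exists>B'\<in>F. \<forall>i<d. \<forall>j<d. \<bar>B $$ (i, j) - B' $$ (i, j)\<bar> \<le> C * \<epsilon>))"
    using degenerate_cover[OF k(1) R0, of "d - k", unfolded dk] by metis
  have sq2: "1 \<le> sqrt 2" "sqrt 2 \<le> 2" by (auto simp: real_le_lsqrt)
  show ?thesis
  proof (intro exI[of _ C] conjI C allI impI)
    fix \<epsilon> :: real assume e: "0 < \<epsilon> \<and> \<epsilon> \<le> 1"
    from cov[OF e] obtain F where F: "finite F" "real (card F) \<le> C * (1 / \<epsilon>) ^ (1 + (\<Sum>l\<in>{1..d - k}. k + l))"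
      "\<And>B. B \<in> degenerate k (d - k) \<Longrightarrow> \<forall>i<d. \<forall>j<d. \<bar>B $$ (i, j)\<bar> \<le> ?s + 2 * r \<Longrightarrow>
        \<exists>B'\<in>F. \<forall>i<d. \<forall>j<d. \<bar>B $$ (i, j) - B' $$ (i, j)\<bar> \<le> C * \<epsilon>" by blast
    define f where "f B' = (\<lambda>(i, j). (B' $$ (i, j) - A $$ (i, j)) / (if i = j then sqrt 2 else 1))" for B'
    show "\<exists>F. finite F \<and>
       real (card F) \<le> C * (1 / \<epsilon>) ^ (1 + (\<Sum>l\<in>{1..d - k}. k + l)) \<and>
       (\<forall>v\<in>{v. A + symm_mat d v \<in> degenerate k (d - k)}. (\<forall>q\<in>upper_indices d. \<bar>v q\<bar> \<le> r) \<longrightarrow>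
          (\<exists>w\<in>F. \<forall>q\<in>upper_indices d. \<bar>v q - w q\<bar> \<le> C * \<epsilon>))"
    proof (intro exI[of _ "f ` F"] conjI ballI impI)
      show "finite (f ` F)" using F by simp
      have "real (card (f ` F)) \<le> real (card F)" using F card_image_le by auto
      then show "real (card (f ` F)) \<le> C * (1 / \<epsilon>) ^ (1 + (\<Sum>l\<in>{1..d - k}. k + l))" using F by linarith
      fix v assume v: "v \<in> {v. A + symm_mat d v \<in> degenerate k (d - k)}" and vr: "\<forall>q\<in>upper_indices d. \<bar>v q\<bar> \<le> r"
      let ?B = "A + symm_mat d v"
      have ent: "?B $$ (i, j) = A $$ (i, j) + (if i < j then v (i, j) else if i = j then sqrt 2 * v (i, i) else v (j, i))"
        if "i < d" "j < d" for i j
        using that A by (auto simp: symm_mat_def)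
      have "\<bar>?B $$ (i, j)\<bar> \<le> ?s + 2 * r" if ij: "i < d" "j < d" for i j
      proof -
        have vb: "\<bar>v (i, j)\<bar> \<le> r" if "i \<le> j" "j < d" for i j using vr that by (auto simp: upper_indices_def)
        have "\<bar>sqrt 2 * v (i, i)\<bar> \<le> 2 * r"
          unfolding abs_mult using sq2 vb[of i i] ij by (intro mult_mono) auto
        then have "\<bar>if i < j then v (i, j) else if i = j then sqrt 2 * v (i, i) else v (j, i)\<bar> \<le> 2 * r"
          using vb[of i j] vb[of j i] ij r by (cases i j rule: linorder_cases) auto
        then show ?thesis unfolding ent[OF ij] using s[OF ij] by linarith
      qed
      then obtain B' where B': "B' \<in> F" "\<And>i j. i < d \<Longrightarrow> j < d \<Longrightarrow> \<bar>?B $$ (i, j) - B' $$ (i, j)\<bar> \<le> C * \<epsilon>"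
        using F(3)[of ?B] v by blast
      show "\<exists>w\<in>f ` F. \<forall>q\<in>upper_indices d. \<bar>v q - w q\<bar> \<le> C * \<epsilon>"
      proof (intro bexI[of _ "f B'"] ballI)
        fix q assume "q \<in> upper_indices d"
        then obtain i j where q: "q = (i, j)" and ij: "i \<le> j" "j < d" by (auto simp: upper_indices_def)
        have b: "\<bar>?B $$ (i, j) - B' $$ (i, j)\<bar> \<le> C * \<epsilon>" using ij by (intro B'(2)) auto
        show "\<bar>v q - f B' q\<bar> \<le> C * \<epsilon>"
        proof (cases "i = j")
          case True
          have "v q - f B' q = (?B $$ (i, j) - B' $$ (i, j)) / sqrt 2"
            using ent[of i j] ij True by (simp add: q f_def field_simps)
          then have "\<bar>v q - f B' q\<bar> = \<bar>?B $$ (i, j) - B' $$ (i, j)\<bar> / sqrt 2" by (simp add: abs_divide)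
          also have "\<dots> \<le> \<bar>?B $$ (i, j) - B' $$ (i, j)\<bar> / 1" using sq2 by (intro divide_left_mono) auto
          finally show ?thesis using b by simp
        next
          case False
          then show ?thesis using b ent[of i j] ij by (simp add: q f_def)
        qed
      qed (use B' in auto)
    qed
  qed
qed

lemma eigenvalue_family_degenerate:
  assumes l: "eigenvalue_family d (A + symm_mat d v) l" and A: "A \<in> carrier_mat d d" "transpose_mat A = A"
    and i: "inj_on i {1..k}" "i ` {1..k} \<subseteq> {1..d}" and eq: "\<And>m. m \<in> {1..k} \<Longrightarrow> l (i m) = r"
  shows "A + symm_mat d v \<in> degenerate k (d - k)"
proof -
  let ?B = "A + symm_mat d v"
  have c: "card (i ` {1..k}) = k" using i(1) by (simp add: card_image)
  then have kd: "k \<le> d" using card_mono[OF _ i(2)] by simp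
  have "transpose_mat (symm_mat d v) = symm_mat d v"
    by (rule eq_matI) (auto simp: symm_mat_def)
  then have t: "transpose_mat ?B = ?B" using A by (simp add: transpose_add)
  let ?S = "{1..d} - i ` {1..k}"
  let ?as = "map l (sorted_list_of_set ?S)"
  have len: "length ?as = d - k" using c i(2) by (simp add: card_Diff_subset)
  have "char_poly ?B = (\<Prod>j\<in>{1..d}. [:- l j, 1:])" using l by (simp add: eigenvalue_family_def)
  also have "{1..d} = i ` {1..k} \<union> ?S" using i(2) by auto
  also have "(\<Prod>j\<in>i ` {1..k} \<union> ?S. [:- l j, 1:]) = (\<Prod>j\<in>i ` {1..k}. [:- l j, 1:]) * (\<Prod>j\<in>?S. [:- l j, 1:])"
    by (rule prod.union_disjoint) auto
  also have "(\<Prod>j\<in>i ` {1..k}. [:- l j, 1:]) = (\<Prod>j\<in>i ` {1..k}. [:- r, 1:])"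
    using eq by (intro prod.cong) auto
  also have "\<dots> = [:- r, 1:] ^ k" using c by simp
  also have "(\<Prod>j\<in>?S. [:- l j, 1:]) = (\<Prod>a\<leftarrow>?as. [:- a, 1:])"
    using prod.distinct_set_conv_list[of "sorted_list_of_set ?S" "\<lambda>j. [:- l j, 1:]"] by (simp add: comp_def)
  finally show ?thesis
    unfolding degenerate_def using len t kd A by (auto simp: transpose_add intro!: exI[of _ r] exI[of _ ?as])
qed

text \<open>Intersecting the covers for \<eta> = 1 / (n + 2) gives one measurable null set, so
  nothing has to be known about the measurability of \<open>H\<close>.\<close>

lemma (in prob_space) null_set_coverI:
  assumes \<kappa>: "1 \<le> \<kappa>" and C: "0 \<le> C"
    and S: "\<And>\<eta>. 0 < \<eta> \<Longrightarrow> \<eta> < 1 \<Longrightarrow> \<exists>S\<in>events. prob S \<le> C * \<eta> ^ \<kappa> \<and> H \<subseteq> S"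
  shows "\<exists>N\<in>null_sets M. H \<subseteq> N"
proof -
  have "\<forall>n :: nat. \<exists>S\<in>events. prob S \<le> C * (1 / real (n + 2)) ^ \<kappa> \<and> H \<subseteq> S"
    using S by simp
  then obtain S where S: "\<And>n :: nat. S n \<in> events" "\<And>n. prob (S n) \<le> C * (1 / real (n + 2)) ^ \<kappa>" "\<And>n. H \<subseteq> S n"
    by metis
  have m: "(\<Inter>n. S n) \<in> events" using S(1) by auto
  have "prob (\<Inter>n. S n) \<le> 0"
  proof (rule LIMSEQ_le_const)
    have "(\<lambda>n. C * (1 / real (n + 2)) ^ \<kappa>) \<longlonglongrightarrow> C * 0 ^ \<kappa>"
      using LIMSEQ_ignore_initial_segment[OF lim_inverse_n', of 2] by (intro tendsto_intros) simp
    then show "(\<lambda>n. C * (1 / real (n + 2)) ^ \<kappa>) \<longlonglongrightarrow> 0" using \<kappa> by (simp add: power_0_left)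
    have "prob (\<Inter>n. S n) \<le> prob (S n)" for n using S(1) by (intro finite_measure_mono) auto
    then show "\<exists>N. \<forall>n\<ge>N. prob (\<Inter>n. S n) \<le> C * (1 / real (n + 2)) ^ \<kappa>" using S(2) order_trans by blast
  qed
  then have "(\<Inter>n. S n) \<in> null_sets M"
    using m by (simp add: null_sets_def emeasure_eq_measure measure_le_0_iff)
  then show ?thesis using S(3) by blast
qed

text \<open>Independence makes the joint law of the sample paths a product of equal factors, which
  is also the law of the paths on the power of \<open>P\<close>; both sides are then restricted to
  the points \<open>p x\<close> by the same measurable map.\<close>

lemma distr_independent_copies:
  fixes K :: "'k set" and p :: "'x \<Rightarrow> 'i::topological_space"
  assumes P: "prob_space P" and M: "prob_space M" and K: "finite K" "K \<noteq> {}"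
    and ic: "independent_copies P \<xi> T M K \<zeta>" and p: "\<And>x. x \<in> X \<Longrightarrow> p x \<in> T"
    and m\<xi>: "\<And>t. t \<in> T \<Longrightarrow> \<xi> t \<in> borel_measurable P"
  shows "distr M (PiM (K \<times> X) (\<lambda>_. borel)) (\<lambda>\<omega>. \<lambda>(k, x)\<in>K \<times> X. \<zeta> k (p x) \<omega>) =
    distr (PiM K (\<lambda>_. P)) (PiM (K \<times> X) (\<lambda>_. borel)) (\<lambda>\<omega>. \<lambda>(k, x)\<in>K \<times> X. \<xi> (p x) (\<omega> k))"
    and "(\<lambda>\<omega>. \<lambda>(k, x)\<in>K \<times> X. \<zeta> k (p x) \<omega>) \<in> measurable M (PiM (K \<times> X) (\<lambda>_. borel))"
proof -
  interpret M: prob_space M by fact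
  interpret P: prob_space P by fact
  let ?S = "path_space T"
  let ?N = "PiM (K \<times> X) (\<lambda>_. borel :: real measure)"
  let ?g = "\<lambda>f. \<lambda>(k, x)\<in>K \<times> X. f k (p x) :: real"
  have iv: "M.indep_vars (\<lambda>_. ?S) (\<lambda>k. sample_path T (\<zeta> k)) K"
    and eq: "\<And>k. k \<in> K \<Longrightarrow> distr M ?S (sample_path T (\<zeta> k)) = distr P ?S (sample_path T \<xi>)"
    using ic by (auto simp: independent_copies_def)
  have m\<zeta>: "sample_path T (\<zeta> k) \<in> measurable M ?S" if "k \<in> K" for k
    using iv that by (auto simp: M.indep_vars_def)
  have ms: "sample_path T \<xi> \<in> measurable P ?S"
    unfolding sample_path_def path_space_def using m\<xi> by (intro measurable_restrict) auto
  have mr: "(\<lambda>\<omega>. \<lambda>k\<in>K. sample_path T (\<zeta> k) \<omega>) \<in> measurable M (PiM K (\<lambda>_. ?S))"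
    using m\<zeta> by (intro measurable_restrict) auto
  have mc: "compose K (sample_path T \<xi>) \<in> measurable (PiM K (\<lambda>_. P)) (PiM K (\<lambda>_. ?S))"
    unfolding compose_def
  proof (rule measurable_restrict)
    show "(\<lambda>\<omega>. sample_path T \<xi> (\<omega> k)) \<in> measurable (PiM K (\<lambda>_. P)) ?S" if "k \<in> K" for k
      by (rule measurable_compose[OF measurable_component_singleton[OF that] ms])
  qed
  have mg: "?g \<in> measurable (PiM K (\<lambda>_. ?S)) ?N"
  proof (rule measurable_restrict)
    fix q assume "q \<in> K \<times> X"
    then obtain k x where q: "q = (k, x)" "k \<in> K" "x \<in> X" by auto
    have "(\<lambda>h. h (p x)) \<in> borel_measurable ?S"
      unfolding path_space_def using p[OF q(3)] by (rule measurable_component_singleton)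
    from measurable_compose[OF measurable_component_singleton[OF q(2)] this]
    show "(\<lambda>f. case q of (k, x) \<Rightarrow> f k (p x)) \<in> borel_measurable (PiM K (\<lambda>_. ?S))" by (simp add: q)
  qed
  have g1: "?g (\<lambda>k\<in>K. sample_path T (\<zeta> k) \<omega>) = (\<lambda>(k, x)\<in>K \<times> X. \<zeta> k (p x) \<omega>)" for \<omega>
    using p by (auto simp: sample_path_def restrict_def fun_eq_iff)
  have g2: "?g (compose K (sample_path T \<xi>) \<omega>) = (\<lambda>(k, x)\<in>K \<times> X. \<xi> (p x) (\<omega> k))" for \<omega>
    using p by (auto simp: sample_path_def compose_def restrict_def fun_eq_iff)
  show "(\<lambda>\<omega>. \<lambda>(k, x)\<in>K \<times> X. \<zeta> k (p x) \<omega>) \<in> measurable M ?N"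
    using measurable_compose[OF mr mg] by (simp only: g1)
  have "distr M ?N (\<lambda>\<omega>. \<lambda>(k, x)\<in>K \<times> X. \<zeta> k (p x) \<omega>) = distr (distr M (PiM K (\<lambda>_. ?S)) (\<lambda>\<omega>. \<lambda>k\<in>K. sample_path T (\<zeta> k) \<omega>)) ?N ?g"
    unfolding distr_distr[OF mg mr] comp_def g1 ..
  also have "distr M (PiM K (\<lambda>_. ?S)) (\<lambda>\<omega>. \<lambda>k\<in>K. sample_path T (\<zeta> k) \<omega>) = PiM K (\<lambda>k. distr M ?S (sample_path T (\<zeta> k)))"
    using M.indep_vars_iff_distr_eq_PiM'[where X = "\<lambda>k. sample_path T (\<zeta> k)" and M' = "\<lambda>_. ?S", OF K(2) m\<zeta>] iv by blast
  also have "\<dots> = PiM K (\<lambda>_. distr P ?S (sample_path T \<xi>))"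
    by (rule PiM_cong) (simp_all add: eq)
  also have "\<dots> = distr (PiM K (\<lambda>_. P)) (PiM K (\<lambda>_. ?S)) (compose K (sample_path T \<xi>))"
  proof -
    let ?L = "distr P ?S (sample_path T \<xi>)"
    have L: "distr P ?L (sample_path T \<xi>) = ?L" by (rule distr_cong) auto
    have "distr (PiM K (\<lambda>_. P)) (PiM K (\<lambda>_. ?L)) (compose K (sample_path T \<xi>)) = PiM K (\<lambda>_. distr P ?L (sample_path T \<xi>))"
      using ms by (intro distr_PiM_finite_prob_space'[OF K(1)] P P.prob_space_distr) auto
    moreover have "distr (PiM K (\<lambda>_. P)) (PiM K (\<lambda>_. ?L)) (compose K (sample_path T \<xi>)) =
       distr (PiM K (\<lambda>_. P)) (PiM K (\<lambda>_. ?S)) (compose K (sample_path T \<xi>))"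
      by (intro distr_cong sets_PiM_cong) auto
    ultimately show ?thesis by (simp only: L)
  qed
  also have "distr (distr (PiM K (\<lambda>_. P)) (PiM K (\<lambda>_. ?S)) (compose K (sample_path T \<xi>))) ?N ?g =
     distr (PiM K (\<lambda>_. P)) ?N (\<lambda>\<omega>. \<lambda>(k, x)\<in>K \<times> X. \<xi> (p x) (\<omega> k))"
    unfolding distr_distr[OF mg mc] comp_def g2 ..
  finally show "distr M ?N (\<lambda>\<omega>. \<lambda>(k, x)\<in>K \<times> X. \<zeta> k (p x) \<omega>) =
     distr (PiM K (\<lambda>_. P)) ?N (\<lambda>\<omega>. \<lambda>(k, x)\<in>K \<times> X. \<xi> (p x) (\<omega> k))" .
qed

context patch begin

text \<open>Continuity links the continuum of parameters to the tree: the values at the corners of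
  the cells containing \<open>t\<close> converge to the value at \<open>t\<close>, so a hit is
  visible in the countably many node values and lies in the preimage of the cover.\<close>

lemma hitting_null:
  fixes M :: "'w measure" and K :: "'k set"
  assumes M: "prob_space M" and K: "finite K" "K \<noteq> {}" and ic: "independent_copies P \<xi> orthant M K \<zeta>"
    and r: "1 \<le> r" and Cc: "1 \<le> Cc" and dim: "pe + \<kappa> = card K"
    and cover: "\<And>\<epsilon>. 0 < \<epsilon> \<Longrightarrow> \<epsilon> \<le> 1 \<Longrightarrow> \<exists>F. finite F \<and> real (card F) \<le> Cc * (1 / \<epsilon>) ^ pe \<and>
       (\<forall>v\<in>\<D>. (\<forall>k\<in>K. \<bar>v k\<bar> \<le> r) \<longrightarrow> (\<exists>w\<in>F. \<forall>k\<in>K. \<bar>v k - w k\<bar> \<le> Cc * \<epsilon>))"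
  shows "\<exists>N\<in>null_sets M. {\<omega> \<in> space M. (\<forall>k\<in>K. continuous_on orthant (\<lambda>t. \<zeta> k t \<omega>)) \<and>
     (\<exists>t. (\<forall>j. x0 $ j \<le> t $ j \<and> t $ j < x0 $ j + \<tau>) \<and> (\<lambda>k. \<zeta> k t \<omega>) \<in> \<D> \<and>
       (\<forall>k\<in>K. \<bar>\<zeta> k t \<omega>\<bar> \<le> r \<and> \<bar>\<zeta> k x0 \<omega>\<bar> \<le> r))} \<subseteq> N" (is "\<exists>N\<in>_. ?H \<subseteq> N")
proof -
  interpret M: prob_space M by fact
  interpret H: critical "cells \<gamma>" "parent \<gamma>" "\<lambda>m. \<Prod>j\<in>UNIV. 2 ^ (lv \<gamma> j (Suc m) - lv \<gamma> j m)" \<kappa> "2 ^ CARD('n)"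
     "law K" K root \<alpha> m0 "2 / d0" "8 * 2 ^ CARD('n) * Bmom ^ (2 * \<kappa>)" "fact (2 * \<kappa>) / (2 ^ \<kappa> * fact \<kappa>) * (\<integral>\<omega>. (\<xi> x0 \<omega>)\<^sup>2 \<partial>P) ^ \<kappa>"
    by (rule critical_law[OF K])
  let ?N = "PiM (K \<times> T.nodes) (\<lambda>_. borel :: real measure)"
  let ?\<Psi> = "\<lambda>\<omega>. \<lambda>(k, x)\<in>K \<times> T.nodes. \<zeta> k (p x) \<omega>"
  note ci = distr_independent_copies[OF prob_space_axioms M K ic p_orthant \<xi>_meas]
  have law: "law K = distr M ?N ?\<Psi>" unfolding law_def by (rule ci(1)[symmetric])
  have m: "?\<Psi> \<in> measurable M ?N" by (rule ci(2))
  from H.hitting_cover[OF r Cc dim cover] obtain C where C: "0 \<le> C" and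
    S: "\<And>\<eta>. 0 < \<eta> \<Longrightarrow> \<eta> < 1 \<Longrightarrow> \<exists>S\<in>sets (law K). measure (law K) S \<le> C * \<eta> ^ \<kappa> \<and> {y \<in> space (law K). H.hits \<D> r y} \<subseteq> S"
    by blast
  have hit: "H.hits \<D> r (?\<Psi> \<omega>)" if \<omega>: "\<omega> \<in> ?H" for \<omega>
  proof -
    have c: "\<And>k. k \<in> K \<Longrightarrow> continuous_on orthant (\<lambda>t. \<zeta> k t \<omega>)" using \<omega> by blast
    from \<omega> obtain t where t: "\<And>j. x0 $ j \<le> t $ j \<and> t $ j < x0 $ j + \<tau>" "(\<lambda>k. \<zeta> k t \<omega>) \<in> \<D>"
      "\<And>k. k \<in> K \<Longrightarrow> \<bar>\<zeta> k t \<omega>\<bar> \<le> r \<and> \<bar>\<zeta> k x0 \<omega>\<bar> \<le> r" by blast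
    let ?c = "address \<gamma> x0 \<tau> t"
    have ac: "?c m \<in> cells \<gamma> m" for m by (rule address_cells[OF \<tau>(1) t(1)])
    have an: "(m, ?c m) \<in> T.nodes" for m using ac by (simp add: T.nodes_def)
    show ?thesis unfolding H.hits_def
    proof (intro exI[of _ ?c] exI[of _ "\<lambda>k. \<zeta> k t \<omega>"] conjI allI ballI ac)
      show "parent \<gamma> m (?c (Suc m)) = ?c m" for m by (rule address_parent[OF \<gamma> \<tau>(1) t(1)])
      show "(\<lambda>k. \<zeta> k t \<omega>) \<in> \<D>" by (rule t(2))
      fix k assume k: "k \<in> K"
      have to: "t \<in> orthant" using pt_E[of t] t(1) E by blast
      have lim: "(\<lambda>m. p (m, ?c m)) \<longlonglongrightarrow> t" by (rule pt_address_tendsto[OF \<gamma> \<tau>(1) t(1)])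
      have "(\<lambda>m. \<zeta> k (p (m, ?c m)) \<omega>) \<longlonglongrightarrow> \<zeta> k t \<omega>"
        by (rule continuous_on_tendsto_compose[OF c[OF k] lim to]) (use p_orthant[OF an] in simp)
      then show "(\<lambda>m. ?\<Psi> \<omega> (k, m, ?c m)) \<longlonglongrightarrow> \<zeta> k t \<omega>" using k an by simp
      show "\<bar>\<zeta> k t \<omega>\<bar> \<le> r" "\<bar>?\<Psi> \<omega> (k, root)\<bar> \<le> r" using t(3)[OF k] k root by auto
    qed
  qed
  show ?thesis
  proof (rule M.null_set_coverI[OF \<kappa>(1) C])
    fix \<eta> :: real assume "0 < \<eta>" "\<eta> < 1"
    from S[OF this] obtain S where S: "S \<in> sets (law K)" "measure (law K) S \<le> C * \<eta> ^ \<kappa>" "{y \<in> space (law K). H.hits \<D> r y} \<subseteq> S" by blast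
    have SN: "S \<in> sets ?N" using S(1) by (simp add: law)
    show "\<exists>S\<in>M.events. M.prob S \<le> C * \<eta> ^ \<kappa> \<and> ?H \<subseteq> S"
    proof (intro bexI[of _ "?\<Psi> -` S \<inter> space M"] conjI)
      show "M.prob (?\<Psi> -` S \<inter> space M) \<le> C * \<eta> ^ \<kappa>"
        using S(2) measure_distr[OF m SN] by (simp add: law)
      show "?\<Psi> -` S \<inter> space M \<in> M.events" by (rule measurable_sets[OF m SN])
      show "?H \<subseteq> ?\<Psi> -` S \<inter> space M"
      proof
        fix \<omega> assume \<omega>: "\<omega> \<in> ?H"
        then have sp: "\<omega> \<in> space M" by blast
        have "?\<Psi> \<omega> \<in> space (law K)" using measurable_space[OF m sp] by (simp add: law)
        then have "?\<Psi> \<omega> \<in> S" using S(3) hit[OF \<omega>] by blast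
        then show "\<omega> \<in> ?\<Psi> -` S \<inter> space M" using sp by blast
      qed
    qed
  qed
qed

end

lemma finite_positive_lower_bound:
  assumes "finite S" "\<And>x. x \<in> S \<Longrightarrow> 0 < f x"
  shows "\<exists>\<tau>>0 :: real. \<forall>x\<in>S. \<tau> \<le> f x"
proof (intro exI[of _ "Min (insert 1 (f ` S))"] conjI ballI)
  show "0 < Min (insert 1 (f ` S))" using assms by (subst Min_gr_iff) auto
qed (use assms in auto)

theorem theorem4p1:
  fixes P :: "'v measure" and \<xi> :: "real ^ 'n \<Rightarrow> 'v \<Rightarrow> real"
    and M :: "'w measure" and \<zeta> :: "nat \<times> nat \<Rightarrow> real ^ 'n \<Rightarrow> 'w \<Rightarrow> real"
    and c c' :: "real ^ 'n" and \<epsilon> :: real and \<gamma> :: "'n::finite \<Rightarrow> real"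
    and d k :: nat and A1 :: "real mat"
    and eigval :: "real ^ 'n \<Rightarrow> 'w \<Rightarrow> nat \<Rightarrow> real"
  assumes "prob_space P" and "prob_space M"
    and "2 \<le> d"
    and "\<forall>j. c $ j < c' $ j"
    and "cbox c c' \<subseteq> orthant"
    and "gaussian_field P orthant \<xi>"
    and "centered_field P orthant \<xi>"
    and "continuous_field P orthant \<xi>"
    and "assumption_A1 P \<xi> c c' \<epsilon> \<gamma>"
    and "assumption_A2 P \<xi> c c' \<epsilon>"
    and "assumption_A3 P \<xi> c c' \<epsilon> \<gamma>"
    and "independent_copies P \<xi> orthant M (upper_indices d) \<zeta>"
    and "A1 \<in> carrier_mat d d" and "transpose_mat A1 = A1"
    and "\<forall>t\<in>orthant. \<forall>\<omega>\<in>space M. eigenvalue_family d (A1 + X1 d \<zeta> t \<omega>) (eigval t \<omega>)"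
    and "k \<in> {2..d}"
    and "(\<Sum>j\<in>UNIV. 1 / alpha \<gamma> j) = (real k + 2) * (real k - 1) / 2"
  shows "{\<omega> \<in> space M. \<exists>t\<in>cbox c c'. \<exists>i :: nat \<Rightarrow> nat.
            strict_mono_on {1..k} i \<and> i ` {1..k} \<subseteq> {1..d} \<and>
            (\<forall>m\<in>{1..k}. eigval t \<omega> (i m) = eigval t \<omega> (i 1))} \<in> null_sets (completion M)"
proof -
  interpret M: prob_space M by fact
  define E where "E = enlarged_box c c' \<epsilon>"
  have ep: "0 < \<epsilon>" and EO: "E \<subseteq> orthant" and \<gamma>: "\<And>j. 0 < \<gamma> j"
    using assms(9) by (simp_all add: assumption_A1_def E_def)
  obtain W :: "real set \<Rightarrow> real ^ 'n \<Rightarrow> 'v \<Rightarrow> real" and \<nu> a0 c0 where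
    gW: "gaussian_field P (sets borel_Rplus \<times> orthant) (\<lambda>(A, t). W A t)"
    and nW: "\<forall>t\<in>E. gaussian_noise P (\<nu> t) (\<lambda>A. W A t) \<and> (AE \<omega> in P. W {0..} t \<omega> = \<xi> t \<omega>)"
    and iW: "\<forall>A\<in>sets borel_Rplus. \<forall>B\<in>sets borel_Rplus. A \<inter> B = {} \<longrightarrow> indep_fields P orthant (W A) (W B)"
    and ac: "0 \<le> a0" "0 < c0" and
    inc: "\<forall>(a::real) (b::ereal). \<forall>s\<in>E. \<forall>t\<in>E. a0 \<le> a \<longrightarrow> ereal a < b \<longrightarrow>
        L2norm P (\<lambda>\<omega>. W {x. a \<le> x \<and> ereal x < b} s \<omega> - \<xi> s \<omega> - W {x. a \<le> x \<and> ereal x < b} t \<omega> + \<xi> t \<omega>)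
          \<le> c0 * ((\<Sum>j\<in>UNIV. a powr \<gamma> j * \<bar>s $ j - t $ j\<bar>) + real_of_ereal (inverse b))"
    and inc0: "\<forall>s\<in>E. \<forall>t\<in>E. L2norm P (\<lambda>\<omega>. W {0..<a0} s \<omega> - W {0..<a0} t \<omega>) \<le> c0 * (\<Sum>j\<in>UNIV. \<bar>s $ j - t $ j\<bar>)"
    using assms(9) unfolding assumption_A1_def E_def[symmetric] Let_def by (elim conjE exE) (rule that)
  have noise: "noise P \<xi> E \<gamma> W \<nu> a0 c0"
  proof (intro noise.intro noise_axioms.intro assms(1,6,7) EO \<gamma> gW ac)
    show "gaussian_noise P (\<nu> t) (\<lambda>A. W A t)" "AE \<omega> in P. W {0..} t \<omega> = \<xi> t \<omega>" if "t \<in> E" for t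
      using nW that by auto
    show "indep_fields P orthant (W A) (W B)" if "A \<in> sets borel_Rplus" "B \<in> sets borel_Rplus" "A \<inter> B = {}" for A B
      using iW that by blast
  qed (use inc inc0 in blast)+
  interpret noise P \<xi> E \<gamma> W \<nu> a0 c0 by (rule noise)
  from assms(10) obtain d0 where d0: "0 < d0" "\<And>t. t \<in> E \<Longrightarrow> d0 \<le> L2norm P (\<xi> t)"
    unfolding assumption_A2_def E_def[symmetric] by blast
  have k: "2 \<le> k" "k \<le> d" using assms(16) by auto
  \<comment> \<open>The division is exact, because \<open>k + 2\<close> and \<open>k - 1\<close>
    have opposite parity.\<close>
  define \<kappa> where "\<kappa> = (k + 2) * (k - 1) div 2"
  have \<kappa>: "real \<kappa> = (real k + 2) * (real k - 1) / 2"
  proof -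
    have "even ((k + 2) * (k - 1))" using k(1) by simp
    then have "2 * \<kappa> = (k + 2) * (k - 1)" by (simp add: \<kappa>_def)
    then have "2 * real \<kappa> = (real k + 2) * (real k - 1)"
      using k(1) by (metis (mono_tags, lifting) of_nat_1 of_nat_add of_nat_diff of_nat_mult of_nat_numeral one_le_numeral order_trans)
    then show ?thesis by simp
  qed
  have \<kappa>1: "1 \<le> \<kappa>"
  proof -
    have "4 * 1 \<le> (real k + 2) * (real k - 1)" using k(1) by (intro mult_mono) auto
    then have "1 \<le> real \<kappa>" using \<kappa> by simp
    then show ?thesis by simp
  qed
  \<comment> \<open>As \<open>1 / alpha \<gamma> j = 1 + \<gamma> j\<close>, the hypothesis on the
    exponents says that the growth rate of the number of cells equals the codimension.\<close>
  have sum\<gamma>: "(\<Sum>j\<in>UNIV. 1 + \<gamma> j) = real \<kappa>"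
    using assms(17) by (simp add: alpha_def \<kappa>)
  let ?K = "upper_indices d"
  have K: "finite ?K" "?K \<noteq> {}"
    using finite_upper_indices card_upper_indices[of d] assms(3) by auto
  let ?pe = "1 + (\<Sum>l\<in>{1..d - k}. k + l)"
  have dim: "?pe + \<kappa> = card ?K" using k by (intro codimension_eq \<kappa>) auto
  let ?D = "{v. A1 + symm_mat d v \<in> degenerate k (d - k)}"
  \<comment> \<open>The requirements on the side of a patch: it stays inside the enlarged box, it
    satisfies the condition of \<open>near_parent\<close>, and it keeps \<open>\<alpha>\<close>
    above 1/2.\<close>
  let ?f = "\<lambda>j. min (min \<epsilon> (1 / (2 * 2 powr (1 + \<gamma> j)))) (min (1 / (a0 + 1)) (d0 / (2 * Cinc)) powr (1 + \<gamma> j))"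
  have "0 < ?f j" for j
  proof -
    have "0 < min (1 / (a0 + 1)) (d0 / (2 * Cinc))" using a0 d0 Cinc_pos by simp
    then have "0 < min (1 / (a0 + 1)) (d0 / (2 * Cinc)) powr (1 + \<gamma> j)" by (simp only: powr_gt_zero)
    then show ?thesis using ep by (simp only: min_less_iff_conj) simp
  qed
  from finite_positive_lower_bound[of UNIV ?f, OF _ this] obtain \<tau> where \<tau>: "0 < \<tau>" and \<tau>f: "\<And>j. \<tau> \<le> ?f j"
    by auto
  have \<tau>1: "2 * \<tau> * 2 powr (1 + \<gamma> j) \<le> 1" for j
  proof -
    have "\<tau> \<le> 1 / (2 * 2 powr (1 + \<gamma> j))" using \<tau>f[of j] by simp
    then show ?thesis by (simp add: pos_le_divide_eq mult_ac)
  qed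
  \<comment> \<open>Half-open patches with these corners tile the region above \<open>c\<close>. A
    patch that contains a point of the box has its corner in the box, though it may stick out by
    less than \<epsilon>.\<close>
  define x0 where "x0 i = (\<chi> j. c $ j + \<tau> * real (i j))" for i :: "'n \<Rightarrow> nat"
  \<comment> \<open>The bound by \<open>1 + real r\<close> restricts to bounded matrices, for which
    finite nets exist; the summand 1 meets the condition that the bound be at least 1.\<close>
  define H where "H r i = {\<omega> \<in> space M. (\<forall>q\<in>?K. continuous_on orthant (\<lambda>t. \<zeta> q t \<omega>)) \<and>
     (\<exists>t. (\<forall>j. x0 i $ j \<le> t $ j \<and> t $ j < x0 i $ j + \<tau>) \<and> (\<lambda>q. \<zeta> q t \<omega>) \<in> ?D \<and>
       (\<forall>q\<in>?K. \<bar>\<zeta> q t \<omega>\<bar> \<le> 1 + real r \<and> \<bar>\<zeta> q (x0 i) \<omega>\<bar> \<le> 1 + real r))}" for r :: nat and i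
  have Hnull: "\<exists>N\<in>null_sets M. H r i \<subseteq> N" if i: "x0 i \<in> cbox c c'" for r i
  proof -
    have "patch P \<xi> E \<gamma> W \<nu> a0 c0 (x0 i) \<tau> d0 \<kappa>"
    proof (intro patch.intro noise patch_axioms.intro \<kappa>1 sum\<gamma> \<tau> \<tau>1 d0)
      show "\<tau> \<le> min (1 / (a0 + 1)) (d0 / (2 * Cinc)) powr (1 + \<gamma> j)" for j using \<tau>f[of j] by simp
      show "t \<in> E" if t: "\<And>j. x0 i $ j \<le> t $ j \<and> t $ j < x0 i $ j + \<tau>" for t
        unfolding E_def enlarged_box_def
      proof (intro CollectI allI)
        fix j
        have "c $ j \<le> x0 i $ j" "x0 i $ j \<le> c' $ j" using i by (auto simp: mem_box_cart)
        moreover have "\<tau> \<le> \<epsilon>" using \<tau>f[of j] by simp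
        ultimately show "c $ j - \<epsilon> < t $ j \<and> t $ j < c' $ j + \<epsilon>" using t[of j] ep by linarith
      qed
      show "x0 i \<in> E"
        using i ep unfolding E_def enlarged_box_def mem_box_cart
        by (intro CollectI allI) (smt (verit))
    qed
    then interpret patch P \<xi> E \<gamma> W \<nu> a0 c0 "x0 i" \<tau> d0 \<kappa> .
    obtain C where C: "1 \<le> C" "\<And>e. 0 < e \<and> e \<le> 1 \<Longrightarrow> \<exists>F. finite F \<and> real (card F) \<le> C * (1 / e) ^ ?pe \<and>
       (\<forall>v\<in>?D. (\<forall>q\<in>?K. \<bar>v q\<bar> \<le> 1 + real r) \<longrightarrow> (\<exists>w\<in>F. \<forall>q\<in>?K. \<bar>v q - w q\<bar> \<le> C * e))"
      using degenerate_parameter_cover[of k d A1 "1 + real r"] k assms(13) by auto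
    show ?thesis
      unfolding H_def by (rule hitting_null[OF assms(2) K assms(12) _ C(1) dim C(2)]) auto
  qed
  have cont: "AE \<omega> in M. \<forall>q\<in>?K. continuous_on orthant (\<lambda>t. \<zeta> q t \<omega>)"
    using assms(12) K(1) by (intro AE_finite_allI) (auto simp: independent_copies_def continuous_field_def)
  then obtain N0 where N0: "N0 \<in> null_sets M" "{\<omega> \<in> space M. \<not> (\<forall>q\<in>?K. continuous_on orthant (\<lambda>t. \<zeta> q t \<omega>))} \<subseteq> N0"
    by (auto simp: eventually_ae_filter)
  let ?I = "{i. x0 i \<in> cbox c c'}"
  let ?N = "N0 \<union> (\<Union>r. \<Union>i\<in>?I. H r i)"
  have "countable ?I" by (rule countable_subset[OF subset_UNIV countableI_type])
  \<comment> \<open>Each \<open>H r i\<close> is only known to lie inside a null set of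
    \<open>M\<close>, hence the completion. The union over bounds and patches is countable.\<close>
  then have "?N \<in> null_sets (completion M)"
    using N0(1) Hnull by (intro null_sets.Un null_sets_UN') (auto simp: null_sets_completion_iff2)
  moreover have "{\<omega> \<in> space M. \<exists>t\<in>cbox c c'. \<exists>i :: nat \<Rightarrow> nat.
            strict_mono_on {1..k} i \<and> i ` {1..k} \<subseteq> {1..d} \<and>
            (\<forall>m\<in>{1..k}. eigval t \<omega> (i m) = eigval t \<omega> (i 1))} \<subseteq> ?N"
  proof
    fix \<omega> assume "\<omega> \<in> {\<omega> \<in> space M. \<exists>t\<in>cbox c c'. \<exists>i :: nat \<Rightarrow> nat.
            strict_mono_on {1..k} i \<and> i ` {1..k} \<subseteq> {1..d} \<and>
            (\<forall>m\<in>{1..k}. eigval t \<omega> (i m) = eigval t \<omega> (i 1))}"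
    then obtain t s where \<omega>: "\<omega> \<in> space M" and t: "t \<in> cbox c c'" and
      s: "strict_mono_on {1..k} s" "s ` {1..k} \<subseteq> {1..d}" "\<And>m. m \<in> {1..k} \<Longrightarrow> eigval t \<omega> (s m) = eigval t \<omega> (s 1)"
      by blast
    show "\<omega> \<in> ?N"
    proof (cases "\<forall>q\<in>?K. continuous_on orthant (\<lambda>t. \<zeta> q t \<omega>)")
      case False
      then show ?thesis using N0(2) \<omega> by blast
    next
      case True
      define i where "i j = nat \<lfloor>(t $ j - c $ j) / \<tau>\<rfloor>" for j
      have tb: "c $ j \<le> t $ j" "t $ j \<le> c' $ j" for j using t by (auto simp: mem_box_cart)
      have i: "x0 i $ j \<le> t $ j \<and> t $ j < x0 i $ j + \<tau>" for j
      proof -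
        let ?x = "(t $ j - c $ j) / \<tau>"
        have "0 \<le> ?x" using tb[of j] \<tau> by simp
        then have "real (i j) = of_int \<lfloor>?x\<rfloor>" by (simp add: i_def)
        then have "real (i j) \<le> ?x" "?x < real (i j) + 1" by linarith+
        then have "real (i j) * \<tau> \<le> t $ j - c $ j" "t $ j - c $ j < (real (i j) + 1) * \<tau>"
          using \<tau> by (simp_all add: pos_le_divide_eq pos_divide_less_eq)
        then show ?thesis by (simp add: x0_def algebra_simps)
      qed
      have "c $ j \<le> x0 i $ j" for j using \<tau> by (simp add: x0_def)
      then have ib: "x0 i \<in> cbox c c'" unfolding mem_box_cart using i tb(2) order_trans by blast
      have ef: "eigenvalue_family d (A1 + symm_mat d (\<lambda>q. \<zeta> q t \<omega>)) (eigval t \<omega>)"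
        using assms(15) t assms(5) \<omega> unfolding X1_symm_mat by blast
      have D: "(\<lambda>q. \<zeta> q t \<omega>) \<in> ?D"
        by (rule CollectI, rule eigenvalue_family_degenerate[OF ef assms(13,14) strict_mono_on_imp_inj_on[OF s(1)] s(2)], rule s(3))
      define b where "b = (\<Sum>q\<in>?K. \<bar>\<zeta> q t \<omega>\<bar> + \<bar>\<zeta> q (x0 i) \<omega>\<bar>)"
      obtain r :: nat where r: "b \<le> real r" using real_arch_simple by blast
      have "\<bar>\<zeta> q t \<omega>\<bar> + \<bar>\<zeta> q (x0 i) \<omega>\<bar> \<le> b" if "q \<in> ?K" for q
        unfolding b_def using that K(1) by (intro member_le_sum[where f = "\<lambda>q. \<bar>\<zeta> q t \<omega>\<bar> + \<bar>\<zeta> q (x0 i) \<omega>\<bar>"]) auto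
      then have "\<bar>\<zeta> q t \<omega>\<bar> \<le> 1 + real r \<and> \<bar>\<zeta> q (x0 i) \<omega>\<bar> \<le> 1 + real r" if "q \<in> ?K" for q
        using that r by (smt (verit))
      then have "\<omega> \<in> H r i" unfolding H_def using \<omega> True i D by blast
      then show ?thesis using ib by blast
    qed
  qed
  ultimately show ?thesis by (rule null_sets_completion_subset[rotated])
qed

end
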